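(* Let $S$ be a closed semi-arithmetic Riemann surface which admits a modular embedding into an arithmetic $X_r$-manifold for some $r\ge1$. Then there exists a sequence of congruence coverings $S_i\to S$ of arbitrarily large degree satisfying $$\mathrm{sys}(S_i)\ \ge\ \frac{4}{3r}\log(\mathrm{area}(S_i))-c \qquad\text{for all } i,$$ where the constant $c$ does not depend on $i$.
   Context: $\mathbb{H}$ is the upper half-plane with the hyperbolic metric. A closed Riemann surface of genus at least $2$ is $S=\Gamma\backslash\mathbb{H}$ for a Fuchsian group (discrete subgroup) $\Gamma<\mathrm{PSL}(2,\mathbb{R})$, and carries the induced hyperbolic metric; $\mathrm{area}$ is hyperbolic area and $\mathrm{sys}(S)$ is the minimal length of a closed geodesic of $S$. Semi-arithmetic: for $\gamma\in\mathrm{PSL}(2,\mathbb{R})$, $\mathrm{Tr}\,\gamma$ is the absolute value of the trace of a lift of $\gamma$ to $\mathrm{SL}(2,\mathbb{R})$. For a Fuchsian group $\Gamma$, $\Gamma^{(2)}$ is the subgroup generated by $\{\gamma^2\mid\gamma\in\Gamma\}$, and $k\Gamma=\mathbb{Q}(\mathrm{Tr}\,\gamma\mid\gamma\in\Gamma^{(2)})$ is the invariant trace field. A cofinite Fuchsian group $\Gamma$ is semi-arithmetic if $k\Gamma$ is a totally real number field and $\mathrm{Tr}\,\gamma$ lies in the ring of integers of $k\Gamma$ for all $\gamma\in\Gamma^{(2)}$. $S=\Gamma\backslash\mathbb{H}$ is semi-arithmetic if $\Gamma$ is. Congruence subgroups and coverings: let $\Gamma$ be semi-arithmetic with $K=k\Gamma$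 and ring of integers $\mathcal{O}_K$, let $P:\mathrm{SL}(2,\mathbb{R})\to\mathrm{PSL}(2,\mathbb{R})$ be the projection, and let $\tilde\Gamma,\tilde\Gamma^{(2)}$ be the preimages of $\Gamma,\Gamma^{(2)}$ under $P$. It is known that there exist a quaternion algebra $B$ over $K$, a maximal order $\mathfrak{O}<B$ and an injective morphism of $K$-algebras $\xi:B\to\mathrm{M}(2,\mathbb{R})$ such that $\xi(\mathfrak{O}^1)<\mathrm{SL}(2,\mathbb{R})$ contains $\tilde\Gamma$ or $\tilde\Gamma^{(2)}$, where $\mathfrak{O}^1$ is the group of elements of $\mathfrak{O}$ of reduced norm $1$; these data are fixed. For a nonzero ideal $\mathfrak{a}\subset\mathcal{O}_K$ put $\mathfrak{a}\mathfrak{O}=\{\sum_j a_j\omega_j\mid a_j\in\mathfrak{a},\ \omega_j\in\mathfrak{O}\}$ and $\mathfrak{O}^1(\mathfrak{a})=\{D\in\mathfrak{O}^1\mid D-1\in\mathfrak{a}\mathfrak{O}\}$. The congruence subgroup of $\Gamma$ of level $\mathfrak{a}$ is $\Gamma(\mathfrak{a})=P(\tilde\Gamma\cap\xi(\mathfrak{O}^1(\mathfrak{a})))$, a finite-index subgroup of $\Gamma$. A congruence covering of $S=\Gamma\backslash\mathbb{H}$ is a covering $\Gamma(\mathfrak{a})\backslash\mathbb{H}\to\Gamma\backslash\mathbb{H}$. Arithmetic $X_r$-manifolds: $X_r=\mathbb{H}^r$ is the product of $r$ copies of $\mathbb{H}$ with the product metric, acted on componentwise by $\mathrm{PSL}(2,\mathbb{R})^r$.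 Let $K$ be a totally real number field and $A$ a quaternion algebra over $K$ that splits at exactly $r$ real embeddings $\sigma_1,\dots,\sigma_r$ of $K$; these give a homomorphism $\rho=(\rho_1,\dots,\rho_r):A\to \mathrm{M}_2(\mathbb{R})^r$ with $\mathrm{tr}(\rho_i(\alpha))=\sigma_i(\mathrm{tr}(\alpha))$. For an order $\mathcal{Q}$ of $A$ with group $\mathcal{Q}^1$ of elements of reduced norm $1$, the image of $\rho(\mathcal{Q}^1)$ in $\mathrm{PSL}(2,\mathbb{R})^r$ is a lattice; a subgroup of $\mathrm{PSL}(2,\mathbb{R})^r$ commensurable with such an image is called an irreducible arithmetic lattice (defined over $K$), and its quotient $\Lambda\backslash\mathbb{H}^r$ is an arithmetic $X_r$-manifold (in general, orbifold). Modular embedding: let $S=\Gamma\backslash\mathbb{H}$ be semi-arithmetic with invariant trace field $K$. Each Galois embedding $\phi:K\to\mathbb{R}$ can be extended to a monomorphism $\Gamma\to\mathrm{PSL}(2,\mathbb{R})$ obtained by applying a suitable extension of $\phi$ to the matrix entries of the elements of $\Gamma$; it is well defined up to conjugation in $\mathrm{PGL}(2,\mathbb{R})$. There is a choice of such monomorphisms $\Phi_1,\dots,\Phi_r$ (for distinct Galois embeddings of $K$), $r\le[K:\mathbb{Q}]$, such that $\Phi=(\Phi_1,\dots,\Phi_r):\Gamma\to\mathrm{PSL}(2,\mathbb{R})^r$ has image contained in an irreducible arithmetic lattice $\Lambda<\mathrm{PSL}(2,\mathbb{R})^r$ defined over $K$ (whose splitting embeddings $\sigma_i$ are the corresponding Galois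 embeddings). $S$ admits a modular embedding (into the arithmetic $X_r$-manifold $\Lambda\backslash\mathbb{H}^r$) if there exists a holomorphic map $F:\mathbb{H}\to\mathbb{H}^r$ with $F(\gamma(z))=\Phi(\gamma)(F(z))$ for all $z\in\mathbb{H}$ and $\gamma\in\Gamma$. *)

theory Defs
  imports "HOL-Analysis.Analysis" "HOL-Algebra.Algebra" "HOL-Algebra.Algebraic_Closure_Type"
begin

unbundle no fps_syntax

section \<open>The groups \<open>SL(2,\<real>)\<close> and \<open>PSL(2,\<real>)\<close>\<close>

definition SL2R :: "(real^2^2) monoid" where
  "SL2R = \<lparr>carrier = {A. det A = 1}, monoid.mult = (**), one = mat 1\<rparr>"

text \<open>An element of \<open>PSL(2,\<real>)\<close> is the set \<open>{A, -A}\<close> of its two lifts.\<close>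

definition PSL2R :: "(real^2^2) set monoid" where
  "PSL2R = SL2R Mod {mat 1, - mat 1}"

definition PSL_proj :: "real^2^2 \<Rightarrow> (real^2^2) set" where
  "PSL_proj A = {mat 1, - mat 1} #>\<^bsub>SL2R\<^esub> A"

definition lifts :: "(real^2^2) set set \<Rightarrow> (real^2^2) set" where
  "lifts \<Gamma> = {A \<in> carrier SL2R. PSL_proj A \<in> \<Gamma>}"

definition Tr :: "(real^2^2) set \<Rightarrow> real" where
  "Tr \<gamma> = \<bar>trace (SOME A. A \<in> \<gamma>)\<bar>"

definition quotient_topology :: "'a topology \<Rightarrow> ('a \<Rightarrow> 'b) \<Rightarrow> 'b topology" where
  "quotient_topology T f =
     topology (\<lambda>U. U \<subseteq> f ` topspace T \<and> openin T {x \<in> topspace T. f x \<in> U})"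

lemma openin_quotient_topology:
  "openin (quotient_topology T f) U \<longleftrightarrow>
     U \<subseteq> f ` topspace T \<and> openin T {x \<in> topspace T. f x \<in> U}"
proof -
  have "istopology (\<lambda>U. U \<subseteq> f ` topspace T \<and> openin T {x \<in> topspace T. f x \<in> U})"
    unfolding istopology_def
  proof (intro conjI allI impI)
    fix S V
    assume S: "S \<subseteq> f ` topspace T \<and> openin T {x \<in> topspace T. f x \<in> S}"
      and V: "V \<subseteq> f ` topspace T \<and> openin T {x \<in> topspace T. f x \<in> V}"
    show "S \<inter> V \<subseteq> f ` topspace T" using S by blast
    have "{x \<in> topspace T. f x \<in> S \<inter> V} =
        {x \<in> topspace T. f x \<in> S} \<inter> {x \<in> topspace T. f x \<in> V}" by blast
    then show "openin T {x \<in> topspace T. f x \<in> S \<inter> V}"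
      using S V by (simp add: openin_Int)
  next
    fix \<K>
    assume K: "\<forall>S\<in>\<K>. S \<subseteq> f ` topspace T \<and> openin T {x \<in> topspace T. f x \<in> S}"
    show "\<Union>\<K> \<subseteq> f ` topspace T" using K by blast
    have "{x \<in> topspace T. f x \<in> \<Union>\<K>} = (\<Union>S\<in>\<K>. {x \<in> topspace T. f x \<in> S})" by blast
    then show "openin T {x \<in> topspace T. f x \<in> \<Union>\<K>}"
      using K by (simp add: openin_clauses(3) image_iff)
  qed
  then show ?thesis
    unfolding quotient_topology_def by (simp add: topology_inverse')
qed

lemma quotient_map_quotient_topology: "quotient_map T (quotient_topology T f) f"
proof -
  have "{x \<in> topspace T. f x \<in> f ` topspace T} = topspace T" by blast
  then have "openin (quotient_topology T f) (f ` topspace T)"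
    by (simp add: openin_quotient_topology)
  then have "topspace (quotient_topology T f) = f ` topspace T"
    by (metis openin_quotient_topology openin_subset openin_topspace subset_antisym)
  then show ?thesis
    by (simp add: quotient_map_def openin_quotient_topology)
qed

definition PSL2R_topology :: "(real^2^2) set topology" where
  "PSL2R_topology = quotient_topology (top_of_set (carrier SL2R)) PSL_proj"

definition fuchsian :: "(real^2^2) set set \<Rightarrow> bool" where
  "fuchsian \<Gamma> \<longleftrightarrow>
     subgroup \<Gamma> PSL2R \<and> subtopology PSL2R_topology \<Gamma> = discrete_topology \<Gamma>"


section \<open>Hyperbolic surfaces \<open>\<Gamma>\<backslash>\<H>\<close>\<close>

definition upper_half_plane :: "complex set" (\<open>\<H>\<close>) where
  "\<H> = {z. Im z > 0}"

definition hyp_dist :: "complex \<Rightarrow> complex \<Rightarrow> real" where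
  "hyp_dist z w = arcosh (1 + (cmod (z - w))\<^sup>2 / (2 * Im z * Im w))"

definition hyp_measure :: "complex measure" where
  "hyp_measure = density lborel (\<lambda>z. ennreal (indicator \<H> z / (Im z)\<^sup>2))"

definition moebius :: "real^2^2 \<Rightarrow> complex \<Rightarrow> complex" where
  "moebius A z = (of_real (A$1$1) * z + of_real (A$1$2)) / (of_real (A$2$1) * z + of_real (A$2$2))"

definition PSL_act :: "(real^2^2) set \<Rightarrow> complex \<Rightarrow> complex" where
  "PSL_act \<gamma> z = moebius (SOME A. A \<in> \<gamma>) z"

definition orbit_pt :: "(real^2^2) set set \<Rightarrow> complex \<Rightarrow> complex set" where
  "orbit_pt \<Gamma> z = (\<lambda>\<gamma>. PSL_act \<gamma> z) ` \<Gamma>"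

definition surface :: "(real^2^2) set set \<Rightarrow> complex set set" where
  "surface \<Gamma> = orbit_pt \<Gamma> ` \<H>"

definition surface_topology :: "(real^2^2) set set \<Rightarrow> complex set topology" where
  "surface_topology \<Gamma> = quotient_topology (top_of_set \<H>) (orbit_pt \<Gamma>)"

text \<open>
  The quotient of \<open>\<H>\<close> by \<open>\<Gamma>\<close> is a closed Riemann surface with the induced hyperbolic metric
  when \<open>\<Gamma>\<close> is Fuchsian, acts freely and has compact quotient; the genus is then
  automatically at least 2.
\<close>

definition closed_surface_group :: "(real^2^2) set set \<Rightarrow> bool" where
  "closed_surface_group \<Gamma> \<longleftrightarrow>
     fuchsian \<Gamma> \<and>
     (\<forall>\<gamma>\<in>\<Gamma>. \<forall>z\<in>\<H>. PSL_act \<gamma> z = z \<longrightarrow> \<gamma> = \<one>\<^bsub>PSL2R\<^esub>) \<and>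
     compact_space (surface_topology \<Gamma>)"

definition fundamental_domain :: "(real^2^2) set set \<Rightarrow> complex set \<Rightarrow> bool" where
  "fundamental_domain \<Gamma> D \<longleftrightarrow>
     D \<in> sets borel \<and> D \<subseteq> \<H> \<and> (\<forall>z\<in>\<H>. \<exists>!w. w \<in> D \<and> w \<in> orbit_pt \<Gamma> z)"

definition cofinite_group :: "(real^2^2) set set \<Rightarrow> bool" where
  "cofinite_group \<Gamma> \<longleftrightarrow> (\<exists>D. fundamental_domain \<Gamma> D \<and> emeasure hyp_measure D < \<infinity>)"

text \<open>The value does not depend on the fundamental domain that is chosen.\<close>

definition hyp_area :: "(real^2^2) set set \<Rightarrow> real" where
  "hyp_area \<Gamma> = measure hyp_measure (SOME D. fundamental_domain \<Gamma> D)"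

definition unit_speed_geodesic :: "(real \<Rightarrow> complex) \<Rightarrow> bool" where
  "unit_speed_geodesic c \<longleftrightarrow> range c \<subseteq> \<H> \<and> (\<forall>s t. hyp_dist (c s) (c t) = \<bar>s - t\<bar>)"

text \<open>
  Since \<open>\<H> \<rightarrow> \<Gamma>\<backslash>\<H>\<close> is a Riemannian covering, the geodesics of \<open>\<Gamma>\<backslash>\<H>\<close> are the projections of
  the geodesics of \<open>\<H>\<close>.  A closed geodesic of length \<open>l\<close> is such a projection that is periodic
  with period \<open>l\<close>; traversing a geodesic several times only adds multiples of its length.
\<close>

definition closed_geodesic :: "(real^2^2) set set \<Rightarrow> (real \<Rightarrow> complex set) \<Rightarrow> real \<Rightarrow> bool" where
  "closed_geodesic \<Gamma> g l \<longleftrightarrow>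
     (\<exists>c. unit_speed_geodesic c \<and> g = orbit_pt \<Gamma> \<circ> c) \<and> l > 0 \<and> (\<forall>t. g (t + l) = g t)"

definition sys :: "(real^2^2) set set \<Rightarrow> real" where
  "sys \<Gamma> = Inf {l. \<exists>g. closed_geodesic \<Gamma> g l}"

text \<open>
  Degree of \<open>\<Gamma>'\<backslash>\<H> \<rightarrow> \<Gamma>\<backslash>\<H>\<close> for \<open>\<Gamma>' \<le> \<Gamma>\<close>, as the cardinality of the fibre over the image of
  \<open>\<i>\<close>; all fibres of a covering of a connected surface have the same cardinality.  An infinite
  fibre would give the value \<open>0\<close>.
\<close>

definition covering_degree :: "(real^2^2) set set \<Rightarrow> (real^2^2) set set \<Rightarrow> nat" where
  "covering_degree \<Gamma>' \<Gamma> = card {p \<in> surface \<Gamma>'. p \<subseteq> orbit_pt \<Gamma> \<i>}"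


section \<open>Number fields inside \<open>\<real>\<close> and semi-arithmetic groups\<close>

abbreviation real_ring :: "real ring" where
  "real_ring \<equiv> ring_of_type_algebra"

abbreviation complex_ring :: "complex ring" where
  "complex_ring \<equiv> ring_of_type_algebra"

definition lin_combs :: "real set \<Rightarrow> 'v::real_vector set \<Rightarrow> 'v set" where
  "lin_combs R V = {\<Sum>j<n. c j *\<^sub>R v j | (n::nat) c v. \<forall>j<n. c j \<in> R \<and> v j \<in> V}"

definition number_field :: "real set \<Rightarrow> bool" where
  "number_field K \<longleftrightarrow> subfield K real_ring \<and> (\<exists>S. finite S \<and> K = lin_combs \<rat> S)"

definition totally_real :: "real set \<Rightarrow> bool" where
  "totally_real K \<longleftrightarrow> (\<forall>\<tau> \<in> ring_hom (real_ring\<lparr>carrier := K\<rparr>) complex_ring. \<tau> ` K \<subseteq> \<real>)"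

definition ring_of_integers :: "real set \<Rightarrow> real set" where
  "ring_of_integers K = {x \<in> K. algebraic_int x}"

text \<open>Embeddings are normalised to be \<open>undefined\<close> outside \<open>K\<close>, so that distinct functions are
  distinct embeddings of \<open>K\<close>.\<close>

definition real_embeddings :: "real set \<Rightarrow> (real \<Rightarrow> real) set" where
  "real_embeddings K = ring_hom (real_ring\<lparr>carrier := K\<rparr>) real_ring \<inter> extensional K"

definition squares_subgroup :: "(real^2^2) set set \<Rightarrow> (real^2^2) set set" where
  "squares_subgroup \<Gamma> = generate PSL2R {\<gamma> \<otimes>\<^bsub>PSL2R\<^esub> \<gamma> | \<gamma>. \<gamma> \<in> \<Gamma>}"

definition inv_trace_field :: "(real^2^2) set set \<Rightarrow> real set" where
  "inv_trace_field \<Gamma> = generate_field real_ring (Tr ` squares_subgroup \<Gamma>)"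

definition semi_arithmetic :: "(real^2^2) set set \<Rightarrow> bool" where
  "semi_arithmetic \<Gamma> \<longleftrightarrow>
     fuchsian \<Gamma> \<and> cofinite_group \<Gamma> \<and>
     number_field (inv_trace_field \<Gamma>) \<and> totally_real (inv_trace_field \<Gamma>) \<and>
     (\<forall>\<gamma> \<in> squares_subgroup \<Gamma>. Tr \<gamma> \<in> ring_of_integers (inv_trace_field \<Gamma>))"


section \<open>Quaternion algebras and orders\<close>

text \<open>
  \<open>(x\<^sub>0, x\<^sub>1, x\<^sub>2, x\<^sub>3)\<close> stands for \<open>x\<^sub>0 + x\<^sub>1 i + x\<^sub>2 j + x\<^sub>3 ij\<close> with \<open>i\<^sup>2 = a\<close>, \<open>j\<^sup>2 = b\<close>, \<open>ij = -ji\<close>;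
  in characteristic \<open>\<noteq> 2\<close> every quaternion algebra over \<open>K\<close> is isomorphic to one of these with
  \<open>a\<close>, \<open>b\<close> nonzero in \<open>K\<close>.
\<close>

type_synonym quat = "real \<times> real \<times> real \<times> real"

fun quat_mult :: "real \<Rightarrow> real \<Rightarrow> quat \<Rightarrow> quat \<Rightarrow> quat" where
  "quat_mult a b (x0, x1, x2, x3) (y0, y1, y2, y3) =
     (x0 * y0 + a * x1 * y1 + b * x2 * y2 - a * b * x3 * y3,
      x0 * y1 + x1 * y0 - b * x2 * y3 + b * x3 * y2,
      x0 * y2 + x2 * y0 + a * x1 * y3 - a * x3 * y1,
      x0 * y3 + x3 * y0 + x1 * y2 - x2 * y1)"

definition quat_alg :: "real set \<Rightarrow> real \<Rightarrow> real \<Rightarrow> quat ring" where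
  "quat_alg K a b =
     \<lparr>carrier = K \<times> K \<times> K \<times> K, monoid.mult = quat_mult a b, one = (1, 0, 0, 0), ring.zero = 0, add = (+)\<rparr>"

definition quat_params :: "real set \<Rightarrow> real \<Rightarrow> real \<Rightarrow> bool" where
  "quat_params K a b \<longleftrightarrow> a \<in> K \<and> a \<noteq> 0 \<and> b \<in> K \<and> b \<noteq> 0"

fun red_norm :: "real \<Rightarrow> real \<Rightarrow> quat \<Rightarrow> real" where
  "red_norm a b (x0, x1, x2, x3) = x0\<^sup>2 - a * x1\<^sup>2 - b * x2\<^sup>2 + a * b * x3\<^sup>2"

fun red_trace :: "quat \<Rightarrow> real" where
  "red_trace (x0, x1, x2, x3) = 2 * x0"

definition is_order :: "real set \<Rightarrow> real \<Rightarrow> real \<Rightarrow> quat set \<Rightarrow> bool" where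
  "is_order K a b Q \<longleftrightarrow>
     subring Q (quat_alg K a b) \<and>
     (\<exists>S. finite S \<and> Q = lin_combs (ring_of_integers K) S) \<and>
     lin_combs K Q = carrier (quat_alg K a b)"

definition maximal_order :: "real set \<Rightarrow> real \<Rightarrow> real \<Rightarrow> quat set \<Rightarrow> bool" where
  "maximal_order K a b Q \<longleftrightarrow>
     is_order K a b Q \<and> (\<forall>Q'. is_order K a b Q' \<and> Q \<subseteq> Q' \<longrightarrow> Q' = Q)"

definition norm_one :: "real \<Rightarrow> real \<Rightarrow> quat set \<Rightarrow> quat set" where
  "norm_one a b Q = {q \<in> Q. red_norm a b q = 1}"

definition M2R :: "(real^2^2) ring" where
  "M2R = \<lparr>carrier = UNIV, monoid.mult = (**), one = mat 1, ring.zero = 0, add = (+)\<rparr>"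

text \<open>Ring homomorphisms to \<open>M(2,\<real>)\<close> that are linear along \<open>\<sigma> : K \<rightarrow> \<real>\<close>.\<close>

definition alg_homs ::
  "real set \<Rightarrow> real \<Rightarrow> real \<Rightarrow> (real \<Rightarrow> real) \<Rightarrow> (quat \<Rightarrow> real^2^2) set" where
  "alg_homs K a b \<sigma> =
     {f \<in> ring_hom (quat_alg K a b) M2R.
        \<forall>x\<in>K. \<forall>q\<in>carrier (quat_alg K a b). f (x *\<^sub>R q) = \<sigma> x *\<^sub>R f q}"


section \<open>Congruence subgroups\<close>

definition congruence_data ::
  "(real^2^2) set set \<Rightarrow> real \<Rightarrow> real \<Rightarrow> quat set \<Rightarrow> (quat \<Rightarrow> real^2^2) \<Rightarrow> bool" where
  "congruence_data \<Gamma> a b \<OO> \<xi> \<longleftrightarrow>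
     (let K = inv_trace_field \<Gamma> in
        quat_params K a b \<and> maximal_order K a b \<OO> \<and>
        \<xi> \<in> alg_homs K a b (\<lambda>x. x) \<and> inj_on \<xi> (carrier (quat_alg K a b)) \<and>
        (lifts \<Gamma> \<subseteq> \<xi> ` norm_one a b \<OO> \<or>
         lifts (squares_subgroup \<Gamma>) \<subseteq> \<xi> ` norm_one a b \<OO>))"

definition nonzero_ideal :: "real set \<Rightarrow> real set \<Rightarrow> bool" where
  "nonzero_ideal K \<aa> \<longleftrightarrow> ideal \<aa> (real_ring\<lparr>carrier := ring_of_integers K\<rparr>) \<and> \<aa> \<noteq> {0}"

definition norm_one_level :: "real \<Rightarrow> real \<Rightarrow> quat set \<Rightarrow> real set \<Rightarrow> quat set" where
  "norm_one_level a b \<OO> \<aa> = {D \<in> norm_one a b \<OO>. D - (1, 0, 0, 0) \<in> lin_combs \<aa> \<OO>}"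

definition congruence_subgroup ::
  "(real^2^2) set set \<Rightarrow> real \<Rightarrow> real \<Rightarrow> quat set \<Rightarrow> (quat \<Rightarrow> real^2^2) \<Rightarrow> real set
     \<Rightarrow> (real^2^2) set set" where
  "congruence_subgroup \<Gamma> a b \<OO> \<xi> \<aa> = PSL_proj ` (lifts \<Gamma> \<inter> \<xi> ` norm_one_level a b \<OO> \<aa>)"


section \<open>Irreducible arithmetic lattices and modular embeddings\<close>

definition PSL2R_power :: "nat \<Rightarrow> (nat \<Rightarrow> (real^2^2) set) monoid" where
  "PSL2R_power r = product_group {..<r} (\<lambda>_. PSL2R)"

definition commensurable :: "('a, 'c) monoid_scheme \<Rightarrow> 'a set \<Rightarrow> 'a set \<Rightarrow> bool" where
  "commensurable G H J \<longleftrightarrow>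
     subgroup H G \<and> subgroup J G \<and>
     finite (rcosets\<^bsub>G\<lparr>carrier := H\<rparr>\<^esub> (H \<inter> J)) \<and>
     finite (rcosets\<^bsub>G\<lparr>carrier := J\<rparr>\<^esub> (H \<inter> J))"

text \<open>
  The base change of \<open>quat_alg K a b\<close> along \<open>\<sigma> : K \<rightarrow> \<real>\<close> is \<open>quat_alg UNIV (\<sigma> a) (\<sigma> b)\<close>.
\<close>

definition splits_at :: "real \<Rightarrow> real \<Rightarrow> (real \<Rightarrow> real) \<Rightarrow> bool" where
  "splits_at a b \<sigma> \<longleftrightarrow>
     (\<exists>f \<in> alg_homs UNIV (\<sigma> a) (\<sigma> b) (\<lambda>x. x).
        bij_betw f (carrier (quat_alg UNIV (\<sigma> a) (\<sigma> b))) (carrier M2R))"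

text \<open>
  \<open>\<sigma> 0, \<dots>, \<sigma> (r - 1)\<close> enumerates, without repetition, all real embeddings of \<open>K\<close> at which the
  quaternion algebra splits.
\<close>

definition irreducible_arithmetic_lattice ::
  "real set \<Rightarrow> nat \<Rightarrow> (nat \<Rightarrow> real \<Rightarrow> real) \<Rightarrow> (nat \<Rightarrow> (real^2^2) set) set \<Rightarrow> bool" where
  "irreducible_arithmetic_lattice K r \<sigma> \<Lambda> \<longleftrightarrow>
     number_field K \<and> totally_real K \<and>
     (\<exists>a b \<rho> Q.
        quat_params K a b \<and>
        bij_betw \<sigma> {..<r} {\<tau> \<in> real_embeddings K. splits_at a b \<tau>} \<and>
        (\<forall>i<r. \<rho> i \<in> alg_homs K a b (\<sigma> i) \<and>
           (\<forall>q \<in> carrier (quat_alg K a b). trace (\<rho> i q) = \<sigma> i (red_trace q))) \<and>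
        is_order K a b Q \<and>
        commensurable (PSL2R_power r) \<Lambda>
          ((\<lambda>q. \<lambda>i\<in>{..<r}. PSL_proj (\<rho> i q)) ` norm_one a b Q))"

text \<open>
  A monomorphism \<open>\<Psi> : \<Gamma> \<rightarrow> PSL(2,\<real>)\<close> obtained from the embedding \<open>\<phi> : K \<rightarrow> \<real>\<close> by applying an
  extension \<open>\<psi>\<close> of \<open>\<phi>\<close> to the matrix entries.  The field \<open>L\<close> contains \<open>K\<close> and all these entries;
  the values of \<open>\<psi>\<close> need not be real, so the result is only required to be conjugate, by some
  complex \<open>h\<close>, to a group of real matrices.  This determines \<open>\<Psi>\<close> up to conjugation in
  \<open>PGL(2,\<real>)\<close>.
\<close>

definition galois_conjugate ::
  "(real^2^2) set set \<Rightarrow> real set \<Rightarrow> (real \<Rightarrow> real) \<Rightarrow> ((real^2^2) set \<Rightarrow> (real^2^2) set) \<Rightarrow> bool" where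
  "galois_conjugate \<Gamma> K \<phi> \<Psi> \<longleftrightarrow>
     \<Psi> \<in> hom (PSL2R\<lparr>carrier := \<Gamma>\<rparr>) PSL2R \<and> inj_on \<Psi> \<Gamma> \<and>
     (\<exists>L \<psi> (h::complex^2^2).
        subfield L real_ring \<and> K \<subseteq> L \<and> (\<forall>A\<in>lifts \<Gamma>. \<forall>i j. A$i$j \<in> L) \<and>
        \<psi> \<in> ring_hom (real_ring\<lparr>carrier := L\<rparr>) complex_ring \<and>
        (\<forall>x\<in>K. \<psi> x = of_real (\<phi> x)) \<and>
        invertible h \<and>
        (\<forall>A\<in>lifts \<Gamma>. \<exists>B\<in>\<Psi> (PSL_proj A).
           (\<chi> i j. of_real (B$i$j)) = h ** (\<chi> i j. \<psi> (A$i$j)) ** matrix_inv h))"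

text \<open>A holomorphic map \<open>F : \<H> \<rightarrow> \<H>\<^sup>r\<close> is given by its components \<open>F 0, \<dots>, F (r - 1)\<close>.\<close>

definition admits_modular_embedding :: "(real^2^2) set set \<Rightarrow> nat \<Rightarrow> bool" where
  "admits_modular_embedding \<Gamma> r \<longleftrightarrow>
     (\<exists>\<sigma> \<Lambda> \<Phi> F.
        irreducible_arithmetic_lattice (inv_trace_field \<Gamma>) r \<sigma> \<Lambda> \<and>
        (\<forall>i<r. galois_conjugate \<Gamma> (inv_trace_field \<Gamma>) (\<sigma> i) (\<Phi> i)) \<and>
        (\<forall>\<gamma>\<in>\<Gamma>. (\<lambda>i\<in>{..<r}. \<Phi> i \<gamma>) \<in> \<Lambda>) \<and>
        (\<forall>i<r. F i holomorphic_on \<H> \<and> F i ` \<H> \<subseteq> \<H> \<and>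
           (\<forall>\<gamma>\<in>\<Gamma>. \<forall>z\<in>\<H>. F i (PSL_act \<gamma> z) = PSL_act (\<Phi> i \<gamma>) (F i z))))"

end

theory Submission
  imports Defs "Jordan_Normal_Form.Char_Poly" "HOL-Complex_Analysis.Complex_Analysis"
begin

text \<open>
  Let \<open>\<Gamma>\<^sub>k\<close> be the congruence subgroup of level \<open>3\<^sup>k\<close>, let \<open>n\<close> be the degree of the invariant trace
  field \<open>K\<close>, and let \<open>A = \<xi> (1 + 3\<^sup>k E)\<close> lift an element \<open>\<gamma> \<noteq> 1\<close> of \<open>\<Gamma>\<^sub>k\<close> with translation
  length \<open>l\<close>.  Since \<open>A\<close> has determinant 1, \<open>2 - tr A = 9\<^sup>k t\<close> with \<open>t = nrd E\<close> a nonzero integer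
  of \<open>K\<close>, so the product of \<open>\<bar>\<sigma> t\<bar>\<close> over the embeddings \<open>\<sigma>\<close> of \<open>K\<close> is at least 1.  At the \<open>r\<close> split
  embeddings the Schwarz-Pick lemma for the modular embedding gives \<open>\<bar>\<sigma> (tr A)\<bar> \<le> 2 cosh (l / 2)\<close>;
  at the others the quaternion algebra is definite and \<open>\<bar>\<sigma> (tr A)\<bar> \<le> 2\<close>.  Multiplying,
  \<open>9\<^bsup>kn\<^esup> \<le> 4\<^sup>n exp (r l / 2)\<close>, i.e. \<open>l \<ge> 4 k n ln 3 / r - O(1)\<close>.  On the other hand norm one forces
  \<open>tr E \<equiv> 0\<close> modulo \<open>3\<^sup>k\<close>, so the index of \<open>\<Gamma>\<^bsub>k+1\<^esub>\<close> in \<open>\<Gamma>\<^sub>k\<close> is at most \<open>3\<^bsup>3n\<^esup>\<close> and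
  the area grows at most like \<open>3\<^bsup>3nk\<^esup>\<close>.
\<close>

hide_const (open) Determinant.det Matrix.mat Matrix.vec Matrix.row Matrix.col Coset.order
  up_ring.coeff up_ring.monom module.smult Polynomials.degree Polynomials.lead_coeff
  Ring_Hom.ring_hom UnivPoly.eval Matrix.transpose_mat Divisibility.irreducible Divisibility.prime
no_notation Matrix.vec_index (infixl "$" 100)
no_notation fps_nth (infixl "$" 75)
no_notation var ("X\<index>")
(* Some of the merged imports declare transitivity rules that would take precedence in calculations. *)
declare order_trans [trans del] less_trans [trans del]
declare order_trans [trans] less_trans [trans]

section \<open>Number fields and their real embeddings\<close>

text \<open>The constant 4/3 compares two exponents. Norm one gives \<open>2 - tr A\<close> a factor
  \<open>9^k\<close> rather than \<open>3^k\<close>, so lengths grow like 4 k n, while one step of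
  the tower multiplies the index by at most \<open>3^(3 n)\<close>: the congruence on the trace
  removes one of the four dimensions of the order, and without it the constant would drop to 1.
  Since 3 is odd, a quaternion \<open>E\<close> of trace \<open>3 s\<close> can be replaced by
  \<open>3 s - 2 E\<close>, which has trace zero and is congruent to it. Only upper bounds for the
  area enter, so congruence classes are counted and no index is computed.

  The obstacle is the embeddings outside the modular embedding. The lattice brings its own
  quaternion algebra, given independently of the one defining the congruences. Commensurability
  helps: some power of \<open>A\<close> maps into the norm-one group of the lattice's order, and a
  trace bound 2 passes from a power to \<open>A\<close> itself.

  That \<open>t\<close> is nonzero means that \<open>tr A\<close> is not 2, i.e. that there are no
  parabolic elements; this follows from compactness. Compactness also gives finite generation, hence
  finite index at level 1 even when only the squares of \<Gamma> lift into the order.\<close>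

definition zspan :: "'a::comm_ring_1 set \<Rightarrow> 'a set" where
  "zspan U = {\<Sum>u\<in>U. of_int (c u) * u | c. True}"

lemma zspan_0: "0 \<in> zspan U"
  unfolding zspan_def by (intro CollectI exI[of _ "\<lambda>_. 0"]) auto

lemma zspan_add: "x \<in> zspan U \<Longrightarrow> y \<in> zspan U \<Longrightarrow> x + y \<in> zspan U"
proof -
  assume "x \<in> zspan U" "y \<in> zspan U"
  then obtain c d where "x = (\<Sum>u\<in>U. of_int (c u) * u)" "y = (\<Sum>u\<in>U. of_int (d u) * u)"
    unfolding zspan_def by blast
  then have "x + y = (\<Sum>u\<in>U. of_int (c u + d u) * u)"
    by (simp add: sum.distrib algebra_simps)
  then show ?thesis unfolding zspan_def by (intro CollectI exI[of _ "\<lambda>u. c u + d u"]) simp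
qed

lemma zspan_int_mult: "x \<in> zspan U \<Longrightarrow> of_int k * x \<in> zspan U"
proof -
  assume "x \<in> zspan U"
  then obtain c where "x = (\<Sum>u\<in>U. of_int (c u) * u)"
    unfolding zspan_def by blast
  then have "of_int k * x = (\<Sum>u\<in>U. of_int (k * c u) * u)"
    by (simp add: sum_distrib_left algebra_simps)
  then show ?thesis unfolding zspan_def by (intro CollectI exI[of _ "\<lambda>u. k * c u"]) simp
qed

lemma zspan_sum: "(\<And>i. i \<in> I \<Longrightarrow> f i \<in> zspan U) \<Longrightarrow> sum f I \<in> zspan U"
  by (induction I rule: infinite_finite_induct) (auto intro: zspan_0 zspan_add)

lemma zspan_base: assumes "finite U" "x \<in> U" shows "x \<in> zspan U"
proof -
  have "(\<Sum>u\<in>U. of_int (if u = x then 1 else 0) * u) = (\<Sum>u\<in>U. if u = x then u else 0)"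
    by (intro sum.cong) auto
  also have "\<dots> = x" using assms by simp
  finally have "x = (\<Sum>u\<in>U. of_int (if u = x then 1 else 0) * u)" by simp
  then show ?thesis unfolding zspan_def by (intro CollectI exI[of _ "\<lambda>u. if u = x then 1 else 0"]) simp
qed

lemma zspan_mult_closed:
  assumes "\<And>u. u \<in> U \<Longrightarrow> x * u \<in> zspan V" "y \<in> zspan U"
  shows "x * y \<in> zspan V"
proof -
  obtain c where "y = (\<Sum>u\<in>U. of_int (c u) * u)"
    using assms(2) unfolding zspan_def by blast
  then have "x * y = (\<Sum>u\<in>U. of_int (c u) * (x * u))"
    by (simp add: sum_distrib_left algebra_simps)
  also have "\<dots> \<in> zspan V" by (intro zspan_sum zspan_int_mult assms)
  finally show ?thesis .
qed

text \<open>Determinant trick: multiplication by \<open>x\<close> acts on \<open>U\<close> through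
  an integer matrix with the generators themselves as eigenvector, so \<open>x\<close> is a root of
  a monic integral characteristic polynomial.\<close>

lemma algebraic_int_if_stable:
  fixes x :: "'a::field_char_0"
  assumes U: "finite U" "u0 \<in> U" "u0 \<noteq> 0" and st: "\<And>u. u \<in> U \<Longrightarrow> x * u \<in> zspan U"
  shows "algebraic_int x"
proof -
  obtain n v where v: "bij_betw v {0..<n::nat} U"
    using ex_bij_betw_nat_finite[OF U(1)] by blast
  have "\<forall>u\<in>U. \<exists>c. x * u = (\<Sum>w\<in>U. of_int (c w :: int) * w)"
    using st unfolding zspan_def by blast
  then obtain c where c: "\<And>u. u \<in> U \<Longrightarrow> x * u = (\<Sum>w\<in>U. of_int (c u w :: int) * w)"
    by metis
  define N where "N = Matrix.mat n n (\<lambda>(i, j). c (v i) (v j))"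
  define A :: "'a Matrix.mat" where "A = map_mat of_int N"
  define w where "w = Matrix.vec n v"
  have N: "N \<in> carrier_mat n n" and A: "A \<in> carrier_mat n n" and w: "w \<in> carrier_vec n"
    by (auto simp: N_def A_def w_def)
  have vU: "v i \<in> U" if "i < n" for i
    using that v by (auto simp: bij_betw_def)
  have "A *\<^sub>v w = x \<cdot>\<^sub>v w"
  proof (rule eq_vecI)
    fix i assume "i < dim_vec (x \<cdot>\<^sub>v w)"
    then have i: "i < n" by (simp add: w_def)
    have "vec_index (A *\<^sub>v w) i = (\<Sum>j = 0..<n. of_int (c (v i) (v j)) * v j)"
      using i by (simp add: A_def N_def w_def scalar_prod_def)
    also have "\<dots> = (\<Sum>u\<in>U. of_int (c (v i) u) * u)"
      by (rule sum.reindex_bij_betw[OF v])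
    also have "\<dots> = x * v i" using c[OF vU[OF i]] by simp
    finally show "vec_index (A *\<^sub>v w) i = vec_index (x \<cdot>\<^sub>v w) i" using i by (simp add: w_def)
  qed (simp add: A_def N_def w_def)
  moreover have "w \<noteq> 0\<^sub>v n"
  proof
    assume "w = 0\<^sub>v n"
    obtain i where "i < n" "v i = u0" using v U(2) by (auto simp: bij_betw_def)
    then have "vec_index w i = u0" by (simp add: w_def)
    then show False using \<open>w = 0\<^sub>v n\<close> \<open>i < n\<close> U(3) by simp
  qed
  ultimately have "eigenvalue A x"
    unfolding eigenvalue_def eigenvector_def using A w by auto
  then have root: "poly (char_poly A) x = 0" using eigenvalue_root_char_poly[OF A] by simp

  have "char_poly A = map_poly of_int (char_poly N)"
    unfolding A_def by (rule of_int_hom.char_poly_hom[OF N])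
  moreover have "lead_coeff (char_poly A) = 1"
    using degree_monic_char_poly[OF A] by simp
  ultimately show ?thesis using root by (intro algebraic_int.intros[of "char_poly A"]) auto
qed

text \<open>The powers of \<open>t\<close> below the degree of its monic equation generate such a
  group, the equation rewriting the top power. Membership of 1 provides the nonzero element that
  \<open>algebraic_int_if_stable\<close> asks for.\<close>

lemma algebraic_int_stable_module:
  fixes t :: "'a::field_char_0"
  assumes "algebraic_int t"
  obtains U where "finite U" "1 \<in> U" "\<And>u. u \<in> U \<Longrightarrow> t * u \<in> zspan U"
proof -
  obtain p where p: "lead_coeff p = 1" "\<forall>i. Polynomial.coeff p i \<in> \<int>" "poly p t = 0"
    using assms by (auto elim: algebraic_int.cases)
  define d where "d = degree p"
  have d: "d > 0"
  proof (rule ccontr)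
    assume "\<not> d > 0"
    then obtain c where "p = [:c:]" unfolding d_def by (auto elim: degree_eq_zeroE)
    then show False using p(1,3) by simp
  qed
  define U where "U = (\<lambda>e. t ^ e) ` {..<d}"
  have fU: "finite U" by (simp add: U_def)
  have t: "t ^ e \<in> zspan U" if "e < d" for e
    using that by (intro zspan_base[OF fU]) (auto simp: U_def)
  have "t ^ d \<in> zspan U"
  proof -
    have "0 = (\<Sum>i\<le>d. Polynomial.coeff p i * t ^ i)" using p(3) by (simp add: poly_altdef d_def)
    also have "\<dots> = (\<Sum>i<d. Polynomial.coeff p i * t ^ i) + t ^ d"
      using p(1) by (simp add: lessThan_Suc_atMost[symmetric] d_def)
    finally have "t ^ d = - (\<Sum>i<d. Polynomial.coeff p i * t ^ i)" by (simp add: add_eq_0_iff)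
    also have "\<dots> = of_int (-1) * (\<Sum>i<d. Polynomial.coeff p i * t ^ i)" by simp
    also have "\<dots> \<in> zspan U"
    proof (intro zspan_int_mult zspan_sum)
      fix i assume "i \<in> {..<d}"
      obtain k where "Polynomial.coeff p i = of_int k" using p(2) by (metis Ints_cases)
      then show "Polynomial.coeff p i * t ^ i \<in> zspan U"
        using t[of i] \<open>i \<in> {..<d}\<close> by (auto intro: zspan_int_mult)
    qed
    finally show ?thesis .
  qed
  then have "t * t ^ e \<in> zspan U" if "e < d" for e
    using t[of "Suc e"] that by (cases "Suc e = d") auto
  then have "t * u \<in> zspan U" if "u \<in> U" for u using that by (auto simp: U_def)
  moreover have "1 \<in> U" using d by (auto simp: U_def intro!: image_eqI[of _ _ 0])
  ultimately show ?thesis using that fU by blast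
qed

text \<open>Products of the generators of the separate stable groups generate one that serves all of
  \<open>T\<close>. This yields sums and products of algebraic integers as well as eigenvalues of
  matrices over them.\<close>

lemma algebraic_ints_stable_module:
  fixes T :: "'a::field_char_0 set"
  assumes "finite T" "\<And>t. t \<in> T \<Longrightarrow> algebraic_int t"
  obtains U where "finite U" "1 \<in> U" "\<And>t u. t \<in> T \<Longrightarrow> u \<in> U \<Longrightarrow> t * u \<in> zspan U"
  using assms
proof (induction T arbitrary: thesis rule: finite_induct)
  case empty
  show ?case by (rule empty(1)[of "{1}"]) auto
next
  case (insert t T)
  obtain U where U: "finite U" "1 \<in> U" "\<And>t u. t \<in> T \<Longrightarrow> u \<in> U \<Longrightarrow> t * u \<in> zspan U"
    using insert.IH insert.prems by blast
  obtain W where W: "finite W" "1 \<in> W" "\<And>w. w \<in> W \<Longrightarrow> t * w \<in> zspan W"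
    using algebraic_int_stable_module insert.prems by (metis insertI1)
  define V where "V = (\<lambda>(u, w). u * w) ` (U \<times> W)"
  have fV: "finite V" using U W by (simp add: V_def)
  have base: "u * w \<in> zspan V" if "u \<in> U" "w \<in> W" for u w
    using that by (intro zspan_base fV) (auto simp: V_def)
  have *: "y * w \<in> zspan V" if "y \<in> zspan U" "w \<in> W" for y w
    using zspan_mult_closed[of U w V y] base that by (simp add: mult.commute)
  have **: "u * y \<in> zspan V" if "y \<in> zspan W" "u \<in> U" for y u
    using zspan_mult_closed[of W u V y] base that by simp
  show ?case
  proof (rule insert.prems(1)[OF fV])
    show "1 \<in> V" using U W by (force simp: V_def)
    fix s v assume s: "s \<in> insert t T" and "v \<in> V"
    then obtain u w where uw: "u \<in> U" "w \<in> W" "v = u * w" by (auto simp: V_def)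
    show "s * v \<in> zspan V"
    proof (cases "s = t")
      case True
      then show ?thesis using **[OF W(3)[OF uw(2)] uw(1)] uw by (simp add: mult_ac)
    next
      case False
      then show ?thesis using *[OF U(3)[OF _ uw(1)] uw(2)] uw s by (simp add: mult_ac)
    qed
  qed
qed

text \<open>Scaling the entries of the eigenvector by a group stable under all matrix entries yields
  a finitely generated group stable under \<open>x\<close>. It is applied to generators of an order,
  which need not form a basis over the ring of integers.\<close>

lemma algebraic_int_eigenvalue:
  fixes x :: "'a::field_char_0"
  assumes J: "finite J" "j0 \<in> J" "v j0 \<noteq> 0"
    and N: "\<And>i j. i \<in> J \<Longrightarrow> j \<in> J \<Longrightarrow> algebraic_int (N i j)"
    and eq: "\<And>i. i \<in> J \<Longrightarrow> x * v i = (\<Sum>j\<in>J. N i j * v j)"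
  shows "algebraic_int x"
proof -
  define T where "T = (\<lambda>(i, j). N i j) ` (J \<times> J)"
  have "finite T" "\<And>t. t \<in> T \<Longrightarrow> algebraic_int t" using J N by (auto simp: T_def)
  then obtain U where U: "finite U" "1 \<in> U"
    "\<And>t u. t \<in> T \<Longrightarrow> u \<in> U \<Longrightarrow> t * u \<in> zspan U"
    using algebraic_ints_stable_module by blast
  define V where "V = (\<lambda>(u, j). u * v j) ` (U \<times> J)"
  have fV: "finite V" using U J by (simp add: V_def)
  have *: "y * v j \<in> zspan V" if "y \<in> zspan U" "j \<in> J" for y j
  proof -
    have "v j * u \<in> zspan V" if "u \<in> U" for u
      using that \<open>j \<in> J\<close> by (intro zspan_base fV) (auto simp: V_def mult.commute)
    from zspan_mult_closed[OF this \<open>y \<in> zspan U\<close>] show ?thesis by (simp add: mult.commute)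
  qed
  show ?thesis
  proof (rule algebraic_int_if_stable[OF fV])
    show "v j0 \<in> V" using U J by (force simp: V_def)
    fix w assume "w \<in> V"
    then obtain u i where ui: "u \<in> U" "i \<in> J" "w = u * v i" by (auto simp: V_def)
    have "x * w = (\<Sum>j\<in>J. (N i j * u) * v j)"
      using eq[OF ui(2)] by (simp add: ui sum_distrib_left mult_ac)
    also have "\<dots> \<in> zspan V" using ui by (intro zspan_sum * U(3)) (auto simp: T_def)
    finally show "x * w \<in> zspan V" .
  qed (rule J)
qed

lemma algebraic_int_add_mult:
  fixes x y :: "'a::field_char_0"
  assumes "algebraic_int x" "algebraic_int y"
  shows algebraic_int_add: "algebraic_int (x + y)" and algebraic_int_mult: "algebraic_int (x * y)"
proof -
  obtain U where U: "finite U" "1 \<in> U" "\<And>t u. t \<in> {x, y} \<Longrightarrow> u \<in> U \<Longrightarrow> t * u \<in> zspan U"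
    using algebraic_ints_stable_module[of "{x, y}"] assms by auto
  show "algebraic_int (x + y)"
    by (rule algebraic_int_if_stable[OF U(1,2)]) (auto simp: distrib_right intro!: zspan_add U)
  show "algebraic_int (x * y)"
    using zspan_mult_closed[of U x U] U
    by (intro algebraic_int_if_stable[OF U(1,2)]) (auto simp: mult.assoc)
qed

lemma algebraic_int_diff:
  fixes x y :: "'a::field_char_0"
  assumes "algebraic_int x" "algebraic_int y"
  shows "algebraic_int (x - y)"
  using algebraic_int_add[OF assms(1) algebraic_int_minus[OF assms(2)]] by simp

section \<open>Minimal polynomials and fields generated by one algebraic number\<close>

definition rpoly :: "rat poly \<Rightarrow> 'a::field_char_0 \<Rightarrow> 'a" where
  "rpoly f x = poly (map_poly of_rat f) x"

lemma rpoly_altdef: "rpoly f x = (\<Sum>i\<le>degree f. of_rat (coeff f i) * x ^ i)"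
  unfolding rpoly_def poly_altdef by (simp add: coeff_map_poly degree_map_poly)

lemma rpoly_0 [simp]: "rpoly 0 x = 0" and rpoly_1 [simp]: "rpoly 1 x = 1"
  by (simp_all add: rpoly_def)

lemma rpoly_pCons [simp]: "rpoly (pCons a p) x = of_rat a + x * rpoly p x"
  by (cases "a = 0 \<and> p = 0") (auto simp: rpoly_def map_poly_pCons)

lemma rpoly_add [simp]: "rpoly (p + q) x = rpoly p x + rpoly q x"
proof (induction p arbitrary: q)
  case (pCons a p)
  obtain b q' where "q = pCons b q'" by (cases q)
  then show ?case by (simp add: pCons.IH of_rat_add distrib_left add_ac)
qed simp

lemma rpoly_smult [simp]: "rpoly (smult c p) x = of_rat c * rpoly p x"
  by (induction p) (auto simp: of_rat_mult algebra_simps)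

lemma rpoly_mult [simp]: "rpoly (p * q) x = rpoly p x * rpoly q x"
  by (induction p) (auto simp: algebra_simps)

lemma rpoly_minus [simp]: "rpoly (- p) x = - rpoly p x"
  using rpoly_smult[of "-1" p x] by simp

lemma rpoly_diff [simp]: "rpoly (p - q) x = rpoly p x - rpoly q x"
  using rpoly_add[of p "-q" x] by simp

lemma rpoly_monom [simp]: "rpoly (monom c n) x = of_rat c * x ^ n"
  by (simp add: rpoly_def map_poly_monom poly_monom)

lemma rpoly_of_real: "rpoly f (of_real x :: complex) = of_real (rpoly f x)"
proof -
  have "of_real (of_rat a) = (of_rat a :: complex)" for a
    by (cases a) (simp add: of_rat_rat)
  then show ?thesis by (induction f) auto
qed

lemma rpoly_sum: "rpoly (sum f I) x = (\<Sum>i\<in>I. rpoly (f i) x)"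
  by (induction I rule: infinite_finite_induct) auto

definition alg_over_Q :: "'a::field_char_0 \<Rightarrow> bool" where
  "alg_over_Q x \<longleftrightarrow> (\<exists>f::rat poly. f \<noteq> 0 \<and> rpoly f x = 0)"

text \<open>Take a nonzero annihilating polynomial of least degree and make it monic; division with
  remainder gives divisibility, and comparing degrees gives irreducibility.\<close>

lemma minimal_polynomial:
  assumes "alg_over_Q x"
  obtains p :: "rat poly" where "irreducible p" "lead_coeff p = 1" "rpoly p x = 0"
    "\<And>q. rpoly q x = 0 \<Longrightarrow> p dvd q"
proof -
  define P where "P f \<longleftrightarrow> (f::rat poly) \<noteq> 0 \<and> rpoly f x = 0" for f
  obtain f where f: "P f" using assms unfolding alg_over_Q_def P_def by blast
  define g where "g = arg_min degree P"
  have g: "P g" unfolding g_def by (rule arg_min_natI[where P=P, OF f])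
  have min: "degree g \<le> degree q" if "P q" for q
    unfolding g_def by (rule arg_min_nat_le[where P=P, OF that])
  define p where "p = smult (inverse (lead_coeff g)) g"
  have p: "lead_coeff p = 1" "rpoly p x = 0" "p \<noteq> 0" "degree p = degree g"
    using g by (auto simp: p_def P_def)
  have dvd: "p dvd q" if "rpoly q x = 0" for q
  proof -
    have "rpoly (q mod p) x = 0"
      using that p(2) by (simp flip: minus_mult_div_eq_mod)
    moreover have "q mod p = 0 \<or> degree (q mod p) < degree g"
      using degree_mod_less[OF p(3), of q] p(4) by auto
    ultimately have "q mod p = 0" using min[of "q mod p"] unfolding P_def by linarith
    then show ?thesis by auto
  qed
  have "irreducible p"
  proof (rule Factorial_Ring.irreducibleI)
    show "p \<noteq> 0" by (rule p)
    show "\<not> is_unit p"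
      using p(1,2) by (auto simp: is_unit_iff_degree[OF p(3)] elim!: degree_eq_zeroE)
    fix a b assume ab: "p = a * b"
    then have nz: "a \<noteq> 0" "b \<noteq> 0" using p(3) by auto
    have "rpoly a x = 0 \<or> rpoly b x = 0" using p(2) ab by simp
    then have "p dvd a \<or> p dvd b" using dvd by auto
    then have "degree p \<le> degree a \<or> degree p \<le> degree b" using nz dvd_imp_degree_le by blast
    moreover have "degree p = degree a + degree b" using ab nz by (simp add: degree_mult_eq)
    ultimately show "is_unit a \<or> is_unit b"
      using nz by (auto simp: is_unit_iff_degree)
  qed
  then show ?thesis using that p dvd by blast
qed

lemma rpoly_pderiv: "poly (pderiv (map_poly of_rat p)) x = rpoly (pderiv p) (x::'a::field_char_0)"
proof -
  have "pderiv (map_poly of_rat p) = map_poly (of_rat :: rat \<Rightarrow> 'a) (pderiv p)"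
    by (rule poly_eqI) (simp add: coeff_pderiv coeff_map_poly of_rat_mult of_rat_add)
  then show ?thesis by (simp add: rpoly_def)
qed

text \<open>In characteristic 0 the derivative is nonzero of smaller degree, hence coprime to
  \<open>p\<close>; a Bezout relation over the rationals then excludes a common root in every
  extension field.\<close>

lemma irreducible_rat_poly_simple_roots:
  fixes x :: "'a::field_char_0"
  assumes p: "irreducible p" and x: "rpoly p x = 0"
  shows "rpoly (pderiv p) x \<noteq> 0"
proof
  assume d: "rpoly (pderiv p) x = 0"
  have p0: "p \<noteq> 0" and nu: "\<not> is_unit p" using p by (auto simp: irreducible_def)
  have deg: "degree p > 0" using nu is_unit_iff_degree[OF p0] by auto
  have "pderiv p \<noteq> 0" using deg by (simp add: pderiv_eq_0_iff)
  then have "\<not> p dvd pderiv p"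
    using dvd_imp_degree_le[of p "pderiv p"] deg by (auto simp: degree_pderiv)
  then have "coprime p (pderiv p)" by (rule prime_elem_imp_coprime[OF irreducible_imp_prime_elem_gcd[OF p]])
  then obtain u v where "u * p + v * pderiv p = 1"
    using bezout_coefficients_fst_snd[of p "pderiv p"] by (metis coprime_imp_gcd_eq_1)
  then have "rpoly u x * rpoly p x + rpoly v x * rpoly (pderiv p) x = 1"
    by (metis rpoly_add rpoly_mult rpoly_1)
  then show False using x d by simp
qed

lemma irreducible_rat_poly_card_roots:
  assumes p: "irreducible p"
  shows "card {z::complex. rpoly p z = 0} = degree p"
proof -
  let ?p = "map_poly of_rat p :: complex poly"
  have p0: "p \<noteq> 0" using p by auto
  have "rsquarefree ?p"
    unfolding rsquarefree_roots
    using irreducible_rat_poly_simple_roots[OF p, where 'a=complex] by (auto simp: rpoly_pderiv rpoly_def)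
  moreover have "?p \<noteq> 0" using calculation by (simp add: rsquarefree_def)
  ultimately have "card {z. poly ?p z = 0} = degree ?p" using rsquarefree_card_degree by blast
  then show ?thesis by (simp add: rpoly_def degree_map_poly)
qed

definition rat_span :: "'a::field_char_0 set \<Rightarrow> 'a set" where
  "rat_span S = {\<Sum>s\<in>S. of_rat (c s) * s | c. True}"

definition adj :: "'a::field_char_0 \<Rightarrow> 'a set" where
  "adj x = range (\<lambda>f. rpoly f x)"

text \<open>A subfield in the plain arithmetic of the type, detached from the ring records of the
  definitions.\<close>

definition fieldset :: "'a::field set \<Rightarrow> bool" where
  "fieldset F \<longleftrightarrow> 1 \<in> F \<and> (\<forall>x\<in>F. \<forall>y\<in>F. x - y \<in> F \<and> x * y \<in> F) \<and> (\<forall>x\<in>F. inverse x \<in> F)"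

lemma fieldset_closed:
  assumes "fieldset F"
  shows fieldset_1: "1 \<in> F" and fieldset_0: "0 \<in> F"
    and fieldset_diff: "\<And>x y. x \<in> F \<Longrightarrow> y \<in> F \<Longrightarrow> x - y \<in> F"
    and fieldset_mult: "\<And>x y. x \<in> F \<Longrightarrow> y \<in> F \<Longrightarrow> x * y \<in> F"
    and fieldset_inverse: "\<And>x. x \<in> F \<Longrightarrow> inverse x \<in> F"
    and fieldset_divide: "\<And>x y. x \<in> F \<Longrightarrow> y \<in> F \<Longrightarrow> x / y \<in> F"
    and fieldset_add: "\<And>x y. x \<in> F \<Longrightarrow> y \<in> F \<Longrightarrow> x + y \<in> F"
    and fieldset_uminus: "\<And>x. x \<in> F \<Longrightarrow> - x \<in> F"
proof -
  show 1: "1 \<in> F" and d: "\<And>x y. x \<in> F \<Longrightarrow> y \<in> F \<Longrightarrow> x - y \<in> F"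
    and m: "\<And>x y. x \<in> F \<Longrightarrow> y \<in> F \<Longrightarrow> x * y \<in> F" and i: "\<And>x. x \<in> F \<Longrightarrow> inverse x \<in> F"
    using assms by (auto simp: fieldset_def)
  show 0: "0 \<in> F" using d[OF 1 1] by simp
  show u: "- x \<in> F" if "x \<in> F" for x using d[OF 0 that] by simp
  show "x + y \<in> F" if "x \<in> F" "y \<in> F" for x y using d[OF that(1) u[OF that(2)]] by simp
  show "x / y \<in> F" if "x \<in> F" "y \<in> F" for x y using m i that by (simp add: divide_inverse)
qed

lemma fieldset_sum: "fieldset F \<Longrightarrow> (\<And>i. i \<in> I \<Longrightarrow> f i \<in> F) \<Longrightarrow> sum f I \<in> F"
  by (induction I rule: infinite_finite_induct) (auto intro: fieldset_0 fieldset_add)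

lemma fieldset_power: "fieldset F \<Longrightarrow> x \<in> F \<Longrightarrow> x ^ n \<in> F"
  by (induction n) (auto intro: fieldset_1 fieldset_mult)

lemma fieldset_rat: "fieldset F \<Longrightarrow> of_rat q \<in> (F :: 'a::field_char_0 set)"
proof -
  assume F: "fieldset F"
  have n: "of_nat n \<in> F" for n by (induction n) (auto intro: fieldset_0 fieldset_1 fieldset_add F)
  have i: "of_int k \<in> F" for k by (cases k) (auto intro!: n fieldset_uminus fieldset_diff F simp: fieldset_1 n F)
  show ?thesis by (cases q) (auto simp: of_rat_rat intro!: fieldset_divide F i)
qed

lemma fieldset_rpoly: "fieldset F \<Longrightarrow> x \<in> F \<Longrightarrow> rpoly f x \<in> F"
  by (induction f) (auto intro: fieldset_0 fieldset_add fieldset_mult fieldset_rat)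

text \<open>A nonzero value of \<open>f\<close> at \<open>x\<close> is inverted by the Bezout
  relation between \<open>f\<close> and the minimal polynomial.\<close>

lemma fieldset_adj: assumes "alg_over_Q x" shows "fieldset (adj x)"
proof -
  obtain p :: "rat poly" where p: "irreducible p" "lead_coeff p = 1" "rpoly p x = 0"
    "\<And>q. rpoly q x = 0 \<Longrightarrow> p dvd q" using minimal_polynomial[OF assms] by blast
  have "inverse (rpoly f x) \<in> adj x" for f
  proof (cases "rpoly f x = 0")
    case True
    then show ?thesis using rpoly_0 unfolding adj_def by (metis inverse_zero rangeI)
  next
    case False
    then have "\<not> p dvd f" using p(3) by auto
    then have "coprime p f" by (rule prime_elem_imp_coprime[OF irreducible_imp_prime_elem_gcd[OF p(1)]])
    then obtain u v where "u * p + v * f = 1"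
      using bezout_coefficients_fst_snd[of p f] by (metis coprime_imp_gcd_eq_1)
    then have "rpoly u x * rpoly p x + rpoly v x * rpoly f x = 1"
      by (metis rpoly_add rpoly_mult rpoly_1)
    then have "inverse (rpoly f x) = rpoly v x" using False p(3) by (simp add: field_simps)
    then show ?thesis by (auto simp: adj_def)
  qed
  then show ?thesis unfolding fieldset_def adj_def
    by (auto simp flip: rpoly_diff rpoly_mult) (metis rangeI rpoly_1)
qed

lemma adj_base: "x \<in> adj x"
  using rpoly_pCons[of 0 1 x] by (auto simp: adj_def intro: range_eqI[of _ _ "[:0, 1:]"])

text \<open>Long division stays within the coefficient field. This permits a minimal polynomial over
  the set \<open>adj u\<close>, although polynomials are formed over a whole type.\<close>

lemma poly_mod_coeff_closed:
  fixes g h :: "'a::field poly"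
  assumes F: "fieldset F" and h: "h \<noteq> 0" "\<And>i. coeff h i \<in> F" and g: "\<And>i. coeff g i \<in> F"
  shows "coeff (g mod h) i \<in> F"
  using g
proof (induction "degree g" arbitrary: g i rule: less_induct)
  case less
  show ?case
  proof (cases "degree g < degree h \<or> g = 0")
    case True
    then show ?thesis using less.prems by (auto simp: mod_poly_less)
  next
    case False
    then have dg: "degree g \<ge> degree h" "g \<noteq> 0" by auto
    define q where "q = monom (lead_coeff g / lead_coeff h) (degree g - degree h)"
    define g' where "g' = g - q * h"
    have cq: "coeff (q * h) i \<in> F" for i
      unfolding q_def coeff_monom_mult
      by (auto intro!: fieldset_0 fieldset_mult fieldset_divide F h less.prems)
    then have c': "coeff g' i \<in> F" for i by (auto simp: g'_def intro!: fieldset_diff F less.prems)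
    have "g mod h = g' mod h" by (simp add: g'_def mod_diff_right_eq[of g "q*h" h, symmetric] flip: mod_diff_eq)
    show ?thesis
    proof (cases "degree g = 0")
      case True
      then have "degree h = 0" using dg by simp
      then have "g mod h = 0" using h(1) by (simp add: is_unit_iff_degree unit_imp_dvd flip: dvd_eq_mod_eq_0)
      then show ?thesis by (simp add: fieldset_0[OF F])
    next
      case False
      have deg: "degree (q * h) = degree g"
        using dg h(1) by (simp add: q_def degree_mult_eq degree_monom_eq monom_eq_0_iff)
      have "lead_coeff q = lead_coeff g / lead_coeff h"
        using dg h(1) by (simp add: q_def degree_monom_eq)
      then have "lead_coeff (q * h) = lead_coeff g" using h(1) unfolding lead_coeff_mult by simp
      moreover note deg
      ultimately have "coeff (q * h) (degree g) = lead_coeff g" by simp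
      then have "degree g' < degree g"
        using degree_diff_le[of g "degree g" "q * h"] deg False
        by (metis coeff_diff degree_0 diff_self g'_def le_neq_implies_less leading_coeff_0_iff order_refl)
      then show ?thesis using less.hyps[of g' i] c' \<open>g mod h = g' mod h\<close> by simp
    qed
  qed
qed

interpretation ratvec: vector_space "\<lambda>q x. of_rat q * (x :: 'a::field_char_0)"
  by unfold_locales (auto simp: of_rat_add of_rat_mult algebra_simps)

text \<open>The family is indexed, so a repeated vector already counts as a dependence; that case
  precedes the reduction to dependence of sets.\<close>

lemma rat_span_dependent:
  fixes v :: "'i \<Rightarrow> 'a::field_char_0"
  assumes S: "finite S" and I: "finite I" "card S < card I" and v: "\<And>i. i \<in> I \<Longrightarrow> v i \<in> rat_span S"
  obtains c where "\<exists>i\<in>I. c i \<noteq> 0" "(\<Sum>i\<in>I. of_rat (c i) * v i) = 0"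
proof (cases "inj_on v I")
  case False
  then obtain i j where ij: "i \<in> I" "j \<in> I" "i \<noteq> j" "v i = v j" by (auto simp: inj_on_def)
  define c where "c k = (if k = i then 1 else if k = j then -1 else 0 :: rat)" for k
  have "(\<Sum>k\<in>I. of_rat (c k) * v k) = (\<Sum>k\<in>{i, j}. of_rat (c k) * v k)"
    using ij I by (intro sum.mono_neutral_right) (auto simp: c_def)
  also have "\<dots> = 0" using ij by (simp add: c_def)
  finally show ?thesis using that[of c] ij by (force simp: c_def)
next
  case True
  have "v ` I \<subseteq> ratvec.span S"
  proof
    fix x assume "x \<in> v ` I"
    then obtain c where "x = (\<Sum>s\<in>S. of_rat (c s) * s)" using v unfolding rat_span_def by blast
    then show "x \<in> ratvec.span S"
      by (simp add: ratvec.span_sum ratvec.span_scale ratvec.span_base)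
  qed
  moreover have "card (v ` I) = card I" using True by (rule card_image)
  ultimately have "ratvec.dependent (v ` I)"
    using ratvec.independent_span_bound[OF S, of "v ` I"] I by auto
  then obtain u where u: "\<exists>w\<in>v ` I. u w \<noteq> 0" "(\<Sum>w\<in>v ` I. of_rat (u w) * w) = 0"
    using ratvec.dependent_finite[of "v ` I"] I by auto
  show ?thesis
  proof (rule that[of "\<lambda>i. u (v i)"])
    show "(\<Sum>i\<in>I. of_rat (u (v i)) * v i) = 0" using u(2) by (simp add: sum.reindex[OF True])
  qed (use u in auto)
qed

lemma alg_over_Q_in_rat_span:
  assumes S: "finite S" and p: "\<And>n. x ^ n \<in> rat_span S"
  shows "alg_over_Q x"
proof -
  obtain c where c: "\<exists>i\<in>{..card S}. c i \<noteq> 0" "(\<Sum>i\<in>{..card S}. of_rat (c i) * x ^ i) = 0"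
    using rat_span_dependent[OF S, of "{..card S}" "\<lambda>i. x ^ i"] p by auto
  define f where "f = (\<Sum>i\<le>card S. monom (c i) i)"
  have "rpoly f x = 0" using c(2) by (simp add: f_def rpoly_sum)
  moreover have "f \<noteq> 0"
  proof -
    obtain i where "i \<le> card S" "c i \<noteq> 0" using c(1) by auto
    then have "coeff f i \<noteq> 0" by (simp add: f_def coeff_sum)
    then show ?thesis by auto
  qed
  ultimately show ?thesis by (auto simp: alg_over_Q_def)
qed

definition min_poly :: "'a::field_char_0 \<Rightarrow> rat poly" where
  "min_poly x = (SOME p. irreducible p \<and> lead_coeff p = 1 \<and> rpoly p x = 0 \<and> (\<forall>q. rpoly q x = 0 \<longrightarrow> p dvd q))"

lemma min_poly:
  assumes "alg_over_Q x"
  shows "irreducible (min_poly x)" "lead_coeff (min_poly x) = 1" "rpoly (min_poly x) x = 0"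
    "\<And>q. rpoly q x = 0 \<Longrightarrow> min_poly x dvd q"
proof -
  have "\<exists>p. irreducible p \<and> lead_coeff p = 1 \<and> rpoly p x = 0 \<and> (\<forall>q. rpoly q x = 0 \<longrightarrow> p dvd q)"
    using minimal_polynomial[OF assms] by metis
  from someI_ex[OF this] show "irreducible (min_poly x)" "lead_coeff (min_poly x) = 1" "rpoly (min_poly x) x = 0"
    "\<And>q. rpoly q x = 0 \<Longrightarrow> min_poly x dvd q" unfolding min_poly_def by blast+
qed

lemma min_poly_nonzero: "alg_over_Q x \<Longrightarrow> min_poly x \<noteq> 0"
  using min_poly(1) by auto

lemma min_poly_degree_pos: "alg_over_Q x \<Longrightarrow> degree (min_poly x) > 0"
  using min_poly(1)[of x] min_poly_nonzero[of x] by (auto simp: irreducible_def is_unit_iff_degree)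

lemma powers_independent:
  assumes x: "alg_over_Q x" and c: "(\<Sum>i<degree (min_poly x). of_rat (c i) * x ^ i) = 0"
    and i: "i < degree (min_poly x)"
  shows "c i = 0"
proof -
  let ?d = "degree (min_poly x)"
  define f where "f = (\<Sum>i<?d. monom (c i) i)"
  have f: "rpoly f x = 0" using c by (simp add: f_def rpoly_sum)
  have "degree f < ?d" unfolding f_def using min_poly_degree_pos[OF x]
    by (intro degree_sum_less) (auto intro: le_less_trans[OF degree_monom_le])
  moreover have "min_poly x dvd f" using min_poly(4)[OF x] f by simp
  ultimately have "f = 0" using dvd_imp_degree_le[of "min_poly x" f] by (cases "f = 0") auto
  moreover have "coeff f i = c i" using i by (simp add: f_def coeff_sum)
  ultimately show ?thesis by simp
qed

lemma adj_eq_power_sums: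
  assumes x: "alg_over_Q x" and y: "y \<in> adj x"
  obtains c where "y = (\<Sum>i<degree (min_poly x). of_rat (c i) * x ^ i)"
proof -
  let ?p = "min_poly x"
  obtain f where f: "y = rpoly f x" using y by (auto simp: adj_def)
  define g where "g = f mod ?p"
  have "rpoly g x = y" using min_poly(3)[OF x] by (simp add: g_def f flip: minus_mult_div_eq_mod)
  moreover have "degree g < degree ?p"
    using degree_mod_less[OF min_poly_nonzero[OF x], of f] min_poly_degree_pos[OF x] by (auto simp: g_def)
  then have "(\<Sum>i\<le>degree g. of_rat (coeff g i) * x ^ i) = (\<Sum>i<degree ?p. of_rat (coeff g i) * x ^ i)"
    by (intro sum.mono_neutral_left) (auto simp: coeff_eq_0)
  ultimately show ?thesis using that[of "coeff g"] by (simp add: rpoly_altdef)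
qed

lemma adj_subset_rat_span:
  assumes x: "alg_over_Q x"
  shows "adj x \<subseteq> rat_span ((\<lambda>i. x ^ i) ` {..<degree (min_poly x)})"
proof
  fix y assume "y \<in> adj x"
  then obtain c where c: "y = (\<Sum>i<degree (min_poly x). of_rat (c i) * x ^ i)"
    using adj_eq_power_sums[OF x] by metis
  \<comment> \<open>\<open>rat_span\<close> sums over a set, so the powers must be distinct before
    they can index the coefficients.\<close>
  have inj: "inj_on (\<lambda>i. x ^ i) {..<degree (min_poly x)}"
  proof (rule inj_onI, rule ccontr)
    fix i j assume ij: "i \<in> {..<degree (min_poly x)}" "j \<in> {..<degree (min_poly x)}" "x ^ i = x ^ j" "i \<noteq> j"
    define c where "c k = (if k = i then 1 else if k = j then -1 else 0 :: rat)" for k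
    have "(\<Sum>k<degree (min_poly x). of_rat (c k) * x ^ k) = (\<Sum>k\<in>{i, j}. of_rat (c k) * x ^ k)"
      using ij by (intro sum.mono_neutral_right) (auto simp: c_def)
    also have "\<dots> = 0" using ij by (simp add: c_def)
    finally have "c i = 0" using powers_independent[OF x] ij by blast
    then show False by (simp add: c_def)
  qed
  show "y \<in> rat_span ((\<lambda>i. x ^ i) ` {..<degree (min_poly x)})"
    unfolding rat_span_def
    by (intro CollectI exI[of _ "\<lambda>s. c (the_inv_into {..<degree (min_poly x)} (\<lambda>i. x ^ i) s)"])
      (simp add: c sum.reindex[OF inj] the_inv_into_f_f[OF inj])
qed

lemma fieldset_adjD: "fieldset F \<Longrightarrow> x \<in> F \<Longrightarrow> adj x \<subseteq> F"
  by (auto simp: adj_def intro: fieldset_rpoly)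

section \<open>The primitive element theorem\<close>

lemma map_poly_of_real_pCons:
  "map_poly of_real (pCons a p) = pCons (of_real a :: complex) (map_poly of_real p)"
  by (cases "a = 0 \<and> p = 0") (auto simp: map_poly_pCons)

lemma map_poly_add_of_real:
  "map_poly of_real (p + q) = (map_poly of_real p + map_poly of_real q :: complex poly)"
  by (rule poly_eqI) (simp add: coeff_map_poly)

lemma map_poly_mult_of_real:
  "map_poly of_real (p * q) = (map_poly of_real p * map_poly of_real q :: complex poly)"
  by (rule poly_eqI) (simp add: coeff_map_poly coeff_mult)

text \<open>With \<open>u = x + c y\<close>, for all but finitely many \<open>c\<close> the only
  common root of the minimal polynomial \<open>g\<close> of \<open>y\<close> and of
  \<open>f(u - c T)\<close> is \<open>y\<close>. The minimal polynomial of \<open>y\<close> over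
  \<open>adj u\<close> divides both, so it is linear and \<open>y\<close> lies in
  \<open>adj u\<close>.\<close>

lemma primitive_element_two:
  fixes x y :: real
  assumes x: "alg_over_Q x" and y: "alg_over_Q y" and xy: "\<And>c. alg_over_Q (x + of_rat c * y)"
  obtains c where "x \<in> adj (x + of_rat c * y)" "y \<in> adj (x + of_rat c * y)"
proof -
  define f where "f = min_poly x"
  define g where "g = min_poly y"
  have f: "f \<noteq> 0" "rpoly f x = 0" and g: "g \<noteq> 0" "rpoly g y = 0" "irreducible g"
    using min_poly min_poly_nonzero x y by (auto simp: f_def g_def)
  have fin: "finite {z::complex. rpoly q z = 0}" if "q \<noteq> 0" for q
    unfolding rpoly_def using that by (intro poly_roots_finite) simp
  \<comment> \<open>The values of \<open>c\<close> for which another conjugate of \<open>y\<close>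
    would be a common root. Pairs with \<open>w\<close> equal to \<open>y\<close> divide by zero and
    contribute only the value 0.\<close>
  define B where "B = (\<lambda>(z, w). (z - of_real x) / (of_real y - w)) `
    ({z::complex. rpoly f z = 0} \<times> {w::complex. rpoly g w = 0})"
  have "finite B" using fin f g by (simp add: B_def)
  moreover have "infinite (range (of_rat :: rat \<Rightarrow> complex))"
  proof
    assume "finite (range (of_rat :: rat \<Rightarrow> complex))"
    then have "finite (UNIV :: rat set)" by (rule finite_imageD) (auto intro: injI)
    then show False using infinite_UNIV_char_0 by blast
  qed
  ultimately obtain c where c: "of_rat c \<notin> B" by (metis finite_subset image_subsetI)
  define u where "u = x + of_rat c * y"
  have F: "fieldset (adj u)" unfolding u_def by (rule fieldset_adj[OF xy])
  \<comment> \<open>A member of least degree is, up to a scalar, the minimal polynomial of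
    \<open>y\<close> over \<open>adj u\<close>.\<close>
  define P where "P h \<longleftrightarrow> h \<noteq> 0 \<and> (\<forall>i. coeff h i \<in> adj u) \<and> poly h y = 0" for h
  have Pg: "P (map_poly of_rat g)"
    using g fieldset_rat[OF F] by (auto simp: P_def coeff_map_poly rpoly_def)
  define h where "h = arg_min degree P"
  have h: "P h" unfolding h_def by (rule arg_min_natI[where P=P, OF Pg])
  have hmin: "degree h \<le> degree q" if "P q" for q
    unfolding h_def by (rule arg_min_nat_le[where P=P, OF that])
  have h0: "h \<noteq> 0" and hF: "\<And>i. coeff h i \<in> adj u" and hy: "poly h y = 0"
    using h by (auto simp: P_def)
  have hdvd: "h dvd q" if q: "\<And>i. coeff q i \<in> adj u" "poly q y = 0" for q
  proof -
    have "poly (q mod h) y = 0" using q hy by (simp flip: minus_mult_div_eq_mod)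
    moreover have "coeff (q mod h) i \<in> adj u" for i by (rule poly_mod_coeff_closed[OF F h0 hF q(1)])
    moreover have "q mod h = 0 \<or> degree (q mod h) < degree h" using degree_mod_less[OF h0, of q] .
    ultimately have "q mod h = 0" using hmin[of "q mod h"] unfolding P_def by (meson linorder_not_less)
    then show ?thesis by auto
  qed
  have hg: "h dvd map_poly of_rat g" using Pg by (intro hdvd) (auto simp: P_def)
  \<comment> \<open>This is \<open>f(u - c T)\<close>: it vanishes at \<open>y\<close> because
    \<open>u - c y = x\<close>.\<close>
  let ?q = "pcompose (map_poly of_rat f) [:u, - of_rat c:]"
  have qF: "coeff ?q i \<in> adj u" for i
  proof -
    have lin: "coeff [:u, - of_rat c:] j \<in> adj u" for j
      using adj_base fieldset_uminus[OF F] fieldset_rat[OF F] fieldset_0[OF F]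
      by (auto simp: coeff_pCons split: nat.split)
    have prod: "coeff (p * q) j \<in> adj u" if "\<And>i. coeff p i \<in> adj u" "\<And>i. coeff q i \<in> adj u" for p q j
      unfolding coeff_mult by (intro fieldset_sum fieldset_mult F that)
    have "coeff (pcompose (map_poly of_rat f) [:u, - of_rat c:]) i \<in> adj u" for f :: "rat poly" and i
    proof (induction f arbitrary: i)
      case 0
      then show ?case by (simp add: fieldset_0[OF F])
    next
      case (pCons a f)
      have "coeff [:of_rat a:] i \<in> adj u" for i
        using fieldset_rat[OF F] fieldset_0[OF F] by (auto simp: coeff_pCons split: nat.split)
      moreover have "pcompose (map_poly of_rat (pCons a f)) [:u, - of_rat c:] =
          [:of_rat a:] + [:u, - of_rat c:] * pcompose (map_poly of_rat f) [:u, - of_rat c:]"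
        using pCons.hyps by (simp add: map_poly_pCons pcompose_pCons)
      ultimately show ?case
        using pCons.IH by (simp only: coeff_add) (intro fieldset_add F prod lin; simp)
    qed
    then show ?thesis .
  qed
  have "poly ?q y = 0" using f by (simp add: poly_pcompose u_def rpoly_def)
  then have hq: "h dvd ?q" by (intro hdvd qF)
  have roots: "w = of_real y" if w: "poly (map_poly of_real h) (w::complex) = 0" for w
  proof (rule ccontr)
    assume ne: "w \<noteq> of_real y"
    have dv: "poly (map_poly of_real q) w = 0" if "h dvd q" for q :: "real poly"
    proof -
      obtain k where "q = h * k" using \<open>h dvd q\<close> by auto
      then have "map_poly of_real q = map_poly of_real h * (map_poly of_real k :: complex poly)"
        by (simp add: of_real_hom.hom_mult map_poly_mult_of_real)
      then show ?thesis using w by simp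
    qed
    have rc: "map_poly of_real (map_poly of_rat q :: real poly) = (map_poly of_rat q :: complex poly)" for q
    proof -
      have "of_real (of_rat a) = (of_rat a :: complex)" for a by (cases a) (simp add: of_rat_rat)
      then show ?thesis by (intro poly_eqI) (simp add: coeff_map_poly)
    qed
    have "rpoly g w = 0" using dv[OF hg] by (simp add: rpoly_def rc)
    moreover have "rpoly f (of_real u - of_rat c * w) = 0"
    proof -
      have "poly (map_poly of_real (pcompose q [:u, - of_rat c:])) w =
          poly (map_poly of_real q) (of_real u - of_rat c * w)" for q :: "real poly"
      proof (induction q)
        case (pCons a q)
        have "of_real (of_rat c) = (of_rat c :: complex)" by (cases c) (simp add: of_rat_rat)
        then show ?case
          by (simp only: pcompose_pCons map_poly_add_of_real map_poly_mult_of_real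
              map_poly_of_real_pCons poly_add poly_mult poly_pCons pCons.IH) (simp add: algebra_simps)
      qed simp
      then show ?thesis using dv[OF hq] by (simp add: rpoly_def rc)
    qed
    ultimately have "((of_real u - of_rat c * w) - of_real x) / (of_real y - w) \<in> B"
      by (auto simp: B_def intro!: image_eqI[of _ _ "(of_real u - of_rat c * w, w)"])
    moreover have "((of_real u - of_rat c * w) - of_real x) / (of_real y - w) = of_rat c"
    proof -
      have "of_real (of_rat c) = (of_rat c :: complex)" by (cases c) (simp add: of_rat_rat)
      then show ?thesis using ne by (simp add: u_def field_simps)
    qed
    ultimately show False using c by simp
  qed
  obtain k where k: "h = [:- y, 1:] * k" using hy by (auto simp: poly_eq_0_iff_dvd)
  have k0: "k \<noteq> 0" using k h0 by auto
  \<comment> \<open>A further factor would have a complex root, again equal to \<open>y\<close>, and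
    \<open>y\<close> would be a double root of \<open>g\<close>.\<close>
  have "degree k = 0"
  proof (rule ccontr)
    assume "degree k \<noteq> 0"
    then have nc: "\<not> constant (poly (map_poly of_real k :: complex poly))"
      by (simp add: constant_degree)
    obtain w where w: "poly (map_poly of_real k) (w::complex) = 0"
      using Fundamental_Theorem_Algebra.fundamental_theorem_of_algebra[OF nc] by (elim exE)
    have "map_poly of_real h = map_poly of_real [:- y, 1:] * (map_poly of_real k :: complex poly)"
      unfolding k by (rule map_poly_mult_of_real)
    then have "poly (map_poly of_real h) w = 0" using w by (simp only: poly_mult mult_zero_right)
    then have "w = of_real y" by (rule roots)
    then have "poly k y = 0" using w by (simp add: of_real_hom.poly_map_poly)
    then obtain k' where k': "k = [:- y, 1:] * k'" by (auto simp: poly_eq_0_iff_dvd)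
    obtain g' where "map_poly of_rat g = h * g'" using hg by (elim dvdE)
    then have "map_poly of_rat g = [:- y, 1:] * ([:- y, 1:] * k') * g'" by (simp only: k k')
    then have "poly (pderiv (map_poly of_rat g)) y = 0"
      by (simp only: pderiv_mult poly_add poly_mult) simp
    then show False using irreducible_rat_poly_simple_roots[OF g(3) g(2)] by (simp add: rpoly_pderiv)
  qed
  then obtain e where e: "k = [:e:]" by (auto elim: degree_eq_zeroE)
  then have "coeff h 0 = - y * e" "coeff h 1 = e" using k by simp_all
  then have "y = - (coeff h 0 / coeff h 1)" using e k0 by auto
  then have yF: "y \<in> adj u" using fieldset_uminus[OF F] fieldset_divide[OF F] hF by simp
  have "x = u - of_rat c * y" by (simp add: u_def)
  then have "x \<in> adj u" using yF by (auto intro!: fieldset_diff fieldset_mult fieldset_rat F adj_base)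
  then show ?thesis using that[of c] yF by (simp add: u_def)
qed

text \<open>Take \<open>x\<close> of largest degree in \<open>K\<close>; degrees are bounded by the
  dimension. If \<open>y\<close> were outside \<open>adj x\<close>, the powers of \<open>x\<close>
  together with \<open>y\<close> would be independent inside \<open>adj u\<close> for some
  \<open>u\<close> in \<open>K\<close>, whose degree would then be too large.\<close>

theorem primitive_element:
  fixes K :: "real set"
  assumes K: "fieldset K" and S: "finite S" "K \<subseteq> rat_span S"
  obtains x where "x \<in> K" "K = adj x" "alg_over_Q x"
proof -
  have alg: "alg_over_Q x" if "x \<in> K" for x
    using fieldset_power[OF K that] S by (intro alg_over_Q_in_rat_span[OF S(1)]) auto
  define D where "D = (\<lambda>x. degree (min_poly x)) ` K"
  have bound: "degree (min_poly x) \<le> card S" if xK: "x \<in> K" for x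
  proof (rule ccontr)
    assume "\<not> degree (min_poly x) \<le> card S"
    then have "card S < card {..<degree (min_poly x)}" by simp
    moreover have "x ^ i \<in> rat_span S" for i using fieldset_power[OF K xK] S(2) by auto
    ultimately obtain c where c: "\<exists>i\<in>{..<degree (min_poly x)}. c i \<noteq> 0"
      "(\<Sum>i<degree (min_poly x). of_rat (c i) * x ^ i) = 0"
      using rat_span_dependent[OF S(1) finite_lessThan, of "degree (min_poly x)" "\<lambda>i. x ^ i"] by metis
    then show False using powers_independent[OF alg[OF xK] c(2)] by auto
  qed
  have "finite D" using bound by (auto simp: D_def intro!: finite_subset[of _ "{..card S}"])
  have "D \<noteq> {}" using fieldset_1[OF K] by (auto simp: D_def)
  have "Max D \<in> D" by (rule Max_in) fact+
  then obtain x where xM: "x \<in> K" "Max D = degree (min_poly x)" by (auto simp: D_def)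
  have x: "x \<in> K" "\<And>y. y \<in> K \<Longrightarrow> degree (min_poly y) \<le> degree (min_poly x)"
    using xM Max_ge[OF \<open>finite D\<close>] by (auto simp: D_def)
  have "y \<in> adj x" if y: "y \<in> K" for y
  proof (rule ccontr)
    assume ny: "y \<notin> adj x"
    have in_K: "x + of_rat c * y \<in> K" for c
      by (intro fieldset_add fieldset_mult fieldset_rat K x y)
    obtain c where c: "x \<in> adj (x + of_rat c * y)" "y \<in> adj (x + of_rat c * y)"
      using primitive_element_two[OF alg[OF x(1)] alg[OF y] alg[OF in_K]] by blast
    define u where "u = x + of_rat c * y"
    have u: "u \<in> K" "alg_over_Q u" using in_K alg by (auto simp: u_def)
    have F: "fieldset (adj u)" by (rule fieldset_adj[OF u(2)])
    define m where "m = degree (min_poly x)"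
    \<comment> \<open>These are \<open>m + 1\<close> vectors in a space of dimension at most
      \<open>m\<close>; the resulting relation must involve \<open>y\<close>, since the powers of
      \<open>x\<close> are independent.\<close>
    define v where "v i = (if i < m then x ^ i else y)" for i
    define T where "T = (\<lambda>i. u ^ i) ` {..<degree (min_poly u)}"
    have "v i \<in> rat_span T" for i
      using adj_subset_rat_span[OF u(2)] c fieldset_power[OF F] by (auto simp: v_def T_def u_def)
    moreover have "card T < card {..m}"
      using card_image_le[of "{..<degree (min_poly u)}" "\<lambda>i. u ^ i"] x(2)[OF u(1)]
      by (simp add: T_def m_def)
    ultimately obtain d where d: "\<exists>i\<in>{..m}. d i \<noteq> 0" "(\<Sum>i\<in>{..m}. of_rat (d i) * v i) = 0"
      using rat_span_dependent[of T "{..m}" v] by (auto simp: T_def)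
    have eq: "(\<Sum>i<m. of_rat (d i) * x ^ i) + of_rat (d m) * y = 0"
      using d(2) by (simp add: v_def flip: lessThan_Suc_atMost)
    show False
    proof (cases "d m = 0")
      case True
      then have "\<And>i. i < m \<Longrightarrow> d i = 0"
        using powers_independent[OF alg[OF x(1)]] eq by (simp add: m_def)
      then show False using d(1) True by (metis atMost_iff le_neq_implies_less)
    next
      case False
      then have "y = - (\<Sum>i<m. of_rat (d i) * x ^ i) / of_rat (d m)"
        using eq by (simp add: field_simps add_eq_0_iff)
      also have "\<dots> \<in> adj x"
        using fieldset_adj[OF alg[OF x(1)]] adj_base
        by (intro fieldset_divide fieldset_uminus fieldset_sum fieldset_mult fieldset_rat fieldset_power)
      finally show False using ny by simp
    qed
  qed
  then have "K = adj x" using fieldset_adjD[OF K x(1)] by auto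
  then show ?thesis using that x(1) alg by blast
qed

section \<open>Real embeddings of a totally real field\<close>

lemma subfield_imp_fieldset:
  assumes "subfield K real_ring"
  shows "fieldset K"
proof -
  interpret R: Ring.field "real_ring" by (rule field_from_type_algebra)
  interpret K: subfield K "real_ring" by (rule assms)
  have r: "\<one>\<^bsub>real_ring\<^esub> = (1::real)" "\<zero>\<^bsub>real_ring\<^esub> = (0::real)"
    "\<And>x y. x \<otimes>\<^bsub>real_ring\<^esub> y = (x * y :: real)" "\<And>x y. x \<oplus>\<^bsub>real_ring\<^esub> y = (x + y :: real)"
    by (simp_all add: ring_of_type_algebra_def)
  have m: "\<ominus>\<^bsub>real_ring\<^esub> x = - x" for x
    using R.minus_equality[of "-x" x] by (simp add: ring_of_type_algebra_def)
  have 1: "1 \<in> K" using subringE(3)[OF subfieldE(1)[OF assms]] r by simp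
  have mult: "x * y \<in> K" if "x \<in> K" "y \<in> K" for x y using subringE(6)[OF subfieldE(1)[OF assms] that] r by simp
  have add: "x + y \<in> K" if "x \<in> K" "y \<in> K" for x y using subringE(7)[OF subfieldE(1)[OF assms] that] r by simp
  have neg: "- x \<in> K" if "x \<in> K" for x using subringE(5)[OF subfieldE(1)[OF assms] that] m by simp
  have inv: "inverse x \<in> K" if x: "x \<in> K" for x
  proof (cases "x = 0")
    case False
    then have "x \<in> K - {\<zero>\<^bsub>real_ring\<^esub>}" using x r by simp
    from R.subfield_m_inv[OF assms this] have "inv\<^bsub>real_ring\<^esub> x \<in> K" "x * inv\<^bsub>real_ring\<^esub> x = 1"
      by (auto simp: r)
    moreover from this have "inv\<^bsub>real_ring\<^esub> x = inverse x" using False by (simp add: field_simps)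
    ultimately show ?thesis by simp
  qed (use x in simp)
  show ?thesis unfolding fieldset_def using 1 mult inv add neg by (metis diff_conv_add_uminus)
qed

lemma lin_combs_rat_subset:
  assumes "finite S"
  shows "lin_combs \<rat> (S :: real set) \<subseteq> rat_span S"
proof
  fix x assume "x \<in> lin_combs \<rat> S"
  then obtain n :: nat and c v where x: "x = (\<Sum>j<n. c j *\<^sub>R v j)" "\<forall>j<n. c j \<in> \<rat> \<and> v j \<in> S"
    unfolding lin_combs_def by blast
  have add: "y + z \<in> rat_span S" if yz: "y \<in> rat_span S" "z \<in> rat_span S" for y z
  proof -
    obtain c d where "y = (\<Sum>s\<in>S. of_rat (c s) * s)" "z = (\<Sum>s\<in>S. of_rat (d s) * s)"
      using yz unfolding rat_span_def by auto
    then have "y + z = (\<Sum>s\<in>S. of_rat (c s + d s) * s)" by (simp add: of_rat_add algebra_simps sum.distrib)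
    then show ?thesis unfolding rat_span_def by (intro CollectI exI[of _ "\<lambda>s. c s + d s"]) simp
  qed
  have "c j *\<^sub>R v j \<in> rat_span S" if j: "j < n" for j
  proof -
    obtain q where q: "c j = of_rat q" using x(2) j by (auto elim: Rats_cases)
    have "(\<Sum>s\<in>S. of_rat (if s = v j then q else 0) * s) = (\<Sum>s\<in>S. if s = v j then of_rat q * s else 0)"
      by (intro sum.cong) auto
    also have "\<dots> = c j *\<^sub>R v j" using assms x(2) j q by simp
    finally show ?thesis unfolding rat_span_def
      by (intro CollectI exI[of _ "\<lambda>s. if s = v j then q else 0"]) simp
  qed
  moreover have "0 \<in> rat_span S" unfolding rat_span_def by (intro CollectI exI[of _ "\<lambda>_. 0"]) simp
  ultimately have "(\<Sum>j<m. c j *\<^sub>R v j) \<in> rat_span S" if "m \<le> n" for m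
    using that by (induction m) (auto intro: add)
  then show "x \<in> rat_span S" using x by simp
qed

lemma ring_hom_real_iff:
  "h \<in> ring_hom (real_ring\<lparr>carrier := K\<rparr>) (ring_of_type_algebra :: 'b::ring_1 ring) \<longleftrightarrow>
     (\<forall>x\<in>K. \<forall>y\<in>K. h (x * y) = h x * h y \<and> h (x + y) = h x + h y) \<and> h 1 = 1"
  by (auto simp: Ring.ring_hom_def ring_of_type_algebra_def)

text \<open>The target type is free, so that real and complex embeddings are treated alike.\<close>

definition field_emb :: "'a::field_char_0 set \<Rightarrow> ('a \<Rightarrow> 'b::field_char_0) \<Rightarrow> bool" where
  "field_emb K h \<longleftrightarrow> fieldset K \<and>
     (\<forall>x\<in>K. \<forall>y\<in>K. h (x * y) = h x * h y \<and> h (x + y) = h x + h y) \<and> h 1 = 1"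

lemma field_embD:
  assumes "field_emb K h"
  shows field_emb_mult: "\<And>x y. x \<in> K \<Longrightarrow> y \<in> K \<Longrightarrow> h (x * y) = h x * h y"
    and field_emb_add: "\<And>x y. x \<in> K \<Longrightarrow> y \<in> K \<Longrightarrow> h (x + y) = h x + h y"
    and field_emb_1: "h 1 = 1" and field_emb_0: "h 0 = 0"
    and field_emb_uminus: "\<And>x. x \<in> K \<Longrightarrow> h (- x) = - h x"
    and field_emb_diff: "\<And>x y. x \<in> K \<Longrightarrow> y \<in> K \<Longrightarrow> h (x - y) = h x - h y"
    and field_emb_nonzero: "\<And>x. x \<in> K \<Longrightarrow> x \<noteq> 0 \<Longrightarrow> h x \<noteq> 0"
proof -
  note F = assms[unfolded field_emb_def, THEN conjunct1]
  show m: "\<And>x y. x \<in> K \<Longrightarrow> y \<in> K \<Longrightarrow> h (x * y) = h x * h y"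
    and a: "\<And>x y. x \<in> K \<Longrightarrow> y \<in> K \<Longrightarrow> h (x + y) = h x + h y" and o: "h 1 = 1"
    using assms by (auto simp: field_emb_def)
  show z: "h 0 = 0" using a[OF fieldset_0[OF F] fieldset_0[OF F]] by simp
  show u: "h (- x) = - h x" if "x \<in> K" for x
    using a[OF that fieldset_uminus[OF F that]] z by (simp add: eq_neg_iff_add_eq_0 add.commute)
  show "h (x - y) = h x - h y" if "x \<in> K" "y \<in> K" for x y
    using a[OF that(1) fieldset_uminus[OF F that(2)]] u[OF that(2)] by simp
  show "h x \<noteq> 0" if "x \<in> K" "x \<noteq> 0" for x
    using m[OF that(1) fieldset_inverse[OF F that(1)]] that o by auto
qed

lemma field_emb_of_rat: assumes "field_emb K h" shows "h (of_rat q) = of_rat q"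
proof -
  note F = assms[unfolded field_emb_def, THEN conjunct1]
  have n: "h (of_nat n) = of_nat n" for n
  proof (induction n)
    case (Suc n)
    have "of_nat n \<in> K" using fieldset_rat[OF F, of "of_nat n"] by simp
    then show ?case using Suc field_emb_add[OF assms fieldset_1[OF F]] field_emb_1[OF assms] by simp
  qed (simp add: field_emb_0[OF assms])
  have iK: "of_int k \<in> K" for k using fieldset_rat[OF F, of "of_int k"] by simp
  have i: "h (of_int k) = of_int k" for k
  proof (cases k rule: int_cases2)
    case (nonpos m)
    have "of_nat m \<in> K" using fieldset_rat[OF F, of "of_nat m"] by simp
    then show ?thesis using nonpos n field_emb_uminus[OF assms] by simp
  qed (use n in simp)
  obtain a b where q: "q = Rat.Fract a b" "b > 0" by (cases q) auto
  then have "of_rat q * of_int b = (of_int a :: 'a)" by (simp add: of_rat_rat)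
  then have "h (of_rat q) * of_int b = of_int a"
    using field_emb_mult[OF assms fieldset_rat[OF F, of q] iK[of b]] i by simp
  then show ?thesis using q by (simp add: of_rat_rat field_simps)
qed

lemma field_emb_rpoly:
  assumes "field_emb K h" "x \<in> K"
  shows "h (rpoly f x) = rpoly f (h x)"
proof (induction f)
  case (pCons a f)
  note F = assms(1)[unfolded field_emb_def, THEN conjunct1]
  show ?case
    using pCons field_emb_add[OF assms(1)] field_emb_mult[OF assms(1)] field_emb_of_rat[OF assms(1)]
      fieldset_rat[OF F] fieldset_mult[OF F] fieldset_rpoly[OF F assms(2)] assms(2) by simp
qed (simp add: field_emb_0[OF assms(1)])

lemma field_emb_algebraic_int:
  assumes "field_emb K h" "x \<in> K" "algebraic_int x"
  shows "algebraic_int (h x)"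
proof -
  obtain p :: "int poly" where p: "poly (map_poly of_int p) x = 0" "lead_coeff p = 1"
    using assms(3) unfolding algebraic_int_altdef_ipoly by blast
  have r: "rpoly (map_poly of_int p) y = poly (map_poly of_int p) y" for y :: "'x::field_char_0"
    by (simp add: rpoly_def map_poly_map_poly o_def)
  have "poly (map_poly of_int p) (h x) = 0"
    using field_emb_rpoly[OF assms(1,2), of "map_poly of_int p"] p(1) field_emb_0[OF assms(1)] by (simp add: r)
  then show ?thesis using p(2) unfolding algebraic_int_altdef_ipoly by blast
qed

text \<open>Sending \<open>rpoly f x\<close> to \<open>rpoly f z\<close> is well defined, as two
  polynomials agreeing at \<open>x\<close> differ by a multiple of
  \<open>min_poly x\<close>.\<close>

lemma field_emb_of_root:
  assumes x: "alg_over_Q x" and z: "rpoly (min_poly x) z = 0"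
  obtains h where "field_emb (adj x) h" "h x = z"
proof -
  define g where "g y = (SOME f. y = rpoly f x)" for y
  define h where "h y = rpoly (g y) z" for y
  have g: "rpoly (g y) x = y" if "y \<in> adj x" for y
    unfolding g_def by (rule sym, rule someI_ex) (use that in \<open>auto simp: adj_def\<close>)
  have h: "h (rpoly f x) = rpoly f z" for f
  proof -
    have "rpoly (g (rpoly f x) - f) x = 0" using g[of "rpoly f x"] by (simp add: adj_def)
    then have "min_poly x dvd g (rpoly f x) - f" by (rule min_poly(4)[OF x])
    then obtain k where "g (rpoly f x) - f = min_poly x * k" by (elim dvdE)
    then have "rpoly (g (rpoly f x) - f) z = 0" using z by (simp del: rpoly_diff)
    then show ?thesis by (simp add: h_def)
  qed
  have "field_emb (adj x) h"
    unfolding field_emb_def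
  proof (intro conjI ballI)
    show "fieldset (adj x)" by (rule fieldset_adj[OF x])
    show "h 1 = 1" using h[of 1] by simp
    fix y w assume "y \<in> adj x" "w \<in> adj x"
    then obtain f f' where "y = rpoly f x" "w = rpoly f' x" by (auto simp: adj_def)
    then show "h (y * w) = h y * h w" "h (y + w) = h y + h w"
      using h[of f] h[of f'] h[of "f * f'"] h[of "f + f'"] by simp_all
  qed
  moreover have "h x = z" using h[of "[:0, 1:]"] by simp
  ultimately show ?thesis using that by blast
qed

lemma real_embeddings_field_emb:
  assumes "fieldset K"
  shows "real_embeddings K = {h. field_emb K h} \<inter> extensional K"
  using assms by (auto simp: real_embeddings_def ring_hom_real_iff field_emb_def)

text \<open>Embeddings are normalised outside \<open>K\<close>, so the image of the generator
  determines the whole function.\<close>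

lemma real_embeddings_bij_roots:
  assumes x: "alg_over_Q x" and K: "K = adj x"
  shows "bij_betw (\<lambda>h. h x) (real_embeddings K) {z. rpoly (min_poly x) z = 0}"
proof -
  have F: "fieldset K" using fieldset_adj[OF x] K by simp
  have xK: "x \<in> K" using adj_base K by simp
  note re = real_embeddings_field_emb[OF F]
  show ?thesis
  proof (rule bij_betwI')
    fix h h' assume h: "h \<in> real_embeddings K" "h' \<in> real_embeddings K"
    show "h x = h' x \<longleftrightarrow> h = h'"
    proof
      assume eq: "h x = h' x"
      show "h = h'"
      proof
        fix y show "h y = h' y"
        proof (cases "y \<in> K")
          case True
          then obtain f where "y = rpoly f x" by (auto simp: K adj_def)
          moreover have "field_emb K h" "field_emb K h'" using h by (auto simp: re)
          ultimately show ?thesis using field_emb_rpoly[OF _ xK] eq by metis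
        next
          case False
          then show ?thesis using h by (auto simp: re extensional_def)
        qed
      qed
    qed simp
  next
    fix h assume h: "h \<in> real_embeddings K"
    then have "rpoly (min_poly x) (h x) = h (rpoly (min_poly x) x)"
      using field_emb_rpoly[of K h x, OF _ xK] by (simp add: re)
    also have "\<dots> = 0" using min_poly(3)[OF x] field_emb_0 h by (auto simp: re)
    finally show "h x \<in> {z. rpoly (min_poly x) z = 0}" by simp
  next
    fix z :: real assume "z \<in> {z. rpoly (min_poly x) z = 0}"
    then obtain h where h: "field_emb (adj x) h" "h x = z" using field_emb_of_root[OF x] by blast
    have "restrict h K \<in> real_embeddings K"
      unfolding re using h F fieldset_add[OF F] fieldset_mult[OF F] fieldset_1[OF F]
      by (auto simp: field_emb_def simp flip: K)
    then show "\<exists>h\<in>real_embeddings K. z = h x" using h xK by (intro bexI[of _ "restrict h K"]) auto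
  qed
qed

lemma number_field_adj:
  assumes "number_field K"
  obtains x where "K = adj x" "alg_over_Q x"
proof -
  have F: "fieldset K" using assms subfield_imp_fieldset by (auto simp: number_field_def)
  obtain S where "finite S" "K = lin_combs \<rat> S" using assms by (auto simp: number_field_def)
  then show ?thesis using primitive_element[OF F, of S] lin_combs_rat_subset[of S] that by blast
qed

text \<open>Every complex root of the minimal polynomial defines a complex embedding and is
  therefore real; the roots are simple, so there are as many as the degree.\<close>

lemma card_real_embeddings:
  assumes tr: "totally_real K" and x: "alg_over_Q x" and K: "K = adj x"
  shows "card (real_embeddings K) = degree (min_poly x)"
proof -
  have "bij_betw of_real {z::real. rpoly (min_poly x) z = 0} {z::complex. rpoly (min_poly x) z = 0}"
  proof (rule bij_betwI')
    fix z :: complex assume "z \<in> {z. rpoly (min_poly x) z = 0}"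
    then obtain h where h: "field_emb (adj x) h" "h x = z" using field_emb_of_root[OF x] by blast
    then have "h \<in> ring_hom (real_ring\<lparr>carrier := K\<rparr>) complex_ring"
      by (simp add: ring_hom_real_iff field_emb_def K)
    then have "z \<in> \<real>" using tr h(2) adj_base[of x] by (auto simp: totally_real_def K)
    then obtain y where y: "z = of_real y" by (auto elim: Reals_cases)
    then show "\<exists>y\<in>{z. rpoly (min_poly x) z = 0}. z = of_real y"
      using \<open>z \<in> {z. _ z = 0}\<close> by (auto simp: rpoly_of_real)
  qed (auto simp: rpoly_of_real)
  then show ?thesis
    using bij_betw_same_card real_embeddings_bij_roots[OF x K]
      irreducible_rat_poly_card_roots[OF min_poly(1)[OF x]] by metis
qed

text \<open>The number of embeddings is also the dimension of \<open>K\<close> over the rationals.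
  This identity ties the norm estimate for lengths to the lattice count for the index.\<close>

lemma number_field_basis:
  assumes "number_field K" "totally_real K"
  defines "n \<equiv> card (real_embeddings K)"
  obtains e where "\<And>x. x \<in> K \<Longrightarrow> \<exists>c. x = (\<Sum>i<n. of_rat (c i) * (e i :: real))"
proof -
  obtain x where x: "K = adj x" "alg_over_Q x" using number_field_adj[OF assms(1)] .
  have "n = degree (min_poly x)" using card_real_embeddings[OF assms(2) x(2,1)] by (simp add: n_def)
  then show ?thesis using that[of "\<lambda>i. x ^ i"] adj_eq_power_sums[OF x(2)] x(1) by metis
qed

lemma card_real_embeddings_pos:
  assumes "number_field K" "totally_real K"
  shows "card (real_embeddings K) > 0" "finite (real_embeddings K)"
proof -
  obtain x where x: "K = adj x" "alg_over_Q x" using number_field_adj[OF assms(1)] .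
  show "card (real_embeddings K) > 0"
    using card_real_embeddings[OF assms(2) x(2,1)] min_poly_degree_pos[OF x(2)] by simp
  then show "finite (real_embeddings K)" by (rule card_ge_0_finite)
qed

text \<open>
  The norm is the determinant of multiplication by \<open>t\<close> in the basis of powers of a primitive element,
  which the Vandermonde matrix of the conjugates diagonalises.
\<close>

lemma prod_embeddings_ge_1:
  assumes nf: "number_field K" "totally_real K" and t: "t \<in> ring_of_integers K" "t \<noteq> 0"
  shows "(\<Prod>h\<in>real_embeddings K. \<bar>h t\<bar>) \<ge> 1"
proof -
  obtain x where x: "K = adj x" "alg_over_Q x" using number_field_adj[OF nf(1)] .
  define n where "n = card (real_embeddings K)"
  have fin: "finite (real_embeddings K)" by (rule card_real_embeddings_pos(2)[OF nf])
  obtain s where s: "bij_betw s {0..<n} (real_embeddings K)"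
    using ex_bij_betw_nat_finite[OF fin] n_def by blast
  have n: "n = degree (min_poly x)" using card_real_embeddings[OF nf(2) x(2,1)] by (simp add: n_def)
  have F: "fieldset K" using fieldset_adj[OF x(2)] x(1) by simp
  have xK: "x \<in> K" using adj_base x(1) by simp
  have tK: "t \<in> K" "algebraic_int t" using t by (auto simp: ring_of_integers_def)
  have emb: "field_emb K (s j)" if "j < n" for j
    using s that real_embeddings_field_emb[OF F] by (auto simp: bij_betw_def)
  have "\<forall>i. \<exists>c. t * x ^ i = (\<Sum>k<n. of_rat (c k) * x ^ k)"
    using adj_eq_power_sums[OF x(2)] fieldset_mult[OF F tK(1) fieldset_power[OF F xK]] x(1) n by metis
  then obtain m where m: "\<And>i. t * x ^ i = (\<Sum>k<n. of_rat (m i k) * x ^ k)" by metis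
  have m': "s j t * s j x ^ i = (\<Sum>k<n. of_rat (m i k) * s j x ^ k)" if j: "j < n" for i j
  proof -
    have pw: "s j (x ^ i) = s j x ^ i" for i
      using field_emb_rpoly[OF emb[OF j] xK, of "monom 1 i"] by simp
    have "(\<Sum>k<n. of_rat (m i k) * x ^ k) = rpoly (\<Sum>k<n. monom (m i k) k) x"
      by (simp add: rpoly_sum)
    then have "s j (t * x ^ i) = rpoly (\<Sum>k<n. monom (m i k) k) (s j x)"
      using field_emb_rpoly[OF emb[OF j] xK] m by simp
    then show ?thesis
      using field_emb_mult[OF emb[OF j] tK(1) fieldset_power[OF F xK]] pw by (simp add: rpoly_sum)
  qed
  define V where "V = Matrix.mat n n (\<lambda>(j, k). s j x ^ k)"
  define N where "N = Matrix.mat n n (\<lambda>(k, i). m i k)"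
  define N' where "N' = map_mat (of_rat :: rat \<Rightarrow> real) N"
  define D where "D = Matrix.mat n n (\<lambda>(i, j). if i = j then s i t else 0)"
  have car: "V \<in> carrier_mat n n" "N \<in> carrier_mat n n" "N' \<in> carrier_mat n n" "D \<in> carrier_mat n n"
    by (auto simp: V_def N_def N'_def D_def)
  have "V * N' = D * V"
  proof (rule eq_matI)
    fix j i assume "j < dim_row (D * V)" "i < dim_col (D * V)"
    then have ji: "j < n" "i < n" using car by auto
    have "(V * N') $$ (j, i) = (\<Sum>k<n. s j x ^ k * of_rat (m i k))"
      using ji by (simp add: V_def N'_def N_def scalar_prod_def lessThan_atLeast0)
    also have "\<dots> = s j t * s j x ^ i" using m'[OF ji(1), of i] by (simp add: mult.commute)
    also have "\<dots> = (\<Sum>k=0..<n. if k = j then s j t * s k x ^ i else 0)" using ji by simp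
    also have "\<dots> = (\<Sum>k=0..<n. (if j = k then s j t else 0) * s k x ^ i)" by (intro sum.cong) auto
    also have "\<dots> = (D * V) $$ (j, i)" using ji by (simp add: V_def D_def scalar_prod_def)
    finally show "(V * N') $$ (j, i) = (D * V) $$ (j, i)" .
  qed (use car in auto)
  then have "Determinant.det V * Determinant.det N' = Determinant.det D * Determinant.det V"
    using det_mult[OF car(1,3)] det_mult[OF car(4,1)] by metis
  \<comment> \<open>A kernel vector of \<open>V\<close> would list the coefficients of a polynomial
    of degree below \<open>n\<close> with \<open>n\<close> distinct roots.\<close>
  moreover have "Determinant.det V \<noteq> 0"
  proof
    assume "Determinant.det V = 0"
    then obtain v where v: "v \<in> carrier_vec n" "v \<noteq> 0\<^sub>v n" "V *\<^sub>v v = 0\<^sub>v n"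
      using det_0_iff_vec_prod_zero_field[OF car(1)] by blast
    define q where "q = (\<Sum>k<n. monom (vec_index v k) k)"
    have "poly q (s j x) = 0" if j: "j < n" for j
    proof -
      have "poly q (s j x) = (\<Sum>k<n. vec_index v k * s j x ^ k)" by (simp add: q_def poly_sum poly_monom)
      also have "\<dots> = vec_index (V *\<^sub>v v) j"
        using j v(1) by (auto simp: V_def scalar_prod_def lessThan_atLeast0 mult.commute intro!: sum.cong)
      finally show ?thesis using v(3) j by simp
    qed
    then have "(\<lambda>h. h x) ` real_embeddings K \<subseteq> {z. poly q z = 0}"
      using bij_betw_imp_surj_on[OF s] by (force simp flip: bij_betw_imp_surj_on[OF s])
    moreover have "card ((\<lambda>h. h x) ` real_embeddings K) = n"
      unfolding n_def using real_embeddings_bij_roots[OF x(2,1)] by (intro card_image) (simp add: bij_betw_def)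
    moreover have "degree q < n"
      unfolding q_def using min_poly_degree_pos[OF x(2)] n
      by (intro degree_sum_less) (auto intro: le_less_trans[OF degree_monom_le])
    ultimately have le: "\<And>m. card {z. poly q z = 0} \<le> m \<Longrightarrow> finite {z. poly q z = 0} \<Longrightarrow> n \<le> m" "degree q < n"
      using card_mono le_trans by metis+
    have "q = 0"
    proof (rule ccontr)
      assume "q \<noteq> 0"
      then have "n \<le> degree q"
        by (intro le(1) card_poly_roots_bound poly_roots_finite)
      then show False using le(2) by simp
    qed
    have "v = 0\<^sub>v n"
    proof (rule eq_vecI)
      fix i assume "i < dim_vec (0\<^sub>v n)"
      then have i: "i < n" by simp
      then have "coeff q i = vec_index v i" by (simp add: q_def coeff_sum)
      then show "vec_index v i = vec_index (0\<^sub>v n) i" using \<open>q = 0\<close> i by simp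
    qed (use v(1) in auto)
    then show False using v(2) by simp
  qed
  ultimately have "Determinant.det N' = Determinant.det D" by simp
  moreover have "Determinant.det N' = of_rat (Determinant.det N)"
    unfolding N'_def by (rule of_rat_hom.hom_det)
  moreover have "Determinant.det D = (\<Prod>i\<in>{0..<n}. s i t)"
    using det_upper_triangular[OF _ car(4)] by (simp add: D_def prod_list_diag_prod upper_triangular_def)
  moreover have "(\<Prod>i\<in>{0..<n}. s i t) = (\<Prod>h\<in>real_embeddings K. h t)"
    by (rule prod.reindex_bij_betw[OF s])
  \<comment> \<open>Rational as a determinant over the rationals and integral as a product of
    algebraic integers, the norm is an integer; being nonzero, it has absolute value at least
    1.\<close>
  ultimately have "(\<Prod>h\<in>real_embeddings K. h t) \<in> \<rat>" by (metis Rats_of_rat)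
  moreover have "algebraic_int (\<Prod>h\<in>A. h t)" if "A \<subseteq> real_embeddings K" for A
    using finite_subset[OF that fin] that
  proof (induction A rule: finite_induct)
    case (insert h A)
    then have "algebraic_int (h t)"
      using field_emb_algebraic_int[OF _ tK] real_embeddings_field_emb[OF F] by auto
    then show ?case using insert by (simp add: algebraic_int_mult)
  qed simp
  ultimately have "(\<Prod>h\<in>real_embeddings K. h t) \<in> \<int>"
    using rational_algebraic_int_is_int by blast
  moreover have "(\<Prod>h\<in>real_embeddings K. h t) \<noteq> 0"
    using fin field_emb_nonzero[OF _ tK(1) t(2)] real_embeddings_field_emb[OF F] by auto
  ultimately have "\<bar>\<Prod>h\<in>real_embeddings K. h t\<bar> \<ge> 1" by (rule Ints_nonzero_abs_ge1)
  then show ?thesis by (simp add: abs_prod)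
qed

text \<open>
  The idea: words of length \<open>j\<close> over \<open>Y\<close>, read as \<open>p\<close>-adic expansions, give \<open>card Y ^ j\<close> distinct
  points of a lattice of rank \<open>d\<close>, all in a box with sides of order \<open>p ^ j\<close>.
\<close>

lemma card_incongruent_le:
  fixes M :: "'v::real_vector set" and e :: "nat \<Rightarrow> 'v" and p :: nat
  assumes p: "p \<ge> 2" and M: "0 \<in> M" "\<And>x y. x \<in> M \<Longrightarrow> y \<in> M \<Longrightarrow> x - y \<in> M"
    and coord: "\<And>x. x \<in> M \<Longrightarrow> \<exists>c. x = (\<Sum>i<d. of_rat (c i) *\<^sub>R e i)"
    and Y: "finite Y" "Y \<subseteq> M"
    and inc: "\<And>x y m. x \<in> Y \<Longrightarrow> y \<in> Y \<Longrightarrow> m \<in> M \<Longrightarrow> x - y = real p *\<^sub>R m \<Longrightarrow> x = y"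
  shows "card Y \<le> p ^ d"
proof -
  have Madd: "x + y \<in> M" if xy: "x \<in> M" "y \<in> M" for x y
    using M(2)[OF xy(1) M(2)[OF M(1) xy(2)]] by simp
  have Mn: "real n *\<^sub>R x \<in> M" if x: "x \<in> M" for n x
    by (induction n) (auto simp: M(1) scaleR_left_distrib intro: Madd x)
  define val where "val j w = (\<Sum>k<j. real p ^ k *\<^sub>R w k)" for j :: nat and w :: "nat \<Rightarrow> 'v"
  have valM: "val j w \<in> M" if w: "\<And>k. k < j \<Longrightarrow> w k \<in> M" for j w
    using w
  proof (induction j)
    case (Suc j)
    have "real p ^ j *\<^sub>R w j \<in> M" using Mn[OF Suc.prems[of j], of "p ^ j"] by simp
    then show ?case using Suc by (auto simp: val_def intro: Madd)
  qed (simp add: val_def M(1))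
  \<comment> \<open>Digits are recovered one at a time: the lowest digits are congruent modulo
    \<open>p\<close>, hence equal by \<open>inc\<close>, and the remaining equation is divided by
    \<open>p\<close>.\<close>
  have val_inj: "w k = w' k"
    if "\<And>k. k < j \<Longrightarrow> w k \<in> Y" "\<And>k. k < j \<Longrightarrow> w' k \<in> Y" "val j w = val j w'" "k < j" for j w w' k
    using that
  proof (induction j arbitrary: w w' k)
    case (Suc j)
    have shift: "val (Suc j) v = v 0 + real p *\<^sub>R val j (\<lambda>k. v (Suc k))" for v
      unfolding val_def by (subst sum.lessThan_Suc_shift) (simp add: scaleR_right.sum)
    let ?v = "\<lambda>k. w (Suc k)" and ?v' = "\<lambda>k. w' (Suc k)"
    have eq: "w 0 - w' 0 = real p *\<^sub>R (val j ?v' - val j ?v)"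
      using Suc.prems(3) unfolding shift by (simp add: algebra_simps)
    have "val j ?v' - val j ?v \<in> M" using Suc.prems(1,2) Y(2) by (intro M(2) valM) auto
    then have 0: "w 0 = w' 0" using inc[OF _ _ _ eq] Suc.prems(1,2) by simp
    then have "val j ?v = val j ?v'" using eq p by simp
    then have "w (Suc k) = w' (Suc k)" if "k < j" for k
      using Suc.IH[of ?v ?v' k] Suc.prems(1,2) that by simp
    then show ?case using 0 Suc.prems(4) by (cases k) auto
  qed simp
  obtain c where c: "\<And>x. x \<in> M \<Longrightarrow> x = (\<Sum>i<d. of_rat (c x i) *\<^sub>R e i)"
    using coord by metis
  \<comment> \<open>A common denominator for the coordinates of the digits; it does not depend on
    the word length \<open>j\<close> below.\<close>
  have "\<exists>N>0. \<forall>x\<in>Y. \<forall>i<d. of_int N * c x i \<in> \<int>"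
  proof -
    define N where "N = (\<Prod>x\<in>Y. \<Prod>i<d. snd (quotient_of (c x i)))"
    have pos: "snd (quotient_of q) > 0" for q by (simp add: quotient_of_denom_pos')
    have "N > 0" unfolding N_def by (intro prod_pos ballI) (simp add: pos)
    moreover have "of_int N * c x i \<in> \<int>" if xi: "x \<in> Y" "i < d" for x i
    proof -
      have "snd (quotient_of (c x i)) dvd (\<Prod>i<d. snd (quotient_of (c x i)))"
        using xi by (intro dvd_prodI) auto
      also have "\<dots> dvd N" unfolding N_def
        by (rule dvd_prodI[of Y x "\<lambda>x. \<Prod>i<d. snd (quotient_of (c x i))"]) (use Y xi in auto)
      finally obtain m where m: "N = snd (quotient_of (c x i)) * m" by (elim dvdE)
      have "c x i = of_int (fst (quotient_of (c x i))) / of_int (snd (quotient_of (c x i)))"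
        by (rule quotient_of_div) simp
      then have "of_int N * c x i = of_int (m * fst (quotient_of (c x i)))"
        using pos[of "c x i"] unfolding m by (simp add: field_simps)
      then show ?thesis by (metis Ints_of_int)
    qed
    ultimately show ?thesis by blast
  qed
  then obtain N where N: "N > 0" "\<And>x i. x \<in> Y \<Longrightarrow> i < d \<Longrightarrow> of_int N * c x i \<in> \<int>" by blast
  define a where "a x i = \<lfloor>of_int N * c x i\<rfloor>" for x i
  have a: "of_int (a x i) = of_int N * c x i" if "x \<in> Y" "i < d" for x i
    using N(2)[OF that] unfolding a_def by (auto elim: Ints_cases)
  have Nx: "real_of_int N *\<^sub>R x = (\<Sum>i<d. real_of_int (a x i) *\<^sub>R e i)" if x: "x \<in> Y" for x
  proof -
    have "x = (\<Sum>i<d. of_rat (c x i) *\<^sub>R e i)" using c Y(2) x by blast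
    then have "real_of_int N *\<^sub>R x = real_of_int N *\<^sub>R (\<Sum>i<d. of_rat (c x i) *\<^sub>R e i)"
      by (rule arg_cong)
    also have "\<dots> = (\<Sum>i<d. (real_of_int N * of_rat (c x i)) *\<^sub>R e i)"
      by (simp add: scaleR_right.sum)
    also have "\<dots> = (\<Sum>i<d. real_of_int (a x i) *\<^sub>R e i)"
    proof (rule sum.cong)
      fix i assume "i \<in> {..<d}"
      then have "of_rat (of_int (a x i)) = (of_rat (of_int N * c x i) :: real)" using a[OF x] by simp
      then show "(real_of_int N * of_rat (c x i)) *\<^sub>R e i = real_of_int (a x i) *\<^sub>R e i"
        by (simp add: of_rat_mult)
    qed simp
    finally show ?thesis .
  qed
  define A where "A = (\<Sum>x\<in>Y. \<Sum>i<d. \<bar>a x i\<bar>)"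
  have A: "\<bar>a x i\<bar> \<le> A" if "x \<in> Y" "i < d" for x i
  proof -
    have "\<bar>a x i\<bar> \<le> (\<Sum>i<d. \<bar>a x i\<bar>)" by (rule member_le_sum) (use that in auto)
    also have "\<dots> \<le> A" unfolding A_def
      by (rule member_le_sum[of x Y "\<lambda>x. \<Sum>i<d. \<bar>a x i\<bar>"]) (use that Y in \<open>auto intro: sum_nonneg\<close>)
    finally show ?thesis .
  qed
  have A0: "A \<ge> 0" unfolding A_def by (intro sum_nonneg) auto
  have bound: "card Y ^ j \<le> nat (2 * A + 1) ^ d * (p ^ d) ^ j" for j
  proof -
    define W where "W = (\<Pi>\<^sub>E k\<in>{..<j}. Y)"
    define b where "b w = (\<lambda>i\<in>{..<d}. \<Sum>k<j. int p ^ k * a (w k) i)" for w :: "nat \<Rightarrow> 'v"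
    define B where "B = A * int p ^ j"
    have W: "w k \<in> Y" if "w \<in> W" "k < j" for w k using that by (auto simp: W_def PiE_def)
    have Nval: "real_of_int N *\<^sub>R val j w = (\<Sum>i<d. real_of_int (b w i) *\<^sub>R e i)" if w: "w \<in> W" for w
    proof -
      have "real_of_int N *\<^sub>R val j w = (\<Sum>k<j. real p ^ k *\<^sub>R (real_of_int N *\<^sub>R w k))"
        by (simp add: val_def scaleR_right.sum mult.commute)
      also have "\<dots> = (\<Sum>k<j. \<Sum>i<d. (real p ^ k * real_of_int (a (w k) i)) *\<^sub>R e i)"
        using Nx W[OF w] by (intro sum.cong) (auto simp: scaleR_right.sum)
      also have "\<dots> = (\<Sum>i<d. \<Sum>k<j. (real p ^ k * real_of_int (a (w k) i)) *\<^sub>R e i)"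
        by (rule sum.swap)
      also have "\<dots> = (\<Sum>i<d. real_of_int (b w i) *\<^sub>R e i)"
        by (intro sum.cong) (auto simp: b_def scaleR_left.sum)
      finally show ?thesis .
    qed
    have "inj_on b W"
    proof (rule inj_onI)
      fix w w' assume w: "w \<in> W" "w' \<in> W" and eq: "b w = b w'"
      have "real_of_int N *\<^sub>R val j w = real_of_int N *\<^sub>R val j w'"
        unfolding Nval[OF w(1)] Nval[OF w(2)] eq ..
      then have "val j w = val j w'" using N(1) by simp
      then have "w k = w' k" if "k < j" for k using val_inj[of j w w' k] W w that by blast
      then show "w = w'" using w unfolding W_def by (intro PiE_ext) auto
    qed
    moreover have "b ` W \<subseteq> (\<Pi>\<^sub>E i\<in>{..<d}. {-B..B})"
    proof
      fix v assume "v \<in> b ` W"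
      then obtain w where w: "w \<in> W" "v = b w" by blast
      have sb: "\<bar>\<Sum>k<j. int p ^ k * a (w k) i\<bar> \<le> B" if i: "i < d" for i
      proof -
        have "\<bar>\<Sum>k<j. int p ^ k * a (w k) i\<bar> \<le> (\<Sum>k<j. int p ^ k * A)"
          using A[OF W[OF w(1)] i]
          by (intro order_trans[OF sum_abs] sum_mono) (auto simp: abs_mult intro!: mult_left_mono)
        also have "\<dots> = A * (\<Sum>k<j. int p ^ k)" by (simp add: sum_distrib_left mult.commute)
        also have "(\<Sum>k<j. int p ^ k) \<le> int p ^ j"
        proof -
          have "(int p - 1) * (\<Sum>k<j. int p ^ k) = int p ^ j - 1" by (simp add: power_diff_1_eq)
          moreover have "(\<Sum>k<j. int p ^ k) \<ge> 0" by (intro sum_nonneg) auto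
          moreover have "1 * (\<Sum>k<j. int p ^ k) \<le> (int p - 1) * (\<Sum>k<j. int p ^ k)"
            using p by (intro mult_right_mono sum_nonneg) auto
          ultimately show ?thesis by linarith
        qed
        finally show ?thesis using A0 by (simp add: B_def mult_left_mono)
      qed
      have "b w i \<in> {-B..B}" if i: "i < d" for i
      proof -
        have "b w i = (\<Sum>k<j. int p ^ k * a (w k) i)" using i by (simp add: b_def)
        then show ?thesis using sb[OF i] by (simp add: abs_le_iff)
      qed
      then show "v \<in> (\<Pi>\<^sub>E i\<in>{..<d}. {-B..B})" using w by (auto simp: PiE_def b_def)
    qed
    moreover have "finite (\<Pi>\<^sub>E i\<in>{..<d}. {-B..B})" by (intro finite_PiE) auto
    ultimately have "card W \<le> card (\<Pi>\<^sub>E i\<in>{..<d}. {-B..B})" by (rule card_inj_on_le)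
    then have "card Y ^ j \<le> nat (2 * B + 1) ^ d" using A0 by (simp add: W_def card_PiE B_def)
    also have "\<dots> \<le> (nat (2 * A + 1) * p ^ j) ^ d"
    proof (rule power_mono)
      have "2 * B + 1 \<le> (2 * A + 1) * int p ^ j"
        using p one_le_power[of "int p" j] by (simp add: B_def algebra_simps)
      then have "nat (2 * B + 1) \<le> nat ((2 * A + 1) * int p ^ j)" by simp
      also have "\<dots> = nat (2 * A + 1) * p ^ j" using A0 by (simp add: nat_mult_distrib nat_power_eq)
      finally show "nat (2 * B + 1) \<le> nat (2 * A + 1) * p ^ j" .
    qed simp
    also have "\<dots> = nat (2 * A + 1) ^ d * (p ^ d) ^ j"
      by (simp add: power_mult_distrib mult.commute flip: power_mult)
    finally show ?thesis .
  qed
  show ?thesis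
  proof (rule ccontr)
    assume "\<not> card Y \<le> p ^ d"
    then have gt: "real (card Y) > real (p ^ d)" by simp
    have pd: "real (p ^ d) > 0" using p by simp
    define q where "q = real (card Y) / real (p ^ d)"
    have "q > 1" using gt pd by (simp add: q_def)
    \<comment> \<open>The factor \<open>(2 A + 1)^d\<close> is independent of \<open>j\<close>, so
      the powers of a ratio above 1 eventually exceed it.\<close>
    then obtain j where j: "real (nat (2 * A + 1) ^ d) < q ^ j" using real_arch_pow by blast
    have "real (card Y ^ j) \<le> real (nat (2 * A + 1) ^ d * (p ^ d) ^ j)" using bound[of j] by (rule of_nat_mono)
    then have "real (card Y) ^ j \<le> real (nat (2 * A + 1) ^ d) * real (p ^ d) ^ j"
      by (simp only: of_nat_mult of_nat_power)
    then have "q ^ j \<le> real (nat (2 * A + 1) ^ d)"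
      using pd by (simp add: q_def power_divide field_simps)
    then show False using j by simp
  qed
qed

section \<open>The hyperbolic plane\<close>

lemma mat2_eq_iff: "(A :: 'a^2^2) = B \<longleftrightarrow> A$1$1 = B$1$1 \<and> A$1$2 = B$1$2 \<and> A$2$1 = B$2$1 \<and> A$2$2 = B$2$2"
  by (auto simp: Finite_Cartesian_Product.vec_eq_iff forall_2)

lemma mat2_mult:
  fixes A B :: "'a::semiring_1^2^2"
  shows "(A ** B)$1$1 = A$1$1 * B$1$1 + A$1$2 * B$2$1" "(A ** B)$1$2 = A$1$1 * B$1$2 + A$1$2 * B$2$2"
    "(A ** B)$2$1 = A$2$1 * B$1$1 + A$2$2 * B$2$1" "(A ** B)$2$2 = A$2$1 * B$1$2 + A$2$2 * B$2$2"
  by (simp_all add: matrix_matrix_mult_def sum_2)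

lemma mat2_one:
  "(mat 1 :: 'a::zero_neq_one^2^2)$1$1 = 1" "(mat 1 :: 'a::zero_neq_one^2^2)$1$2 = 0"
  "(mat 1 :: 'a::zero_neq_one^2^2)$2$1 = 0" "(mat 1 :: 'a::zero_neq_one^2^2)$2$2 = 1"
  by (simp_all add: Finite_Cartesian_Product.mat_def)

lemma trace_2: "trace (A :: 'a::comm_semiring_1^2^2) = A$1$1 + A$2$2"
  by (simp add: trace_def sum_2)

definition mk2 :: "'a \<Rightarrow> 'a \<Rightarrow> 'a \<Rightarrow> 'a \<Rightarrow> 'a^2^2" where
  "mk2 a b c d = (\<chi> i j. if i = 1 then (if j = 1 then a else b) else (if j = 1 then c else d))"

lemma mk2_nth [simp]: "mk2 a b c d $1$1 = a" "mk2 a b c d $1$2 = b" "mk2 a b c d $2$1 = c" "mk2 a b c d $2$2 = d"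
  by (simp_all add: mk2_def)

definition adj2 :: "real^2^2 \<Rightarrow> real^2^2" where
  "adj2 A = mk2 (A$2$2) (- A$1$2) (- A$2$1) (A$1$1)"

lemma det_neg2: "det (- A :: real^2^2) = det A"
  by (simp add: det_2)

lemma SL2R_simps [simp]:
  "carrier SL2R = {A. det A = 1}" "x \<otimes>\<^bsub>SL2R\<^esub> y = x ** y" "\<one>\<^bsub>SL2R\<^esub> = mat 1"
  by (simp_all add: SL2R_def)

lemma adj2_mult: "det A = 1 \<Longrightarrow> adj2 A ** A = mat 1" "det A = 1 \<Longrightarrow> A ** adj2 A = mat 1"
  "det A = 1 \<Longrightarrow> det (adj2 A) = 1"
  by (auto simp: mat2_eq_iff mat2_mult mat2_one adj2_def det_2 algebra_simps)

lemma SL2R_group: "group SL2R"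
proof (rule groupI)
  fix x assume "x \<in> carrier SL2R"
  then show "\<exists>y\<in>carrier SL2R. y \<otimes>\<^bsub>SL2R\<^esub> x = \<one>\<^bsub>SL2R\<^esub>"
    using adj2_mult by (intro bexI[of _ "adj2 x"]) auto
qed (auto simp: det_mul matrix_mul_assoc)

lemma SL2R_inv: "det A = 1 \<Longrightarrow> inv\<^bsub>SL2R\<^esub> A = adj2 A"
  using group.inv_equality[OF SL2R_group, of "adj2 A" A] adj2_mult by simp

lemma minus_mat_mult: "(- A :: real^2^2) ** (B :: real^2^2) = - (A ** B)" "(A :: real^2^2) ** (- B :: real^2^2) = - (A ** B)"
  by (auto simp: mat2_eq_iff mat2_mult)

lemma center_normal: "{mat 1, - mat 1} \<lhd> SL2R"
proof (rule group.normalI[OF SL2R_group])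
  show "subgroup {mat 1, - mat 1} SL2R"
  proof (rule group.subgroupI[OF SL2R_group])
    fix a assume a: "a \<in> {mat 1, - mat 1 :: real^2^2}"
    then have "inv\<^bsub>SL2R\<^esub> a = a"
      by (subst SL2R_inv) (auto simp: det_neg2 mat2_eq_iff adj2_def mat2_one det_2)
    then show "inv\<^bsub>SL2R\<^esub> a \<in> {mat 1, - mat 1}" using a by simp
  qed (auto simp: det_neg2 minus_mat_mult)
  show "\<forall>x\<in>carrier SL2R. {mat 1, - mat 1} #>\<^bsub>SL2R\<^esub> x = x <#\<^bsub>SL2R\<^esub> {mat 1, - mat 1}"
    by (simp add: r_coset_def l_coset_def minus_mat_mult)
qed

lemma PSL2R_group: "group PSL2R"
  unfolding PSL2R_def by (rule normal.factorgroup_is_group[OF center_normal])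

lemma PSL_proj_eq: "PSL_proj A = {A, - A}"
  by (auto simp: PSL_proj_def r_coset_def minus_mat_mult)

lemma PSL_proj_carrier: "carrier PSL2R = PSL_proj ` {A. det A = 1}"
  by (auto simp: PSL2R_def FactGroup_def RCOSETS_def PSL_proj_def)

lemma PSL_one: "\<one>\<^bsub>PSL2R\<^esub> = PSL_proj (mat 1)"
  by (simp add: PSL2R_def FactGroup_def PSL_proj_eq)

lemma PSL_mult: "PSL_proj A \<otimes>\<^bsub>PSL2R\<^esub> PSL_proj B = PSL_proj (A ** B)"
  by (auto simp: PSL2R_def FactGroup_def set_mult_def PSL_proj_eq minus_mat_mult)

lemma PSL_proj_eq_iff: "PSL_proj A = PSL_proj B \<longleftrightarrow> A = B \<or> A = - B"
  by (auto simp: PSL_proj_eq doubleton_eq_iff)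

lemma PSL_proj_uminus: "PSL_proj (- A) = PSL_proj A"
  by (auto simp: PSL_proj_eq)

lemma PSL_inv: "det A = 1 \<Longrightarrow> inv\<^bsub>PSL2R\<^esub> (PSL_proj A) = PSL_proj (adj2 A)"
  by (rule group.inv_equality[OF PSL2R_group])
    (auto simp: PSL_mult adj2_mult PSL_one PSL_proj_carrier)

lemma lifts_iff: "A \<in> lifts \<Gamma> \<longleftrightarrow> det A = 1 \<and> PSL_proj A \<in> \<Gamma>"
  by (simp add: lifts_def)

lemma lift_exists:
  assumes "\<gamma> \<in> carrier PSL2R" obtains A where "det A = 1" "PSL_proj A = \<gamma>"
  using assms by (auto simp: PSL_proj_carrier)

lemma moebius_uminus: "moebius (- A) z = moebius A z"
proof -
  have "moebius (- A) z = (- (of_real (A$1$1) * z + of_real (A$1$2))) / (- (of_real (A$2$1) * z + of_real (A$2$2)))"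
    by (simp add: moebius_def)
  then show ?thesis by (simp only: minus_divide_divide moebius_def)
qed

lemma PSL_act_proj: "PSL_act (PSL_proj A) z = moebius A z"
proof -
  have "(SOME B. B \<in> PSL_proj A) \<in> PSL_proj A" by (rule someI[of _ A]) (simp add: PSL_proj_eq)
  then show ?thesis by (auto simp: PSL_act_def PSL_proj_eq moebius_uminus)
qed

text \<open>The automorphy factor \<open>c z + d\<close>: its inverse square is the derivative of
  the transformation, and its squared modulus is the factor by which imaginary parts are
  divided.\<close>

definition mden :: "real^2^2 \<Rightarrow> complex \<Rightarrow> complex" where
  "mden A z = of_real (A$2$1) * z + of_real (A$2$2)"

lemma mden_nonzero: assumes "det A = 1" "Im z > 0" shows "mden A z \<noteq> 0"
proof
  assume 0: "mden A z = 0"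
  from arg_cong[OF this, of Im] have "A$2$1 = 0" using assms by (simp add: mden_def)
  moreover from arg_cong[OF 0, of Re] this have "A$2$2 = 0" by (simp add: mden_def)
  ultimately show False using assms(1) by (simp add: det_2)
qed

lemma moebius_alt: "moebius A z = (of_real (A$1$1) * z + of_real (A$1$2)) / mden A z"
  by (simp add: moebius_def mden_def)

lemma moebius_diff:
  assumes "det A = 1" "Im z > 0" "Im w > 0"
  shows "moebius A z - moebius A w = (z - w) / (mden A z * mden A w)"
proof -
  have "of_real (A$1$1 * A$2$2 - A$1$2 * A$2$1) = (1::complex)" using assms(1) by (simp add: det_2)
  then have d: "of_real (A$1$1) * of_real (A$2$2) = 1 + of_real (A$1$2) * (of_real (A$2$1) :: complex)"
    by (simp add: algebra_simps)
  have "(of_real (A$1$1) * z + of_real (A$1$2)) * mden A w - (of_real (A$1$1) * w + of_real (A$1$2)) * mden A z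
      = (of_real (A$1$1) * of_real (A$2$2) - of_real (A$1$2) * of_real (A$2$1)) * (z - w)"
    by (simp add: mden_def algebra_simps)
  also have "\<dots> = z - w" unfolding d by simp
  finally show ?thesis using mden_nonzero assms unfolding moebius_alt by (simp add: diff_frac_eq)
qed

lemma moebius_Im:
  assumes "det A = 1" "Im z > 0"
  shows "Im (moebius A z) = Im z / (cmod (mden A z))\<^sup>2"
proof -
  have e: "(cmod (mden A z))\<^sup>2 = (A$2$1 * Re z + A$2$2)\<^sup>2 + (A$2$1 * Im z)\<^sup>2"
    by (simp add: mden_def cmod_power2)
  have "Im (moebius A z) = (A$1$1 * Im z * (A$2$1 * Re z + A$2$2) - (A$1$1 * Re z + A$1$2) * (A$2$1 * Im z)) / (cmod (mden A z))\<^sup>2"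
    unfolding e by (simp add: moebius_def Im_divide)
  also have "A$1$1 * Im z * (A$2$1 * Re z + A$2$2) - (A$1$1 * Re z + A$1$2) * (A$2$1 * Im z) = det A * Im z"
    by (simp add: det_2 algebra_simps)
  finally show ?thesis using assms by simp
qed

lemma moebius_Im_pos: "det A = 1 \<Longrightarrow> Im z > 0 \<Longrightarrow> Im (moebius A z) > 0"
  using moebius_Im mden_nonzero by simp

lemma moebius_in_H: "det A = 1 \<Longrightarrow> z \<in> \<H> \<Longrightarrow> moebius A z \<in> \<H>"
  using moebius_Im_pos by (simp add: upper_half_plane_def)

lemma moebius_comp:
  assumes "det A = 1" "det B = 1" "Im z > 0"
  shows "moebius (A ** B) z = moebius A (moebius B z)"
proof -
  define u where "u = of_real (B$1$1) * z + of_real (B$1$2)"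
  define v where "v = mden B z"
  have v: "v \<noteq> 0" using mden_nonzero[OF assms(2,3)] by (simp add: v_def)
  have "moebius (A ** B) z = (of_real (A$1$1) * u + of_real (A$1$2) * v) / (of_real (A$2$1) * u + of_real (A$2$2) * v)"
    by (simp add: moebius_def mat2_mult u_def v_def mden_def algebra_simps)
  also have "\<dots> = ((of_real (A$1$1) * (u / v) + of_real (A$1$2)) * v) / ((of_real (A$2$1) * (u / v) + of_real (A$2$2)) * v)"
    using v by (simp add: distrib_right)
  also have "\<dots> = moebius A (u / v)" using v by (simp add: moebius_def)
  also have "u / v = moebius B z" by (simp add: moebius_alt u_def v_def)
  finally show ?thesis .
qed

lemma moebius_one: "moebius (mat 1) z = z"
  by (simp add: moebius_def mat2_one)

lemma moebius_adj2:
  assumes "det A = 1" "Im z > 0"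
  shows "moebius (adj2 A) (moebius A z) = z" "moebius A (moebius (adj2 A) z) = z"
  using moebius_comp[of "adj2 A" A z] moebius_comp[of A "adj2 A" z] adj2_mult[OF assms(1)] assms
  by (simp_all add: moebius_one)

section \<open>Hyperbolic distance and displacement\<close>

lemma cosh_hyp_dist:
  assumes "Im z > 0" "Im w > 0"
  shows "cosh (hyp_dist z w) = 1 + (cmod (z - w))\<^sup>2 / (2 * Im z * Im w)"
  unfolding hyp_dist_def using assms by (intro cosh_arcosh_real) simp

lemma hyp_dist_nonneg: "Im z > 0 \<Longrightarrow> Im w > 0 \<Longrightarrow> hyp_dist z w \<ge> 0"
  unfolding hyp_dist_def by (intro arcosh_nonneg_real) simp

lemma hyp_dist_moebius:
  assumes "det A = 1" "Im z > 0" "Im w > 0"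
  shows "hyp_dist (moebius A z) (moebius A w) = hyp_dist z w"
proof -
  have n: "cmod (mden A z) \<noteq> 0" "cmod (mden A w) \<noteq> 0" using mden_nonzero assms by auto
  have "(cmod (moebius A z - moebius A w))\<^sup>2 / (2 * Im (moebius A z) * Im (moebius A w)) = (cmod (z - w))\<^sup>2 / (2 * Im z * Im w)"
    using n unfolding moebius_diff[OF assms] moebius_Im[OF assms(1,2)] moebius_Im[OF assms(1,3)]
    by (simp add: norm_divide norm_mult power_divide power_mult_distrib)
  then show ?thesis by (simp add: hyp_dist_def)
qed

lemma hyp_dist_mono:
  assumes "(cmod (z' - w'))\<^sup>2 / (Im z' * Im w') \<le> (cmod (z - w))\<^sup>2 / (Im z * Im w)"
    and "Im z > 0" "Im w > 0" "Im z' > 0" "Im w' > 0"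
  shows "hyp_dist z' w' \<le> hyp_dist z w"
proof -
  have "cosh (hyp_dist z' w') \<le> cosh (hyp_dist z w)"
    using assms by (simp add: cosh_hyp_dist mult.assoc)
  then show ?thesis
    using cosh_real_nonneg_le_iff hyp_dist_nonneg assms by blast
qed

lemma hyp_dist_eq_0: assumes "Im z > 0" "Im w > 0" shows "hyp_dist z w = 0 \<longleftrightarrow> z = w"
proof
  assume "hyp_dist z w = 0"
  then show "z = w" using cosh_hyp_dist[OF assms] assms by simp
qed (simp add: hyp_dist_def arcosh_1)

text \<open>The quadratic vanishes exactly at the fixed points of \<open>A\<close>: it is the
  negative of \<open>moebius A z - z\<close> times the automorphy factor, and the modulus of that
  factor cancels against the imaginary part of the image.\<close>

lemma cosh_displacement:
  assumes A: "det A = 1" and z: "Im z > 0"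
  shows "cosh (hyp_dist z (moebius A z)) = 1 +
    (cmod (of_real (A$2$1) * z\<^sup>2 + of_real (A$2$2 - A$1$1) * z - of_real (A$1$2)))\<^sup>2 / (2 * (Im z)\<^sup>2)"
proof -
  define q where "q = of_real (A$2$1) * z\<^sup>2 + of_real (A$2$2 - A$1$1) * z - of_real (A$1$2)"
  have m: "mden A z \<noteq> 0" using mden_nonzero[OF A z] .
  have dq: "(moebius A z - z) * mden A z = - q"
    using m by (simp add: moebius_alt q_def mden_def field_simps power2_eq_square)
  have "cmod (z - moebius A z) * cmod (mden A z) = cmod q"
    by (subst norm_minus_commute) (simp add: dq flip: norm_mult)
  then have "(cmod (z - moebius A z))\<^sup>2 * (cmod (mden A z))\<^sup>2 = (cmod q)\<^sup>2"
    by (simp flip: power_mult_distrib)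
  then show ?thesis
    using m z unfolding cosh_hyp_dist[OF z moebius_Im_pos[OF A z]] moebius_Im[OF A z] q_def[symmetric]
    by (simp add: field_simps power2_eq_square)
qed

text \<open>
  The quadratic polynomial in \<open>cosh_displacement\<close> has discriminant \<open>tr\<^sup>2 - 4\<close>,
  which bounds its size relative to \<open>Im z\<close> from below.
\<close>

lemma trace_le_cosh_displacement:
  assumes A: "det A = 1" and z: "Im z > 0"
  shows "\<bar>trace A\<bar> \<le> 2 * cosh (hyp_dist z (moebius A z) / 2)"
proof -
  define a where "a = A$1$1" define b where "b = A$1$2" define c where "c = A$2$1" define d where "d = A$2$2"
  define x where "x = Re z" define y where "y = Im z"
  have y: "y > 0" using z by (simp add: y_def)
  have det: "a * d - b * c = 1" using A by (simp add: det_2 a_def b_def c_def d_def)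
  define q where "q = of_real c * z\<^sup>2 + of_real (d - a) * z - of_real b"
  have ch: "cosh (hyp_dist z (moebius A z)) = 1 + (cmod q)\<^sup>2 / (2 * y\<^sup>2)"
    unfolding cosh_displacement[OF A z] by (simp add: q_def a_def b_def c_def d_def y_def)
  \<comment> \<open>The difference is a perfect square; for hyperbolic \<open>A\<close> it vanishes
    exactly on the axis.\<close>
  have "(cmod q)\<^sup>2 - y\<^sup>2 * ((a + d)\<^sup>2 - 4) = (c * x\<^sup>2 + (d - a) * x - b + c * y\<^sup>2)\<^sup>2"
  proof -
    have "Re q = c * (x\<^sup>2 - y\<^sup>2) + (d - a) * x - b" "Im q = y * (2 * c * x + (d - a))"
      by (simp_all add: q_def x_def y_def power2_eq_square algebra_simps)
    then have cm: "(cmod q)\<^sup>2 = (c * (x\<^sup>2 - y\<^sup>2) + (d - a) * x - b)\<^sup>2 + (y * (2 * c * x + (d - a)))\<^sup>2"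
      unfolding cmod_power2 by (simp only:)
    have e: "(a + d)\<^sup>2 - 4 = (d - a)\<^sup>2 + 4 * b * c"
      using det by (simp add: power2_eq_square algebra_simps)
    show ?thesis unfolding cm e by (simp add: power2_eq_square algebra_simps)
  qed
  then have "y\<^sup>2 * ((a + d)\<^sup>2 - 4) \<le> (cmod q)\<^sup>2"
    using zero_le_power2[of "c * x\<^sup>2 + (d - a) * x - b + c * y\<^sup>2"] by linarith
  then have "y\<^sup>2 * ((a + d)\<^sup>2 - 4) / (2 * y\<^sup>2) \<le> (cmod q)\<^sup>2 / (2 * y\<^sup>2)"
    by (rule divide_right_mono) simp
  moreover have "y\<^sup>2 * ((a + d)\<^sup>2 - 4) / (2 * y\<^sup>2) = ((a + d)\<^sup>2 - 4) / 2" using y by simp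
  ultimately have "((a + d)\<^sup>2 - 4) / 2 \<le> (cmod q)\<^sup>2 / (2 * y\<^sup>2)" by simp
  then have "(a + d)\<^sup>2 / 2 - 1 \<le> cosh (hyp_dist z (moebius A z))" unfolding ch by (simp add: diff_divide_distrib)
  also have "\<dots> = 2 * (cosh (hyp_dist z (moebius A z) / 2))\<^sup>2 - 1"
    using cosh_double_cosh[of "hyp_dist z (moebius A z) / 2"] by simp
  finally have "(trace A)\<^sup>2 \<le> (2 * cosh (hyp_dist z (moebius A z) / 2))\<^sup>2"
    by (simp add: trace_2 a_def d_def power_mult_distrib)
  then have "\<bar>trace A\<bar> \<le> \<bar>2 * cosh (hyp_dist z (moebius A z) / 2)\<bar>"
    unfolding abs_le_square_iff .
  then show ?thesis by (simp add: cosh_real_pos less_imp_le)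
qed

section \<open>The Schwarz-Pick lemma\<close>

lemma frac_le_iff: "(0::real) < y \<Longrightarrow> 0 < z \<Longrightarrow> x / y \<le> w / z \<longleftrightarrow> x * z \<le> w * y"
  by (metis pos_divide_le_eq pos_le_divide_eq times_divide_eq_left)

lemma cmod_diff_cnj_sq:
  "(cmod (z - cnj w))\<^sup>2 = (cmod (z - w))\<^sup>2 + 4 * (Im z * Im w)"
  unfolding cmod_power2 by (simp add: power2_eq_square algebra_simps)

text \<open>Cayley transforms centred at \<open>w\<close> and \<open>F w\<close> turn the map into a
  self-map of the disc fixing 0, to which the Schwarz lemma applies.\<close>

lemma Schwarz_Pick:
  assumes hol: "F holomorphic_on \<H>" and im: "F ` \<H> \<subseteq> \<H>" and z: "z \<in> \<H>" and w: "w \<in> \<H>"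
  shows "hyp_dist (F z) (F w) \<le> hyp_dist z w"
proof -
  have F: "Im (F u) > 0" if "Im u > 0" for u using im that by (auto simp: upper_half_plane_def)
  have zw: "Im z > 0" "Im w > 0" using z w by (auto simp: upper_half_plane_def)
  \<comment> \<open>Inverse of the Cayley transform centred at \<open>w\<close>; \<open>G\<close> is
    \<open>F\<close> read in the disc coordinates centred at \<open>w\<close> and
    \<open>F w\<close>.\<close>
  define D where "D \<zeta> = (w - cnj w * \<zeta>) / (1 - \<zeta>)" for \<zeta>
  define G where "G \<zeta> = (F (D \<zeta>) - F w) / (F (D \<zeta>) - cnj (F w))" for \<zeta>
  have ne1: "1 - \<zeta> \<noteq> 0" if "cmod \<zeta> < 1" for \<zeta> using that by auto
  have DIm: "Im (D \<zeta>) > 0" if \<zeta>: "cmod \<zeta> < 1" for \<zeta>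
  proof -
    have pos: "(cmod (1 - \<zeta>))\<^sup>2 > 0" using ne1[OF \<zeta>] by simp
    have "Im (D \<zeta>) = Im w * (1 - (cmod \<zeta>)\<^sup>2) / (cmod (1 - \<zeta>))\<^sup>2"
      unfolding cmod_power2 by (simp add: D_def Im_divide power2_eq_square algebra_simps)
    moreover have "(cmod \<zeta>)\<^sup>2 < 1" using \<zeta> by (simp add: power_less_one_iff)
    ultimately show ?thesis using pos zw by simp
  qed
  have den: "u - cnj v \<noteq> 0" if "Im u > 0" "Im v > 0" for u v
  proof
    assume "u - cnj v = 0"
    from arg_cong[OF this, of Im] show False using that by simp
  qed
  have lt: "cmod ((u - v) / (u - cnj v)) < 1" if uv: "Im u > 0" "Im v > 0" for u v
  proof -
    have "(cmod (u - v))\<^sup>2 < (cmod (u - cnj v))\<^sup>2" using uv unfolding cmod_diff_cnj_sq by simp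
    then have "cmod (u - v) < cmod (u - cnj v)" by (rule power2_less_imp_less) simp
    then show ?thesis using den[OF uv] by (simp add: norm_divide)
  qed
  have Dhol: "D holomorphic_on ball 0 1"
    unfolding D_def by (intro holomorphic_intros) (use ne1 in \<open>auto simp: dist_norm\<close>)
  have "(F \<circ> D) holomorphic_on ball 0 1"
    by (rule holomorphic_on_compose_gen[OF Dhol hol])
      (use DIm in \<open>auto simp: upper_half_plane_def dist_norm\<close>)
  then have FD: "(\<lambda>\<zeta>. F (D \<zeta>)) holomorphic_on ball 0 1" by (simp add: o_def)
  have Ghol: "G holomorphic_on ball 0 1"
    unfolding G_def by (intro holomorphic_intros FD) (use den F DIm zw in \<open>auto simp: dist_norm\<close>)
  have G1: "cmod (G \<zeta>) < 1" if "cmod \<zeta> < 1" for \<zeta>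
    unfolding G_def using lt F DIm that zw by blast
  have G0: "G 0 = 0" by (simp add: G_def D_def)
  define \<zeta> where "\<zeta> = (z - w) / (z - cnj w)"
  have \<zeta>: "cmod \<zeta> < 1" unfolding \<zeta>_def by (rule lt[OF zw])
  have "cmod (G \<zeta>) \<le> cmod \<zeta>" by (rule Schwarz_Lemma(1)[OF Ghol G0 G1 \<zeta>])
  moreover have "D \<zeta> = z"
  proof -
    have d: "z - cnj w \<noteq> 0" by (rule den[OF zw])
    have d': "w - cnj w \<noteq> 0" by (rule den[OF zw(2) zw(2)])
    have n1: "1 - \<zeta> = (w - cnj w) / (z - cnj w)" unfolding \<zeta>_def using d by (simp add: field_simps)
    have n2: "w - cnj w * \<zeta> = z * (w - cnj w) / (z - cnj w)" unfolding \<zeta>_def using d by (simp add: field_simps)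
    show ?thesis unfolding D_def n1 n2 using d d' by simp
  qed
  ultimately have "cmod ((F z - F w) / (F z - cnj (F w))) \<le> cmod ((z - w) / (z - cnj w))"
    by (simp add: G_def \<zeta>_def)
  then have "(cmod ((F z - F w) / (F z - cnj (F w))))\<^sup>2 \<le> (cmod ((z - w) / (z - cnj w)))\<^sup>2"
    by (rule power_mono) simp
  then have le: "(cmod (F z - F w))\<^sup>2 / ((cmod (F z - F w))\<^sup>2 + 4 * (Im (F z) * Im (F w)))
      \<le> (cmod (z - w))\<^sup>2 / ((cmod (z - w))\<^sup>2 + 4 * (Im z * Im w))"
    by (simp only: norm_divide power_divide cmod_diff_cnj_sq)
  \<comment> \<open>\<open>P / (P + 4 Q)\<close> increases with \<open>P / Q\<close>, which turns
    the disc inequality into one for the ratio entering \<open>hyp_dist\<close>.\<close>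
  have ineq: "P / Q \<le> p / q" if "P / (P + 4 * Q) \<le> p / (p + 4 * q)" "P \<ge> 0" "p \<ge> 0" "Q > 0" "q > 0" for P Q p q :: real
  proof -
    have "P + 4 * Q > 0" "p + 4 * q > 0" using that by auto
    then have "P * (p + 4 * q) \<le> p * (P + 4 * Q)" using that(1) by (simp only: frac_le_iff)
    then have "P * q \<le> p * Q" by (simp add: algebra_simps)
    then show ?thesis using that(4,5) by (simp only: frac_le_iff)
  qed
  have "(cmod (F z - F w))\<^sup>2 / (Im (F z) * Im (F w)) \<le> (cmod (z - w))\<^sup>2 / (Im z * Im w)"
    by (rule ineq[OF le]) (use zw F in auto)
  then show ?thesis by (rule hyp_dist_mono) (use zw F in auto)
qed

section \<open>Geodesics and axes of hyperbolic transformations\<close>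

lemma hyp_dist_imaginary_axis:
  "hyp_dist (\<i> * of_real (exp s)) (\<i> * of_real (exp t)) = \<bar>s - t\<bar>"
proof -
  have "cmod (\<i> * of_real (exp s) - \<i> * of_real (exp t)) = cmod (\<i> * of_real (exp s - exp t))"
    by (simp add: algebra_simps)
  also have "\<dots> = \<bar>exp s - exp t\<bar>" unfolding norm_mult norm_of_real by simp
  finally have "1 + (cmod (\<i> * of_real (exp s) - \<i> * of_real (exp t)))\<^sup>2 / (2 * exp s * exp t) =
      1 + (exp s - exp t)\<^sup>2 / (2 * exp s * exp t)" by simp
  also have "\<dots> = (exp (s - t) + exp (- (s - t))) / 2"
  proof -
    have "1 + (a - b)\<^sup>2 / (2 * a * b) = (a / b + b / a) / 2" if "a > 0" "b > 0" for a b :: real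
    proof -
      have "1 + (a - b)\<^sup>2 / (2 * a * b) = (2 * a * b + (a - b)\<^sup>2) / (2 * a * b)"
        using that by (simp add: add_divide_distrib)
      also have "2 * a * b + (a - b)\<^sup>2 = a * a + b * b" by (simp add: power2_eq_square algebra_simps)
      also have "(a * a + b * b) / (2 * a * b) = (a / b + b / a) / 2"
        using that by (simp add: add_divide_distrib)
      finally show ?thesis .
    qed
    from this[of "exp s" "exp t"] show ?thesis by (simp add: exp_diff)
  qed
  also have "\<dots> = cosh \<bar>s - t\<bar>" by (simp add: cosh_def abs_if)
  finally have fin: "1 + (cmod (\<i> * of_real (exp s) - \<i> * of_real (exp t)))\<^sup>2 / (2 * exp s * exp t) = cosh \<bar>s - t\<bar>" .
  have "hyp_dist (\<i> * of_real (exp s)) (\<i> * of_real (exp t)) = arcosh (cosh \<bar>s - t\<bar>)"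
    unfolding fin[symmetric] by (simp add: hyp_dist_def)
  also have "\<dots> = \<bar>s - t\<bar>" by (rule arcosh_cosh_real) simp
  finally show ?thesis .
qed

text \<open>The matrix \<open>Q\<close> of eigenvectors conjugates \<open>A\<close> to
  \<open>diag(l, 1 / l)\<close>, which translates the imaginary axis by \<open>2 ln l\<close>; the
  axis of \<open>A\<close> is the image of the imaginary axis under \<open>Q\<close>.\<close>

lemma axis_of_eigenvectors:
  fixes A :: "real^2^2"
  assumes A: "det A = 1" and l: "l > 1" and d: "v1 * w2 - v2 * w1 \<noteq> 0"
    and v: "A$1$1 * v1 + A$1$2 * v2 = l * v1" "A$2$1 * v1 + A$2$2 * v2 = l * v2"
    and w: "A$1$1 * w1 + A$1$2 * w2 = w1 / l" "A$2$1 * w1 + A$2$2 * w2 = w2 / l"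
  obtains c where "unit_speed_geodesic c" "\<And>t. moebius A (c t) = c (t + 2 * ln l)"
proof -
  define \<delta> where "\<delta> = v1 * w2 - v2 * w1"
  \<comment> \<open>Scaling both eigenvectors by \<open>s\<close> and the second one by the sign
    \<open>e\<close> gives \<open>Q\<close> determinant 1.\<close>
  define s where "s = 1 / sqrt \<bar>\<delta>\<bar>"
  define e where "e = sgn \<delta>"
  define Q where "Q = mk2 (s * v1) (s * e * w1) (s * v2) (s * e * w2)"
  define L where "L = mk2 l 0 0 (1 / l)"
  have "det Q = s\<^sup>2 * (e * \<delta>)" by (simp add: det_2 Q_def \<delta>_def power2_eq_square algebra_simps)
  also have "e * \<delta> = \<bar>\<delta>\<bar>" by (simp add: e_def abs_sgn)
  finally have Q: "det Q = 1" using d by (simp add: s_def power_divide \<delta>_def)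
  have L: "det L = 1" using l by (simp add: det_2 L_def)
  have "A$1$1 * (s * v1) + A$1$2 * (s * v2) = s * (A$1$1 * v1 + A$1$2 * v2)"
    "A$2$1 * (s * v1) + A$2$2 * (s * v2) = s * (A$2$1 * v1 + A$2$2 * v2)"
    "A$1$1 * (s * e * w1) + A$1$2 * (s * e * w2) = s * e * (A$1$1 * w1 + A$1$2 * w2)"
    "A$2$1 * (s * e * w1) + A$2$2 * (s * e * w2) = s * e * (A$2$1 * w1 + A$2$2 * w2)"
    by (simp_all add: algebra_simps)
  then have AQ: "A ** Q = Q ** L"
    unfolding mat2_eq_iff mat2_mult Q_def L_def mk2_nth v w by simp
  define c where "c t = moebius Q (\<i> * of_real (exp t))" for t
  have im: "Im (\<i> * of_real (exp t)) > 0" for t by simp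
  have "unit_speed_geodesic c"
    unfolding unit_speed_geodesic_def c_def using moebius_in_H[OF Q]
    by (auto simp only: hyp_dist_moebius[OF Q im im] hyp_dist_imaginary_axis upper_half_plane_def image_subset_iff mem_Collect_eq im)
  moreover have "moebius A (c t) = c (t + 2 * ln l)" for t
  proof -
    have "moebius A (c t) = moebius (Q ** L) (\<i> * of_real (exp t))"
      unfolding c_def by (simp only: moebius_comp[OF A Q im, symmetric] AQ)
    also have "\<dots> = moebius Q (moebius L (\<i> * of_real (exp t)))" by (rule moebius_comp[OF Q L im])
    also have "moebius L (\<i> * of_real (exp t)) = \<i> * of_real (exp (t + 2 * ln l))"
    proof -
      have "exp (t + 2 * ln l) = exp t * l\<^sup>2" using l by (simp add: exp_add exp_double)
      then show ?thesis using l by (simp add: moebius_def L_def power2_eq_square)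
    qed
    finally show ?thesis by (simp add: c_def)
  qed
  ultimately show ?thesis using that by blast
qed

text \<open>Supplies closed geodesics in the quotient, without which the infimum in
  \<open>sys\<close> would run over the empty set. Passing to \<open>- A\<close> makes the trace
  positive and keeps the action.\<close>

lemma hyperbolic_axis:
  fixes A :: "real^2^2"
  assumes A: "det A = 1" and tr: "\<bar>trace A\<bar> > 2"
  obtains c l where "unit_speed_geodesic c" "l > 0" "\<And>t. moebius A (c t) = c (t + l)"
proof -
  have pos: thesis if A: "det A = 1" and tr: "trace A > 2"
    and **: "\<And>c l. unit_speed_geodesic c \<Longrightarrow> l > 0 \<Longrightarrow> (\<And>t. moebius A (c t) = c (t + l)) \<Longrightarrow> thesis"
    for A :: "real^2^2" and thesis
  proof -
    define T where "T = trace A"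
    define s where "s = sqrt (T\<^sup>2 - 4)"
    define l where "l = (T + s) / 2"
    have T: "T > 2" "T\<^sup>2 > 4" using tr power_strict_mono[of 2 T 2] by (auto simp: T_def)
    have s: "s \<ge> 0" "s\<^sup>2 = T\<^sup>2 - 4" using T by (auto simp: s_def)
    have l1: "l > 1" using T(1) s(1) by (simp add: l_def)
    have "l\<^sup>2 = (T\<^sup>2 + s\<^sup>2 + 2 * T * s) / 4"
      by (simp add: l_def power_divide power2_sum)
    also have "\<dots> = T * l - 1" unfolding s(2) by (simp add: l_def field_simps power2_eq_square)
    finally have l2: "l\<^sup>2 = T * l - 1" .
    define m where "m = 1 / l"
    have Tm: "T = l + m" using l2 l1 by (simp add: m_def field_simps power2_eq_square)
    have lm: "l * m = 1" using l1 by (simp add: m_def)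
    have "m < 1" using l1 by (simp add: m_def)
    then have lm': "l \<noteq> m" using l1 by simp
    define a b c d where abcd: "a = A$1$1" "b = A$1$2" "c = A$2$1" "d = A$2$2"
    have ad: "a + d = l + m" and det: "a * d - b * c = 1"
      using Tm A by (auto simp: T_def trace_2 det_2 abcd)
    have char_l: "(l - a) * (l - d) = b * c" and char_m: "(m - a) * (m - d) = b * c"
    proof -
      have q: "(x - a) * (x - d) - b * c = x\<^sup>2 - (a + d) * x + (a * d - b * c)" for x
        by (simp add: power2_eq_square algebra_simps)
      have "(x - a) * (x - d) - b * c = (x - l) * (x - m)" for x
        unfolding q ad det by (simp add: power2_eq_square algebra_simps lm)
      from this[of l] this[of m] show "(l - a) * (l - d) = b * c" "(m - a) * (m - d) = b * c" by auto
    qed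
    have fin: thesis if asm: "v1 * w2 - v2 * w1 \<noteq> 0" "a * v1 + b * v2 = l * v1" "c * v1 + d * v2 = l * v2"
      "a * w1 + b * w2 = w1 * m" "c * w1 + d * w2 = w2 * m" for v1 v2 w1 w2
    proof -
      obtain g where g: "unit_speed_geodesic g" "\<And>t. moebius A (g t) = g (t + 2 * ln l)"
        by (rule axis_of_eigenvectors[OF A l1 asm(1)]) (use asm in \<open>simp_all add: m_def abcd\<close>)
      then show thesis using **[OF g(1) _ g(2)] l1 by simp
    qed
    \<comment> \<open>The eigenvectors are \<open>(l - d, c)\<close> and \<open>(m - d, c)\<close>,
      or \<open>(b, l - a)\<close> and \<open>(b, m - a)\<close>, whichever pair has a nonzero
      common entry; the diagonal case uses the standard basis.\<close>
    consider "c \<noteq> 0" | "b \<noteq> 0" | "b = 0" "c = 0" by blast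
    then show thesis
    proof cases
      case 1
      show thesis by (rule fin[of "l - d" c c "m - d"]) (use 1 char_l char_m lm' in \<open>simp_all add: algebra_simps\<close>)
    next
      case 2
      show thesis by (rule fin[of b "m - a" "l - a" b]) (use 2 char_l char_m lm' in \<open>simp_all add: algebra_simps\<close>)
    next
      case 3
      then have "l = a \<and> m = d \<or> l = d \<and> m = a" using char_l ad by auto
      then show thesis
      proof
        assume "l = a \<and> m = d"
        then show thesis by (intro fin[of 1 1 0 0]) (use 3 in simp_all)
      next
        assume "l = d \<and> m = a"
        then show thesis by (intro fin[of 0 0 1 1]) (use 3 in simp_all)
      qed
    qed
  qed
  show ?thesis
  proof (cases "trace A > 2")
    case True
    show ?thesis by (rule pos[OF A True]) (rule that)
  next
    case False
    then have "trace (- A) > 2" using tr by (simp add: trace_2 abs_if split: if_splits)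
    then show ?thesis
      by (rule pos[of "- A", rotated]) (auto simp: A det_neg2 moebius_uminus intro: that)
  qed
qed

section \<open>Cocompact Fuchsian groups\<close>

lemma (in group) comm_group_if_exponent_2:
  assumes sq: "\<And>x. x \<in> carrier G \<Longrightarrow> x \<otimes> x = \<one>"
  shows "comm_group G"
proof (rule group_comm_groupI)
  fix x y assume xy: "x \<in> carrier G" "y \<in> carrier G"
  have i: "inv z = z" if "z \<in> carrier G" for z
    using sq[OF that] that by (simp add: inv_equality)
  have "x \<otimes> y = inv (x \<otimes> y)" by (rule i[symmetric]) (use xy in simp)
  also have "\<dots> = inv y \<otimes> inv x" using xy by (rule inv_mult_group)
  also have "\<dots> = y \<otimes> x" using i xy by simp
  finally show "x \<otimes> y = y \<otimes> x" .
qed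

text \<open>A new generator \<open>t\<close> enlarges a subgroup \<open>S\<close> to the union of
  \<open>S\<close> and \<open>S t\<close>, which at most doubles it.\<close>

lemma (in comm_group) finite_generate_exponent_2:
  assumes sq: "\<And>x. x \<in> carrier G \<Longrightarrow> x \<otimes> x = \<one>" and T: "finite T" "T \<subseteq> carrier G"
  shows "finite (generate G T)"
  using T
proof (induction T rule: finite_induct)
  case empty
  show ?case using generate_empty by simp
next
  case (insert t T)
  define S where "S = generate G T"
  have S: "subgroup S G" unfolding S_def using insert.prems by (intro generate_is_subgroup) auto
  have Sc: "s \<in> carrier G" if "s \<in> S" for s using subgroup.mem_carrier[OF S that] .
  have t: "t \<in> carrier G" "inv t = t" using insert.prems sq[of t] inv_equality[of t t] by auto
  define W where "W = S \<union> (\<lambda>s. s \<otimes> t) ` S"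
  have "subgroup W G"
  proof (rule subgroupI)
    show "W \<subseteq> carrier G" using Sc t by (auto simp: W_def)
    show "W \<noteq> {}" using subgroup.one_closed[OF S] by (auto simp: W_def)
    show "inv x \<in> W" if "x \<in> W" for x
    proof -
      have "inv (s \<otimes> t) = inv s \<otimes> t" if "s \<in> S" for s
        using that t Sc by (simp add: inv_mult)
      then show ?thesis using that subgroup.m_inv_closed[OF S] by (auto simp: W_def)
    qed
    show "x \<otimes> y \<in> W" if "x \<in> W" "y \<in> W" for x y
    proof -
      have 1: "s \<otimes> t \<otimes> s' = (s \<otimes> s') \<otimes> t" "s \<otimes> (s' \<otimes> t) = (s \<otimes> s') \<otimes> t"
        "s \<otimes> t \<otimes> (s' \<otimes> t) = (s \<otimes> s') \<otimes> (t \<otimes> t)" if "s \<in> S" "s' \<in> S" for s s'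
        using that Sc t by (simp_all add: m_ac)
      show ?thesis
        using that 1 sq[OF t(1)] subgroup.m_closed[OF S] Sc by (auto simp: W_def)
    qed
  qed
  moreover have "insert t T \<subseteq> W"
    using generate.incl[of _ T G] subgroup.one_closed[OF S] t
    by (auto simp: W_def S_def intro!: image_eqI[of _ _ \<one>])
  ultimately have "generate G (insert t T) \<subseteq> W" by (intro generate_subgroup_incl)
  moreover have "finite W" using insert by (simp add: W_def S_def)
  ultimately show ?case by (rule finite_subset)
qed

text \<open>The quotient of a finitely generated group by the squares is a finite elementary abelian 2-group.\<close>

lemma (in group) finite_index_if_squares:
  assumes T: "finite T" "T \<subseteq> carrier G" "carrier G = generate G T"
    and H: "subgroup H G" and sq: "\<And>x. x \<in> carrier G \<Longrightarrow> x \<otimes> x \<in> H"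
  shows "finite (rcosets H)"
proof -
  have Hc: "h \<in> carrier G" if "h \<in> H" for h using subgroup.mem_carrier[OF H that] .
  have N: "H \<lhd> G"
    unfolding normal_inv_iff
  proof (intro conjI ballI H)
    fix x h assume x: "x \<in> carrier G" and h: "h \<in> H"
    \<comment> \<open>Writes the conjugate as a product of a square, \<open>inv h\<close> and the
      inverse of a square, all of them in \<open>H\<close>.\<close>
    have "x \<otimes> h \<otimes> inv x = (x \<otimes> h) \<otimes> (x \<otimes> h) \<otimes> inv h \<otimes> inv (x \<otimes> x)"
    proof -
      have "a \<otimes> (inv a \<otimes> b) = b" if "a \<in> carrier G" "b \<in> carrier G" for a b
        using that by (simp flip: m_assoc)
      then show ?thesis using x Hc[OF h] by (simp add: m_assoc inv_mult_group)
    qed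
    also have "\<dots> \<in> H"
      using x h Hc[OF h] sq[of x] sq[of "x \<otimes> h"] subgroup.m_closed[OF H] subgroup.m_inv_closed[OF H] by simp
    finally show "x \<otimes> h \<otimes> inv x \<in> H" .
  qed
  interpret N: normal H G by (rule N)
  interpret Q: group "G Mod H" by (rule N.factorgroup_is_group)
  interpret h: group_hom G "G Mod H" "\<lambda>a. H #> a" using N.r_coset_hom_Mod by unfold_locales
  have car: "carrier (G Mod H) = (\<lambda>a. H #> a) ` carrier G" by (auto simp: FactGroup_def RCOSETS_def)
  have e2: "y \<otimes>\<^bsub>G Mod H\<^esub> y = \<one>\<^bsub>G Mod H\<^esub>" if y: "y \<in> carrier (G Mod H)" for y
  proof -
    obtain x where x: "x \<in> carrier G" "y = H #> x" using y car by auto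
    have "y \<otimes>\<^bsub>G Mod H\<^esub> y = H #> (x \<otimes> x)" using x h.hom_mult[of x x] by simp
    also have "\<dots> = H" by (rule coset_join2) (use x sq H in auto)
    finally show ?thesis by (simp add: FactGroup_def)
  qed
  interpret Q: comm_group "G Mod H" by (rule Q.comm_group_if_exponent_2[OF e2])
  have "finite (generate (G Mod H) ((\<lambda>a. H #> a) ` T))"
    by (rule Q.finite_generate_exponent_2[OF e2]) (use T car in auto)
  also have "generate (G Mod H) ((\<lambda>a. H #> a) ` T) = (\<lambda>a. H #> a) ` carrier G"
    using h.generate_img[OF T(2)] T(3) by simp
  finally show ?thesis using car by (simp add: FactGroup_def)
qed

section \<open>Discreteness and the action on the half-plane\<close>

lemma psl_act:
  assumes "\<gamma> \<in> carrier PSL2R" "z \<in> \<H>"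
  shows psl_act_closed: "PSL_act \<gamma> z \<in> \<H>"
    and psl_act_inv: "PSL_act (inv\<^bsub>PSL2R\<^esub> \<gamma>) (PSL_act \<gamma> z) = z" "PSL_act \<gamma> (PSL_act (inv\<^bsub>PSL2R\<^esub> \<gamma>) z) = z"
    and psl_act_mult: "\<delta> \<in> carrier PSL2R \<Longrightarrow> PSL_act (\<delta> \<otimes>\<^bsub>PSL2R\<^esub> \<gamma>) z = PSL_act \<delta> (PSL_act \<gamma> z)"
proof -
  obtain A where A: "det A = 1" "\<gamma> = PSL_proj A" using lift_exists[OF assms(1)] by metis
  have z: "Im z > 0" using assms(2) by (simp add: upper_half_plane_def)
  show "PSL_act \<gamma> z \<in> \<H>" using moebius_in_H[OF A(1) assms(2)] A by (simp add: PSL_act_proj)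
  show "PSL_act (inv\<^bsub>PSL2R\<^esub> \<gamma>) (PSL_act \<gamma> z) = z" "PSL_act \<gamma> (PSL_act (inv\<^bsub>PSL2R\<^esub> \<gamma>) z) = z"
    using moebius_adj2[OF A(1) z] A by (simp_all add: PSL_inv PSL_act_proj)
  assume "\<delta> \<in> carrier PSL2R"
  then obtain B where B: "det B = 1" "\<delta> = PSL_proj B" using lift_exists by metis
  show "PSL_act (\<delta> \<otimes>\<^bsub>PSL2R\<^esub> \<gamma>) z = PSL_act \<delta> (PSL_act \<gamma> z)"
    unfolding A(2) B(2) PSL_mult PSL_act_proj by (rule moebius_comp[OF B(1) A(1) z])
qed

lemma psl_act_one: "PSL_act \<one>\<^bsub>PSL2R\<^esub> z = z"
  by (simp add: PSL_one PSL_act_proj moebius_one)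

lemma hyp_dist_psl_act:
  assumes "\<gamma> \<in> carrier PSL2R" "z \<in> \<H>" "w \<in> \<H>"
  shows "hyp_dist (PSL_act \<gamma> z) (PSL_act \<gamma> w) = hyp_dist z w"
proof -
  obtain A where A: "det A = 1" "\<gamma> = PSL_proj A" using lift_exists[OF assms(1)] by metis
  then show ?thesis using hyp_dist_moebius assms by (simp add: PSL_act_proj upper_half_plane_def)
qed

lemma psl_act_continuous:
  assumes "\<gamma> \<in> carrier PSL2R" shows "continuous_on \<H> (PSL_act \<gamma>)"
proof -
  obtain A where A: "det A = 1" "\<gamma> = PSL_proj A" using lift_exists[OF assms(1)] by metis
  have "mden A z \<noteq> 0" if "z \<in> \<H>" for z using mden_nonzero[OF A(1)] that by (simp add: upper_half_plane_def)
  then have "continuous_on \<H> (moebius A)" unfolding moebius_def mden_def by (intro continuous_intros) auto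
  then show ?thesis using A by (simp add: PSL_act_proj[abs_def] cong: continuous_on_cong)
qed

lemma open_H: "open \<H>"
  unfolding upper_half_plane_def by (rule open_halfspace_Im_gt)

lemma orbit_pt_iff: "w \<in> orbit_pt \<Gamma> z \<longleftrightarrow> (\<exists>\<gamma>\<in>\<Gamma>. w = PSL_act \<gamma> z)"
  by (auto simp: orbit_pt_def)

lemma orbit_pt_psl_act:
  assumes G: "subgroup G PSL2R" and \<gamma>: "\<gamma> \<in> G" and z: "z \<in> \<H>"
  shows "orbit_pt G (PSL_act \<gamma> z) = orbit_pt G z"
proof -
  have c: "\<delta> \<in> carrier PSL2R" if \<delta>: "\<delta> \<in> G" for \<delta> using subgroup.mem_carrier[OF G \<delta>] .
  have sub: "orbit_pt G (PSL_act \<delta> w) \<subseteq> orbit_pt G w" if \<delta>: "\<delta> \<in> G" and w: "w \<in> \<H>" for \<delta> w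
  proof
    fix u assume "u \<in> orbit_pt G (PSL_act \<delta> w)"
    then obtain \<epsilon> where \<epsilon>: "\<epsilon> \<in> G" "u = PSL_act \<epsilon> (PSL_act \<delta> w)" unfolding orbit_pt_iff by blast
    have "u = PSL_act (\<epsilon> \<otimes>\<^bsub>PSL2R\<^esub> \<delta>) w" unfolding \<epsilon>(2) by (rule psl_act_mult[OF c[OF \<delta>] w c[OF \<epsilon>(1)], symmetric])
    then show "u \<in> orbit_pt G w" unfolding orbit_pt_iff using subgroup.m_closed[OF G \<epsilon>(1) \<delta>] by blast
  qed
  have "orbit_pt G z = orbit_pt G (PSL_act (inv\<^bsub>PSL2R\<^esub> \<gamma>) (PSL_act \<gamma> z))"
    by (simp only: psl_act_inv(1)[OF c[OF \<gamma>] z])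
  also have "\<dots> \<subseteq> orbit_pt G (PSL_act \<gamma> z)"
    by (rule sub[OF subgroup.m_inv_closed[OF G \<gamma>] psl_act_closed[OF c[OF \<gamma>] z]])
  finally show ?thesis using sub[OF \<gamma> z] by blast
qed

lemma orbit_pt_self: assumes "subgroup G PSL2R" shows "z \<in> orbit_pt G z"
  unfolding orbit_pt_iff using subgroup.one_closed[OF assms] psl_act_one[of z, symmetric] by blast

text \<open>Compact boxes exhausting the half-plane; their open counterparts serve in covering
  arguments.\<close>

definition H_box :: "nat \<Rightarrow> complex set" where
  "H_box k = {z. cmod z \<le> real k \<and> Im z \<ge> 1 / real k}"

definition H_obox :: "nat \<Rightarrow> complex set" where
  "H_obox k = {z. cmod z < real k \<and> Im z > 1 / real k}"

lemma H_obox_subset: "H_obox k \<subseteq> H_box k" by (auto simp: H_obox_def H_box_def)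

lemma H_box_subset: "k > 0 \<Longrightarrow> H_box k \<subseteq> \<H>"
proof
  fix z assume k: "k > 0" and z: "z \<in> H_box k"
  have "0 < 1 / real k" using k by simp
  also have "\<dots> \<le> Im z" using z by (simp add: H_box_def)
  finally show "z \<in> \<H>" by (simp add: upper_half_plane_def)
qed

lemma open_H_obox: "open (H_obox k)"
proof -
  have "H_obox k = ball 0 (real k) \<inter> {z. Im z > 1 / real k}" by (auto simp: H_obox_def dist_norm)
  then show ?thesis by (simp add: open_halfspace_Im_gt open_Int)
qed

lemma compact_H_box: "compact (H_box k)"
proof -
  have "H_box k = cball 0 (real k) \<inter> {z. Im z \<ge> 1 / real k}" by (auto simp: H_box_def dist_norm)
  then show ?thesis by (simp add: closed_halfspace_Im_ge compact_Int_closed)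
qed

lemma H_obox_mono: "0 < k \<Longrightarrow> k \<le> m \<Longrightarrow> H_obox k \<subseteq> H_obox m"
proof
  fix z assume k: "0 < k" "k \<le> m" and z: "z \<in> H_obox k"
  have "1 / real m \<le> 1 / real k" using k by (simp add: frac_le)
  then show "z \<in> H_obox m" using z k by (auto simp: H_obox_def)
qed

lemma H_obox_cover: "z \<in> \<H> \<Longrightarrow> \<exists>k>0. z \<in> H_obox k"
proof -
  assume z: "z \<in> \<H>"
  obtain k :: nat where k: "real k > max (cmod z) (1 / Im z)" using reals_Archimedean2 by blast
  have "1 / Im z > 0" using z by (simp add: upper_half_plane_def)
  then have "real k > 0" using k by linarith
  moreover have "1 / real k < Im z"
    using k z \<open>real k > 0\<close> by (simp add: upper_half_plane_def field_simps)
  ultimately show ?thesis using k by (intro exI[of _ k]) (auto simp: H_obox_def)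
qed

text \<open>The imaginary part of the image bounds \<open>c z + d\<close>, the image itself then
  bounds \<open>a z + b\<close>, and a real linear form bounded at a point with imaginary part at
  least \<open>1 / k\<close> has bounded coefficients. \<open>2 k^4\<close> is a common majorant for
  the four entries.\<close>

lemma entries_bounded:
  assumes A: "det A = 1" and k: "k > 0" and z: "z \<in> H_box k" "moebius A z \<in> H_box k"
  shows "\<bar>A$i$j\<bar> \<le> 2 * real k ^ 4"
proof -
  define a b c d where abcd: "a = A$1$1" "b = A$1$2" "c = A$2$1" "d = A$2$2"
  define K where "K = real k"
  have K: "K \<ge> 1" using k by (simp add: K_def)
  have zb: "cmod z \<le> K" "Im z \<ge> 1 / K" and wb: "cmod (moebius A z) \<le> K" "Im (moebius A z) \<ge> 1 / K"
    using z by (auto simp: H_box_def K_def)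
  have y: "Im z > 0" using H_box_subset[OF k] z by (auto simp: upper_half_plane_def)
  have m: "cmod (mden A z) > 0" using mden_nonzero[OF A y] by simp
  have "1 / K \<le> Im z / (cmod (mden A z))\<^sup>2" using wb(2) moebius_Im[OF A y] by simp
  then have "(cmod (mden A z))\<^sup>2 \<le> Im z * K" using m K by (simp add: field_simps)
  also have "\<dots> \<le> K * K" using zb(1) abs_Im_le_cmod[of z] K by (intro mult_right_mono) auto
  finally have "cmod (mden A z) \<le> K"
    using K by (metis power2_eq_square power2_le_imp_le order_trans zero_le_one)
  have num: "cmod (of_real a * z + of_real b) \<le> K * K"
  proof -
    have "of_real a * z + of_real b = moebius A z * mden A z" using m by (simp add: moebius_alt abcd)
    then show ?thesis
      using wb(1) \<open>cmod (mden A z) \<le> K\<close> K by (simp add: norm_mult mult_mono)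
  qed
  have gen: "\<bar>u\<bar> \<le> M * K \<and> \<bar>v\<bar> \<le> M + M * K * K" if "cmod (of_real u * z + of_real v) \<le> M" for u v M
  proof -
    have "\<bar>u\<bar> * Im z = \<bar>Im (of_real u * z + of_real v)\<bar>" using y by (simp add: abs_mult)
    also have "\<dots> \<le> M" using that abs_Im_le_cmod order_trans by blast
    finally have "\<bar>u\<bar> * (1 / K) \<le> M" using zb(2) by (meson abs_ge_zero mult_left_mono order_trans)
    then have u: "\<bar>u\<bar> \<le> M * K" using K by (simp add: field_simps)
    have "\<bar>v\<bar> = \<bar>Re (of_real u * z + of_real v) - u * Re z\<bar>" by simp
    also have "\<dots> \<le> \<bar>Re (of_real u * z + of_real v)\<bar> + \<bar>u\<bar> * \<bar>Re z\<bar>" by (simp add: abs_triangle_ineq4 flip: abs_mult)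
    also have "\<dots> \<le> M + (M * K) * K"
    proof (rule add_mono)
      show "\<bar>Re (of_real u * z + of_real v)\<bar> \<le> M" using that abs_Re_le_cmod order_trans by blast
      show "\<bar>u\<bar> * \<bar>Re z\<bar> \<le> (M * K) * K"
        using u zb(1) abs_Re_le_cmod[of z] by (intro mult_mono) auto
    qed
    finally show ?thesis using u by simp
  qed
  have P: "K \<le> K ^ 4" "K ^ 2 \<le> K ^ 4" "K ^ 3 \<le> K ^ 4" "1 \<le> K ^ 4"
    using K power_increasing[of 1 4 K] power_increasing[of 2 4 K] power_increasing[of 3 4 K] by auto
  have "\<bar>a\<bar> \<le> K ^ 3 \<and> \<bar>b\<bar> \<le> K ^ 2 + K ^ 4"
    using gen[OF num] by (simp add: power2_eq_square power3_eq_cube power4_eq_xxxx)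
  moreover have "\<bar>c\<bar> \<le> K ^ 2 \<and> \<bar>d\<bar> \<le> K + K ^ 3"
    using gen[of c d K] \<open>cmod (mden A z) \<le> K\<close>
    by (simp add: mden_def abcd power2_eq_square power3_eq_cube)
  ultimately have "\<bar>a\<bar> \<le> 2 * K ^ 4" "\<bar>b\<bar> \<le> 2 * K ^ 4" "\<bar>c\<bar> \<le> 2 * K ^ 4" "\<bar>d\<bar> \<le> 2 * K ^ 4"
    using P by linarith+
  then show ?thesis using exhaust_2[of i] exhaust_2[of j] by (auto simp: abcd K_def)
qed

definition near_one :: "real \<Rightarrow> real^2^2 \<Rightarrow> bool" where
  "near_one e A \<longleftrightarrow> \<bar>A$1$1 - 1\<bar> < e \<and> \<bar>A$1$2\<bar> < e \<and> \<bar>A$2$1\<bar> < e \<and> \<bar>A$2$2 - 1\<bar> < e"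

lemma norm_mat2_le: "norm (A :: real^2^2) \<le> \<bar>A$1$1\<bar> + \<bar>A$1$2\<bar> + \<bar>A$2$1\<bar> + \<bar>A$2$2\<bar>"
proof -
  have "norm A \<le> norm (A$1) + norm (A$2)"
    unfolding norm_vec_def[of A] using L2_set_le_sum[of UNIV "\<lambda>i. norm (A$i)"] by (simp add: sum_2)
  moreover have "norm (A$i) \<le> \<bar>A$i$1\<bar> + \<bar>A$i$2\<bar>" for i
    using norm_le_l1_cart[of "A$i"] by (simp add: sum_2)
  from this[of 1] this[of 2] calculation show ?thesis by linarith
qed

lemma fuchsian_discrete:
  assumes "fuchsian \<Gamma>"
  obtains e where "e > 0" "\<And>A. A \<in> lifts \<Gamma> \<Longrightarrow> near_one e A \<Longrightarrow> A = mat 1"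
proof -
  have sub: "subgroup \<Gamma> PSL2R" and disc: "subtopology PSL2R_topology \<Gamma> = discrete_topology \<Gamma>"
    using assms by (auto simp: fuchsian_def)
  let ?o = "PSL_proj (mat 1)"
  have o: "?o \<in> \<Gamma>" using subgroup.one_closed[OF sub] by (simp add: PSL_one)
  then have "openin (subtopology PSL2R_topology \<Gamma>) {?o}" unfolding disc by simp
  then obtain W where W: "openin PSL2R_topology W" "{?o} = W \<inter> \<Gamma>"
    by (auto simp: openin_subtopology)
  have "openin (top_of_set (carrier SL2R)) {x \<in> carrier SL2R. PSL_proj x \<in> W}"
    using W(1) by (simp add: PSL2R_topology_def openin_quotient_topology)
  then obtain V where V: "open V" "{x \<in> carrier SL2R. PSL_proj x \<in> W} = carrier SL2R \<inter> V"
    by (auto simp: openin_open)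
  have "mat 1 \<in> V" using V(2) W(2) by auto
  then obtain \<delta> where \<delta>: "\<delta> > 0" "ball (mat 1) \<delta> \<subseteq> V" using V(1) open_contains_ball by blast
  \<comment> \<open>The norm is at most the sum of the four entry deviations, whence
    \<open>\<delta> / 4\<close>; the cap 1 excludes \<open>- mat 1\<close>, which represents the
    same element of PSL2.\<close>
  define e where "e = min (\<delta> / 4) 1"
  show ?thesis
  proof (rule that[of e])
    show "e > 0" using \<delta> by (simp add: e_def)
    fix A assume A: "A \<in> lifts \<Gamma>" and near: "near_one e A"
    have "norm (A - mat 1) \<le> \<bar>A$1$1 - 1\<bar> + \<bar>A$1$2\<bar> + \<bar>A$2$1\<bar> + \<bar>A$2$2 - 1\<bar>"
      using norm_mat2_le[of "A - mat 1"] by (simp add: mat2_one)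
    also have "\<dots> < \<delta>" using near unfolding near_one_def e_def by linarith
    finally have "A \<in> V" using \<delta>(2) by (auto simp: dist_norm norm_minus_commute)
    then have "PSL_proj A \<in> W \<inter> \<Gamma>" using V(2) A by (auto simp: lifts_iff)
    then have "PSL_proj A \<in> {?o}" unfolding W(2) .
    then have "A = mat 1 \<or> A = - mat 1" by (simp add: PSL_proj_eq_iff)
    moreover have "A \<noteq> - mat 1"
    proof
      assume "A = - mat 1"
      then have "A$1$1 = -1" by (simp add: mat2_one)
      then show False using near by (simp add: near_one_def e_def)
    qed
    ultimately show "A = mat 1" by simp
  qed
qed

lemma lifts_closed:
  assumes "subgroup \<Gamma> PSL2R"
  shows lifts_mult: "\<And>A B. A \<in> lifts \<Gamma> \<Longrightarrow> B \<in> lifts \<Gamma> \<Longrightarrow> A ** B \<in> lifts \<Gamma>"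
    and lifts_adj2: "\<And>A. A \<in> lifts \<Gamma> \<Longrightarrow> adj2 A \<in> lifts \<Gamma>"
  using subgroup.m_closed[OF assms] subgroup.m_inv_closed[OF assms]
  by (auto simp: lifts_iff det_mul adj2_mult simp flip: PSL_mult PSL_inv)

text \<open>Two lifts with entries in the same small cells have a quotient near the identity, so
  discreteness makes them equal; bounded entries meet only finitely many cells.\<close>

lemma finite_bounded_lifts:
  assumes F: "fuchsian \<Gamma>"
  shows "finite {A \<in> lifts \<Gamma>. \<forall>i j. \<bar>A$i$j\<bar> \<le> M}"
proof -
  have sub: "subgroup \<Gamma> PSL2R" using F by (simp add: fuchsian_def)
  define S where "S = {A \<in> lifts \<Gamma>. \<forall>i j. \<bar>A$i$j\<bar> \<le> M}"
  obtain e where e: "e > 0" "\<And>A. A \<in> lifts \<Gamma> \<Longrightarrow> near_one e A \<Longrightarrow> A = mat 1"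
    using fuchsian_discrete[OF F] by blast
  show ?thesis
  proof (cases "M \<le> 0")
    case True
    have "S \<subseteq> {0}"
    proof
      fix A assume "A \<in> S"
      then have "\<bar>A$i$j\<bar> \<le> 0" for i j using True order_trans unfolding S_def by blast
      then show "A \<in> {0}" by (simp add: mat2_eq_iff)
    qed
    then show ?thesis unfolding S_def by (rule finite_subset) simp
  next
    case False
    \<comment> \<open>Each entry of \<open>A ** adj2 B - mat 1\<close> is a sum of two products of
      size at most \<open>\<delta> * M\<close>, hence at most \<open>e / 2\<close>.\<close>
    define \<delta> where "\<delta> = e / (4 * M)"
    have \<delta>: "\<delta> > 0" using e False by (simp add: \<delta>_def)
    define f where "f A = (\<lfloor>A$1$1 / \<delta>\<rfloor>, \<lfloor>A$1$2 / \<delta>\<rfloor>, \<lfloor>A$2$1 / \<delta>\<rfloor>, \<lfloor>A$2$2 / \<delta>\<rfloor>)" for A :: "real^2^2"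
    have fl: "\<bar>u - v\<bar> < \<delta>" if "\<lfloor>u / \<delta>\<rfloor> = \<lfloor>v / \<delta>\<rfloor>" for u v
    proof -
      have "\<bar>u / \<delta> - v / \<delta>\<bar> < 1" using that by linarith
      then have "\<bar>(u - v) / \<delta>\<bar> < 1" by (simp add: diff_divide_distrib)
      then show ?thesis using \<delta> by (simp add: abs_divide)
    qed
    have "inj_on f S"
    proof (rule inj_onI)
      fix A B assume A: "A \<in> S" and B: "B \<in> S" and eq: "f A = f B"
      have dA: "det A = 1" and dB: "det B = 1" using A B by (auto simp: S_def lifts_iff)
      have d: "\<bar>A$1$1 - B$1$1\<bar> < \<delta>" "\<bar>A$1$2 - B$1$2\<bar> < \<delta>" "\<bar>A$2$1 - B$2$1\<bar> < \<delta>" "\<bar>A$2$2 - B$2$2\<bar> < \<delta>"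
        using eq by (auto simp: f_def intro: fl)
      have bB: "\<bar>B$i$j\<bar> \<le> M" for i j using B by (auto simp: S_def)
      have est: "\<bar>p * u + q * v\<bar> < e" if "\<bar>p\<bar> < \<delta>" "\<bar>q\<bar> < \<delta>" "\<bar>u\<bar> \<le> M" "\<bar>v\<bar> \<le> M" for p q u v
      proof -
        have "\<bar>p * u + q * v\<bar> \<le> \<bar>p\<bar> * \<bar>u\<bar> + \<bar>q\<bar> * \<bar>v\<bar>" by (metis abs_mult abs_triangle_ineq)
        also have "\<dots> \<le> \<delta> * M + \<delta> * M" using that by (intro add_mono mult_mono) auto
        also have "\<dots> = e / 2" using False by (simp add: \<delta>_def)
        also have "\<dots> < e" using e by simp
        finally show ?thesis .
      qed
      define C where "C = A ** adj2 B"
      have det: "B$1$1 * B$2$2 - B$1$2 * B$2$1 = 1" using dB by (simp add: det_2)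
      have "C$1$1 - 1 = (A$1$1 - B$1$1) * B$2$2 + (A$1$2 - B$1$2) * (- B$2$1)"
        "C$1$2 = (A$1$1 - B$1$1) * (- B$1$2) + (A$1$2 - B$1$2) * B$1$1"
        "C$2$1 = (A$2$1 - B$2$1) * B$2$2 + (A$2$2 - B$2$2) * (- B$2$1)"
        "C$2$2 - 1 = (A$2$1 - B$2$1) * (- B$1$2) + (A$2$2 - B$2$2) * B$1$1"
        using det by (simp_all add: C_def mat2_mult adj2_def algebra_simps)
      then have "near_one e C"
        unfolding near_one_def using est d bB by (simp only: abs_minus_cancel)
      moreover have "C \<in> lifts \<Gamma>"
        using A B unfolding C_def S_def by (auto intro: lifts_mult[OF sub] lifts_adj2[OF sub])
      ultimately have "C = mat 1" using e(2) by blast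
      then have "A ** (adj2 B ** B) = B" by (simp add: C_def matrix_mul_assoc)
      then show "A = B" using adj2_mult[OF dB] by simp
    qed
    moreover have "finite (f ` S)"
    proof (rule finite_subset)
      define N where "N = \<lceil>M / \<delta>\<rceil> + 1"
      have "\<lfloor>u / \<delta>\<rfloor> \<in> {-N..N}" if "\<bar>u\<bar> \<le> M" for u
      proof -
        have "\<bar>u / \<delta>\<bar> \<le> M / \<delta>" using that \<delta> by (simp add: abs_divide divide_right_mono)
        then have "u / \<delta> \<le> M / \<delta> \<and> - (u / \<delta>) \<le> M / \<delta>" by (simp only: abs_le_iff)
        then have "- (M / \<delta>) \<le> u / \<delta>" "u / \<delta> \<le> M / \<delta>" by linarith+
        then have "\<lfloor>- (M / \<delta>)\<rfloor> \<le> \<lfloor>u / \<delta>\<rfloor>" "\<lfloor>u / \<delta>\<rfloor> \<le> \<lfloor>M / \<delta>\<rfloor>" by (simp_all only: floor_mono)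
        moreover have "\<lfloor>M / \<delta>\<rfloor> \<le> \<lceil>M / \<delta>\<rceil>" by (rule floor_le_ceiling)
        ultimately have "- \<lceil>M / \<delta>\<rceil> \<le> \<lfloor>u / \<delta>\<rfloor>" "\<lfloor>u / \<delta>\<rfloor> \<le> \<lceil>M / \<delta>\<rceil>"
          unfolding floor_minus by (blast, metis order_trans)
        then show ?thesis unfolding N_def by simp
      qed
      then show "f ` S \<subseteq> {-N..N} \<times> {-N..N} \<times> {-N..N} \<times> {-N..N}" by (auto simp: f_def S_def)
    qed auto
    ultimately show ?thesis unfolding S_def by (rule finite_imageD[rotated])
  qed
qed

section \<open>Closed surface groups\<close>

locale surface_group =
  fixes \<Gamma> :: "(real^2^2) set set"
  assumes csg: "closed_surface_group \<Gamma>"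
begin

lemma fuchs: "fuchsian \<Gamma>" and sub: "subgroup \<Gamma> PSL2R"
  using csg by (auto simp: closed_surface_group_def fuchsian_def)

lemma in_PSL: "\<gamma> \<in> \<Gamma> \<Longrightarrow> \<gamma> \<in> carrier PSL2R"
  by (rule subgroup.mem_carrier[OF sub])

lemmas one_in = subgroup.one_closed[OF sub]
lemmas mult_in = subgroup.m_closed[OF sub]
lemmas inv_in = subgroup.m_inv_closed[OF sub]

lemma free: "\<gamma> \<in> \<Gamma> \<Longrightarrow> z \<in> \<H> \<Longrightarrow> PSL_act \<gamma> z = z \<Longrightarrow> \<gamma> = \<one>\<^bsub>PSL2R\<^esub>"
  using csg by (auto simp: closed_surface_group_def)

lemma act_eq_imp_eq:
  assumes "\<gamma> \<in> \<Gamma>" "\<delta> \<in> \<Gamma>" "z \<in> \<H>" "PSL_act \<gamma> z = PSL_act \<delta> z"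
  shows "\<gamma> = \<delta>"
proof -
  interpret P: group PSL2R by (rule PSL2R_group)
  have "PSL_act (inv\<^bsub>PSL2R\<^esub> \<delta> \<otimes>\<^bsub>PSL2R\<^esub> \<gamma>) z = z"
    using psl_act_mult[OF in_PSL[OF assms(1)] assms(3), of "inv\<^bsub>PSL2R\<^esub> \<delta>"]
      psl_act_inv[OF in_PSL[OF assms(2)] assms(3)] assms in_PSL by simp
  then have "inv\<^bsub>PSL2R\<^esub> \<delta> \<otimes>\<^bsub>PSL2R\<^esub> \<gamma> = \<one>\<^bsub>PSL2R\<^esub>" using assms free mult_in inv_in by blast
  then have "inv\<^bsub>PSL2R\<^esub> (inv\<^bsub>PSL2R\<^esub> \<delta>) = \<gamma>"
    using assms in_PSL by (intro P.inv_equality) (auto simp: P.inv_comm)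
  then show ?thesis using assms in_PSL by simp
qed

text \<open>Proper discontinuity on boxes: the returning elements have lifts with bounded
  entries.\<close>

lemma finite_box_return:
  assumes k: "k > 0"
  shows "finite {\<gamma> \<in> \<Gamma>. \<exists>z\<in>H_box k. PSL_act \<gamma> z \<in> H_box k}"
proof (rule finite_subset)
  show "{\<gamma> \<in> \<Gamma>. \<exists>z\<in>H_box k. PSL_act \<gamma> z \<in> H_box k} \<subseteq>
      PSL_proj ` {A \<in> lifts \<Gamma>. \<forall>i j. \<bar>A$i$j\<bar> \<le> 2 * real k ^ 4}"
  proof
    fix \<gamma> assume "\<gamma> \<in> {\<gamma> \<in> \<Gamma>. \<exists>z\<in>H_box k. PSL_act \<gamma> z \<in> H_box k}"
    then obtain z where \<gamma>: "\<gamma> \<in> \<Gamma>" and z: "z \<in> H_box k" "PSL_act \<gamma> z \<in> H_box k" by blast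
    obtain A where A: "det A = 1" "PSL_proj A = \<gamma>" using lift_exists[OF in_PSL[OF \<gamma>]] by blast
    have "moebius A z \<in> H_box k" using z(2) A(2) PSL_act_proj by metis
    then have "\<bar>A$i$j\<bar> \<le> 2 * real k ^ 4" for i j using entries_bounded[OF A(1) k z(1)] by blast
    then show "\<gamma> \<in> PSL_proj ` {A \<in> lifts \<Gamma>. \<forall>i j. \<bar>A$i$j\<bar> \<le> 2 * real k ^ 4}"
      using A \<gamma> by (intro image_eqI[of _ _ A]) (auto simp: lifts_iff)
  qed
  show "finite (PSL_proj ` {A \<in> lifts \<Gamma>. \<forall>i j. \<bar>A$i$j\<bar> \<le> 2 * real k ^ 4})"
    by (intro finite_imageI finite_bounded_lifts fuchs)
qed

lemma orbit_eq_iff: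
  assumes "z \<in> \<H>" "w \<in> \<H>"
  shows "orbit_pt \<Gamma> z = orbit_pt \<Gamma> w \<longleftrightarrow> (\<exists>\<gamma>\<in>\<Gamma>. w = PSL_act \<gamma> z)"
proof
  assume eq: "orbit_pt \<Gamma> z = orbit_pt \<Gamma> w"
  show "\<exists>\<gamma>\<in>\<Gamma>. w = PSL_act \<gamma> z" using orbit_pt_self[OF sub, of w] unfolding eq[symmetric] orbit_pt_iff .
qed (use orbit_pt_psl_act[OF sub _ assms(1)] in auto)

text \<open>The projected open boxes cover the compact quotient and increase, so the largest box of
  a finite subcover meets every orbit.\<close>

lemma cocompact:
  obtains k where "k > 0" "\<And>z. z \<in> \<H> \<Longrightarrow> \<exists>\<gamma>\<in>\<Gamma>. PSL_act \<gamma> z \<in> H_obox k"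
proof -
  define U where "U k = orbit_pt \<Gamma> ` H_obox k" for k
  have HH: "k > 0 \<Longrightarrow> H_obox k \<subseteq> \<H>" for k using H_obox_subset H_box_subset by blast
  have top: "topspace (surface_topology \<Gamma>) = orbit_pt \<Gamma> ` \<H>"
    using quotient_imp_surjective_map[OF quotient_map_quotient_topology[of "top_of_set \<H>" "orbit_pt \<Gamma>"]]
    by (simp add: surface_topology_def)
  have pre: "z \<in> \<H> \<Longrightarrow> k > 0 \<Longrightarrow> orbit_pt \<Gamma> z \<in> U k \<longleftrightarrow> (\<exists>\<gamma>\<in>\<Gamma>. PSL_act \<gamma> z \<in> H_obox k)" for z k
    unfolding U_def image_iff using orbit_eq_iff HH[of k] psl_act_closed[OF in_PSL] by (metis subsetD)
  have op: "openin (surface_topology \<Gamma>) (U k)" if k: "k > 0" for k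
  proof -
    have "{z \<in> \<H>. orbit_pt \<Gamma> z \<in> U k} = (\<Union>\<gamma>\<in>\<Gamma>. \<H> \<inter> PSL_act \<gamma> -` H_obox k)"
      using pre k by auto
    moreover have pc: "openin (top_of_set \<H>) (\<H> \<inter> PSL_act \<gamma> -` H_obox k)" if "\<gamma> \<in> \<Gamma>" for \<gamma>
      by (rule continuous_openin_preimage_gen[OF psl_act_continuous[OF in_PSL[OF that]] open_H_obox])
    ultimately have "openin (top_of_set \<H>) {z \<in> \<H>. orbit_pt \<Gamma> z \<in> U k}"
      by (simp only:) (rule openin_Union, use pc in blast)
    then show ?thesis
      using HH[OF k] by (auto simp: surface_topology_def openin_quotient_topology U_def)
  qed
  have cov: "topspace (surface_topology \<Gamma>) \<subseteq> \<Union>(U ` {0<..})"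
  proof
    fix p assume "p \<in> topspace (surface_topology \<Gamma>)"
    then obtain z where z: "z \<in> \<H>" "p = orbit_pt \<Gamma> z" using top by blast
    then obtain k where "k > 0" "z \<in> H_obox k" using H_obox_cover by blast
    then show "p \<in> \<Union>(U ` {0<..})" using z by (auto simp: U_def)
  qed
  have "compactin (surface_topology \<Gamma>) (topspace (surface_topology \<Gamma>))"
    using csg by (simp add: closed_surface_group_def compact_space_def)
  then obtain \<F> where \<F>: "finite \<F>" "\<F> \<subseteq> U ` {0<..}" "topspace (surface_topology \<Gamma>) \<subseteq> \<Union>\<F>"
    using op cov unfolding compactin_def by (metis (no_types, lifting) greaterThan_iff imageE)
  then obtain N where N: "finite N" "N \<subseteq> {0<..}" "\<F> = U ` N" by (meson finite_subset_image)
  \<comment> \<open>Inserting 1 makes the maximum exist and be positive.\<close>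
  define m where "m = Max (insert 1 N)"
  have le: "k \<le> m" if "k \<in> insert 1 N" for k
    unfolding m_def by (rule Max_ge) (use N(1) that in auto)
  have "1 \<le> m" by (rule le) simp
  then have m1: "m > 0" by simp
  have m2: "k \<le> m" if "k \<in> N" for k by (rule le) (use that in simp)
  note m = m1 m2
  show ?thesis
  proof (rule that[OF m(1)])
    fix z assume z: "z \<in> \<H>"
    then obtain k where k: "k \<in> N" "orbit_pt \<Gamma> z \<in> U k" using \<F>(3) N(3) top by blast
    then have "k > 0" using N(2) by auto
    then obtain \<gamma> where "\<gamma> \<in> \<Gamma>" "PSL_act \<gamma> z \<in> H_obox k" using pre[OF z] k by blast
    then show "\<exists>\<gamma>\<in>\<Gamma>. PSL_act \<gamma> z \<in> H_obox m"
      using H_obox_mono[OF \<open>k > 0\<close> m(2)[OF k(1)]] by blast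
  qed
qed

text \<open>Provides the countable additivity with which fundamental domains are compared.\<close>

lemma countable: "countable \<Gamma>"
proof -
  have "\<Gamma> \<subseteq> (\<Union>k\<in>{0<..}. {\<gamma> \<in> \<Gamma>. \<exists>z\<in>H_box k. PSL_act \<gamma> z \<in> H_box k})"
  proof
    fix \<gamma> assume \<gamma>: "\<gamma> \<in> \<Gamma>"
    have i: "\<i> \<in> \<H>" by (simp add: upper_half_plane_def)
    obtain k l where kl: "k > 0" "\<i> \<in> H_obox k" "l > 0" "PSL_act \<gamma> \<i> \<in> H_obox l"
      using H_obox_cover[OF i] H_obox_cover[OF psl_act_closed[OF in_PSL[OF \<gamma>] i]] by blast
    have "\<i> \<in> H_box (max k l)" "PSL_act \<gamma> \<i> \<in> H_box (max k l)"
      using kl H_obox_mono[of k "max k l"] H_obox_mono[of l "max k l"] H_obox_subset[of "max k l"] by auto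
    then show "\<gamma> \<in> (\<Union>k\<in>{0<..}. {\<gamma> \<in> \<Gamma>. \<exists>z\<in>H_box k. PSL_act \<gamma> z \<in> H_box k})"
      using \<gamma> kl by (intro UN_I[of "max k l"]) auto
  qed
  then show ?thesis
    by (rule countable_subset) (rule countable_UN, simp, rule countable_finite, rule finite_box_return, simp)
qed

text \<open>Finitely many translates of a compact box cannot cover the unbounded half-plane.
  Infinity keeps the congruence subgroups nontrivial and lets the covering degree grow.\<close>

lemma infinite: "infinite \<Gamma>"
proof
  assume fin: "finite \<Gamma>"
  obtain k where k: "k > 0" "\<And>z. z \<in> \<H> \<Longrightarrow> \<exists>\<gamma>\<in>\<Gamma>. PSL_act \<gamma> z \<in> H_obox k" using cocompact by blast
  have HB: "H_box k \<subseteq> \<H>" by (rule H_box_subset[OF k(1)])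
  have "\<H> \<subseteq> (\<Union>\<gamma>\<in>\<Gamma>. PSL_act \<gamma> ` H_box k)"
  proof
    fix z assume z: "z \<in> \<H>"
    then obtain \<gamma> where \<gamma>: "\<gamma> \<in> \<Gamma>" "PSL_act \<gamma> z \<in> H_box k" using k(2) H_obox_subset by blast
    have "z = PSL_act (inv\<^bsub>PSL2R\<^esub> \<gamma>) (PSL_act \<gamma> z)" using psl_act_inv(1)[OF in_PSL[OF \<gamma>(1)] z] by simp
    then show "z \<in> (\<Union>\<gamma>\<in>\<Gamma>. PSL_act \<gamma> ` H_box k)" using \<gamma> inv_in by blast
  qed
  moreover have "compact (\<Union>\<gamma>\<in>\<Gamma>. PSL_act \<gamma> ` H_box k)"
    using fin in_PSL by (intro compact_UN compact_continuous_image compact_H_box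
        continuous_on_subset[OF psl_act_continuous HB]) auto
  ultimately have "bounded \<H>" using compact_imp_bounded bounded_subset by blast
  then obtain B where B: "\<And>z. z \<in> \<H> \<Longrightarrow> cmod z \<le> B" by (auto simp: bounded_iff)
  have "cmod (Complex 0 (\<bar>B\<bar> + 1)) = \<bar>B\<bar> + 1" by (simp add: cmod_def)
  moreover have "\<bar>B\<bar> + 1 > 0" by linarith
  ultimately show False using B[of "Complex 0 (\<bar>B\<bar> + 1)"] by (simp add: upper_half_plane_def)
qed

text \<open>Let \<open>S\<close> be generated by the elements returning some box point to the box.
  The points brought into the box by elements of \<open>S\<close> and those brought there by other
  elements form disjoint open sets covering the connected half-plane, so no element lies outside
  \<open>S\<close>.\<close>

lemma finitely_generated:
  obtains T where "finite T" "T \<subseteq> \<Gamma>" "\<Gamma> = generate PSL2R T"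
proof -
  interpret P: group PSL2R by (rule PSL2R_group)
  obtain k where k: "k > 0" "\<And>z. z \<in> \<H> \<Longrightarrow> \<exists>\<gamma>\<in>\<Gamma>. PSL_act \<gamma> z \<in> H_obox k" using cocompact by blast
  have OH: "H_obox k \<subseteq> \<H>" using H_obox_subset H_box_subset[OF k(1)] by blast
  define T where "T = {\<gamma> \<in> \<Gamma>. \<exists>z\<in>H_obox k. PSL_act \<gamma> z \<in> H_obox k}"
  have T: "T \<subseteq> \<Gamma>" "finite T"
    using finite_subset[OF _ finite_box_return[OF k(1)], of T] H_obox_subset by (auto simp: T_def)
  define S where "S = generate PSL2R T"
  have Tc: "T \<subseteq> carrier PSL2R" using T in_PSL by blast
  have S: "subgroup S PSL2R" unfolding S_def by (rule P.generate_is_subgroup[OF Tc])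
  have S\<Gamma>: "S \<subseteq> \<Gamma>" unfolding S_def using T sub by (intro P.generate_subgroup_incl)
  define V where "V R = {z \<in> \<H>. \<exists>\<gamma>\<in>R. PSL_act \<gamma> z \<in> H_obox k}" for R
  have op: "open (V R)" if "R \<subseteq> \<Gamma>" for R
  proof -
    have "V R = (\<Union>\<gamma>\<in>R. \<H> \<inter> PSL_act \<gamma> -` H_obox k)" by (auto simp: V_def)
    moreover have pc: "open (\<H> \<inter> PSL_act \<gamma> -` H_obox k)" if "\<gamma> \<in> R" for \<gamma>
      using that \<open>R \<subseteq> \<Gamma>\<close> by (intro continuous_open_preimage psl_act_continuous in_PSL open_H open_H_obox) auto
    ultimately show ?thesis by (simp only:) (rule open_UN, use pc in blast)
  qed
  have disj: "V S \<inter> V (\<Gamma> - S) = {}"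
  proof (rule ccontr)
    assume "V S \<inter> V (\<Gamma> - S) \<noteq> {}"
    then obtain z \<gamma> \<delta> where z: "z \<in> \<H>" and \<gamma>: "\<gamma> \<in> S" "PSL_act \<gamma> z \<in> H_obox k"
      and \<delta>: "\<delta> \<in> \<Gamma>" "\<delta> \<notin> S" "PSL_act \<delta> z \<in> H_obox k" by (auto simp: V_def)
    have \<gamma>\<Gamma>: "\<gamma> \<in> \<Gamma>" using \<gamma> S\<Gamma> by blast
    define \<eta> where "\<eta> = \<delta> \<otimes>\<^bsub>PSL2R\<^esub> inv\<^bsub>PSL2R\<^esub> \<gamma>"
    have "PSL_act \<eta> (PSL_act \<gamma> z) = PSL_act \<delta> z"
      unfolding \<eta>_def using psl_act_mult[OF in_PSL[OF inv_in[OF \<gamma>\<Gamma>]] psl_act_closed[OF in_PSL[OF \<gamma>\<Gamma>] z] in_PSL[OF \<delta>(1)]]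
        psl_act_inv(1)[OF in_PSL[OF \<gamma>\<Gamma>] z] by simp
    \<comment> \<open>\<open>\<eta>\<close> sends the box point \<open>PSL_act \<gamma> z\<close> to
      the box point \<open>PSL_act \<delta> z\<close>.\<close>
    then have "\<eta> \<in> T" using \<gamma> \<delta> \<gamma>\<Gamma> mult_in inv_in by (auto simp: T_def \<eta>_def intro!: bexI[of _ "PSL_act \<gamma> z"])
    then have "\<eta> \<in> S" unfolding S_def by (rule generate.incl)
    then have "\<eta> \<otimes>\<^bsub>PSL2R\<^esub> \<gamma> \<in> S" using \<gamma> subgroup.m_closed[OF S] by blast
    moreover have "\<eta> \<otimes>\<^bsub>PSL2R\<^esub> \<gamma> = \<delta>"
      using in_PSL[OF \<gamma>\<Gamma>] in_PSL[OF \<delta>(1)] by (simp add: \<eta>_def P.m_assoc)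
    ultimately show False using \<delta> by simp
  qed
  have cov: "\<H> \<subseteq> V S \<union> V (\<Gamma> - S)" using k(2) S\<Gamma> by (fastforce simp: V_def)
  have ne: "H_obox k \<noteq> {}"
    using k(2)[of \<i>] by (auto simp: upper_half_plane_def)
  have conn: "connected \<H>"
    unfolding upper_half_plane_def by (intro convex_connected convex_halfspace_Im_gt)
  have "V S \<inter> \<H> \<noteq> {}"
  proof -
    obtain u where "u \<in> H_obox k" using ne by blast
    then have "u \<in> V S" using OH subgroup.one_closed[OF S] psl_act_one[of u] by (force simp: V_def)
    then show ?thesis by (auto simp: V_def)
  qed
  then have "V (\<Gamma> - S) \<inter> \<H> = {}"
    using connectedD[OF conn op[OF S\<Gamma>] op[of "\<Gamma> - S"]] disj cov by blast
  have "\<Gamma> \<subseteq> S"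
  proof (rule ccontr)
    assume "\<not> \<Gamma> \<subseteq> S"
    then obtain \<delta> where \<delta>: "\<delta> \<in> \<Gamma> - S" by blast
    obtain u where u: "u \<in> H_obox k" using ne by blast
    have "PSL_act \<delta> (PSL_act (inv\<^bsub>PSL2R\<^esub> \<delta>) u) = u" "PSL_act (inv\<^bsub>PSL2R\<^esub> \<delta>) u \<in> \<H>"
      using psl_act_inv(2)[OF in_PSL, of \<delta> u] psl_act_closed[OF in_PSL[OF inv_in], of \<delta> u] \<delta> u OH by auto
    then have "PSL_act (inv\<^bsub>PSL2R\<^esub> \<delta>) u \<in> V (\<Gamma> - S)"
      unfolding V_def using \<delta> u by (intro CollectI conjI bexI[of _ \<delta>]) simp_all
    then show False using \<open>V (\<Gamma> - S) \<inter> \<H> = {}\<close> by (auto simp: V_def)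
  qed
  then show ?thesis using that[OF T(2,1)] S\<Gamma> by (simp add: S_def)
qed

end

text \<open>A distance with \<open>cosh\<close> at most 2 changes the imaginary part by a factor of
  at most 4 and moves the point by at most three times its height; both fit into the box of index
  \<open>4 * k\<close>.\<close>

lemma H_box_enlarge:
  assumes k: "k > 0" and w: "w \<in> H_box k" and w': "Im w' > 0" and d: "cosh (hyp_dist w w') \<le> 2"
  shows "w' \<in> H_box (4 * k)"
proof -
  define v where "v = Im w" define u where "u = Im w'"
  have v: "v > 0" using H_box_subset[OF k] w by (auto simp: upper_half_plane_def v_def)
  have u: "u > 0" using w' by (simp add: u_def)
  have "(cmod (w - w'))\<^sup>2 / (2 * v * u) \<le> 1"
    using d cosh_hyp_dist[of w w'] v u by (simp add: u_def v_def)
  then have c: "(cmod (w - w'))\<^sup>2 \<le> 2 * v * u" using u v by (simp add: pos_divide_le_eq)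
  have "(v - u)\<^sup>2 \<le> (cmod (w - w'))\<^sup>2"
    using abs_Im_le_cmod[of "w - w'"] by (simp add: u_def v_def abs_le_square_iff[symmetric])
  then have uv: "(v - u)\<^sup>2 \<le> 2 * v * u" using c by linarith
  \<comment> \<open>The inequality reads \<open>s^2 - 4 s t + t^2 \<le> 0\<close>, so
    \<open>s / t\<close> is at most 2 + sqrt 3.\<close>
  have four: "s \<le> 4 * t" if "(s - t)\<^sup>2 \<le> 2 * s * t" "s > 0" "t > 0" for s t :: real
  proof (rule ccontr)
    assume "\<not> s \<le> 4 * t"
    then have "s - 4 * t > 0" by simp
    then have "(s - 4 * t) * s + t * t > 0" using that by (simp add: add_pos_pos)
    then show False using that(1) by (simp add: power2_eq_square algebra_simps)
  qed
  have u4: "u \<le> 4 * v" by (rule four) (use uv u v in \<open>simp_all add: power2_commute mult_ac\<close>)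
  have v4: "v \<le> 4 * u" by (rule four) (use uv u v in auto)
  have vk: "v \<le> real k" "1 / real k \<le> v"
    using w abs_Im_le_cmod[of w] by (auto simp: H_box_def v_def)
  note c
  also have "2 * v * u \<le> 2 * v * (4 * v)" by (rule mult_left_mono) (use u4 v in auto)
  also have "\<dots> \<le> (3 * v)\<^sup>2" by (simp add: power2_eq_square)
  finally have "(cmod (w - w'))\<^sup>2 \<le> (3 * v)\<^sup>2" .
  then have "cmod (w - w') \<le> 3 * v" by (rule power2_le_imp_le) (use v in simp)
  then have "cmod w' \<le> 4 * real k"
    using norm_triangle_ineq2[of w' w] w vk by (simp add: H_box_def norm_minus_commute)
  moreover have "1 / real (4 * k) \<le> u" using vk(2) v4 by (simp add: field_simps)
  ultimately show ?thesis by (simp add: H_box_def u_def)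
qed

context surface_group
begin

text \<open>Conjugation moves the point into a compact box. An element displacing a box point by
  little sends it into a larger box, so there are finitely many of these, and each has a positive
  minimal displacement on the box by freeness.\<close>

lemma displacement_gap:
  obtains e where "e > 0" "\<And>\<gamma> z. \<gamma> \<in> \<Gamma> \<Longrightarrow> \<gamma> \<noteq> \<one>\<^bsub>PSL2R\<^esub> \<Longrightarrow> z \<in> \<H> \<Longrightarrow> cosh (hyp_dist z (PSL_act \<gamma> z)) \<ge> 1 + e"
proof -
  interpret P: group PSL2R by (rule PSL2R_group)
  obtain k where k: "k > 0" "\<And>z. z \<in> \<H> \<Longrightarrow> \<exists>\<gamma>\<in>\<Gamma>. PSL_act \<gamma> z \<in> H_obox k" using cocompact by blast
  \<comment> \<open>By \<open>H_box_enlarge\<close>, box \<open>4 * k\<close> contains every point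
    with \<open>cosh\<close> of the distance to a point of \<open>H_box k\<close> at most 2.\<close>
  define T where "T = {\<gamma> \<in> \<Gamma>. \<exists>z\<in>H_box (4 * k). PSL_act \<gamma> z \<in> H_box (4 * k)} - {\<one>\<^bsub>PSL2R\<^esub>}"
  have fT: "finite T" unfolding T_def using finite_box_return[of "4 * k"] k(1) by simp
  have BH: "H_box k \<subseteq> \<H>" by (rule H_box_subset[OF k(1)])
  have "\<exists>e>0. \<forall>z\<in>H_box k. cosh (hyp_dist z (PSL_act \<gamma> z)) \<ge> 1 + e" if \<gamma>T: "\<gamma> \<in> T" for \<gamma>
  proof -
    have \<gamma>: "\<gamma> \<in> \<Gamma>" "\<gamma> \<noteq> \<one>\<^bsub>PSL2R\<^esub>" using \<gamma>T by (auto simp: T_def)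
    have im: "Im z > 0" "Im (PSL_act \<gamma> z) > 0" if "z \<in> H_box k" for z
      using that BH psl_act_closed[OF in_PSL[OF \<gamma>(1)], of z] by (auto simp: upper_half_plane_def)
    define f where "f z = (cmod (z - PSL_act \<gamma> z))\<^sup>2 / (2 * Im z * Im (PSL_act \<gamma> z))" for z
    have cont: "continuous_on (H_box k) f"
      unfolding f_def
      by (intro continuous_intros continuous_on_subset[OF psl_act_continuous[OF in_PSL[OF \<gamma>(1)]] BH])
        (use im in force)
    have ne: "H_box k \<noteq> {}" using k(2)[of \<i>] H_obox_subset by (force simp: upper_half_plane_def)
    obtain z0 where z0: "z0 \<in> H_box k" "\<And>z. z \<in> H_box k \<Longrightarrow> f z0 \<le> f z"
      using continuous_attains_inf[OF compact_H_box ne cont] by blast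
    have "PSL_act \<gamma> z0 \<noteq> z0" using free[OF \<gamma>(1)] \<gamma>(2) z0(1) BH by blast
    then have "f z0 > 0" using im[OF z0(1)] by (simp add: f_def)
    moreover have "cosh (hyp_dist z (PSL_act \<gamma> z)) = 1 + f z" if "z \<in> H_box k" for z
      using cosh_hyp_dist[OF im[OF that]] by (simp add: f_def)
    ultimately show ?thesis using z0(2) by (intro exI[of _ "f z0"]) auto
  qed
  then obtain g where g: "\<And>\<gamma>. \<gamma> \<in> T \<Longrightarrow> g \<gamma> > 0"
    "\<And>\<gamma> z. \<gamma> \<in> T \<Longrightarrow> z \<in> H_box k \<Longrightarrow> cosh (hyp_dist z (PSL_act \<gamma> z)) \<ge> 1 + g \<gamma>"
    by metis
  \<comment> \<open>The inserted 1 accounts for the nontrivial elements outside \<open>T\<close>,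
    whose displacement at box points has \<open>cosh\<close> above 2.\<close>
  define e where "e = Min (insert 1 (g ` T))"
  have e: "e > 0" unfolding e_def using fT g(1) by (subst Min_gr_iff) auto
  have e1: "e \<le> 1" "\<And>\<gamma>. \<gamma> \<in> T \<Longrightarrow> e \<le> g \<gamma>" unfolding e_def using fT by (auto intro: Min_le)
  show ?thesis
  proof (rule that[OF e])
    fix \<gamma> z assume \<gamma>: "\<gamma> \<in> \<Gamma>" "\<gamma> \<noteq> \<one>\<^bsub>PSL2R\<^esub>" and z: "z \<in> \<H>"
    obtain \<delta> where \<delta>: "\<delta> \<in> \<Gamma>" "PSL_act \<delta> z \<in> H_obox k" using k(2)[OF z] by blast
    note c = in_PSL[OF \<gamma>(1)] in_PSL[OF \<delta>(1)]
    define w where "w = PSL_act \<delta> z"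
    define \<eta> where "\<eta> = \<delta> \<otimes>\<^bsub>PSL2R\<^esub> \<gamma> \<otimes>\<^bsub>PSL2R\<^esub> inv\<^bsub>PSL2R\<^esub> \<delta>"
    have w: "w \<in> H_box k" "w \<in> \<H>" using \<delta>(2) H_obox_subset BH by (auto simp: w_def)
    have \<eta>\<Gamma>: "\<eta> \<in> \<Gamma>" unfolding \<eta>_def using \<gamma> \<delta> mult_in inv_in by simp
    have \<eta>w: "PSL_act \<eta> w = PSL_act \<delta> (PSL_act \<gamma> z)"
    proof -
      have "PSL_act \<eta> w = PSL_act (\<delta> \<otimes>\<^bsub>PSL2R\<^esub> \<gamma>) (PSL_act (inv\<^bsub>PSL2R\<^esub> \<delta>) w)"
        unfolding \<eta>_def by (rule psl_act_mult) (use c w in auto)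
      also have "PSL_act (inv\<^bsub>PSL2R\<^esub> \<delta>) w = z" unfolding w_def by (rule psl_act_inv(1)[OF c(2) z])
      also have "PSL_act (\<delta> \<otimes>\<^bsub>PSL2R\<^esub> \<gamma>) z = PSL_act \<delta> (PSL_act \<gamma> z)" by (rule psl_act_mult[OF c(1) z c(2)])
      finally show ?thesis .
    qed
    have d: "hyp_dist w (PSL_act \<eta> w) = hyp_dist z (PSL_act \<gamma> z)"
      using hyp_dist_psl_act[OF c(2) z psl_act_closed[OF c(1) z]] \<eta>w by (simp only: w_def)
    have \<eta>1: "\<eta> \<noteq> \<one>\<^bsub>PSL2R\<^esub>"
    proof
      assume "\<eta> = \<one>\<^bsub>PSL2R\<^esub>"
      then have "\<delta> \<otimes>\<^bsub>PSL2R\<^esub> \<gamma> = \<delta>" using c unfolding \<eta>_def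
        by (metis P.inv_closed P.inv_equality P.inv_inv P.m_closed)
      then show False using c \<gamma>(2) by simp
    qed
    show "cosh (hyp_dist z (PSL_act \<gamma> z)) \<ge> 1 + e"
    proof (cases "cosh (hyp_dist w (PSL_act \<eta> w)) \<le> 2")
      case True
      have "PSL_act \<eta> w \<in> H_box (4 * k)"
        by (rule H_box_enlarge[OF k(1) w(1) _ True])
          (use psl_act_closed[OF in_PSL[OF \<eta>\<Gamma>] w(2)] in \<open>simp add: upper_half_plane_def\<close>)
      moreover have "w \<in> H_box (4 * k)"
        by (rule H_box_enlarge[OF k(1) w(1)]) (use w in \<open>simp_all add: upper_half_plane_def hyp_dist_def arcosh_1\<close>)
      ultimately have "\<eta> \<in> T" using \<eta>\<Gamma> \<eta>1 by (auto simp: T_def)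
      then show ?thesis using g(2)[OF _ w(1)] e1(2) d by fastforce
    next
      case False
      then show ?thesis using d e1(1) by simp
    qed
  qed
qed

text \<open>A trace of absolute value at most 2 means elliptic or parabolic; at a suitable point the
  displacement is then smaller than \<open>displacement_gap\<close> allows.\<close>

lemma lift_hyperbolic:
  assumes A: "A \<in> lifts \<Gamma>" and n1: "A \<noteq> mat 1" "A \<noteq> - mat 1"
  shows "\<bar>trace A\<bar> > 2"
proof (rule ccontr)
  assume "\<not> \<bar>trace A\<bar> > 2"
  then have tr: "\<bar>trace A\<bar> \<le> 2" by simp
  have dA: "det A = 1" and \<gamma>: "PSL_proj A \<in> \<Gamma>" using A by (auto simp: lifts_iff)
  have \<gamma>1: "PSL_proj A \<noteq> \<one>\<^bsub>PSL2R\<^esub>" using n1 by (simp add: PSL_one PSL_proj_eq_iff)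
  define a b c d where abcd: "a = A$1$1" "b = A$1$2" "c = A$2$1" "d = A$2$2"
  have det: "a * d - b * c = 1" using dA by (simp add: det_2 abcd)
  have tr': "(a + d)\<^sup>2 \<le> 4"
    using tr abs_le_square_iff[of "a + d" 2] by (simp add: trace_2 abcd)
  obtain e where e: "e > 0" "\<And>\<gamma> z. \<gamma> \<in> \<Gamma> \<Longrightarrow> \<gamma> \<noteq> \<one>\<^bsub>PSL2R\<^esub> \<Longrightarrow> z \<in> \<H> \<Longrightarrow> cosh (hyp_dist z (PSL_act \<gamma> z)) \<ge> 1 + e"
    using displacement_gap by blast
  define q :: "complex \<Rightarrow> complex" where "q z = of_real c * z\<^sup>2 + of_real (d - a) * z - of_real b" for z
  have gap: "e \<le> (cmod (q z))\<^sup>2 / (2 * (Im z)\<^sup>2)" if "Im z > 0" for z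
    using e(2)[OF \<gamma> \<gamma>1, of z] cosh_displacement[OF dA that] that
    by (simp add: PSL_act_proj q_def abcd upper_half_plane_def)
  show False
  proof (cases "c = 0")
    case True
    have "(a - d)\<^sup>2 = (a + d)\<^sup>2 - 4" using det True by (simp add: power2_eq_square algebra_simps)
    then have "(a - d)\<^sup>2 \<le> 0" using tr' by linarith
    then have "a - d = 0" by (simp only: power2_less_eq_zero_iff)
    then have ad: "a = d" by simp
    have "b \<noteq> 0"
    proof
      assume "b = 0"
      have "a * a = 1" using det ad True by simp
      then have "a = 1 \<or> a = -1" by (simp add: square_eq_1_iff)
      then show False using n1 True \<open>b = 0\<close> ad by (auto simp: mat2_eq_iff mat2_one abcd)
    qed
    \<comment> \<open>The height at which this translation has \<open>cosh\<close> of the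
      displacement equal to \<open>1 + e / 2\<close>.\<close>
    define t where "t = \<bar>b\<bar> / sqrt e"
    have t: "t > 0" "t\<^sup>2 = b\<^sup>2 / e" using \<open>b \<noteq> 0\<close> e(1) by (auto simp: t_def power_divide)
    have "q (Complex 0 t) = - of_real b" by (simp add: q_def True ad)
    then have "e \<le> b\<^sup>2 / (2 * t\<^sup>2)" using gap[of "Complex 0 t"] t(1) by simp
    then show False unfolding t(2) using \<open>b \<noteq> 0\<close> e(1) by simp
  next
    case False
    \<comment> \<open>The real part of the fixed points; on this vertical line the quadratic takes
      real values.\<close>
    define x where "x = (a - d) / (2 * c)"
    have xc: "2 * c * x = a - d" using False by (simp add: x_def)
    define D where "D = 4 - (a + d)\<^sup>2"
    have D0: "D \<ge> 0" using tr' by (simp add: D_def)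
    have D: "4 * c * (c * x\<^sup>2 + b) = - D"
    proof -
      have "4 * c * (c * x\<^sup>2 + b) = (2 * c * x)\<^sup>2 + 4 * (b * c)" by (simp add: power2_eq_square algebra_simps)
      also have "\<dots> = - D" unfolding xc using det by (simp add: D_def power2_eq_square algebra_simps)
      finally show ?thesis .
    qed
    have qx: "q (Complex x t) = of_real (- (c * x\<^sup>2 + b) - c * t\<^sup>2)" for t
    proof -
      have da: "d - a = - (2 * c * x)" using xc by simp
      show ?thesis unfolding q_def da
        by (simp add: complex_eq_iff power2_eq_square algebra_simps)
    qed
    have qx': "cmod (q (Complex x t)) = \<bar>D - 4 * c\<^sup>2 * t\<^sup>2\<bar> / (4 * \<bar>c\<bar>)" for t
    proof -
      have "4 * c * (- (c * x\<^sup>2 + b) - c * t\<^sup>2) = D - 4 * c\<^sup>2 * t\<^sup>2"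
        using D by (simp add: power2_eq_square algebra_simps)
      then have "- (c * x\<^sup>2 + b) - c * t\<^sup>2 = (D - 4 * c\<^sup>2 * t\<^sup>2) / (4 * c)" using False by (simp add: field_simps)
      then show ?thesis unfolding qx norm_of_real by (simp add: abs_divide abs_mult)
    qed
    \<comment> \<open>For \<open>D = 0\<close> a height above the parabolic fixed point where the
      displacement term is \<open>e / 2\<close>; otherwise the height of the elliptic fixed point,
      where it vanishes.\<close>
    define t where "t = (if D = 0 then sqrt e / \<bar>c\<bar> else sqrt D / (2 * \<bar>c\<bar>))"
    have t: "t > 0" using False e D0 by (simp add: t_def)
    have gt: "e \<le> (\<bar>D - 4 * c\<^sup>2 * t\<^sup>2\<bar> / (4 * \<bar>c\<bar>))\<^sup>2 / (2 * t\<^sup>2)"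
      using gap[of "Complex x t"] t unfolding qx' by simp
    show False
    proof (cases "D = 0")
      case True
      have t2: "c\<^sup>2 * t\<^sup>2 = e" using True False e(1) by (simp add: t_def power_divide)
      have "(\<bar>D - 4 * c\<^sup>2 * t\<^sup>2\<bar> / (4 * \<bar>c\<bar>))\<^sup>2 / (2 * t\<^sup>2) = (4 * (c\<^sup>2 * t\<^sup>2))\<^sup>2 / (32 * (c\<^sup>2 * t\<^sup>2))"
        using True by (simp add: power_divide power_mult_distrib)
      also have "\<dots> = e / 2" unfolding t2 using e(1) by (simp add: power2_eq_square)
      finally show False using gt e(1) by simp
    next
      case D1: False
      have "4 * c\<^sup>2 * t\<^sup>2 = D" using D1 False D0 by (simp add: t_def power_divide power_mult_distrib)
      then show False using gt e(1) by simp
    qed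
  qed
qed

end

section \<open>Invariance of hyperbolic area\<close>

definition v2c :: "real^2 \<Rightarrow> complex" where "v2c v = Complex (v$1) (v$2)"
definition c2v :: "complex \<Rightarrow> real^2" where "c2v z = (\<chi> i. if i = 1 then Re z else Im z)"

lemma c2v_nth [simp]: "c2v z $ 1 = Re z" "c2v z $ 2 = Im z"
  by (simp_all add: c2v_def)

lemma v2c_c2v [simp]: "v2c (c2v z) = z" "c2v (v2c v) = v"
  by (simp_all add: v2c_def complex_eq_iff Finite_Cartesian_Product.vec_eq_iff forall_2)

lemma v2c_sel [simp]: "Re (v2c v) = v$1" "Im (v2c v) = v$2"
  by (simp_all add: v2c_def)

lemma linear_v2c: "linear v2c" and linear_c2v: "linear c2v"
  by (auto intro!: linearI simp: v2c_def complex_eq_iff c2v_def Finite_Cartesian_Product.vec_eq_iff)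

lemma bl_v2c: "bounded_linear v2c" and bl_c2v: "bounded_linear c2v"
  using linear_v2c linear_c2v by (auto intro: linear_conv_bounded_linear[THEN iffD1])

lemma v2c_measurable [measurable]: "v2c \<in> borel_measurable borel"
  by (intro borel_measurable_continuous_onI linear_continuous_on bl_v2c)

lemma prod_Basis_complex: "(\<Prod>b\<in>Basis. (z::complex) \<bullet> b) = Re z * Im z"
  by (simp add: Basis_complex_def)

lemma prod_Basis_vec2: "(\<Prod>b\<in>Basis. (v::real^2) \<bullet> b) = v$1 * v$2"
proof -
  have b: "(Basis :: (real^2) set) = range (\<lambda>i. axis i 1)" by (auto simp: Basis_vec_def Basis_real_def)
  have "inj (\<lambda>i. axis i (1::real) :: real^2)" by (auto simp: inj_def axis_eq_axis)
  then have "(\<Prod>b\<in>Basis. v \<bullet> b) = (\<Prod>i\<in>UNIV. v \<bullet> axis i 1)"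
    unfolding b by (subst prod.reindex) (simp_all add: o_def)
  also have "\<dots> = v$1 * v$2" by (simp add: UNIV_2 inner_axis)
  finally show ?thesis .
qed

text \<open>Lebesgue measure is determined by its values on boxes. The change of variables formula
  is applied on \<open>real^2\<close>, to which area integrals are carried this way.\<close>

lemma lborel_complex_eq: "(lborel :: complex measure) = distr lborel borel v2c"
proof (rule lborel_eqI)
  fix l u :: complex assume le: "\<And>b. b \<in> Basis \<Longrightarrow> l \<bullet> b \<le> u \<bullet> b"
  have ri: "Re l \<le> Re u" "Im l \<le> Im u" using le[of 1] le[of \<i>] by (auto simp: Basis_complex_def)
  have "v2c -` box l u \<inter> space lborel = box (c2v l) (c2v u)"
    by (auto simp: box_def Basis_complex_def mem_box_cart forall_2 Basis_vec_def inner_axis)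
  then have "emeasure (distr lborel borel v2c) (box l u) = emeasure lborel (box (c2v l) (c2v u))"
    by (simp add: emeasure_distr)
  also have "\<dots> = (\<Prod>b\<in>Basis. (c2v u - c2v l) \<bullet> b)"
    by (rule emeasure_lborel_box) (use ri in \<open>auto simp: Basis_vec_def inner_axis forall_2 c2v_def\<close>)
  also have "(\<Prod>b\<in>Basis. (c2v u - c2v l) \<bullet> b) = (\<Prod>b\<in>Basis. (u - l) \<bullet> b)"
    unfolding prod_Basis_vec2 prod_Basis_complex by simp
  finally show "emeasure (distr lborel borel v2c) (box l u) = (\<Prod>b\<in>Basis. (u - l) \<bullet> b)" .
qed simp

lemma H_borel [measurable]: "\<H> \<in> sets borel"
  using open_H by simp

lemma hyp_density_measurable [measurable]: "(\<lambda>z. indicator \<H> z / (Im z)\<^sup>2 :: real) \<in> borel_measurable borel"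
  by measurable

lemma emeasure_hyp:
  assumes E: "E \<in> sets borel" "E \<subseteq> \<H>"
  shows "emeasure hyp_measure E = (\<integral>\<^sup>+ v. ennreal (indicator (v2c -` E) v * (1 / (v$2)\<^sup>2)) \<partial>lborel)"
proof -
  have "emeasure hyp_measure E = (\<integral>\<^sup>+ z. ennreal (indicator \<H> z / (Im z)\<^sup>2) * indicator E z \<partial>lborel)"
    unfolding hyp_measure_def using E by (subst emeasure_density) auto
  also have "\<dots> = (\<integral>\<^sup>+ z. ennreal (indicator E z * (1 / (Im z)\<^sup>2)) \<partial>lborel)"
    using E(2) by (intro nn_integral_cong) (auto simp: indicator_def)
  also have "\<dots> = (\<integral>\<^sup>+ v. ennreal (indicator E (v2c v) * (1 / (Im (v2c v))\<^sup>2)) \<partial>lborel)"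
    using E(1) unfolding lborel_complex_eq by (subst nn_integral_distr) auto
  also have "\<dots> = (\<integral>\<^sup>+ v. ennreal (indicator (v2c -` E) v * (1 / (v$2)\<^sup>2)) \<partial>lborel)"
    by (intro nn_integral_cong) (auto simp: indicator_def)
  finally show ?thesis .
qed

lemma moebius_deriv:
  assumes A: "det A = 1" and z: "Im z > 0"
  shows "(moebius A has_field_derivative 1 / (mden A z)\<^sup>2) (at z)"
proof -
  have d: "of_real (A$1$1) * of_real (A$2$2) - of_real (A$1$2) * of_real (A$2$1) = (1::complex)"
    using A unfolding det_2 by (metis of_real_1 of_real_diff of_real_mult)
  have m: "mden A z \<noteq> 0" by (rule mden_nonzero[OF A z])
  have "((\<lambda>z. (of_real (A$1$1) * z + of_real (A$1$2)) / (of_real (A$2$1) * z + of_real (A$2$2))) has_field_derivative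
      (of_real (A$1$1) * mden A z - (of_real (A$1$1) * z + of_real (A$1$2)) * of_real (A$2$1)) / (mden A z * mden A z)) (at z)"
    using m unfolding mden_def by (auto intro!: derivative_eq_intros)
  moreover have "of_real (A$1$1) * mden A z - (of_real (A$1$1) * z + of_real (A$1$2)) * of_real (A$2$1) = 1"
    unfolding d[symmetric] mden_def by (simp add: algebra_simps)
  ultimately show ?thesis unfolding moebius_def[abs_def] by (simp add: power2_eq_square)
qed

text \<open>The Jacobian of a holomorphic map is the squared modulus of its derivative.\<close>

lemma det_mult_complex: "det (matrix (\<lambda>h. c2v (w * v2c h))) = (cmod w)\<^sup>2"
proof -
  have "v2c (axis 1 1) = 1" "v2c (axis 2 1) = \<i>"
    by (simp_all add: complex_eq_iff axis_def)
  then show ?thesis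
    unfolding cmod_power2 by (simp add: det_2 matrix_def power2_eq_square axis_def)
qed

text \<open>Change of variables, with the Jacobian cancelling the change of the density. Finite
  measure lets the area be expressed by \<open>has_integral\<close> with a real value.\<close>

lemma hyp_measure_moebius:
  assumes A: "det A = 1" and E: "E \<in> sets borel" "E \<subseteq> \<H>" and fin: "emeasure hyp_measure E < \<infinity>"
    and AE: "moebius A ` E \<in> sets borel"
  shows "emeasure hyp_measure (moebius A ` E) = emeasure hyp_measure E"
proof -
  define S where "S = v2c -` E" define T where "T = v2c -` (moebius A ` E)"
  define B where "B = adj2 A"
  have B: "det B = 1" using adj2_mult(3)[OF A] by (simp add: B_def)
  define g where "g = (\<lambda>v. c2v (moebius A (v2c v)))"
  define h where "h = (\<lambda>v. c2v (moebius B (v2c v)))"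
  define f where "f v = 1 / (v$2)\<^sup>2" for v :: "real^2"
  define g' where "g' v = (\<lambda>x. c2v (1 / (mden A (v2c v))\<^sup>2 * v2c x))" for v
  define h' where "h' v = (\<lambda>x. c2v (1 / (mden B (v2c v))\<^sup>2 * v2c x))" for v
  have SH: "Im (v2c v) > 0" if "v \<in> S" for v using that E(2) by (auto simp: S_def upper_half_plane_def)
  have AEH: "moebius A ` E \<subseteq> \<H>" using moebius_in_H[OF A] E(2) by blast
  have TH: "Im (v2c v) > 0" if "v \<in> T" for v
  proof -
    have "v2c v \<in> \<H>" using that AEH by (auto simp: T_def)
    then show ?thesis by (simp only: upper_half_plane_def mem_Collect_eq)
  qed
  have der: "((\<lambda>v. c2v (moebius C (v2c v))) has_derivative (\<lambda>x. c2v (1 / (mden C (v2c v))\<^sup>2 * v2c x))) (at v within U)"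
    if C: "det C = 1" "Im (v2c v) > 0" for C v U
  proof -
    have 1: "(v2c has_derivative v2c) (at v within U)" by (rule bounded_linear_imp_has_derivative[OF bl_v2c])
    have 2: "(moebius C has_derivative (\<lambda>x. 1 / (mden C (v2c v))\<^sup>2 * x)) (at (v2c v) within v2c ` U)"
      using moebius_deriv[OF C] has_field_derivative_at_within unfolding has_field_derivative_def by blast
    have 3: "(c2v has_derivative c2v) (at (moebius C (v2c v)) within W)" for W
      by (rule bounded_linear_imp_has_derivative[OF bl_c2v])
    from has_derivative_in_compose[OF has_derivative_in_compose[OF 1 2] 3] show ?thesis .
  qed
  have cancel: "moebius B (moebius A z) = z" "moebius A (moebius B z) = z" if "Im z > 0" for z
    using moebius_adj2[OF A that] by (simp_all add: B_def)
  have hg: "g x \<in> T \<and> h (g x) = x" if x: "x \<in> S" for x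
    using x cancel[OF SH[OF x]] by (auto simp: g_def h_def T_def S_def)
  have gh: "h y \<in> S \<and> g (h y) = y" if y: "y \<in> T" for y
  proof -
    obtain z where z: "z \<in> E" "v2c y = moebius A z" using y by (auto simp: T_def)
    then have "moebius B (v2c y) = z" using cancel(1)[of z] E(2) by (auto simp: upper_half_plane_def)
    then show ?thesis using z by (simp add: h_def g_def S_def) (metis v2c_c2v(2))
  qed
  \<comment> \<open>Cocycle relation of the automorphy factors; it makes the derivatives of
    \<open>g\<close> and \<open>h\<close> inverse to each other.\<close>
  have mprod: "mden B z * mden A (moebius B z) = 1" if z: "Im z > 0" for z
  proof -
    have m: "mden B z \<noteq> 0" by (rule mden_nonzero[OF B z])
    have "mden A (moebius B z) * mden B z = of_real (A$2$1) * (of_real (B$1$1) * z + of_real (B$1$2)) + of_real (A$2$2) * mden B z"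
      using m by (simp add: mden_def[of A] moebius_alt distrib_right)
    also have "\<dots> = of_real (A$1$1 * A$2$2 - A$1$2 * A$2$1)"
      by (simp add: mden_def B_def adj2_def algebra_simps)
    also have "\<dots> = 1" using A by (simp add: det_2)
    finally show ?thesis by (simp add: mult.commute)
  qed
  have id: "h' y \<circ> g' (h y) = id" if y: "y \<in> T" for y
  proof -
    have "(mden B (v2c y))\<^sup>2 * (mden A (moebius B (v2c y)))\<^sup>2 = 1"
      using mprod[OF TH[OF y]] by (simp flip: power_mult_distrib)
    moreover have "1 / (mden B (v2c y))\<^sup>2 * (1 / (mden A (moebius B (v2c y)))\<^sup>2 * u)
        = u / ((mden B (v2c y))\<^sup>2 * (mden A (moebius B (v2c y)))\<^sup>2)" for u by simp
    ultimately have e: "1 / (mden B (v2c y))\<^sup>2 * (1 / (mden A (moebius B (v2c y)))\<^sup>2 * u) = u" for u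
      by (simp only: div_by_1)
    show ?thesis by (simp only: h'_def g'_def h_def fun_eq_iff o_def id_def v2c_c2v e) simp
  qed
  \<comment> \<open>The Jacobian is the modulus of the automorphy factor to the power -4, and
    \<open>f (g x)\<close> gains the same modulus to the power 4.\<close>
  have fS: "\<bar>det (matrix (g' x))\<bar> * f (g x) = f x" if x: "x \<in> S" for x
  proof -
    have m: "mden A (v2c x) \<noteq> 0" by (rule mden_nonzero[OF A SH[OF x]])
    have "\<bar>det (matrix (g' x))\<bar> = 1 / (cmod (mden A (v2c x)))\<^sup>2 ^ 2"
      unfolding g'_def det_mult_complex by (simp add: norm_divide norm_power power_divide)
    moreover have "g x $ 2 = x$2 / (cmod (mden A (v2c x)))\<^sup>2"
      using moebius_Im[OF A SH[OF x]] by (simp add: g_def)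
    ultimately show ?thesis using m by (simp add: f_def power_divide)
  qed
  obtain r where r: "emeasure hyp_measure E = ennreal r" "r \<ge> 0"
    using fin by (cases "emeasure hyp_measure E") auto
  have meas: "(\<lambda>v. indicator S v * f v) \<in> borel_measurable borel"
  proof -
    have "S \<in> sets borel" unfolding S_def using measurable_sets[OF v2c_measurable E(1)] by simp
    then show ?thesis unfolding f_def by measurable
  qed
  have "((\<lambda>v. indicator S v * f v) has_integral r) UNIV"
  proof (rule nn_integral_has_integral[OF meas])
    show "0 \<le> indicator S v * f v" for v by (simp add: f_def)
    show "(\<integral>\<^sup>+ v. ennreal (indicator S v * f v) \<partial>lborel) = ennreal r"
      using r(1) unfolding emeasure_hyp[OF E] by (simp add: S_def f_def)
  qed (rule r(2))
  then have "(f has_integral r) S"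
    by (subst has_integral_restrict_UNIV[symmetric]) (simp add: indicator_def of_bool_def if_distrib if_distribR cong: if_cong)
  then have "((\<lambda>x. \<bar>det (matrix (g' x))\<bar> * f (g x)) has_integral r) S"
    by (rule has_integral_eq[rotated]) (simp add: fS)
  moreover have "((\<lambda>x. \<bar>det (matrix (g' x))\<bar> * f (g x)) has_integral r) S \<longleftrightarrow> (f has_integral r) T"
  proof (rule cov_invertible_nonneg_eq[where h = h and h' = h'])
    show "(g has_derivative g' x) (at x within S)" if "x \<in> S" for x
      unfolding g_def g'_def by (rule der[OF A SH[OF that]])
    show "(h has_derivative h' y) (at y within T)" if "y \<in> T" for y
      unfolding h_def h'_def by (rule der[OF B TH[OF that]])
    show "0 \<le> f y" for y by (simp add: f_def)
  qed (fact hg gh id)+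
  ultimately have fT: "(f has_integral r) T" by blast
  have f0: "0 \<le> f v" for v by (simp add: f_def)
  from fT have "(\<integral>\<^sup>+ v. ennreal (indicator T v * f v) \<partial>lborel) = ennreal r"
    using f0 by (intro nn_integral_has_integral_lebesgue)
  then show ?thesis
    unfolding emeasure_hyp[OF AE AEH] r(1) by (simp add: T_def f_def)
qed

text \<open>An image under \<gamma> is a preimage under the continuous inverse action.\<close>

lemma psl_image_borel:
  assumes \<gamma>: "\<gamma> \<in> carrier PSL2R" and E: "E \<in> sets borel" "E \<subseteq> \<H>"
  shows "PSL_act \<gamma> ` E \<in> sets borel" "PSL_act \<gamma> ` E \<subseteq> \<H>"
proof -
  interpret P: group PSL2R by (rule PSL2R_group)
  have i: "inv\<^bsub>PSL2R\<^esub> \<gamma> \<in> carrier PSL2R" using \<gamma> by simp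
  show H: "PSL_act \<gamma> ` E \<subseteq> \<H>" using psl_act_closed[OF \<gamma>] E(2) by blast
  have "PSL_act \<gamma> ` E = PSL_act (inv\<^bsub>PSL2R\<^esub> \<gamma>) -` E \<inter> space (restrict_space borel \<H>)"
  proof (intro Set.set_eqI iffI)
    fix w assume "w \<in> PSL_act \<gamma> ` E"
    then show "w \<in> PSL_act (inv\<^bsub>PSL2R\<^esub> \<gamma>) -` E \<inter> space (restrict_space borel \<H>)"
      using psl_act_inv(1)[OF \<gamma>] E(2) H by (auto simp: space_restrict_space subset_iff)
  next
    fix w assume "w \<in> PSL_act (inv\<^bsub>PSL2R\<^esub> \<gamma>) -` E \<inter> space (restrict_space borel \<H>)"
    then have w: "PSL_act (inv\<^bsub>PSL2R\<^esub> \<gamma>) w \<in> E" "w \<in> \<H>" by (auto simp: space_restrict_space)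
    then show "w \<in> PSL_act \<gamma> ` E" using psl_act_inv(2)[OF \<gamma> w(2)] by (intro image_eqI[OF _ w(1)]) simp
  qed
  also have "\<dots> \<in> sets (restrict_space borel \<H>)"
    by (rule measurable_sets[OF borel_measurable_continuous_on_restrict[OF psl_act_continuous[OF i]] E(1)])
  finally show "PSL_act \<gamma> ` E \<in> sets borel" by (simp add: sets_restrict_space_iff)
qed

lemma hyp_measure_psl:
  assumes \<gamma>: "\<gamma> \<in> carrier PSL2R" and E: "E \<in> sets borel" "E \<subseteq> \<H>" and fin: "emeasure hyp_measure E < \<infinity>"
  shows "emeasure hyp_measure (PSL_act \<gamma> ` E) = emeasure hyp_measure E"
proof -
  obtain A where A: "det A = 1" "PSL_proj A = \<gamma>" using lift_exists[OF \<gamma>] by blast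
  have "PSL_act \<gamma> = moebius A" using A by (auto simp: fun_eq_iff PSL_act_proj)
  then show ?thesis using hyp_measure_moebius[OF A(1) E fin] psl_image_borel[OF \<gamma> E] by simp
qed

lemma sets_hyp_measure [simp]: "sets hyp_measure = sets borel"
  by (simp add: hyp_measure_def)

section \<open>Areas of fundamental domains\<close>

context surface_group
begin

text \<open>Cut \<open>E\<close> according to the group element moving a point into
  \<open>D\<close>; freeness makes the pieces disjoint, and their translates tile \<open>D\<close>.
  The comparison is needed because \<open>hyp_area\<close> evaluates an arbitrarily chosen
  domain.\<close>

lemma fundamental_domain_area_le:
  assumes \<Gamma>': "subgroup \<Gamma>' PSL2R" "\<Gamma>' \<subseteq> \<Gamma>" and D: "fundamental_domain \<Gamma>' D" "fundamental_domain \<Gamma>' E"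
    and fin: "emeasure hyp_measure E < \<infinity>"
  shows "emeasure hyp_measure D \<le> emeasure hyp_measure E"
proof -
  note inv' = subgroup.m_inv_closed[OF \<Gamma>'(1)] and mult' = subgroup.m_closed[OF \<Gamma>'(1)]
  have c: "\<gamma> \<in> carrier PSL2R" if "\<gamma> \<in> \<Gamma>'" for \<gamma> using that \<Gamma>' in_PSL by blast
  have Db: "D \<in> sets borel" "D \<subseteq> \<H>" and Eb: "E \<in> sets borel" "E \<subseteq> \<H>"
    and Du: "\<And>z. z \<in> \<H> \<Longrightarrow> \<exists>!w. w \<in> D \<and> w \<in> orbit_pt \<Gamma>' z" and Eu: "\<And>z. z \<in> \<H> \<Longrightarrow> \<exists>!w. w \<in> E \<and> w \<in> orbit_pt \<Gamma>' z"
    using D by (auto simp: fundamental_domain_def)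
  \<comment> \<open>The part of \<open>E\<close> that \<gamma> moves into \<open>D\<close>.\<close>
  define Y where "Y \<gamma> = PSL_act (inv\<^bsub>PSL2R\<^esub> \<gamma>) ` D \<inter> E" for \<gamma>
  have Yb: "Y \<gamma> \<in> sets borel" "Y \<gamma> \<subseteq> \<H>" if "\<gamma> \<in> \<Gamma>'" for \<gamma>
    using psl_image_borel[OF c[OF inv'[OF that]] Db] Eb by (auto simp: Y_def)
  have Yfin: "emeasure hyp_measure (Y \<gamma>) < \<infinity>" for \<gamma>
    using emeasure_mono[of "Y \<gamma>" E hyp_measure] Eb fin by (auto simp: Y_def intro: le_less_trans)
  have YD: "y \<in> \<H> \<and> y \<in> E \<and> PSL_act \<gamma> y \<in> D" if "\<gamma> \<in> \<Gamma>'" "y \<in> Y \<gamma>" for \<gamma> y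
    using that psl_act_inv(2)[OF c[OF that(1)]] Db(2) Eb(2) by (auto simp: Y_def)
  have disjY: "disjoint_family_on Y \<Gamma>'"
    unfolding disjoint_family_on_def
  proof (intro ballI impI, rule ccontr)
    fix \<gamma> \<delta> assume g: "\<gamma> \<in> \<Gamma>'" "\<delta> \<in> \<Gamma>'" "\<gamma> \<noteq> \<delta>" and "Y \<gamma> \<inter> Y \<delta> \<noteq> {}"
    then obtain y where y: "y \<in> Y \<gamma>" "y \<in> Y \<delta>" by blast
    have "PSL_act \<gamma> y \<in> D \<and> PSL_act \<gamma> y \<in> orbit_pt \<Gamma>' y" "PSL_act \<delta> y \<in> D \<and> PSL_act \<delta> y \<in> orbit_pt \<Gamma>' y"
      using YD[OF g(1) y(1)] YD[OF g(2) y(2)] g by (auto simp: orbit_pt_iff)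
    then have "PSL_act \<gamma> y = PSL_act \<delta> y" using Du YD[OF g(1) y(1)] by blast
    then show False using act_eq_imp_eq[of \<gamma> \<delta> y] g \<Gamma>'(2) YD[OF g(1) y(1)] by blast
  qed
  have disjI: "disjoint_family_on (\<lambda>\<gamma>. PSL_act \<gamma> ` Y \<gamma>) \<Gamma>'"
    unfolding disjoint_family_on_def
  proof (intro ballI impI, rule ccontr)
    fix \<gamma> \<delta> assume g: "\<gamma> \<in> \<Gamma>'" "\<delta> \<in> \<Gamma>'" "\<gamma> \<noteq> \<delta>" and "PSL_act \<gamma> ` Y \<gamma> \<inter> PSL_act \<delta> ` Y \<delta> \<noteq> {}"
    then obtain y y' where y: "y \<in> Y \<gamma>" "y' \<in> Y \<delta>" "PSL_act \<gamma> y = PSL_act \<delta> y'" by blast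
    define x where "x = PSL_act \<gamma> y"
    have yy: "y \<in> \<H>" "y \<in> E" "y' \<in> \<H>" "y' \<in> E" using YD g y by blast+
    have x: "x \<in> \<H>" using psl_act_closed[OF c[OF g(1)] yy(1)] by (simp add: x_def)
    have "y = PSL_act (inv\<^bsub>PSL2R\<^esub> \<gamma>) x" "y' = PSL_act (inv\<^bsub>PSL2R\<^esub> \<delta>) x"
      using psl_act_inv(1)[OF c[OF g(1)] yy(1)] psl_act_inv(1)[OF c[OF g(2)] yy(3)] y(3) by (simp_all add: x_def)
    then have "y \<in> orbit_pt \<Gamma>' x" "y' \<in> orbit_pt \<Gamma>' x" using inv' g by (auto simp: orbit_pt_iff)
    then have "y = y'" using Eu[OF x] yy by blast
    then show False using act_eq_imp_eq[of \<gamma> \<delta> y] y(3) g \<Gamma>'(2) yy by blast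
  qed
  have D_eq: "D = (\<Union>\<gamma>\<in>\<Gamma>'. PSL_act \<gamma> ` Y \<gamma>)"
  proof
    show "D \<subseteq> (\<Union>\<gamma>\<in>\<Gamma>'. PSL_act \<gamma> ` Y \<gamma>)"
    proof
      fix x assume x: "x \<in> D"
      then have xH: "x \<in> \<H>" using Db by blast
      then obtain y where y: "y \<in> E" "y \<in> orbit_pt \<Gamma>' x" using Eu by blast
      then obtain \<delta> where \<delta>: "\<delta> \<in> \<Gamma>'" "y = PSL_act \<delta> x" by (auto simp: orbit_pt_iff)
      have P: "inv\<^bsub>PSL2R\<^esub> (inv\<^bsub>PSL2R\<^esub> \<delta>) = \<delta>" using c[OF \<delta>(1)] group.inv_inv[OF PSL2R_group] by blast
      have "y \<in> Y (inv\<^bsub>PSL2R\<^esub> \<delta>)" using y \<delta> x P by (auto simp: Y_def)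
      moreover have "x = PSL_act (inv\<^bsub>PSL2R\<^esub> \<delta>) y" using psl_act_inv(1)[OF c[OF \<delta>(1)] xH] \<delta>(2) by simp
      ultimately show "x \<in> (\<Union>\<gamma>\<in>\<Gamma>'. PSL_act \<gamma> ` Y \<gamma>)" using inv'[OF \<delta>(1)] by blast
    qed
    show "(\<Union>\<gamma>\<in>\<Gamma>'. PSL_act \<gamma> ` Y \<gamma>) \<subseteq> D" using YD by blast
  qed
  have cnt: "countable \<Gamma>'" using countable_subset[OF \<Gamma>'(2) countable] .
  have "emeasure hyp_measure D = (\<integral>\<^sup>+ \<gamma>. emeasure hyp_measure (PSL_act \<gamma> ` Y \<gamma>) \<partial>count_space \<Gamma>')"
    unfolding D_eq by (rule emeasure_UN_countable[OF _ cnt disjI]) (use psl_image_borel c Yb in auto)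
  also have "\<dots> = (\<integral>\<^sup>+ \<gamma>. emeasure hyp_measure (Y \<gamma>) \<partial>count_space \<Gamma>')"
    by (intro nn_integral_cong hyp_measure_psl) (use c Yb Yfin in auto)
  also have "\<dots> = emeasure hyp_measure (\<Union>\<gamma>\<in>\<Gamma>'. Y \<gamma>)"
    by (rule emeasure_UN_countable[OF _ cnt disjY, symmetric]) (use Yb in auto)
  also have "\<dots> \<le> emeasure hyp_measure E"
    by (rule emeasure_mono) (use Eb in \<open>auto simp: Y_def\<close>)
  finally show ?thesis .
qed

text \<open>Translating \<open>D\<close> by coset representatives gives a fundamental domain of the
  subgroup; as an inequality is enough, \<open>R\<close> may list a coset several times.\<close>

lemma hyp_area_le:
  assumes D: "fundamental_domain \<Gamma> D" "emeasure hyp_measure D < \<infinity>"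
    and \<Gamma>': "subgroup \<Gamma>' PSL2R" "\<Gamma>' \<subseteq> \<Gamma>"
    and R: "finite R" "R \<subseteq> \<Gamma>" "\<Gamma> \<subseteq> (\<Union>\<rho>\<in>R. \<Gamma>' #>\<^bsub>PSL2R\<^esub> \<rho>)"
  shows "hyp_area \<Gamma>' \<le> real (card R) * measure hyp_measure D"
proof -
  interpret P: group PSL2R by (rule PSL2R_group)
  have c: "\<gamma> \<in> carrier PSL2R" if "\<gamma> \<in> \<Gamma>" for \<gamma> using that in_PSL by blast
  have c': "\<Gamma>' \<subseteq> carrier PSL2R" using \<Gamma>' c by blast
  have Db: "D \<in> sets borel" "D \<subseteq> \<H>" and Du: "\<And>z. z \<in> \<H> \<Longrightarrow> \<exists>!w. w \<in> D \<and> w \<in> orbit_pt \<Gamma> z"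
    using D by (auto simp: fundamental_domain_def)
  \<comment> \<open>Depends on the coset alone, so repetitions in \<open>R\<close> yield the same
    translate and orbit points in \<open>D'\<close> stay unique.\<close>
  define rep where "rep \<rho> = (SOME x. x \<in> \<Gamma>' #>\<^bsub>PSL2R\<^esub> \<rho>)" for \<rho>
  have rep: "rep \<rho> \<in> \<Gamma>' #>\<^bsub>PSL2R\<^esub> \<rho>" if "\<rho> \<in> \<Gamma>" for \<rho>
    unfolding rep_def by (rule someI[of _ \<rho>]) (rule P.rcos_self[OF c[OF that] \<Gamma>'(1)])
  have rep\<Gamma>: "rep \<rho> \<in> \<Gamma>" if "\<rho> \<in> \<Gamma>" for \<rho>
    using rep[OF that] that \<Gamma>'(2) mult_in by (auto simp: r_coset_def)
  have coset_rep: "\<Gamma>' #>\<^bsub>PSL2R\<^esub> rep \<rho> = \<Gamma>' #>\<^bsub>PSL2R\<^esub> \<rho>" if "\<rho> \<in> \<Gamma>" for \<rho>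
    using P.repr_independence[OF rep[OF that] c[OF that] \<Gamma>'(1)] by simp
  define D' where "D' = (\<Union>\<rho>\<in>rep ` R. PSL_act \<rho> ` D)"
  have repR: "rep ` R \<subseteq> \<Gamma>" using R rep\<Gamma> by blast
  have fd: "fundamental_domain \<Gamma>' D'"
    unfolding fundamental_domain_def
  proof (intro conjI ballI)
    show "D' \<in> sets borel" unfolding D'_def
      using R repR psl_image_borel[OF c _ _] Db by (intro sets.finite_UN) auto
    show "D' \<subseteq> \<H>" unfolding D'_def using repR psl_act_closed[OF c] Db by blast
    fix z assume z: "z \<in> \<H>"
    obtain w where w: "w \<in> D" "w \<in> orbit_pt \<Gamma> z" using Du[OF z] by blast
    have wH: "w \<in> \<H>" using w Db by blast
    obtain \<gamma> where \<gamma>: "\<gamma> \<in> \<Gamma>" "w = PSL_act \<gamma> z" using w by (auto simp: orbit_pt_iff)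
    have zw: "z = PSL_act (inv\<^bsub>PSL2R\<^esub> \<gamma>) w" using psl_act_inv(1)[OF c[OF \<gamma>(1)] z] \<gamma> by simp
    obtain \<rho> where \<rho>: "\<rho> \<in> R" "inv\<^bsub>PSL2R\<^esub> \<gamma> \<in> \<Gamma>' #>\<^bsub>PSL2R\<^esub> \<rho>" using R(3) inv_in[OF \<gamma>(1)] by blast
    then have \<rho>\<Gamma>: "\<rho> \<in> \<Gamma>" using R by blast
    have "inv\<^bsub>PSL2R\<^esub> \<gamma> \<in> \<Gamma>' #>\<^bsub>PSL2R\<^esub> rep \<rho>" using \<rho> coset_rep[OF \<rho>\<Gamma>] by simp
    then obtain g where g: "g \<in> \<Gamma>'" "inv\<^bsub>PSL2R\<^esub> \<gamma> = g \<otimes>\<^bsub>PSL2R\<^esub> rep \<rho>" by (auto simp: r_coset_def)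
    have gc: "g \<in> carrier PSL2R" using g c' by blast
    define w' where "w' = PSL_act (rep \<rho>) w"
    have w'H: "w' \<in> \<H>" unfolding w'_def by (rule psl_act_closed[OF c[OF rep\<Gamma>[OF \<rho>\<Gamma>]] wH])
    have "z = PSL_act g w'" unfolding zw g(2) w'_def by (rule psl_act_mult[OF c[OF rep\<Gamma>[OF \<rho>\<Gamma>]] wH gc])
    then have w'z: "w' = PSL_act (inv\<^bsub>PSL2R\<^esub> g) z" using psl_act_inv(1)[OF gc w'H] by simp
    have ex: "w' \<in> D' \<and> w' \<in> orbit_pt \<Gamma>' z"
    proof
      show "w' \<in> D'" unfolding D'_def w'_def using w(1) \<rho>(1) by blast
      show "w' \<in> orbit_pt \<Gamma>' z"
        unfolding orbit_pt_iff using subgroup.m_inv_closed[OF \<Gamma>'(1) g(1)] w'z by blast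
    qed
    show "\<exists>!w. w \<in> D' \<and> w \<in> orbit_pt \<Gamma>' z"
    proof (rule ex1I[where P = "\<lambda>w. w \<in> D' \<and> w \<in> orbit_pt \<Gamma>' z", OF ex])
      fix u assume u: "u \<in> D' \<and> u \<in> orbit_pt \<Gamma>' z"
      then obtain \<mu> v where \<mu>: "\<mu> \<in> R" "v \<in> D" "u = PSL_act (rep \<mu>) v" by (auto simp: D'_def)
      have \<mu>\<Gamma>: "\<mu> \<in> \<Gamma>" using \<mu> R by blast
      have vH: "v \<in> \<H>" using \<mu> Db by blast
      obtain h where h: "h \<in> \<Gamma>'" "u = PSL_act h z" using u by (auto simp: orbit_pt_iff)
      have hc: "h \<in> carrier PSL2R" "h \<in> \<Gamma>" using h c' \<Gamma>' by blast+
      have hg: "h \<otimes>\<^bsub>PSL2R\<^esub> g \<in> \<Gamma>'" using subgroup.m_closed[OF \<Gamma>'(1) h(1) g(1)] .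
      have u1: "u = PSL_act (h \<otimes>\<^bsub>PSL2R\<^esub> g) w'"
        using psl_act_mult[OF gc w'H hc(1)] h(2) \<open>z = PSL_act g w'\<close> by simp
      have "v = PSL_act (inv\<^bsub>PSL2R\<^esub> (rep \<mu>)) u"
        using psl_act_inv(1)[OF c[OF rep\<Gamma>[OF \<mu>\<Gamma>]] vH] \<mu>(3) by simp
      also have "\<dots> = PSL_act (inv\<^bsub>PSL2R\<^esub> (rep \<mu>) \<otimes>\<^bsub>PSL2R\<^esub> h) z"
        unfolding h(2) by (rule psl_act_mult[OF hc(1) z, symmetric]) (use c[OF rep\<Gamma>[OF \<mu>\<Gamma>]] in simp)
      finally have "v \<in> orbit_pt \<Gamma> z"
        unfolding orbit_pt_iff using mult_in[OF inv_in[OF rep\<Gamma>[OF \<mu>\<Gamma>]] hc(2)] by blast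
      then have vw: "v = w" using Du[OF z] w \<mu>(2) by blast
      have "PSL_act (rep \<mu>) w = PSL_act (h \<otimes>\<^bsub>PSL2R\<^esub> g \<otimes>\<^bsub>PSL2R\<^esub> rep \<rho>) w"
        using u1 \<mu>(3) vw psl_act_mult[OF c[OF rep\<Gamma>[OF \<rho>\<Gamma>]] wH, of "h \<otimes>\<^bsub>PSL2R\<^esub> g"] hg c'
        by (auto simp: w'_def)
      then have eq: "rep \<mu> = h \<otimes>\<^bsub>PSL2R\<^esub> g \<otimes>\<^bsub>PSL2R\<^esub> rep \<rho>"
        using act_eq_imp_eq[OF rep\<Gamma>[OF \<mu>\<Gamma>] _ wH] hg \<Gamma>'(2) mult_in rep\<Gamma>[OF \<rho>\<Gamma>] by blast
      have "rep \<mu> \<in> \<Gamma>' #>\<^bsub>PSL2R\<^esub> rep \<rho>" unfolding eq r_coset_def using hg by blast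
      then have "\<Gamma>' #>\<^bsub>PSL2R\<^esub> rep \<mu> = \<Gamma>' #>\<^bsub>PSL2R\<^esub> rep \<rho>"
        using P.repr_independence[OF _ c[OF rep\<Gamma>[OF \<rho>\<Gamma>]] \<Gamma>'(1)] by blast
      then have "\<Gamma>' #>\<^bsub>PSL2R\<^esub> \<mu> = \<Gamma>' #>\<^bsub>PSL2R\<^esub> \<rho>" using coset_rep \<mu>\<Gamma> \<rho>\<Gamma> by simp
      then have "rep \<mu> = rep \<rho>" by (simp add: rep_def)
      then show "u = w'" using \<mu>(3) vw by (simp add: w'_def)
    qed
  qed
  have "emeasure hyp_measure D' \<le> (\<Sum>\<rho>\<in>rep ` R. emeasure hyp_measure (PSL_act \<rho> ` D))"
    unfolding D'_def by (rule emeasure_subadditive_finite)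
      (use R repR psl_image_borel[OF c _ _] Db in auto)
  also have "\<dots> = (\<Sum>\<rho>\<in>rep ` R. emeasure hyp_measure D)"
    using repR c hyp_measure_psl[OF _ Db D(2)] by (intro sum.cong) auto
  also have "\<dots> = of_nat (card (rep ` R)) * emeasure hyp_measure D" by simp
  also have "\<dots> \<le> of_nat (card R) * emeasure hyp_measure D"
    using card_image_le[OF R(1), of rep] by (intro mult_right_mono) auto
  finally have D'm: "emeasure hyp_measure D' \<le> of_nat (card R) * emeasure hyp_measure D" .
  then have D'fin: "emeasure hyp_measure D' < \<infinity>"
    by (rule le_less_trans) (use D(2) in \<open>simp add: ennreal_mult_less_top of_nat_less_top\<close>)
  \<comment> \<open>The domain that \<open>hyp_area\<close> evaluates, compared with the explicit
    \<open>D'\<close>.\<close>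
  define X where "X = (SOME D. fundamental_domain \<Gamma>' D)"
  have "fundamental_domain \<Gamma>' X" unfolding X_def by (rule someI[of _ D']) (rule fd)
  then have "emeasure hyp_measure X \<le> of_nat (card R) * emeasure hyp_measure D"
    using fundamental_domain_area_le[OF \<Gamma>' _ fd D'fin] D'm order_trans by blast
  also have "emeasure hyp_measure D = ennreal (measure hyp_measure D)"
    using D(2) by (intro emeasure_eq_ennreal_measure) auto
  finally have "emeasure hyp_measure X \<le> ennreal (real (card R) * measure hyp_measure D)"
    by (simp add: ennreal_mult ennreal_of_nat_eq_real_of_nat)
  then have "measure hyp_measure X \<le> real (card R) * measure hyp_measure D"
    unfolding measure_def by (intro enn2real_leI) auto
  then show ?thesis by (simp add: hyp_area_def X_def)
qed

end

section \<open>Quaternion algebras and trace bounds\<close>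

lemma quat_alg_simps [simp]:
  "carrier (quat_alg K a b) = K \<times> K \<times> K \<times> K" "x \<otimes>\<^bsub>quat_alg K a b\<^esub> y = quat_mult a b x y"
  "\<one>\<^bsub>quat_alg K a b\<^esub> = (1, 0, 0, 0)" "\<zero>\<^bsub>quat_alg K a b\<^esub> = 0" "x \<oplus>\<^bsub>quat_alg K a b\<^esub> y = x + y"
  by (simp_all add: quat_alg_def)

lemma M2R_simps [simp]:
  "carrier M2R = UNIV" "x \<otimes>\<^bsub>M2R\<^esub> y = x ** y" "\<one>\<^bsub>M2R\<^esub> = mat 1" "x \<oplus>\<^bsub>M2R\<^esub> y = x + y"
  by (simp_all add: M2R_def)

lemma trace_scaleR: "trace (c *\<^sub>R A :: real^2^2) = c * trace A"
  by (simp add: trace_2 algebra_simps)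

lemma trace_add2: "trace (A + B :: real^2^2) = trace A + trace B"
  by (simp add: trace_2)

lemma scaleR_mat_mult: "(c *\<^sub>R (A :: real^2^2)) ** (B :: real^2^2) = c *\<^sub>R (A ** B)"
  "(A :: real^2^2) ** (c *\<^sub>R (B :: real^2^2)) = c *\<^sub>R (A ** B)"
  by (auto simp: mat2_eq_iff mat2_mult algebra_simps)

text \<open>With its counterpart for the reduced norm, this expresses determinant and reduced norm
  by the same formula in traces, so that \<open>det_xi\<close> follows from
  \<open>trace_xi\<close>.\<close>

lemma det2_via_trace: "det (A :: real^2^2) = ((trace A)\<^sup>2 - trace (A ** A)) / 2"
  by (simp add: det_2 trace_2 mat2_mult power2_eq_square algebra_simps)

lemma red_norm_via_trace: "red_norm a b q = ((red_trace q)\<^sup>2 - red_trace (quat_mult a b q q)) / 2"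
  by (cases q) (simp add: power2_eq_square algebra_simps)

locale quat_rep =
  fixes K :: "real set" and a b :: real and \<xi> :: "quat \<Rightarrow> real^2^2"
  assumes F: "fieldset K" and par: "quat_params K a b" and hom: "\<xi> \<in> alg_homs K a b (\<lambda>x. x)"
begin

lemma ab: "a \<in> K" "b \<in> K" "a \<noteq> 0" "b \<noteq> 0"
  using par by (auto simp: quat_params_def)

abbreviation "B \<equiv> K \<times> K \<times> K \<times> K"

lemma K0: "0 \<in> K" and K1: "1 \<in> K" using fieldset_0[OF F] fieldset_1[OF F] by auto

lemmas Kcl = fieldset_add[OF F] fieldset_diff[OF F] fieldset_mult[OF F] fieldset_uminus[OF F] K0 K1

lemma xi_mult: "x \<in> B \<Longrightarrow> y \<in> B \<Longrightarrow> \<xi> (quat_mult a b x y) = \<xi> x ** \<xi> y"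
  and xi_add: "x \<in> B \<Longrightarrow> y \<in> B \<Longrightarrow> \<xi> (x + y) = \<xi> x + \<xi> y"
  and xi_one: "\<xi> (1, 0, 0, 0) = mat 1"
  and xi_scale: "c \<in> K \<Longrightarrow> x \<in> B \<Longrightarrow> \<xi> (c *\<^sub>R x) = c *\<^sub>R \<xi> x"
  using hom by (auto simp: alg_homs_def Ring.ring_hom_def)

lemma mult_B: "x \<in> B \<Longrightarrow> y \<in> B \<Longrightarrow> quat_mult a b x y \<in> B"
  using ab by (auto intro!: Kcl)

text \<open>Each of \<open>i\<close>, \<open>j\<close>, \<open>ij\<close> anticommutes with a basis
  element \<open>x\<close> whose square is a nonzero scalar \<open>c\<close>. Then
  \<open>tr (x y x)\<close> equals both \<open>c tr y\<close> and \<open>- c tr y\<close>, so pure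
  quaternions have trace zero.\<close>

lemma trace_xi:
  assumes "q \<in> B" shows "trace (\<xi> q) = red_trace q"
proof -
  let ?i = "(0, 1, 0, 0) :: quat" and ?j = "(0, 0, 1, 0) :: quat" and ?k = "(0, 0, 0, 1) :: quat"
  have B: "?i \<in> B" "?j \<in> B" "?k \<in> B" "(1, 0, 0, 0) \<in> B" using K0 K1 by auto
  have 0: "trace (\<xi> y) = 0"
    if y: "y \<in> B" and x: "x \<in> B" and c: "c \<in> K" "c \<noteq> 0"
      and sq: "quat_mult a b x x = c *\<^sub>R (1, 0, 0, 0)" and anti: "quat_mult a b (quat_mult a b x y) x = (- c) *\<^sub>R y" for x y c
  proof -
    have "\<xi> x ** \<xi> x = c *\<^sub>R mat 1" using xi_mult[OF x x] sq xi_scale[OF c(1) B(4)] xi_one by simp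
    have "trace (\<xi> x ** \<xi> y ** \<xi> x) = trace (\<xi> x ** (\<xi> x ** \<xi> y))" by (rule trace_mul_sym)
    also have "\<xi> x ** (\<xi> x ** \<xi> y) = c *\<^sub>R \<xi> y"
      using \<open>\<xi> x ** \<xi> x = c *\<^sub>R mat 1\<close> by (simp add: matrix_mul_assoc scaleR_mat_mult)
    also have "\<xi> x ** \<xi> y ** \<xi> x = (- c) *\<^sub>R \<xi> y"
      using xi_mult[OF mult_B[OF x y] x] xi_mult[OF x y] xi_scale[OF fieldset_uminus[OF F c(1)] y] anti by simp
    finally have "- c * trace (\<xi> y) = c * trace (\<xi> y)" by (simp only: trace_scaleR)
    then show ?thesis using c(2) by simp
  qed
  have t: "trace (\<xi> ?i) = 0" "trace (\<xi> ?j) = 0" "trace (\<xi> ?k) = 0"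
    using 0[of ?i ?j b] 0[of ?j ?i a] 0[of ?k ?i a] B ab by simp_all
  obtain x0 x1 x2 x3 where q: "q = (x0, x1, x2, x3)" by (cases q)
  have x: "x0 \<in> K" "x1 \<in> K" "x2 \<in> K" "x3 \<in> K" using assms by (auto simp: q)
  have qs: "q = x0 *\<^sub>R (1, 0, 0, 0) + (x1 *\<^sub>R ?i + (x2 *\<^sub>R ?j + x3 *\<^sub>R ?k))" by (simp add: q)
  have "\<xi> (x0 *\<^sub>R (1, 0, 0, 0) + (x1 *\<^sub>R ?i + (x2 *\<^sub>R ?j + x3 *\<^sub>R ?k))) = x0 *\<^sub>R \<xi> (1, 0, 0, 0) + (x1 *\<^sub>R \<xi> ?i + (x2 *\<^sub>R \<xi> ?j + x3 *\<^sub>R \<xi> ?k))"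
  proof -
    have sB: "c *\<^sub>R y \<in> B" if "c \<in> K" "y \<in> B" for c y using that by (auto intro!: Kcl)
    have aB: "y + z \<in> B" if "y \<in> B" "z \<in> B" for y z using that by (auto intro!: Kcl)
    show ?thesis
      by (simp only: xi_add[OF sB[OF x(1) B(4)] aB[OF sB[OF x(2) B(1)] aB[OF sB[OF x(3) B(2)] sB[OF x(4) B(3)]]]]
          xi_add[OF sB[OF x(2) B(1)] aB[OF sB[OF x(3) B(2)] sB[OF x(4) B(3)]]]
          xi_add[OF sB[OF x(3) B(2)] sB[OF x(4) B(3)]]
          xi_scale[OF x(1) B(4)] xi_scale[OF x(2) B(1)] xi_scale[OF x(3) B(2)] xi_scale[OF x(4) B(3)])
  qed
  then have "trace (\<xi> q) = trace (x0 *\<^sub>R \<xi> (1, 0, 0, 0) + (x1 *\<^sub>R \<xi> ?i + (x2 *\<^sub>R \<xi> ?j + x3 *\<^sub>R \<xi> ?k)))"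
    unfolding qs by (rule arg_cong)
  moreover have "trace (mat 1 :: real^2^2) = 2" by (simp add: trace_2 mat2_one)
  ultimately show ?thesis by (simp only: trace_add2 trace_scaleR t xi_one) (simp add: q)
qed

lemma det_xi:
  assumes "q \<in> B" shows "det (\<xi> q) = red_norm a b q"
  unfolding det2_via_trace red_norm_via_trace
  using trace_xi[OF assms] trace_xi[OF mult_B[OF assms assms]] xi_mult[OF assms assms] by simp

lemma red_in_K: "q \<in> B \<Longrightarrow> red_trace q \<in> K" "q \<in> B \<Longrightarrow> red_norm a b q \<in> K"
proof -
  assume q: "q \<in> B"
  obtain x0 x1 x2 x3 where q': "q = (x0, x1, x2, x3)" by (cases q)
  have x: "x0 \<in> K" "x1 \<in> K" "x2 \<in> K" "x3 \<in> K" using q by (auto simp: q')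
  have rt: "red_trace q = x0 + x0" by (simp add: q')
  show "red_trace q \<in> K" unfolding rt by (intro Kcl x)
  show "red_norm a b q \<in> K" using x ab unfolding q' red_norm.simps power2_eq_square by (intro Kcl) auto
qed

end

section \<open>Integrality of traces and norms in an order\<close>

lemma ring_of_integers_closed:
  assumes F: "fieldset K"
  shows "1 \<in> ring_of_integers K" "0 \<in> ring_of_integers K"
    "\<And>x y. x \<in> ring_of_integers K \<Longrightarrow> y \<in> ring_of_integers K \<Longrightarrow> x + y \<in> ring_of_integers K"
    "\<And>x y. x \<in> ring_of_integers K \<Longrightarrow> y \<in> ring_of_integers K \<Longrightarrow> x - y \<in> ring_of_integers K"
    "\<And>x y. x \<in> ring_of_integers K \<Longrightarrow> y \<in> ring_of_integers K \<Longrightarrow> x * y \<in> ring_of_integers K"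
    "\<And>n. of_nat n \<in> ring_of_integers K"
proof -
  show 1: "1 \<in> ring_of_integers K" and 0: "0 \<in> ring_of_integers K"
    using fieldset_1[OF F] fieldset_0[OF F] by (auto simp: ring_of_integers_def)
  show p: "x + y \<in> ring_of_integers K" "x - y \<in> ring_of_integers K" "x * y \<in> ring_of_integers K"
    if "x \<in> ring_of_integers K" "y \<in> ring_of_integers K" for x y
    using that fieldset_add[OF F] fieldset_diff[OF F] fieldset_mult[OF F]
    by (auto simp: ring_of_integers_def algebraic_int_add algebraic_int_mult algebraic_int_diff)
  show "of_nat n \<in> ring_of_integers K" for n by (induction n) (auto intro: 0 1 p)
qed

lemma complex_eigenvector2:
  fixes x11 x12 x21 x22 l :: complex
  assumes "(l - x11) * (l - x22) = x12 * x21"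
  obtains w1 w2 where "w1 \<noteq> 0 \<or> w2 \<noteq> 0" "x11 * w1 + x12 * w2 = l * w1" "x21 * w1 + x22 * w2 = l * w2"
proof -
  consider "x12 \<noteq> 0" | "x21 \<noteq> 0" | "x12 = 0" "x21 = 0" by blast
  then show ?thesis
  proof cases
    case 1
    show ?thesis by (rule that[of x12 "l - x11"]) (use 1 assms in \<open>simp_all add: algebra_simps\<close>)
  next
    case 2
    show ?thesis by (rule that[of "l - x22" x21]) (use 2 assms in \<open>simp_all add: algebra_simps\<close>)
  next
    case 3
    then consider "l = x11" | "l = x22" using assms by auto
    then show ?thesis
    proof cases
      case 1
      show ?thesis by (rule that[of 1 0]) (use 1 3 in simp_all)
    next
      case 2
      show ?thesis by (rule that[of 0 1]) (use 2 3 in simp_all)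
    qed
  qed
qed

locale quat_order = quat_rep +
  fixes \<OO> :: "quat set"
  assumes ord: "is_order K a b \<OO>"
begin

abbreviation "O\<^sub>K \<equiv> ring_of_integers K"

lemma OB: "\<OO> \<subseteq> B" and O_mult: "x \<in> \<OO> \<Longrightarrow> y \<in> \<OO> \<Longrightarrow> quat_mult a b x y \<in> \<OO>"
  and O_add: "x \<in> \<OO> \<Longrightarrow> y \<in> \<OO> \<Longrightarrow> x + y \<in> \<OO>" and O_one: "(1, 0, 0, 0) \<in> \<OO>"
proof -
  have s: "subring \<OO> (quat_alg K a b)" using ord by (simp add: is_order_def)
  show "\<OO> \<subseteq> B" using subringE(1)[OF s] by simp
  show "x \<in> \<OO> \<Longrightarrow> y \<in> \<OO> \<Longrightarrow> quat_mult a b x y \<in> \<OO>" using subringE(6)[OF s, of x y] by simp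
  show "x \<in> \<OO> \<Longrightarrow> y \<in> \<OO> \<Longrightarrow> x + y \<in> \<OO>" using subringE(7)[OF s, of x y] by simp
  show "(1, 0, 0, 0) \<in> \<OO>" using subringE(3)[OF s] by simp
qed

lemma O_scale:
  assumes c: "c \<in> O\<^sub>K" and x: "x \<in> \<OO>" shows "c *\<^sub>R x \<in> \<OO>"
proof -
  obtain S where S: "\<OO> = lin_combs O\<^sub>K S" using ord by (auto simp: is_order_def)
  then obtain n :: nat and d v where x': "x = (\<Sum>j<n. d j *\<^sub>R v j)" "\<forall>j<n. d j \<in> O\<^sub>K \<and> v j \<in> S"
    using x unfolding lin_combs_def by blast
  have "c *\<^sub>R x = (\<Sum>j<n. (c * d j) *\<^sub>R v j)" by (simp add: x'(1) scaleR_right.sum)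
  moreover have "\<forall>j<n. c * d j \<in> O\<^sub>K \<and> v j \<in> S" using x'(2) ring_of_integers_closed(5)[OF F c] by auto
  ultimately show ?thesis unfolding S lin_combs_def
    by (intro CollectI exI[of _ n] exI[of _ "\<lambda>j. c * d j"] exI[of _ v]) simp
qed

lemma O_uminus: "x \<in> \<OO> \<Longrightarrow> - x \<in> \<OO>"
proof -
  have "-1 \<in> O\<^sub>K" using ring_of_integers_closed(4)[OF F ring_of_integers_closed(2)[OF F] ring_of_integers_closed(1)[OF F]] by simp
  then show "x \<in> \<OO> \<Longrightarrow> - x \<in> \<OO>" using O_scale[of "-1" x] by simp
qed

lemma O_diff: "x \<in> \<OO> \<Longrightarrow> y \<in> \<OO> \<Longrightarrow> x - y \<in> \<OO>"
  using O_add[of x "-y"] O_uminus by simp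

lemma O_sum: "(\<And>i. i \<in> I \<Longrightarrow> f i \<in> \<OO>) \<Longrightarrow> sum f I \<in> \<OO>"
proof (induction I rule: infinite_finite_induct)
  case empty
  show ?case using O_diff[OF O_one O_one] by simp
qed (use O_diff[OF O_one O_one] O_add in auto)

text \<open>Right multiplication by \<open>E\<close> acts on a finite generating set of the order by
  a matrix over the ring of integers. Applying the matrices of the generators to an eigenvector of
  \<open>\<xi> E\<close> and taking one coordinate gives an eigenvector of that matrix.\<close>

lemma eigenvalue_integral:
  fixes l :: complex
  assumes E: "E \<in> \<OO>" and l: "(l - of_real (\<xi> E $1$1)) * (l - of_real (\<xi> E $2$2)) = of_real (\<xi> E $1$2) * of_real (\<xi> E $2$1)"
  shows "algebraic_int l"
proof -
  obtain S where S: "finite S" "\<OO> = lin_combs O\<^sub>K S" using ord by (auto simp: is_order_def)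
  have base: "s \<in> \<OO>" if "s \<in> S" for s
    unfolding S(2) lin_combs_def
    by (intro CollectI exI[of _ "1::nat"] exI[of _ "\<lambda>_. 1"] exI[of _ "\<lambda>_. s"])
      (use that ring_of_integers_closed(1)[OF F] in auto)
  have coef: "\<exists>N. (\<forall>s\<in>S. N s \<in> O\<^sub>K) \<and> x = (\<Sum>s\<in>S. N s *\<^sub>R s)" if x: "x \<in> \<OO>" for x
  proof -
    obtain n :: nat and d v where x': "x = (\<Sum>j<n. d j *\<^sub>R v j)" "\<forall>j<n. d j \<in> O\<^sub>K \<and> v j \<in> S"
      using x unfolding S(2) lin_combs_def by blast
    \<comment> \<open>\<open>lin_combs\<close> allows repeated generators; their coefficients are
      collected here.\<close>
    define N where "N s = (\<Sum>j | j < n \<and> v j = s. d j)" for s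
    have osum: "sum f I \<in> O\<^sub>K" if "\<And>i. i \<in> I \<Longrightarrow> f i \<in> O\<^sub>K" for f and I :: "nat set"
      using that by (induction I rule: infinite_finite_induct) (auto intro: ring_of_integers_closed[OF F])
    have "(\<Sum>j<n. d j *\<^sub>R v j) = (\<Sum>s\<in>S. \<Sum>j | j \<in> {..<n} \<and> v j = s. d j *\<^sub>R v j)"
      by (rule sum.group[symmetric]) (use S x' in auto)
    also have "\<dots> = (\<Sum>s\<in>S. N s *\<^sub>R s)"
      unfolding N_def by (intro sum.cong refl) (simp add: scaleR_left.sum)
    finally have "x = (\<Sum>s\<in>S. N s *\<^sub>R s)" using x' by simp
    moreover have "N s \<in> O\<^sub>K" for s unfolding N_def by (rule osum) (use x' in auto)
    ultimately show ?thesis by (intro exI[of _ N] conjI ballI)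
  qed
  have "\<forall>s\<in>S. \<exists>N. (\<forall>s'\<in>S. N s' \<in> O\<^sub>K) \<and> quat_mult a b s E = (\<Sum>s'\<in>S. N s' *\<^sub>R s')"
    using coef O_mult base E by blast
  from bchoice[OF this] obtain N where N0: "\<forall>s\<in>S. (\<forall>s'\<in>S. N s s' \<in> O\<^sub>K) \<and> quat_mult a b s E = (\<Sum>s'\<in>S. N s s' *\<^sub>R s')" ..
  have N: "N s s' \<in> O\<^sub>K" if "s \<in> S" "s' \<in> S" for s s' using N0 that by simp
  have NE: "quat_mult a b s E = (\<Sum>s'\<in>S. N s s' *\<^sub>R s')" if "s \<in> S" for s using N0 that by simp
  obtain w1 w2 where w: "w1 \<noteq> 0 \<or> w2 \<noteq> 0"
    "of_real (\<xi> E $1$1) * w1 + of_real (\<xi> E $1$2) * w2 = l * w1" "of_real (\<xi> E $2$1) * w1 + of_real (\<xi> E $2$2) * w2 = l * w2"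
    using complex_eigenvector2[OF l] .
  \<comment> \<open>The \<open>r\<close>-th coordinate of \<open>X\<close> applied to the
    eigenvector \<open>(w1, w2)\<close>.\<close>
  define v where "v r X = of_real (X $ r $ 1) * w1 + of_real (X $ r $ 2) * w2" for r :: 2 and X :: "real^2^2"
  have v_add: "v r (X + Y) = v r X + v r Y" and v_scale: "v r (c *\<^sub>R X) = of_real c * v r X" for r X Y c
    by (simp_all add: v_def algebra_simps)
  have v_E: "v r (X ** \<xi> E) = l * v r X" for r X
  proof -
    have "(X ** \<xi> E)$r$1 = X$r$1 * \<xi> E$1$1 + X$r$2 * \<xi> E$2$1" "(X ** \<xi> E)$r$2 = X$r$1 * \<xi> E$1$2 + X$r$2 * \<xi> E$2$2"
      by (simp_all add: matrix_matrix_mult_def sum_2)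
    then have "v r (X ** \<xi> E) = of_real (X$r$1) * (of_real (\<xi> E $1$1) * w1 + of_real (\<xi> E $1$2) * w2)
        + of_real (X$r$2) * (of_real (\<xi> E $2$1) * w1 + of_real (\<xi> E $2$2) * w2)"
      by (simp add: v_def algebra_simps)
    then show ?thesis unfolding w by (simp add: v_def algebra_simps)
  qed
  have xi_sum: "\<xi> (\<Sum>s\<in>T. c s *\<^sub>R s) = (\<Sum>s\<in>T. c s *\<^sub>R \<xi> s)" if "finite T" "T \<subseteq> S" "\<And>s. s \<in> S \<Longrightarrow> c s \<in> O\<^sub>K" for T c
    using that
  proof (induction T rule: finite_induct)
    case empty
    show ?case using xi_scale[of 0 "(1,0,0,0)"] K0 K1 by (simp add: zero_prod_def)
  next
    case (insert s T)
    have sS: "s \<in> S" and TS: "T \<subseteq> S" using insert.prems(1) by simp_all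
    have cs: "c u \<in> O\<^sub>K" if "u \<in> S" for u by (rule insert.prems(2)[OF that])
    have 1: "c s *\<^sub>R s \<in> B" using O_scale[OF cs[OF sS] base[OF sS]] OB by blast
    have "c u *\<^sub>R u \<in> \<OO>" if "u \<in> T" for u using O_scale cs base that TS by blast
    then have 2: "(\<Sum>u\<in>T. c u *\<^sub>R u) \<in> B" using O_sum[of T "\<lambda>u. c u *\<^sub>R u"] OB by blast
    have 3: "\<xi> (c s *\<^sub>R s) = c s *\<^sub>R \<xi> s"
      by (rule xi_scale) (use cs[OF sS] base[OF sS] OB in \<open>auto simp: ring_of_integers_def simp del: mem_Times_iff split_paired_All\<close>)
    have "\<xi> (\<Sum>u\<in>T. c u *\<^sub>R u) = (\<Sum>u\<in>T. c u *\<^sub>R \<xi> u)" by (rule insert.IH) (use TS cs in auto)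
    then show ?case
      using xi_add[OF 1 2] 3 insert.hyps by simp
  qed
  have v_sum: "v r (\<Sum>s\<in>T. c s *\<^sub>R \<xi> s) = (\<Sum>s\<in>T. of_real (c s) * v r (\<xi> s))" for r c T
  proof (induction T rule: infinite_finite_induct)
    case (insert s T)
    then show ?case by (simp add: v_add v_scale)
  qed (simp_all add: v_def)
  \<comment> \<open>A coordinate in which the eigenvector is nonzero; since 1 is a combination of
    the generators, one of them has a nonzero value there.\<close>
  obtain r where r: "v r (mat 1) \<noteq> 0"
  proof (cases "w1 = 0")
    case True
    then show ?thesis using that[of 2] w(1) by (simp add: v_def mat2_one)
  next
    case False
    then show ?thesis using that[of 1] by (simp add: v_def mat2_one)
  qed
  obtain c where c: "\<And>s. s \<in> S \<Longrightarrow> c s \<in> O\<^sub>K" "(1, 0, 0, 0) = (\<Sum>s\<in>S. c s *\<^sub>R s)" using coef[OF O_one] by blast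
  have v1: "v r (mat 1) = (\<Sum>s\<in>S. of_real (c s) * v r (\<xi> s))"
  proof -
    have "\<xi> (1, 0, 0, 0) = (\<Sum>s\<in>S. c s *\<^sub>R \<xi> s)"
      unfolding c(2) by (rule xi_sum[OF S(1) order_refl]) (rule c(1))
    then show ?thesis by (simp only: xi_one v_sum)
  qed
  have "\<exists>s0\<in>S. v r (\<xi> s0) \<noteq> 0"
  proof (rule ccontr)
    assume "\<not> ?thesis"
    then have "(\<Sum>s\<in>S. of_real (c s) * v r (\<xi> s)) = 0" by (intro sum.neutral) simp
    then show False using r v1 by simp
  qed
  then obtain s0 where s0: "s0 \<in> S" "v r (\<xi> s0) \<noteq> 0" by blast
  show ?thesis
  proof (rule algebraic_int_eigenvalue[of S s0 "\<lambda>s. v r (\<xi> s)" "\<lambda>s s'. of_real (N s s')"])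
    fix s assume s: "s \<in> S"
    have "l * v r (\<xi> s) = v r (\<xi> (quat_mult a b s E))"
      using xi_mult[OF subsetD[OF OB base[OF s]] subsetD[OF OB E]] v_E[of r "\<xi> s"] by simp
    also have "\<dots> = (\<Sum>s'\<in>S. of_real (N s s') * v r (\<xi> s'))"
      unfolding NE[OF s] by (subst xi_sum[OF S(1) order_refl]) (auto simp only: v_sum intro: N[OF s])
    finally show "l * v r (\<xi> s) = (\<Sum>s'\<in>S. of_real (N s s') * v r (\<xi> s'))" .
  qed (use S s0 N in \<open>auto simp: ring_of_integers_def\<close>)
qed

text \<open>Trace and determinant of the matrix are the sum and the product of its two eigenvalues,
  which are integral but possibly not real.\<close>

lemma order_integral:
  assumes E: "E \<in> \<OO>"
  shows "red_trace E \<in> O\<^sub>K" "red_norm a b E \<in> O\<^sub>K"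
proof -
  have EB: "E \<in> B" using E OB by blast
  define p q s u where pq: "p = (of_real (\<xi> E $1$1) :: complex)" "q = (of_real (\<xi> E $1$2) :: complex)"
    "s = (of_real (\<xi> E $2$1) :: complex)" "u = (of_real (\<xi> E $2$2) :: complex)"
  define D where "D = csqrt ((p - u)\<^sup>2 + 4 * q * s)"
  have D2: "D * D = (p - u)\<^sup>2 + 4 * q * s" by (simp add: D_def flip: power2_eq_square)
  define l1 where "l1 = (p + u + D) / 2"
  define l2 where "l2 = (p + u - D) / 2"
  have "(l1 - p) * (l1 - u) = q * s"
  proof -
    have "4 * ((l1 - p) * (l1 - u)) = D * D - (p - u)\<^sup>2" by (simp add: l1_def power2_eq_square field_simps)
    then show ?thesis unfolding D2 by simp
  qed
  then have a1: "algebraic_int l1" by (intro eigenvalue_integral[OF E]) (simp add: pq)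
  have "(l2 - p) * (l2 - u) = q * s"
  proof -
    have "4 * ((l2 - p) * (l2 - u)) = D * D - (p - u)\<^sup>2" by (simp add: l2_def power2_eq_square field_simps)
    then show ?thesis unfolding D2 by simp
  qed
  then have a2: "algebraic_int l2" by (intro eigenvalue_integral[OF E]) (simp add: pq)
  have "l1 + l2 = of_real (trace (\<xi> E))" by (simp add: l1_def l2_def trace_2 pq field_simps)
  then have "algebraic_int (of_real (red_trace E) :: complex)"
    using algebraic_int_add[OF a1 a2] trace_xi[OF EB] by simp
  then show "red_trace E \<in> O\<^sub>K" using red_in_K(1)[OF EB] by (simp add: ring_of_integers_def)
  have "l1 * l2 = ((p + u)\<^sup>2 - D * D) / 4" by (simp add: l1_def l2_def power2_eq_square field_simps)
  also have "\<dots> = p * u - q * s" unfolding D2 by (simp add: power2_eq_square field_simps)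
  also have "\<dots> = of_real (det (\<xi> E))" by (simp add: det_2 pq)
  finally have "algebraic_int (of_real (red_norm a b E) :: complex)"
    using algebraic_int_mult[OF a1 a2] det_xi[OF EB] by simp
  then show "red_norm a b E \<in> O\<^sub>K" using red_in_K(2)[OF EB] by (simp add: ring_of_integers_def)
qed

end

section \<open>Trace bounds at split and nonsplit embeddings\<close>

lemma half_sum_identities:
  fixes s u v x y :: real
  assumes "s \<noteq> 0"
  shows "(u + v) / 2 + (u - v) / (2 * s) * s = u" "(u + v) / 2 - (u - v) / (2 * s) * s = v"
    "((x + y * s) + (x - y * s)) / 2 = x" "((x + y * s) - (x - y * s)) / (2 * s) = y"
proof -
  have "(u - v) / (2 * s) * s = (u - v) / 2" using assms by simp
  then show "(u + v) / 2 + (u - v) / (2 * s) * s = u" "(u + v) / 2 - (u - v) / (2 * s) * s = v"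
    by (simp_all only:) (simp_all add: field_simps)
  show "((x + y * s) + (x - y * s)) / 2 = x" by simp
  have "(x + y * s) - (x - y * s) = y * (2 * s)" by simp
  then show "((x + y * s) - (x - y * s)) / (2 * s) = y" using assms by (simp only:) simp
qed

text \<open>If one parameter has a real square root \<open>s\<close>, its generator goes to
  \<open>diag(s, -s)\<close> and the other generator to the antidiagonal matrix whose entries are
  its own square and 1; \<open>g\<close> is the explicit inverse.\<close>

lemma splits_if_pos:
  assumes ab: "\<sigma> a \<noteq> 0" "\<sigma> b \<noteq> 0" and pos: "\<sigma> a > 0 \<or> \<sigma> b > 0"
  shows "splits_at a b \<sigma>"
proof -
  define \<alpha> where "\<alpha> = \<sigma> a" define \<beta> where "\<beta> = \<sigma> b"
  have bij: "bij_betw f (carrier (quat_alg UNIV \<alpha> \<beta>)) (carrier M2R)"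
    if "\<And>A. f (g A) = A" "\<And>q. g (f q) = q" for f and g :: "real^2^2 \<Rightarrow> quat"
    by (rule bij_betw_byWitness[of _ g]) (use that in auto)
  consider "\<alpha> > 0" | "\<beta> > 0" using pos by (auto simp: \<alpha>_def \<beta>_def)
  then show ?thesis
  proof cases
    case 1
    define s where "s = sqrt \<alpha>"
    have s: "s * s = \<alpha>" "s \<noteq> 0" using 1 by (simp_all add: s_def)
    define f :: "quat \<Rightarrow> real^2^2" where
      "f = (\<lambda>(x0, x1, x2, x3). mk2 (x0 + x1 * s) (\<beta> * (x2 + x3 * s)) (x2 - x3 * s) (x0 - x1 * s))"
    define g :: "real^2^2 \<Rightarrow> quat" where
      "g A = ((A$1$1 + A$2$2) / 2, (A$1$1 - A$2$2) / (2 * s), (A$1$2 / \<beta> + A$2$1) / 2, (A$1$2 / \<beta> - A$2$1) / (2 * s))" for A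
    have "bij_betw f (carrier (quat_alg UNIV \<alpha> \<beta>)) (carrier M2R)"
    proof (rule bij)
      show "f (g A) = A" for A
        using ab(2) unfolding f_def g_def prod.case mat2_eq_iff mk2_nth half_sum_identities[OF s(2)] by (simp add: \<beta>_def)
      show "g (f q) = q" for q
      proof -
        obtain x0 x1 x2 x3 where q: "q = (x0, x1, x2, x3)" by (cases q)
        have "\<beta> * u / \<beta> = u" for u using ab(2) by (simp add: \<beta>_def)
        then show ?thesis
          unfolding q f_def g_def prod.case mk2_nth by (simp only: half_sum_identities[OF s(2)])
      qed
    qed
    moreover have "f \<in> alg_homs UNIV \<alpha> \<beta> (\<lambda>x. x)"
      by (auto simp: alg_homs_def Ring.ring_hom_def f_def mat2_eq_iff mat2_mult mat2_one s(1)[symmetric] algebra_simps)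
    ultimately show ?thesis unfolding splits_at_def \<alpha>_def \<beta>_def by blast
  next
    case 2
    define s where "s = sqrt \<beta>"
    have s: "s * s = \<beta>" "s \<noteq> 0" using 2 by (simp_all add: s_def)
    define f :: "quat \<Rightarrow> real^2^2" where
      "f = (\<lambda>(x0, x1, x2, x3). mk2 (x0 + x2 * s) (\<alpha> * (x1 - x3 * s)) (x1 + x3 * s) (x0 - x2 * s))"
    define g :: "real^2^2 \<Rightarrow> quat" where
      "g A = ((A$1$1 + A$2$2) / 2, (A$2$1 + A$1$2 / \<alpha>) / 2, (A$1$1 - A$2$2) / (2 * s), (A$2$1 - A$1$2 / \<alpha>) / (2 * s))" for A
    have "bij_betw f (carrier (quat_alg UNIV \<alpha> \<beta>)) (carrier M2R)"
    proof (rule bij)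
      show "f (g A) = A" for A
        using ab(1) unfolding f_def g_def prod.case mat2_eq_iff mk2_nth half_sum_identities[OF s(2)] by (simp add: \<alpha>_def)
      show "g (f q) = q" for q
      proof -
        obtain x0 x1 x2 x3 where q: "q = (x0, x1, x2, x3)" by (cases q)
        have "\<alpha> * u / \<alpha> = u" for u using ab(1) by (simp add: \<alpha>_def)
        then show ?thesis
          unfolding q f_def g_def prod.case mk2_nth by (simp only: half_sum_identities[OF s(2)])
      qed
    qed
    moreover have "f \<in> alg_homs UNIV \<alpha> \<beta> (\<lambda>x. x)"
      by (auto simp: alg_homs_def Ring.ring_hom_def f_def mat2_eq_iff mat2_mult mat2_one s(1)[symmetric] algebra_simps)
    ultimately show ?thesis unfolding splits_at_def \<alpha>_def \<beta>_def by blast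
  qed
qed

text \<open>Nonsplit means that both parameters become negative, so the norm form is positive
  definite and norm one bounds the scalar part by 1.\<close>

lemma nonsplit_red_trace_bound:
  assumes \<sigma>: "field_emb K \<sigma>" and par: "quat_params K a b" and ns: "\<not> splits_at a b \<sigma>"
    and q: "q \<in> K \<times> K \<times> K \<times> K" "red_norm a b q = 1"
  shows "\<bar>\<sigma> (red_trace q)\<bar> \<le> 2"
proof -
  have F: "fieldset K" using \<sigma> by (simp add: field_emb_def)
  have ab: "a \<in> K" "a \<noteq> 0" "b \<in> K" "b \<noteq> 0" using par by (auto simp: quat_params_def)
  have nz: "\<sigma> a \<noteq> 0" "\<sigma> b \<noteq> 0" using field_emb_nonzero[OF \<sigma>] ab by auto
  have neg: "\<sigma> a < 0" "\<sigma> b < 0" using ns splits_if_pos[of \<sigma> a b] nz by force+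
  obtain x0 x1 x2 x3 where q': "q = (x0, x1, x2, x3)" by (cases q)
  have x: "x0 \<in> K" "x1 \<in> K" "x2 \<in> K" "x3 \<in> K" using q by (auto simp: q')
  note cl = x ab fieldset_mult[OF F] fieldset_diff[OF F] fieldset_add[OF F]
  have "\<sigma> (red_norm a b q) = (\<sigma> x0)\<^sup>2 - \<sigma> a * (\<sigma> x1)\<^sup>2 - \<sigma> b * (\<sigma> x2)\<^sup>2 + \<sigma> a * \<sigma> b * (\<sigma> x3)\<^sup>2"
    by (simp add: q' power2_eq_square field_emb_mult[OF \<sigma>] field_emb_add[OF \<sigma>] field_emb_diff[OF \<sigma>] cl)
  then have eq: "(\<sigma> x0)\<^sup>2 - \<sigma> a * (\<sigma> x1)\<^sup>2 - \<sigma> b * (\<sigma> x2)\<^sup>2 + \<sigma> a * \<sigma> b * (\<sigma> x3)\<^sup>2 = 1"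
    using q(2) field_emb_1[OF \<sigma>] by simp
  have "\<sigma> a * (\<sigma> x1)\<^sup>2 \<le> 0" "\<sigma> b * (\<sigma> x2)\<^sup>2 \<le> 0" "\<sigma> a * \<sigma> b * (\<sigma> x3)\<^sup>2 \<ge> 0"
    using neg by (auto simp: mult_nonpos_nonneg mult_nonpos_nonpos)
  then have "(\<sigma> x0)\<^sup>2 \<le> 1\<^sup>2" using eq by simp
  then have "\<bar>\<sigma> x0\<bar> \<le> 1" by (simp add: abs_square_le_1)
  moreover have "\<sigma> (red_trace q) = \<sigma> x0 + \<sigma> x0"
    using field_emb_add[OF \<sigma> x(1) x(1)] by (simp add: q')
  ultimately show ?thesis by linarith
qed

primrec mpow :: "real^2^2 \<Rightarrow> nat \<Rightarrow> real^2^2" where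
  "mpow A 0 = mat 1"
| "mpow A (Suc n) = A ** mpow A n"

text \<open>The trace of the \<open>n\<close>-th power of a matrix of determinant 1 and trace
  \<open>t\<close>; it is twice the Chebyshev polynomial of the first kind at
  \<open>t / 2\<close>.\<close>

fun cheb :: "real \<Rightarrow> nat \<Rightarrow> real" where
  "cheb t 0 = 2"
| "cheb t (Suc 0) = t"
| "cheb t (Suc (Suc n)) = t * cheb t (Suc n) - cheb t n"

lemma mpow_add: "mpow A (m + n) = mpow A m ** mpow A n"
  by (induction m) (simp_all add: matrix_mul_assoc)

lemma trace_mpow:
  assumes "det A = 1" shows "trace (mpow A n) = cheb (trace A) n"
proof -
  have rec: "trace (A ** (A ** M)) = trace A * trace (A ** M) - trace M" for M :: "real^2^2"
  proof -
    have "trace (A ** (A ** M)) = trace A * trace (A ** M) - det A * trace M"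
      by (simp add: trace_2 mat2_mult det_2 algebra_simps)
    then show ?thesis using assms by simp
  qed
  show ?thesis
    by (induction "trace A" n rule: cheb.induct) (simp_all add: rec, simp_all add: trace_2 mat2_one)
qed

text \<open>Above 2 the recursion makes absolute values strictly increasing. Contrapositively, a
  bound 2 for the trace of a power descends to the matrix itself.\<close>

lemma cheb_gt_2:
  assumes "\<bar>x\<bar> > 2" "n \<ge> 1" shows "\<bar>cheb x n\<bar> > 2"
proof -
  have "\<bar>cheb x (Suc n)\<bar> > \<bar>cheb x n\<bar> \<and> \<bar>cheb x n\<bar> \<ge> 2" for n
  proof (induction n)
    case (Suc n)
    have "2 * \<bar>cheb x (Suc n)\<bar> < \<bar>x\<bar> * \<bar>cheb x (Suc n)\<bar>"
      using assms(1) Suc by (intro mult_strict_right_mono) auto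
    also have "\<dots> \<le> \<bar>x * cheb x (Suc n) - cheb x n\<bar> + \<bar>cheb x n\<bar>"
      using abs_triangle_ineq[of "x * cheb x (Suc n) - cheb x n" "cheb x n"] by (simp add: abs_mult)
    finally show ?case using Suc by simp
  qed (use assms in simp)
  from this[of "n - 1"] show ?thesis using assms(2) by simp
qed

lemma cheb_closed:
  assumes "fieldset K" "t \<in> K" shows "cheb t n \<in> K"
proof -
  have "2 \<in> K" using fieldset_rat[OF assms(1), of 2] by simp
  then show ?thesis
    using assms(2) by (induction t n rule: cheb.induct) (auto intro: fieldset_diff[OF assms(1)] fieldset_mult[OF assms(1)])
qed

lemma field_emb_cheb:
  assumes h: "field_emb K h" and t: "t \<in> K" shows "h (cheb t n) = cheb (h t) n"
proof -
  have F: "fieldset K" using h by (simp add: field_emb_def)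
  have "h 2 = 2" using field_emb_of_rat[OF h, of 2] by simp
  then show ?thesis
    using t by (induction t n rule: cheb.induct)
      (simp_all add: field_emb_diff[OF h] field_emb_mult[OF h] fieldset_mult[OF F] cheb_closed[OF F])
qed

text \<open>The extended embedding and the conjugating matrix are arbitrary, but the trace ignores
  conjugation and lies in \<open>K\<close>, where the extension is prescribed.\<close>

lemma galois_conjugate_trace:
  assumes g: "galois_conjugate \<Gamma> K \<phi> \<Psi>" and A: "A \<in> lifts \<Gamma>" and tr: "trace A \<in> K"
  obtains B where "B \<in> \<Psi> (PSL_proj A)" "trace B = \<phi> (trace A)"
proof -
  from g obtain L \<psi> and h :: "complex^2^2" where L: "\<forall>A\<in>lifts \<Gamma>. \<forall>i j. A$i$j \<in> L"
    and \<psi>: "\<psi> \<in> ring_hom (real_ring\<lparr>carrier := L\<rparr>) complex_ring" and ext: "\<forall>x\<in>K. \<psi> x = of_real (\<phi> x)"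
    and h: "invertible h"
    and conj: "\<forall>A\<in>lifts \<Gamma>. \<exists>B\<in>\<Psi> (PSL_proj A). (\<chi> i j. of_real (B$i$j)) = h ** (\<chi> i j. \<psi> (A$i$j)) ** matrix_inv h"
    unfolding galois_conjugate_def by blast
  obtain B where B: "B \<in> \<Psi> (PSL_proj A)" "(\<chi> i j. of_real (B$i$j)) = h ** (\<chi> i j. \<psi> (A$i$j)) ** matrix_inv h"
    using conj A by blast
  have add: "\<psi> (x + y) = \<psi> x + \<psi> y" if "x \<in> L" "y \<in> L" for x y
    using \<psi> that unfolding ring_hom_real_iff by blast
  have inv: "matrix_inv h ** h = mat 1"
    using h someI_ex[of "\<lambda>A'. h ** A' = mat 1 \<and> A' ** h = mat 1"]
    unfolding invertible_def matrix_inv_def by blast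
  have "of_real (trace B) = trace ((\<chi> i j. of_real (B$i$j)) :: complex^2^2)" by (simp add: trace_2)
  also have "\<dots> = trace (matrix_inv h ** (h ** (\<chi> i j. \<psi> (A$i$j)) :: complex^2^2))" unfolding B(2) by (rule trace_mul_sym)
  also have "\<dots> = trace ((\<chi> i j. \<psi> (A$i$j)) :: complex^2^2)" by (simp add: matrix_mul_assoc inv)
  also have "\<dots> = \<psi> (trace A)" using L A by (simp add: trace_2 add)
  also have "\<dots> = of_real (\<phi> (trace A))" using ext tr by simp
  finally show ?thesis using that[OF B(1)] by simp
qed

text \<open>The equivariant map carries \<open>z\<close> and its translate to a point and its
  translate under the conjugate element, without increasing the distance; the bound of the trace by
  the displacement is then applied to the conjugate.\<close>

lemma split_trace_bound:
  assumes g: "galois_conjugate \<Gamma> K \<phi> \<Psi>" and A: "A \<in> lifts \<Gamma>" and tr: "trace A \<in> K"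
    and hol: "F holomorphic_on \<H>" "F ` \<H> \<subseteq> \<H>"
    and eqv: "\<forall>\<gamma>\<in>\<Gamma>. \<forall>z\<in>\<H>. F (PSL_act \<gamma> z) = PSL_act (\<Psi> \<gamma>) (F z)" and z: "z \<in> \<H>"
  shows "\<bar>\<phi> (trace A)\<bar> \<le> 2 * cosh (hyp_dist z (moebius A z) / 2)"
proof -
  obtain B where B: "B \<in> \<Psi> (PSL_proj A)" "trace B = \<phi> (trace A)"
    using galois_conjugate_trace[OF g A tr] .
  have \<gamma>: "PSL_proj A \<in> \<Gamma>" and dA: "det A = 1" using A by (auto simp: lifts_iff)
  have "\<Psi> (PSL_proj A) \<in> carrier PSL2R"
    using g \<gamma> unfolding galois_conjugate_def hom_def by auto
  then obtain C where C: "det C = 1" "PSL_proj C = \<Psi> (PSL_proj A)" using lift_exists by blast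
  have Fz: "F z \<in> \<H>" using hol z by blast
  have "B \<in> PSL_proj C" using B(1) C(2) by simp
  then have "\<bar>trace B\<bar> = \<bar>trace C\<bar>" unfolding PSL_proj_eq by (auto simp: trace_2)
  also have "\<bar>trace C\<bar> \<le> 2 * cosh (hyp_dist (F z) (moebius C (F z)) / 2)"
    by (rule trace_le_cosh_displacement[OF C(1)]) (use Fz in \<open>simp add: upper_half_plane_def\<close>)
  also have "moebius C (F z) = F (moebius A z)"
    using eqv \<gamma> z PSL_act_proj C(2) by metis
  also have "2 * cosh (hyp_dist (F z) (F (moebius A z)) / 2) \<le> 2 * cosh (hyp_dist z (moebius A z) / 2)"
  proof -
    have Az: "moebius A z \<in> \<H>" by (rule moebius_in_H[OF dA z])
    have "hyp_dist (F z) (F (moebius A z)) \<le> hyp_dist z (moebius A z)" by (rule Schwarz_Pick[OF hol z Az])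
    moreover have "hyp_dist (F z) (F (moebius A z)) \<ge> 0"
      using hol z Az by (intro hyp_dist_nonneg) (auto simp: upper_half_plane_def)
    ultimately show ?thesis by (subst mult_le_cancel_left_pos, simp, subst cosh_real_nonneg_le_iff) auto
  qed
  finally show ?thesis by (simp only: B(2))
qed

text \<open>Commensurability brings some power of the image of \<open>A\<close> into the norm-one
  group of the lattice's order. The trace of that power is plus or minus a reduced trace, bounded by
  2 at \<open>\<tau>\<close>, and \<open>cheb_gt_2\<close> passes the bound back to
  \<open>A\<close>.\<close>

lemma nonsplit_trace_bound:
  assumes sub: "subgroup \<Gamma> PSL2R"
    and lat: "irreducible_arithmetic_lattice K r \<sigma> \<Lambda>" and r: "r \<ge> 1"
    and g: "\<And>i. i < r \<Longrightarrow> galois_conjugate \<Gamma> K (\<sigma> i) (\<Phi> i)"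
    and im: "\<And>\<gamma>. \<gamma> \<in> \<Gamma> \<Longrightarrow> (\<lambda>i\<in>{..<r}. \<Phi> i \<gamma>) \<in> \<Lambda>"
    and A: "A \<in> lifts \<Gamma>" and tr: "trace A \<in> K"
    and \<tau>: "\<tau> \<in> real_embeddings K" "\<tau> \<notin> \<sigma> ` {..<r}"
  shows "\<bar>\<tau> (trace A)\<bar> \<le> 2"
proof -
  from lat obtain a b \<rho> Q where nf: "number_field K" and par: "quat_params K a b"
    and bij: "bij_betw \<sigma> {..<r} {\<tau> \<in> real_embeddings K. splits_at a b \<tau>}"
    and \<rho>: "\<And>i q. i < r \<Longrightarrow> q \<in> carrier (quat_alg K a b) \<Longrightarrow> trace (\<rho> i q) = \<sigma> i (red_trace q)"
    and Q: "is_order K a b Q"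
    and com: "commensurable (PSL2R_power r) \<Lambda> ((\<lambda>q. \<lambda>i\<in>{..<r}. PSL_proj (\<rho> i q)) ` norm_one a b Q)"
    unfolding irreducible_arithmetic_lattice_def by blast
  have F: "fieldset K" using nf subfield_imp_fieldset by (auto simp: number_field_def)
  define J where "J = (\<lambda>q. \<lambda>i\<in>{..<r}. PSL_proj (\<rho> i q)) ` norm_one a b Q"
  let ?G = "PSL2R_power r"
  interpret P: group PSL2R by (rule PSL2R_group)
  interpret G: group ?G unfolding PSL2R_power_def by (rule product_group) (rule PSL2R_group)
  have \<Lambda>: "subgroup \<Lambda> ?G" and J: "subgroup J ?G"
    and fin: "finite (rcosets\<^bsub>?G\<lparr>carrier := \<Lambda>\<rparr>\<^esub> (\<Lambda> \<inter> J))"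
    using com unfolding commensurable_def J_def by auto
  have Gm: "(x \<otimes>\<^bsub>?G\<^esub> y) = (\<lambda>i\<in>{..<r}. x i \<otimes>\<^bsub>PSL2R\<^esub> y i)" for x y
    by (simp add: PSL2R_power_def)
  have dA: "det A = 1" and \<gamma>: "PSL_proj A \<in> \<Gamma>" using A by (auto simp: lifts_iff)
  have pL: "mpow A n \<in> lifts \<Gamma>" for n
  proof (induction n)
    case (Suc n)
    then show ?case
      using subgroup.m_closed[OF sub \<gamma>] dA by (auto simp: lifts_iff det_mul simp flip: PSL_mult)
  qed (use subgroup.one_closed[OF sub] in \<open>simp add: lifts_iff PSL_one\<close>)
  then have p\<Gamma>: "PSL_proj (mpow A n) \<in> \<Gamma>" for n by (simp add: lifts_iff)
  define y where "y n = (\<lambda>i\<in>{..<r}. \<Phi> i (PSL_proj (mpow A n)))" for n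
  have y\<Lambda>: "y n \<in> \<Lambda>" for n unfolding y_def by (rule im[OF p\<Gamma>])
  have yG: "y n \<in> carrier ?G" for n using subgroup.mem_carrier[OF \<Lambda> y\<Lambda>] .
  have y_add: "y (m + n) = y m \<otimes>\<^bsub>?G\<^esub> y n" for m n
  proof -
    have "\<Phi> i (PSL_proj (mpow A (m + n))) = \<Phi> i (PSL_proj (mpow A m)) \<otimes>\<^bsub>PSL2R\<^esub> \<Phi> i (PSL_proj (mpow A n))"
      if i: "i < r" for i
    proof -
      have "\<Phi> i \<in> hom (PSL2R\<lparr>carrier := \<Gamma>\<rparr>) PSL2R" using g[OF i] by (simp add: galois_conjugate_def)
      then show ?thesis unfolding mpow_add PSL_mult[symmetric] using p\<Gamma> by (simp add: hom_def)
    qed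
    then show ?thesis unfolding Gm by (auto simp: y_def fun_eq_iff)
  qed
  have HG: "r_coset (?G\<lparr>carrier := \<Lambda>\<rparr>) (\<Lambda> \<inter> J) x = r_coset ?G (\<Lambda> \<inter> J) x" for x
    by (simp add: r_coset_def)
  \<comment> \<open>There are finitely many cosets, so two powers share one; their quotient is a
    positive power whose image lies in \<open>J\<close>.\<close>
  have "\<not> inj (\<lambda>n. r_coset ?G (\<Lambda> \<inter> J) (y n))"
  proof
    assume "inj (\<lambda>n. r_coset ?G (\<Lambda> \<inter> J) (y n))"
    moreover have "range (\<lambda>n. r_coset ?G (\<Lambda> \<inter> J) (y n)) \<subseteq> rcosets\<^bsub>?G\<lparr>carrier := \<Lambda>\<rparr>\<^esub> (\<Lambda> \<inter> J)"
      using y\<Lambda> by (auto simp: RCOSETS_def HG)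
    ultimately show False using fin finite_subset range_inj_infinite by blast
  qed
  then obtain m n where mn: "m \<noteq> n" "r_coset ?G (\<Lambda> \<inter> J) (y m) = r_coset ?G (\<Lambda> \<inter> J) (y n)"
    by (auto simp: inj_def)
  have pos: "\<exists>k\<ge>1. y k \<in> J" if eq: "m < n" "r_coset ?G (\<Lambda> \<inter> J) (y m) = r_coset ?G (\<Lambda> \<inter> J) (y n)" for m n
  proof -
    have "\<one>\<^bsub>?G\<^esub> \<in> \<Lambda> \<inter> J" using subgroup.one_closed \<Lambda> J by blast
    then have "y n \<in> r_coset ?G (\<Lambda> \<inter> J) (y n)" using yG[of n] by (force simp: r_coset_def)
    then obtain h where h: "h \<in> \<Lambda> \<inter> J" "y n = h \<otimes>\<^bsub>?G\<^esub> y m" unfolding eq(2)[symmetric] by (auto simp: r_coset_def)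
    have "h \<in> carrier ?G" using h subgroup.mem_carrier[OF \<Lambda>] by blast
    moreover have "y (n - m) \<otimes>\<^bsub>?G\<^esub> y m = h \<otimes>\<^bsub>?G\<^esub> y m" using y_add[of "n - m" m] eq(1) h(2) by simp
    ultimately have "y (n - m) = h" using yG by (simp add: G.r_cancel)
    then show ?thesis using h eq(1) by (intro exI[of _ "n - m"]) auto
  qed
  have "\<exists>k\<ge>1. y k \<in> J"
    using pos[of m n] pos[of n m] mn by (cases m n rule: linorder_cases) auto
  then obtain k where k: "k \<ge> 1" "y k \<in> J" by blast
  then obtain q where q: "q \<in> norm_one a b Q" "y k = (\<lambda>i\<in>{..<r}. PSL_proj (\<rho> i q))" by (auto simp: J_def)
  have qB: "q \<in> K \<times> K \<times> K \<times> K" and qn: "red_norm a b q = 1"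
    using q(1) Q subringE(1)[of Q "quat_alg K a b"] by (auto simp: norm_one_def is_order_def)
  have \<sigma>0: "field_emb K (\<sigma> 0)" and \<tau>': "field_emb K \<tau>"
    using bij r \<tau> real_embeddings_field_emb[OF F] by (auto simp: bij_betw_def)
  have ns: "\<not> splits_at a b \<tau>" using bij \<tau> by (auto simp: bij_betw_def)
  define t where "t = trace (mpow A k)"
  have t: "t = cheb (trace A) k" by (simp add: t_def trace_mpow[OF dA])
  have tK: "t \<in> K" unfolding t by (rule cheb_closed[OF F tr])
  have qK: "red_trace q \<in> K"
  proof -
    obtain x0 x1 x2 x3 where "q = (x0, x1, x2, x3)" by (cases q)
    then show ?thesis using qB fieldset_add[OF F, of x0 x0] by simp
  qed
  \<comment> \<open>The component at \<open>\<sigma> 0\<close> alone determines the trace of the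
    power up to sign, because \<open>\<sigma> 0\<close> is injective on \<open>K\<close>; this is
    where \<open>r \<ge> 1\<close> enters.\<close>
  obtain C where C: "C \<in> \<Phi> 0 (PSL_proj (mpow A k))" "trace C = \<sigma> 0 t"
    using galois_conjugate_trace[OF g[of 0] pL] r tK by (auto simp: t_def)
  have "\<Phi> 0 (PSL_proj (mpow A k)) = PSL_proj (\<rho> 0 q)"
    using fun_cong[OF q(2), of 0] r by (simp add: y_def)
  then have "trace C = \<sigma> 0 (red_trace q) \<or> trace C = - \<sigma> 0 (red_trace q)"
    using C(1) \<rho>[of 0 q] qB r by (auto simp: PSL_proj_eq trace_2)
  then have "\<sigma> 0 (t - red_trace q) = 0 \<or> \<sigma> 0 (t + red_trace q) = 0"
    using C(2) field_emb_diff[OF \<sigma>0 tK qK] field_emb_add[OF \<sigma>0 tK qK] by auto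
  then have "t - red_trace q = 0 \<or> t + red_trace q = 0"
    using field_emb_nonzero[OF \<sigma>0 fieldset_diff[OF F tK qK]] field_emb_nonzero[OF \<sigma>0 fieldset_add[OF F tK qK]] by blast
  then have "t = red_trace q \<or> t = - red_trace q" by linarith
  then have "\<bar>\<tau> t\<bar> = \<bar>\<tau> (red_trace q)\<bar>" using field_emb_uminus[OF \<tau>' qK] by auto
  also have "\<dots> \<le> 2" by (rule nonsplit_red_trace_bound[OF \<tau>' par ns qB qn])
  finally have "\<bar>cheb (\<tau> (trace A)) k\<bar> \<le> 2" unfolding t field_emb_cheb[OF \<tau>' tr] .
  then show ?thesis using cheb_gt_2[of "\<tau> (trace A)" k] k(1) by linarith
qed

section \<open>Principal congruence subgroups of level a power of 3\<close>

lemma card_incongruent_le_index: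
  fixes M :: "'v::real_vector set" and e :: "'i \<Rightarrow> 'v" and p :: nat
  assumes I: "finite I" and p: "p \<ge> 2" and M: "0 \<in> M" "\<And>x y. x \<in> M \<Longrightarrow> y \<in> M \<Longrightarrow> x - y \<in> M"
    and coord: "\<And>x. x \<in> M \<Longrightarrow> \<exists>c. x = (\<Sum>i\<in>I. of_rat (c i) *\<^sub>R e i)"
    and Y: "finite Y" "Y \<subseteq> M"
    and inc: "\<And>x y m. x \<in> Y \<Longrightarrow> y \<in> Y \<Longrightarrow> m \<in> M \<Longrightarrow> x - y = real p *\<^sub>R m \<Longrightarrow> x = y"
  shows "card Y \<le> p ^ card I"
proof -
  obtain f where f: "bij_betw f {0..<card I} I" using ex_bij_betw_nat_finite[OF I] by blast
  then have f: "bij_betw f {..<card I} I" by (simp add: lessThan_atLeast0)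
  show ?thesis
  proof (rule card_incongruent_le[OF p M, where e = "\<lambda>k. e (f k)"])
    fix x assume "x \<in> M"
    then obtain c where "x = (\<Sum>i\<in>I. of_rat (c i) *\<^sub>R e i)" using coord by blast
    then have "x = (\<Sum>k<card I. of_rat (c (f k)) *\<^sub>R e (f k))"
      using sum.reindex_bij_betw[OF f, of "\<lambda>i. of_rat (c i) *\<^sub>R e i"] by simp
    then show "\<exists>c. x = (\<Sum>k<card I. of_rat (c k) *\<^sub>R e (f k))" by (intro exI[of _ "\<lambda>k. c (f k)"])
  qed (use Y inc in auto)
qed

text \<open>An incongruent set of largest size cannot be extended, so every element is related to
  one of its members.\<close>

lemma maximal_incongruent_subset:
  assumes bound: "\<And>Y. finite Y \<Longrightarrow> Y \<subseteq> G \<Longrightarrow> (\<forall>x\<in>Y. \<forall>y\<in>Y. r x y \<longrightarrow> x = y) \<Longrightarrow> card Y \<le> (N::nat)"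
    and sym: "\<And>x y. x \<in> G \<Longrightarrow> y \<in> G \<Longrightarrow> r x y \<Longrightarrow> r y x" and refl: "\<And>x. x \<in> G \<Longrightarrow> r x x"
  obtains Y where "finite Y" "Y \<subseteq> G" "card Y \<le> N" "\<forall>x\<in>G. \<exists>y\<in>Y. r x y"
proof -
  define P where "P Y \<longleftrightarrow> finite Y \<and> Y \<subseteq> G \<and> (\<forall>x\<in>Y. \<forall>y\<in>Y. r x y \<longrightarrow> x = y)" for Y
  have "P {}" by (simp add: P_def)
  moreover have "\<forall>Y. P Y \<longrightarrow> card Y < Suc N" using bound by (auto simp: P_def less_Suc_eq_le)
  ultimately have "\<exists>Y. P Y \<and> (\<forall>Z. P Z \<longrightarrow> card Z \<le> card Y)" by (rule ex_has_greatest_nat)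
  then obtain Y where Y: "P Y" "\<And>Z. P Z \<Longrightarrow> card Z \<le> card Y" by blast
  have "\<exists>y\<in>Y. r x y" if x: "x \<in> G" for x
  proof (rule ccontr)
    assume no: "\<not> (\<exists>y\<in>Y. r x y)"
    then have "x \<notin> Y" using refl x by blast
    have "P (insert x Y)" using Y(1) x no sym unfolding P_def by blast
    from Y(2)[OF this] show False using \<open>x \<notin> Y\<close> Y(1) by (simp add: P_def)
  qed
  then have "\<forall>x\<in>G. \<exists>y\<in>Y. r x y" by blast
  moreover have "finite Y" "Y \<subseteq> G" "card Y \<le> N" using Y(1) bound[of Y] by (simp_all add: P_def)
  ultimately show ?thesis by (rule that[rotated 3])
qed

text \<open>Representatives may repeat cosets, since only upper bounds for the index are
  wanted.\<close>

definition cover :: "(real^2^2) set set \<Rightarrow> (real^2^2) set set \<Rightarrow> (real^2^2) set set \<Rightarrow> bool" where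
  "cover H G R \<longleftrightarrow> finite R \<and> R \<subseteq> G \<and> G \<subseteq> (\<Union>\<rho>\<in>R. H #>\<^bsub>PSL2R\<^esub> \<rho>)"

lemma cover_trans:
  assumes "cover H G R" "cover L H S" and G: "subgroup G PSL2R" "H \<subseteq> G" and "L \<subseteq> H"
  obtains T where "cover L G T" "card T \<le> card S * card R"
proof -
  interpret P: group PSL2R by (rule PSL2R_group)
  have c: "x \<in> carrier PSL2R" if "x \<in> G" for x using subgroup.mem_carrier[OF G(1) that] .
  have R: "finite R" "R \<subseteq> G" "G \<subseteq> (\<Union>\<rho>\<in>R. H #>\<^bsub>PSL2R\<^esub> \<rho>)" and S: "finite S" "S \<subseteq> H" "H \<subseteq> (\<Union>\<rho>\<in>S. L #>\<^bsub>PSL2R\<^esub> \<rho>)"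
    using assms by (auto simp: cover_def)
  define T where "T = (\<lambda>(s, \<rho>). s \<otimes>\<^bsub>PSL2R\<^esub> \<rho>) ` (S \<times> R)"
  have "card T \<le> card (S \<times> R)" unfolding T_def by (rule card_image_le) (use R S in simp)
  then have "card T \<le> card S * card R" by (simp add: card_cartesian_product)
  moreover have "cover L G T"
    unfolding cover_def
  proof (intro conjI)
    show "finite T" using R S by (simp add: T_def)
    show "T \<subseteq> G" 
    proof
      fix t assume "t \<in> T"
      then obtain s \<rho> where t: "s \<in> S" "\<rho> \<in> R" "t = s \<otimes>\<^bsub>PSL2R\<^esub> \<rho>" unfolding T_def by blast
      have "s \<in> G" "\<rho> \<in> G" using t S(2) R(2) G(2) by blast+
      then show "t \<in> G" unfolding t(3) by (rule subgroup.m_closed[OF G(1)])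
    qed
    show "G \<subseteq> (\<Union>\<rho>\<in>T. L #>\<^bsub>PSL2R\<^esub> \<rho>)"
    proof
      fix g assume "g \<in> G"
      then obtain \<rho> h where \<rho>: "\<rho> \<in> R" "h \<in> H" "g = h \<otimes>\<^bsub>PSL2R\<^esub> \<rho>" using R(3) by (fastforce simp: r_coset_def)
      then obtain s l where s: "s \<in> S" "l \<in> L" "h = l \<otimes>\<^bsub>PSL2R\<^esub> s" using S(3) by (fastforce simp: r_coset_def)
      have "g = l \<otimes>\<^bsub>PSL2R\<^esub> (s \<otimes>\<^bsub>PSL2R\<^esub> \<rho>)"
        unfolding \<rho>(3) s(3) by (rule P.m_assoc) (use c \<rho> s R S assms in blast)+
      then show "g \<in> (\<Union>\<rho>\<in>T. L #>\<^bsub>PSL2R\<^esub> \<rho>)" using s \<rho> by (force simp: T_def r_coset_def)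
    qed
  qed
  ultimately show ?thesis using that by blast
qed

section \<open>Norm-one quaternions congruent to 1 modulo a power of 3\<close>

locale number_quat_order = quat_order +
  assumes nf: "number_field K" "totally_real K"
begin

definition deg where "deg = card (real_embeddings K)"

definition level :: "nat \<Rightarrow> real set" where "level k = (\<lambda>x. 3 ^ k * x) ` O\<^sub>K"

lemma pow3: "3 ^ k \<in> O\<^sub>K"
  using ring_of_integers_closed(6)[OF F, of "3 ^ k"] by simp

lemma nonzero_ideal_level: "nonzero_ideal K (level k)"
proof -
  let ?R = "real_ring\<lparr>carrier := O\<^sub>K\<rparr>"
  note cl = ring_of_integers_closed[OF F]
  have R: "cring ?R"
  proof (rule cringI)
    show "abelian_group ?R"
    proof (rule abelian_groupI)
      fix x assume "x \<in> carrier ?R"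
      then show "\<exists>y\<in>carrier ?R. y \<oplus>\<^bsub>?R\<^esub> x = \<zero>\<^bsub>?R\<^esub>"
        using cl(4)[OF cl(2), of x] by (intro bexI[of _ "- x"]) (auto simp: ring_of_type_algebra_def)
    qed (auto simp: ring_of_type_algebra_def cl)
    show "comm_monoid ?R"
      by (rule comm_monoidI) (auto simp: ring_of_type_algebra_def cl)
  qed (auto simp: ring_of_type_algebra_def algebra_simps)
  then interpret R: cring ?R .
  have um: "- x \<in> O\<^sub>K" if "x \<in> O\<^sub>K" for x using cl(4)[OF cl(2) that] by simp
  have "ideal (level k) ?R"
  proof (rule idealI)
    show "ring ?R" by (rule R.ring_axioms)
    show "subgroup (level k) (add_monoid ?R)"
    proof (rule group.subgroupI)
      show "group (add_monoid ?R)" by (rule R.add.group_axioms)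
      show "level k \<subseteq> carrier (add_monoid ?R)" using cl(5)[OF pow3] by (auto simp: level_def)
      show "level k \<noteq> {}" using cl(1) by (auto simp: level_def)
      fix x assume x: "x \<in> level k"
      then obtain u where u: "u \<in> O\<^sub>K" "x = 3 ^ k * u" by (auto simp: level_def)
      have "inv\<^bsub>add_monoid ?R\<^esub> x = - x"
        by (rule group.inv_equality[OF R.add.group_axioms])
          (use u cl(5)[OF pow3 u(1)] um in \<open>auto simp: ring_of_type_algebra_def\<close>)
      then show "inv\<^bsub>add_monoid ?R\<^esub> x \<in> level k"
        using u um[OF u(1)] by (auto simp: level_def intro!: image_eqI[of _ _ "- u"])
      fix y assume "y \<in> level k"
      then obtain v where v: "v \<in> O\<^sub>K" "y = 3 ^ k * v" by (auto simp: level_def)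
      show "x \<otimes>\<^bsub>add_monoid ?R\<^esub> y \<in> level k"
        using u v cl(3)[OF u(1) v(1)]
        by (auto simp: level_def ring_of_type_algebra_def distrib_left intro!: image_eqI[of _ _ "u + v"])
    qed
    fix x y assume x: "x \<in> level k" and y: "y \<in> carrier ?R"
    then obtain u where u: "u \<in> O\<^sub>K" "x = 3 ^ k * u" by (auto simp: level_def)
    have yO: "y \<in> O\<^sub>K" using y by simp
    show "y \<otimes>\<^bsub>?R\<^esub> x \<in> level k" "x \<otimes>\<^bsub>?R\<^esub> y \<in> level k"
      using u cl(5)[OF u(1) yO]
      by (auto simp: level_def ring_of_type_algebra_def mult_ac intro!: image_eqI[of _ _ "u * y"])
  qed
  moreover have "level k \<noteq> {0}"
  proof
    assume eq: "level k = {0}"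
    have "3 ^ k * 1 \<in> level k" unfolding level_def by (rule imageI) (rule cl(1))
    then have "(3::real) ^ k = 0" unfolding eq by simp
    then show False by simp
  qed
  ultimately show ?thesis unfolding nonzero_ideal_def by (rule conjI)
qed

text \<open>The ideal is principal, so the power of 3 can be pulled out of every
  combination.\<close>

lemma lin_combs_level: "lin_combs (level k) \<OO> = (\<lambda>E. 3 ^ k *\<^sub>R E) ` \<OO>"
proof
  show "lin_combs (level k) \<OO> \<subseteq> (\<lambda>E. 3 ^ k *\<^sub>R E) ` \<OO>"
  proof
    fix x assume "x \<in> lin_combs (level k) \<OO>"
    then obtain n :: nat and c v where x: "x = (\<Sum>j<n. c j *\<^sub>R v j)" "\<forall>j<n. c j \<in> level k \<and> v j \<in> \<OO>"
      unfolding lin_combs_def by blast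
    then have "\<forall>j<n. \<exists>u\<in>O\<^sub>K. c j = 3 ^ k * u" by (auto simp: level_def)
    then have "\<forall>j. \<exists>u. j < n \<longrightarrow> u \<in> O\<^sub>K \<and> c j = 3 ^ k * u" by blast
    from choice[OF this] obtain u where u: "\<And>j. j < n \<Longrightarrow> u j \<in> O\<^sub>K" "\<And>j. j < n \<Longrightarrow> c j = 3 ^ k * u j" by blast
    have "x = 3 ^ k *\<^sub>R (\<Sum>j<n. u j *\<^sub>R v j)" unfolding x(1) using u(2) by (simp add: scaleR_right.sum)
    moreover have "(\<Sum>j<n. u j *\<^sub>R v j) \<in> \<OO>" using u(1) x(2) by (intro O_sum O_scale) auto
    ultimately show "x \<in> (\<lambda>E. 3 ^ k *\<^sub>R E) ` \<OO>" by blast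
  qed
  show "(\<lambda>E. 3 ^ k *\<^sub>R E) ` \<OO> \<subseteq> lin_combs (level k) \<OO>"
  proof
    fix x assume "x \<in> (\<lambda>E. 3 ^ k *\<^sub>R E) ` \<OO>"
    then obtain E where E: "E \<in> \<OO>" "x = 3 ^ k *\<^sub>R E" by blast
    have "3 ^ k * 1 \<in> level k" unfolding level_def by (rule imageI) (rule ring_of_integers_closed(1)[OF F])
    then show "x \<in> lin_combs (level k) \<OO>" unfolding lin_combs_def
      by (intro CollectI exI[of _ "1::nat"] exI[of _ "\<lambda>_. 3 ^ k"] exI[of _ "\<lambda>_. E"]) (use E in simp)
  qed
qed

text \<open>The unit quaternion is abbreviated without reference to the level, as it serves as base
  point of the congruences at every \<open>k\<close>.\<close>

abbreviation "Q1 \<equiv> (1, 0, 0, 0) :: quat"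

definition cj :: "quat \<Rightarrow> quat" where "cj q = red_trace q *\<^sub>R Q1 - q"

definition L where "L k = norm_one_level a b \<OO> (level k)"

lemma L_iff: "D \<in> L k \<longleftrightarrow> D \<in> \<OO> \<and> red_norm a b D = 1 \<and> (\<exists>E\<in>\<OO>. D = Q1 + 3 ^ k *\<^sub>R E)"
proof -
  have "D - Q1 = 3 ^ k *\<^sub>R E \<longleftrightarrow> D = Q1 + 3 ^ k *\<^sub>R E" for E by (auto simp: algebra_simps)
  then show ?thesis
    unfolding L_def norm_one_level_def norm_one_def lin_combs_level image_iff by auto
qed

lemma L_O: "D \<in> L k \<Longrightarrow> D \<in> \<OO>" and L_B: "D \<in> L k \<Longrightarrow> D \<in> B" and L_norm: "D \<in> L k \<Longrightarrow> red_norm a b D = 1"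
  using OB unfolding L_iff by blast+

lemma det_L: "D \<in> L k \<Longrightarrow> det (\<xi> D) = 1"
  using det_xi[OF L_B] L_norm by simp

lemma cj_O: "q \<in> \<OO> \<Longrightarrow> cj q \<in> \<OO>"
  unfolding cj_def using order_integral(1) O_one by (intro O_diff O_scale)

lemma quat_identities:
  "quat_mult a b q (cj q) = red_norm a b q *\<^sub>R Q1" "red_norm a b (cj q) = red_norm a b q"
  "quat_mult a b (x - y) z = quat_mult a b x z - quat_mult a b y z"
  "quat_mult a b (x + y) z = quat_mult a b x z + quat_mult a b y z"
  "quat_mult a b (c *\<^sub>R x) z = c *\<^sub>R quat_mult a b x z" "quat_mult a b Q1 z = z"
  by (cases q; cases x; cases y; cases z; simp add: cj_def power2_eq_square algebra_simps)+

lemma red_norm_mult: "x \<in> B \<Longrightarrow> y \<in> B \<Longrightarrow> red_norm a b (quat_mult a b x y) = red_norm a b x * red_norm a b y"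
  using det_xi[OF mult_B, of x y] xi_mult[of x y] det_xi[of x] det_xi[of y] by (simp add: det_mul)

lemma xi_cj: assumes "D \<in> L k" shows "\<xi> (cj D) = adj2 (\<xi> D)"
proof -
  have D: "D \<in> B" "cj D \<in> B" using L_B[OF assms] cj_O[OF L_O[OF assms]] OB by blast+
  have "\<xi> D ** \<xi> (cj D) = mat 1"
    using xi_mult[OF D] quat_identities(1)[of D] L_norm[OF assms] xi_one by simp
  then have "adj2 (\<xi> D) ** (\<xi> D ** \<xi> (cj D)) = adj2 (\<xi> D)" by simp
  then show ?thesis using adj2_mult(1)[OF det_L[OF assms]] by (simp add: matrix_mul_assoc)
qed

lemma L_mult: assumes "x \<in> L k" "y \<in> L k" shows "quat_mult a b x y \<in> L k"
proof -
  obtain E E' where E: "E \<in> \<OO>" "x = Q1 + 3 ^ k *\<^sub>R E" "E' \<in> \<OO>" "y = Q1 + 3 ^ k *\<^sub>R E'"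
    using assms unfolding L_iff by blast
  have "quat_mult a b x y = y + 3 ^ k *\<^sub>R quat_mult a b E y"
    unfolding E(2) by (simp only: quat_identities)
  also have "\<dots> = Q1 + 3 ^ k *\<^sub>R (E' + quat_mult a b E y)" unfolding E(4) by (simp add: scaleR_right_distrib add.assoc)
  finally have "quat_mult a b x y = Q1 + 3 ^ k *\<^sub>R (E' + quat_mult a b E y)" .
  moreover have "E' + quat_mult a b E y \<in> \<OO>" using E L_O[OF assms(2)] by (intro O_add O_mult)
  moreover have "quat_mult a b x y \<in> \<OO>" by (rule O_mult[OF L_O L_O, OF assms])
  moreover have "red_norm a b (quat_mult a b x y) = 1"
    using red_norm_mult[OF L_B L_B, OF assms] L_norm[OF assms(1)] L_norm[OF assms(2)] by simp
  ultimately show ?thesis unfolding L_iff by blast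
qed

text \<open>Split \<open>x cj(y)\<close> into \<open>y cj(y)\<close>, which is the norm 1, and
  \<open>(x - y) cj(y)\<close>. Congruent elements thus lie in the same coset, so counting
  congruence classes bounds the index.\<close>

lemma L_quotient:
  assumes "x \<in> L k" "y \<in> L k" "x - y = 3 ^ j *\<^sub>R E" "E \<in> \<OO>" shows "quat_mult a b x (cj y) \<in> L j"
proof -
  have O: "cj y \<in> \<OO>" by (rule cj_O[OF L_O[OF assms(2)]])
  have "quat_mult a b x (cj y) = quat_mult a b y (cj y) + quat_mult a b (x - y) (cj y)"
    by (simp only: quat_identities(3)) simp
  also have "\<dots> = Q1 + 3 ^ j *\<^sub>R quat_mult a b E (cj y)"
    unfolding assms(3) using quat_identities(1)[of y] L_norm[OF assms(2)] by (simp only: quat_identities(5)) simp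
  finally have "quat_mult a b x (cj y) = Q1 + 3 ^ j *\<^sub>R quat_mult a b E (cj y)" .
  moreover have "red_norm a b (quat_mult a b x (cj y)) = 1"
    using red_norm_mult[OF L_B[OF assms(1)] subsetD[OF OB O]] quat_identities(2)[of y]
      L_norm[OF assms(1)] L_norm[OF assms(2)] by simp
  ultimately show ?thesis unfolding L_iff using O_mult[OF L_O[OF assms(1)] O] O_mult[OF assms(4) O] by blast
qed

lemma L_one: "Q1 \<in> L k"
proof -
  have "0 \<in> \<OO>" using O_diff[OF O_one O_one] by simp
  moreover have "Q1 = Q1 + 3 ^ k *\<^sub>R 0" by simp
  moreover have "red_norm a b Q1 = 1" by simp
  ultimately show ?thesis unfolding L_iff using O_one by blast
qed

lemma L_cj: assumes "x \<in> L k" shows "cj x \<in> L k"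
proof -
  obtain E where E: "E \<in> \<OO>" "x = Q1 + 3 ^ k *\<^sub>R E" using assms unfolding L_iff by blast
  have "quat_mult a b Q1 (cj x) \<in> L k"
    by (rule L_quotient[OF L_one assms, of k "- E"]) (use E O_uminus in auto)
  then show ?thesis by (simp only: quat_identities)
qed

text \<open>
  If \<open>D = 1 + 3\<^sup>k E\<close> has norm \<open>1\<close> and \<open>k > 0\<close>, then \<open>tr E = - 3\<^sup>k nrd E\<close> is divisible by \<open>3\<close>,
  so \<open>E\<close> is congruent modulo \<open>3\<close> to an element of trace zero. These form a lattice of rank \<open>3 deg\<close>.
\<close>

lemma L_trace_zero_representative:
  assumes D: "D \<in> L (Suc k)"
  obtains E s where "E \<in> \<OO>" "D = Q1 + 3 ^ Suc k *\<^sub>R E" "s \<in> O\<^sub>K" "red_trace ((3 * s) *\<^sub>R Q1 - 2 *\<^sub>R E) = 0"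
proof -
  obtain E where E: "E \<in> \<OO>" "D = Q1 + 3 ^ Suc k *\<^sub>R E" using D unfolding L_iff by blast
  have norm: "red_norm a b (Q1 + c *\<^sub>R E) = 1 + c * red_trace E + c\<^sup>2 * red_norm a b E" for c
    by (cases E) (simp add: power2_eq_square algebra_simps)
  have "3 ^ Suc k * (red_trace E + 3 ^ Suc k * red_norm a b E) = 0"
    using norm[of "3 ^ Suc k"] L_norm[OF D] by (simp add: E(2) power2_eq_square algebra_simps)
  then have tr: "red_trace E = - (3 ^ Suc k * red_norm a b E)" by (simp add: add_eq_0_iff)
  \<comment> \<open>Now \<open>tr E = 3 s\<close>, so \<open>3 s - 2 E\<close> has trace zero, and
    it is congruent to \<open>E\<close> modulo 3.\<close>
  define s where "s = - (3 ^ k * red_norm a b E)"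
  have "s \<in> O\<^sub>K"
    using ring_of_integers_closed(4)[OF F ring_of_integers_closed(2)[OF F]
        ring_of_integers_closed(5)[OF F pow3 order_integral(2)[OF E(1)]]] by (simp add: s_def)
  moreover have "red_trace ((3 * s) *\<^sub>R Q1 - 2 *\<^sub>R E) = 2 * (3 * s) - 2 * red_trace E"
    by (cases E) simp
  then have "red_trace ((3 * s) *\<^sub>R Q1 - 2 *\<^sub>R E) = 0" unfolding tr s_def by simp
  ultimately show ?thesis using that E by blast
qed

text \<open>Trace zero removes one of the four blocks of coordinates, lowering the rank from
  \<open>4 * deg\<close> to \<open>3 * deg\<close>.\<close>

lemma coords:
  obtains e :: "nat \<Rightarrow> real" where
    "\<And>x. x \<in> B \<Longrightarrow> \<exists>c. x = (\<Sum>(p, i)\<in>{..<4} \<times> {..<deg}. of_rat (c (p, i)) *\<^sub>R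
        (if p = 0 then (e i, 0, 0, 0) else if p = Suc 0 then (0, e i, 0, 0) else if p = 2 then (0, 0, e i, 0) else (0, 0, 0, e i)))"
    "\<And>x. x \<in> B \<Longrightarrow> red_trace x = 0 \<Longrightarrow> \<exists>c. x = (\<Sum>(p, i)\<in>{..<3} \<times> {..<deg}. of_rat (c (p, i)) *\<^sub>R
        (if p = 0 then (0, e i, 0, 0) else if p = Suc 0 then (0, 0, e i, 0) else (0, 0, 0, e i)))"
proof -
  obtain e where e: "\<And>x. x \<in> K \<Longrightarrow> \<exists>c. x = (\<Sum>i<deg. of_rat (c i) * (e i :: real))"
    using number_field_basis[OF nf] unfolding deg_def by blast
  have sums: "(\<Sum>i<n. (g i, 0::real, 0::real, 0::real)) = ((\<Sum>i<n. g i), 0, 0, 0)"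
    "(\<Sum>i<n. (0::real, g i, 0::real, 0::real)) = (0, (\<Sum>i<n. g i), 0, 0)"
    "(\<Sum>i<n. (0::real, 0::real, g i, 0::real)) = (0, 0, (\<Sum>i<n. g i), 0)"
    "(\<Sum>i<n. (0::real, 0::real, 0::real, g i)) = (0, 0, 0, (\<Sum>i<n. g i))"
    for g :: "nat \<Rightarrow> real" and n :: nat
    by (induction n) (simp_all add: zero_prod_def)
  show ?thesis
  proof (rule that[of e])
    fix x assume x: "x \<in> B"
    obtain x0 x1 x2 x3 where x': "x = (x0, x1, x2, x3)" by (cases x)
    have K: "x0 \<in> K" "x1 \<in> K" "x2 \<in> K" "x3 \<in> K" using x by (simp_all add: x')
    obtain c0 where c0: "x0 = (\<Sum>i<deg. of_rat (c0 i) * e i)" using e[OF K(1)] by blast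
    obtain c1 where c1: "x1 = (\<Sum>i<deg. of_rat (c1 i) * e i)" using e[OF K(2)] by blast
    obtain c2 where c2: "x2 = (\<Sum>i<deg. of_rat (c2 i) * e i)" using e[OF K(3)] by blast
    obtain c3 where c3: "x3 = (\<Sum>i<deg. of_rat (c3 i) * e i)" using e[OF K(4)] by blast
    note c = c0 c1 c2 c3
    show "\<exists>c. x = (\<Sum>(p, i)\<in>{..<4} \<times> {..<deg}. of_rat (c (p, i)) *\<^sub>R
        (if p = 0 then (e i, 0, 0, 0) else if p = Suc 0 then (0, e i, 0, 0) else if p = 2 then (0, 0, e i, 0) else (0, 0, 0, e i)))"
      by (rule exI[of _ "\<lambda>(p, i). if p = 0 then c0 i else if p = Suc 0 then c1 i else if p = 2 then c2 i else c3 i"])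
        (simp add: sum.cartesian_product[symmetric] numeral_eq_Suc sums x' c)
    assume "red_trace x = 0"
    then have "x0 = 0" by (simp add: x')
    then show "\<exists>c. x = (\<Sum>(p, i)\<in>{..<3} \<times> {..<deg}. of_rat (c (p, i)) *\<^sub>R
        (if p = 0 then (0, e i, 0, 0) else if p = Suc 0 then (0, 0, e i, 0) else (0, 0, 0, e i)))"
      by (intro exI[of _ "\<lambda>(p, i). if p = 0 then c1 i else if p = Suc 0 then c2 i else c3 i"])
        (simp add: sum.cartesian_product[symmetric] numeral_eq_Suc sums x' c(2-4))
  qed
qed

lemma card_incongruent_O:
  assumes Y: "finite Y" "Y \<subseteq> \<OO>" and inc: "\<And>x y m. x \<in> Y \<Longrightarrow> y \<in> Y \<Longrightarrow> m \<in> \<OO> \<Longrightarrow> x - y = 3 *\<^sub>R m \<Longrightarrow> x = y"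
  shows "card Y \<le> 3 ^ (4 * deg)"
proof -
  obtain e :: "nat \<Rightarrow> real" where e: "\<And>x. x \<in> B \<Longrightarrow> \<exists>c. x = (\<Sum>(p, i)\<in>{..<4} \<times> {..<deg}. of_rat (c (p, i)) *\<^sub>R
        (if p = 0 then (e i, 0, 0, 0) else if p = Suc 0 then (0, e i, 0, 0) else if p = 2 then (0, 0, e i, 0) else (0, 0, 0, e i)))"
    by (rule coords) blast
  have "card Y \<le> 3 ^ card ({..<4::nat} \<times> {..<deg})"
  proof (rule card_incongruent_le_index[where M = \<OO> and
        e = "\<lambda>(p, i). if p = 0 then (e i, 0, 0, 0) else if p = Suc 0 then (0, e i, 0, 0) else if p = 2 then (0, 0, e i, 0) else (0, 0, 0, e i)"])
    show "0 \<in> \<OO>" using O_diff[OF O_one O_one] by simp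
    fix x assume "x \<in> \<OO>"
    then have "x \<in> B" using OB by blast
    from e[OF this] show "\<exists>c. x = (\<Sum>i\<in>{..<4} \<times> {..<deg}. of_rat (c i) *\<^sub>R
       (case i of (p, i) \<Rightarrow> if p = 0 then (e i, 0, 0, 0) else if p = Suc 0 then (0, e i, 0, 0) else if p = 2 then (0, 0, e i, 0) else (0, 0, 0, e i)))"
      by (simp add: case_prod_unfold)
  qed (use Y inc O_diff in auto)
  then show ?thesis by (simp add: card_cartesian_product)
qed

lemma card_incongruent_trace_zero:
  assumes Y: "finite Y" "Y \<subseteq> {x \<in> \<OO>. red_trace x = 0}"
    and inc: "\<And>x y m. x \<in> Y \<Longrightarrow> y \<in> Y \<Longrightarrow> m \<in> \<OO> \<Longrightarrow> x - y = 3 *\<^sub>R m \<Longrightarrow> x = y"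
  shows "card Y \<le> 3 ^ (3 * deg)"
proof -
  obtain e :: "nat \<Rightarrow> real" where e: "\<And>x. x \<in> B \<Longrightarrow> red_trace x = 0 \<Longrightarrow> \<exists>c. x = (\<Sum>(p, i)\<in>{..<3} \<times> {..<deg}. of_rat (c (p, i)) *\<^sub>R
        (if p = 0 then (0, e i, 0, 0) else if p = Suc 0 then (0, 0, e i, 0) else (0, 0, 0, e i)))"
    by (rule coords) blast
  have "card Y \<le> 3 ^ card ({..<3::nat} \<times> {..<deg})"
  proof (rule card_incongruent_le_index[where M = "{x \<in> \<OO>. red_trace x = 0}" and
        e = "\<lambda>(p, i). if p = 0 then (0, e i, 0, 0) else if p = Suc 0 then (0, 0, e i, 0) else (0, 0, 0, e i)"])
    show "0 \<in> {x \<in> \<OO>. red_trace x = 0}" using O_diff[OF O_one O_one] by (simp add: zero_prod_def)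
    fix x assume x: "x \<in> {x \<in> \<OO>. red_trace x = 0}"
    then have "x \<in> B" "red_trace x = 0" using OB by blast+
    from e[OF this] show "\<exists>c. x = (\<Sum>i\<in>{..<3} \<times> {..<deg}. of_rat (c i) *\<^sub>R
       (case i of (p, i) \<Rightarrow> if p = 0 then (0, e i, 0, 0) else if p = Suc 0 then (0, 0, e i, 0) else (0, 0, 0, e i)))"
      by (simp add: case_prod_unfold)
    fix y assume y: "y \<in> {x \<in> \<OO>. red_trace x = 0}"
    have "red_trace (x - y) = red_trace x - red_trace y" by (cases x; cases y) simp
    then show "x - y \<in> {x \<in> \<OO>. red_trace x = 0}" using x y O_diff[of x y] by simp
  qed (use Y inc in auto)
  then show ?thesis by (simp add: card_cartesian_product)
qed

text \<open>For \<open>k = 0\<close> no condition on the trace is available, hence the exponent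
  \<open>4 * deg\<close>. For larger \<open>k\<close> the trace zero elements \<open>f D\<close> are
  congruent to \<open>E D\<close> modulo 3, so incongruent \<open>D\<close> give incongruent
  \<open>f D\<close>.\<close>

lemma card_L_incongruent:
  assumes Y: "finite Y" "Y \<subseteq> L k"
    and inc: "\<And>x y m. x \<in> Y \<Longrightarrow> y \<in> Y \<Longrightarrow> m \<in> \<OO> \<Longrightarrow> x - y = 3 ^ Suc k *\<^sub>R m \<Longrightarrow> x = y"
  shows "card Y \<le> (if k = 0 then 3 ^ (4 * deg) else 3 ^ (3 * deg))"
proof (cases k)
  case 0
  have "card Y \<le> 3 ^ (4 * deg)"
    by (rule card_incongruent_O[OF Y(1)]) (use Y(2) L_O inc 0 in auto)
  then show ?thesis using 0 by simp
next
  case (Suc k')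
  define P where "P D E s \<longleftrightarrow> E \<in> \<OO> \<and> D = Q1 + 3 ^ k *\<^sub>R E \<and> s \<in> O\<^sub>K \<and> red_trace ((3 * s) *\<^sub>R Q1 - 2 *\<^sub>R E) = 0" for D E s
  have "\<exists>Es. D \<in> Y \<longrightarrow> P D (fst Es) (snd Es)" for D
  proof (cases "D \<in> Y")
    case True
    then have "D \<in> L (Suc k')" using Y(2) Suc by blast
    then obtain E s where "E \<in> \<OO>" "D = Q1 + 3 ^ Suc k' *\<^sub>R E" "s \<in> O\<^sub>K" "red_trace ((3 * s) *\<^sub>R Q1 - 2 *\<^sub>R E) = 0"
      by (rule L_trace_zero_representative)
    then have "P D E s" unfolding P_def Suc by blast
    then show ?thesis by (intro exI[of _ "(E, s)"]) simp
  qed blast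
  then have "\<forall>D. \<exists>Es. D \<in> Y \<longrightarrow> P D (fst Es) (snd Es)" by blast
  from choice[OF this] obtain h where h: "\<And>D. D \<in> Y \<Longrightarrow> P D (fst (h D)) (snd (h D))" by blast
  define E s where "E = fst \<circ> h" and "s = snd \<circ> h"
  have Es: "P D (E D) (s D)" if D: "D \<in> Y" for D using h[OF D] by (simp add: E_def s_def)
  define f where "f D = (3 * s D) *\<^sub>R Q1 - 2 *\<^sub>R E D" for D
  have fO: "f D \<in> {x \<in> \<OO>. red_trace x = 0}" if D: "D \<in> Y" for D
  proof -
    have "3 * s D \<in> O\<^sub>K" "2 \<in> O\<^sub>K"
      using Es[OF D] ring_of_integers_closed(5)[OF F pow3[of 1], of "s D"] ring_of_integers_closed(6)[OF F, of 2]
      by (auto simp: P_def)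
    then show ?thesis using Es[OF D] O_one unfolding f_def P_def by (auto intro!: O_diff O_scale simp del: scaleR_Pair)
  qed
  have eqD: "D = D'" if D: "D \<in> Y" "D' \<in> Y" and m: "m \<in> \<OO>" "f D - f D' = 3 *\<^sub>R m" for D D' m
  proof -
    note P = Es[OF D(1), unfolded P_def] Es[OF D(2), unfolded P_def]
    \<comment> \<open>\<open>f D - f D' = 3 m\<close> reads
      \<open>3 (s D - s D') - 2 (E D - E D') = 3 m\<close>; solving for \<open>E D - E D'\<close>
      gives three times this element.\<close>
    define m' where "m' = (E D - E D') + m - (s D - s D') *\<^sub>R Q1"
    have "m' \<in> \<OO>" unfolding m'_def
      using P m O_one ring_of_integers_closed(4)[OF F, of "s D" "s D'"] by (intro O_diff O_add O_scale) auto
    moreover have "E D - E D' = 3 *\<^sub>R m'"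
    proof -
      have "3 *\<^sub>R m' = 3 *\<^sub>R (E D - E D') + (f D - f D') - (3 * (s D - s D')) *\<^sub>R Q1"
        unfolding m'_def m(2) by (simp add: scaleR_diff_right scaleR_add_right del: scaleR_Pair)
      also have "\<dots> = E D - E D'"
        unfolding f_def by (cases "E D"; cases "E D'") (simp add: algebra_simps)
      finally show ?thesis by simp
    qed
    then have "D - D' = 3 ^ Suc k *\<^sub>R m'"
    proof -
      have "D - D' = (Q1 + 3 ^ k *\<^sub>R E D) - (Q1 + 3 ^ k *\<^sub>R E D')"
        by (rule arg_cong2[where f = "(-)"]) (use P in blast)+
      also have "\<dots> = 3 ^ k *\<^sub>R (E D - E D')" by (simp add: scaleR_diff_right del: scaleR_Pair)
      also have "\<dots> = 3 ^ Suc k *\<^sub>R m'" unfolding \<open>E D - E D' = 3 *\<^sub>R m'\<close> by (simp add: mult.commute)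
      finally show ?thesis .
    qed
    ultimately show ?thesis using inc[OF D] by blast
  qed
  have "inj_on f Y"
  proof (rule inj_onI)
    fix D D' assume D: "D \<in> Y" "D' \<in> Y" "f D = f D'"
    have "0 \<in> \<OO>" using O_diff[OF O_one O_one] by simp
    then show "D = D'" using eqD[OF D(1,2), of 0] D(3) by simp
  qed
  then have "card Y = card (f ` Y)" by (simp add: card_image)
  also have "\<dots> \<le> 3 ^ (3 * deg)"
  proof (rule card_incongruent_trace_zero)
    show "finite (f ` Y)" using Y(1) by simp
    show "f ` Y \<subseteq> {x \<in> \<OO>. red_trace x = 0}" using fO by (rule image_subsetI)
    fix x y m assume x: "x \<in> f ` Y" and y: "y \<in> f ` Y" and m: "m \<in> \<OO>" "x - y = 3 *\<^sub>R m"
    obtain D where D: "D \<in> Y" "x = f D" using x by (rule imageE)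
    obtain D' where D': "D' \<in> Y" "y = f D'" using y by (rule imageE)
    show "x = y" using eqD[OF D(1) D'(1) m(1) m(2)[unfolded D(2) D'(2)]] unfolding D(2) D'(2) by (rule arg_cong)
  qed
  finally show ?thesis using Suc by simp
qed

end

section \<open>The tower of congruence subgroups\<close>

locale congruence_setting = surface_group \<Gamma> + number_quat_order "inv_trace_field \<Gamma>" a b \<xi> \<OO>
  for \<Gamma> a b \<xi> \<OO> +
  fixes r :: nat
  assumes squares: "lifts (squares_subgroup \<Gamma>) \<subseteq> \<xi> ` norm_one a b \<OO>"
    and r: "r \<ge> 1" and embedding: "admits_modular_embedding \<Gamma> r"
    and cofinite: "cofinite_group \<Gamma>"
begin

abbreviation "K \<equiv> inv_trace_field \<Gamma>"

definition G where "G k = congruence_subgroup \<Gamma> a b \<OO> \<xi> (level k)"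

lemma G_iff: "\<gamma> \<in> G k \<longleftrightarrow> \<gamma> \<in> \<Gamma> \<and> (\<exists>D\<in>L k. \<gamma> = PSL_proj (\<xi> D))"
proof -
  have "\<gamma> \<in> G k \<longleftrightarrow> (\<exists>A. A \<in> lifts \<Gamma> \<and> (\<exists>D\<in>L k. A = \<xi> D) \<and> \<gamma> = PSL_proj A)"
    unfolding G_def congruence_subgroup_def L_def by blast
  also have "\<dots> \<longleftrightarrow> (\<exists>D\<in>L k. \<xi> D \<in> lifts \<Gamma> \<and> \<gamma> = PSL_proj (\<xi> D))" by blast
  also have "\<dots> \<longleftrightarrow> (\<exists>D\<in>L k. PSL_proj (\<xi> D) \<in> \<Gamma> \<and> \<gamma> = PSL_proj (\<xi> D))"
    unfolding lifts_iff using det_L by blast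
  finally show ?thesis by blast
qed

lemma G_le: "G k \<subseteq> \<Gamma>" unfolding G_iff subset_iff by blast

lemma quotient_G:
  assumes x: "x = PSL_proj (\<xi> D)" "x \<in> \<Gamma>" "D \<in> L k" and y: "y = PSL_proj (\<xi> D')" "y \<in> \<Gamma>" "D' \<in> L k"
    and E: "D - D' = 3 ^ j *\<^sub>R E" "E \<in> \<OO>"
  shows "x \<otimes>\<^bsub>PSL2R\<^esub> inv\<^bsub>PSL2R\<^esub> y \<in> G j"
proof -
  have "x \<otimes>\<^bsub>PSL2R\<^esub> inv\<^bsub>PSL2R\<^esub> y = PSL_proj (\<xi> (quat_mult a b D (cj D')))"
    unfolding x(1) y(1) PSL_inv[OF det_L[OF y(3)]] PSL_mult
    using xi_mult[OF L_B[OF x(3)] L_B[OF L_cj[OF y(3)]]] xi_cj[OF y(3)] by simp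
  then show ?thesis
    unfolding G_iff using mult_in[OF x(2) inv_in[OF y(2)]] L_quotient[OF x(3) y(3) E] by blast
qed

lemma O_zero: "0 \<in> \<OO>" using O_diff[OF O_one O_one] by simp

lemma G_one: "\<one>\<^bsub>PSL2R\<^esub> \<in> G k"
  unfolding G_iff PSL_one using one_in L_one xi_one by (metis PSL_one)

lemma G_sub: "subgroup (G k) PSL2R"
proof (rule group.subgroupI[OF PSL2R_group])
  show "G k \<subseteq> carrier PSL2R" using G_le in_PSL by blast
  show "G k \<noteq> {}" using G_one by blast
  fix x assume "x \<in> G k"
  then obtain D where D: "x \<in> \<Gamma>" "D \<in> L k" "x = PSL_proj (\<xi> D)" unfolding G_iff by blast
  have "inv\<^bsub>PSL2R\<^esub> x = PSL_proj (\<xi> (cj D))"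
    unfolding D(3) PSL_inv[OF det_L[OF D(2)]] xi_cj[OF D(2)] ..
  then show "inv\<^bsub>PSL2R\<^esub> x \<in> G k" unfolding G_iff using inv_in[OF D(1)] L_cj[OF D(2)] by blast
  fix y assume "y \<in> G k"
  then obtain D' where D': "y \<in> \<Gamma>" "D' \<in> L k" "y = PSL_proj (\<xi> D')" unfolding G_iff by blast
  have "x \<otimes>\<^bsub>PSL2R\<^esub> y = PSL_proj (\<xi> (quat_mult a b D D'))"
    unfolding D(3) D'(3) PSL_mult xi_mult[OF L_B[OF D(2)] L_B[OF D'(2)]] ..
  then show "x \<otimes>\<^bsub>PSL2R\<^esub> y \<in> G k" unfolding G_iff using mult_in[OF D(1) D'(1)] L_mult[OF D(2) D'(2)] by blast
qed

lemma G_Suc: "G (Suc k) \<subseteq> G k"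
proof
  fix x assume "x \<in> G (Suc k)"
  then obtain D where D: "x \<in> \<Gamma>" "D \<in> L (Suc k)" "x = PSL_proj (\<xi> D)" unfolding G_iff by blast
  obtain E where E: "D \<in> \<OO>" "red_norm a b D = 1" "E \<in> \<OO>" "D = Q1 + 3 ^ Suc k *\<^sub>R E"
    using D(2) unfolding L_iff by blast
  have "3 *\<^sub>R E \<in> \<OO>" using O_scale[OF pow3[of 1] E(3)] by (simp del: scaleR_Pair)
  moreover have "D = Q1 + 3 ^ k *\<^sub>R (3 *\<^sub>R E)" unfolding E(4) by (simp add: mult.commute del: scaleR_Pair)
  ultimately have "D \<in> L k" unfolding L_iff using E(1,2) by blast
  then show "x \<in> G k" unfolding G_iff using D by blast
qed

text \<open>A maximal set of elements whose chosen quaternions are incongruent modulo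
  \<open>3 ^ Suc k\<close> represents all cosets, by \<open>quotient_G\<close>.\<close>

lemma cover_step:
  obtains S where "cover (G (Suc k)) (G k) S" "card S \<le> (if k = 0 then 3 ^ (4 * deg) else 3 ^ (3 * deg))"
proof -
  have "\<forall>\<gamma>. \<exists>D. \<gamma> \<in> G k \<longrightarrow> D \<in> L k \<and> \<gamma> = PSL_proj (\<xi> D)" unfolding G_iff by blast
  from choice[OF this] obtain d where d: "\<And>\<gamma>. \<gamma> \<in> G k \<Longrightarrow> d \<gamma> \<in> L k" "\<And>\<gamma>. \<gamma> \<in> G k \<Longrightarrow> \<gamma> = PSL_proj (\<xi> (d \<gamma>))"
    by blast
  define R where "R \<gamma> \<delta> \<longleftrightarrow> (\<exists>m\<in>\<OO>. d \<gamma> - d \<delta> = 3 ^ Suc k *\<^sub>R m)" for \<gamma> \<delta>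
  have bound: "card Y \<le> (if k = 0 then 3 ^ (4 * deg) else 3 ^ (3 * deg))"
    if Y: "finite Y" "Y \<subseteq> G k" "\<forall>x\<in>Y. \<forall>y\<in>Y. R x y \<longrightarrow> x = y" for Y
  proof -
    have "inj_on d Y"
    proof (rule inj_onI)
      fix x y assume "x \<in> Y" "y \<in> Y" "d x = d y"
      then show "x = y" using d(2)[of x] d(2)[of y] Y(2) by auto
    qed
    then have "card Y = card (d ` Y)" by (rule card_image[symmetric])
    also have "\<dots> \<le> (if k = 0 then 3 ^ (4 * deg) else 3 ^ (3 * deg))"
    proof (rule card_L_incongruent)
      show "finite (d ` Y)" using Y(1) by simp
      show "d ` Y \<subseteq> L k" using d(1) Y(2) by blast
      fix x y m assume x: "x \<in> d ` Y" and y: "y \<in> d ` Y" and m: "m \<in> \<OO>" "x - y = 3 ^ Suc k *\<^sub>R m"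
      obtain \<gamma> where \<gamma>: "\<gamma> \<in> Y" "x = d \<gamma>" using x by blast
      obtain \<delta> where \<delta>: "\<delta> \<in> Y" "y = d \<delta>" using y by blast
      have "R \<gamma> \<delta>" unfolding R_def using m unfolding \<gamma>(2) \<delta>(2) by blast
      then have "\<gamma> = \<delta>" using Y(3) \<gamma>(1) \<delta>(1) by blast
      then show "x = y" unfolding \<gamma>(2) \<delta>(2) by (rule arg_cong)
    qed
    finally show ?thesis .
  qed
  have sym: "R y x" if xy: "R x y" for x y
  proof -
    obtain m where m: "m \<in> \<OO>" "d x - d y = 3 ^ Suc k *\<^sub>R m" using xy unfolding R_def by blast
    have "d y - d x = - (d x - d y)" by (rule minus_diff_eq[symmetric])
    also have "\<dots> = 3 ^ Suc k *\<^sub>R (- m)" unfolding m(2) by (rule scaleR_minus_right[symmetric])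
    finally show ?thesis unfolding R_def using O_uminus[OF m(1)] by blast
  qed
  have refl: "R x x" for x unfolding R_def by (rule bexI[OF _ O_zero]) (simp del: scaleR_Pair)
  obtain Y where Y: "finite Y" "Y \<subseteq> G k" "card Y \<le> (if k = 0 then 3 ^ (4 * deg) else 3 ^ (3 * deg))"
      "\<forall>x\<in>G k. \<exists>y\<in>Y. R x y"
    by (rule maximal_incongruent_subset[of "G k" R, OF bound sym refl])
  have "cover (G (Suc k)) (G k) Y"
    unfolding cover_def
  proof (intro conjI subsetI)
    fix x assume x: "x \<in> G k"
    then obtain y m where y: "y \<in> Y" "m \<in> \<OO>" "d x - d y = 3 ^ Suc k *\<^sub>R m" using Y(4) unfolding R_def by blast
    have yG: "y \<in> G k" using y(1) Y(2) by blast
    have xyc: "x \<in> carrier PSL2R" "y \<in> carrier PSL2R" "x \<in> \<Gamma>" "y \<in> \<Gamma>" using x yG G_le in_PSL by blast+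
    have "x \<otimes>\<^bsub>PSL2R\<^esub> inv\<^bsub>PSL2R\<^esub> y \<in> G (Suc k)"
      by (rule quotient_G[OF d(2)[OF x] xyc(3) d(1)[OF x] d(2)[OF yG] xyc(4) d(1)[OF yG] y(3,2)])
    moreover have "x = x \<otimes>\<^bsub>PSL2R\<^esub> inv\<^bsub>PSL2R\<^esub> y \<otimes>\<^bsub>PSL2R\<^esub> y"
      using group.inv_solve_right'[OF PSL2R_group, of "x \<otimes>\<^bsub>PSL2R\<^esub> inv\<^bsub>PSL2R\<^esub> y" x y] xyc
        monoid.m_closed[OF group.is_monoid[OF PSL2R_group]] group.inv_closed[OF PSL2R_group] by simp
    ultimately show "x \<in> (\<Union>\<rho>\<in>Y. G (Suc k) #>\<^bsub>PSL2R\<^esub> \<rho>)" unfolding r_coset_def using y(1) by blast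
  qed (use Y in auto)
  then show ?thesis using Y(3) by (rule that)
qed

text \<open>For \<open>k = 0\<close> the congruence is void, so \<open>G 0\<close> contains
  everything in \<Gamma> that lifts to the norm-one group.\<close>

lemma square_in_G0: assumes "\<gamma> \<in> \<Gamma>" shows "\<gamma> \<otimes>\<^bsub>PSL2R\<^esub> \<gamma> \<in> G 0"
proof -
  have "\<gamma> \<otimes>\<^bsub>PSL2R\<^esub> \<gamma> \<in> squares_subgroup \<Gamma>"
    unfolding squares_subgroup_def by (rule generate.incl) (use assms in blast)
  moreover obtain A where A: "det A = 1" "PSL_proj A = \<gamma> \<otimes>\<^bsub>PSL2R\<^esub> \<gamma>"
    using lift_exists[OF in_PSL[OF mult_in[OF assms assms]]] by blast
  ultimately have "A \<in> lifts (squares_subgroup \<Gamma>)" unfolding lifts_iff by simp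
  then obtain D where D: "A = \<xi> D" "D \<in> norm_one a b \<OO>" using squares by blast
  have DO: "D \<in> \<OO>" "red_norm a b D = 1" using D(2) unfolding norm_one_def by blast+
  have "D = Q1 + 3 ^ 0 *\<^sub>R (D - Q1)" by (simp del: scaleR_Pair)
  then have "D \<in> L 0" unfolding L_iff using DO O_diff[OF DO(1) O_one] by blast
  then show ?thesis unfolding G_iff using mult_in[OF assms assms] A(2) D(1) by blast
qed

text \<open>\<Gamma> itself may fail to lift to the order; finite generation together with the
  squares gives the finite index of \<open>G 0\<close>.\<close>

lemma cover_G0: obtains R where "cover (G 0) \<Gamma> R"
proof -
  let ?P = "PSL2R\<lparr>carrier := \<Gamma>\<rparr>"
  interpret P: group PSL2R by (rule PSL2R_group)
  interpret Q: group ?P by (rule subgroup.subgroup_is_group[OF sub PSL2R_group])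
  obtain T where T: "finite T" "T \<subseteq> \<Gamma>" "\<Gamma> = generate PSL2R T" by (rule finitely_generated)
  have fin: "finite (rcosets\<^bsub>?P\<^esub> (G 0))"
  proof (rule Q.finite_index_if_squares[OF T(1)])
    show "T \<subseteq> carrier ?P" using T(2) by simp
    show "carrier ?P = generate ?P T" using P.generate_consistent[OF T(2) sub] T(3) by simp
    show "subgroup (G 0) ?P" by (rule P.subgroup_incl[OF G_sub sub G_le])
  qed (use square_in_G0 in simp)
  define pick where "pick C = (SOME x. x \<in> C)" for C :: "(real^2^2) set set"
  have c: "x \<in> carrier PSL2R" if x: "x \<in> G k" for x k using x G_le in_PSL by blast
  have coset: "x \<in> G 0 #>\<^bsub>PSL2R\<^esub> pick (G 0 #>\<^bsub>PSL2R\<^esub> x) \<and> pick (G 0 #>\<^bsub>PSL2R\<^esub> x) \<in> \<Gamma>"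
    if x: "x \<in> \<Gamma>" for x
  proof -
    have "\<one>\<^bsub>PSL2R\<^esub> \<otimes>\<^bsub>PSL2R\<^esub> x \<in> G 0 #>\<^bsub>PSL2R\<^esub> x" unfolding r_coset_def using G_one by blast
    then have "pick (G 0 #>\<^bsub>PSL2R\<^esub> x) \<in> G 0 #>\<^bsub>PSL2R\<^esub> x" unfolding pick_def by (rule someI)
    then obtain h where h: "h \<in> G 0" "pick (G 0 #>\<^bsub>PSL2R\<^esub> x) = h \<otimes>\<^bsub>PSL2R\<^esub> x" unfolding r_coset_def by blast
    have eq: "x = inv\<^bsub>PSL2R\<^esub> h \<otimes>\<^bsub>PSL2R\<^esub> (h \<otimes>\<^bsub>PSL2R\<^esub> x)"
      using P.inv_solve_left[OF in_PSL[OF x] c[OF h(1)] P.m_closed[OF c[OF h(1)] in_PSL[OF x]]] by simp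
    have "inv\<^bsub>PSL2R\<^esub> h \<otimes>\<^bsub>PSL2R\<^esub> (h \<otimes>\<^bsub>PSL2R\<^esub> x) \<in> G 0 #>\<^bsub>PSL2R\<^esub> (h \<otimes>\<^bsub>PSL2R\<^esub> x)"
      unfolding r_coset_def using subgroup.m_inv_closed[OF G_sub h(1)] by blast
    then have "x \<in> G 0 #>\<^bsub>PSL2R\<^esub> pick (G 0 #>\<^bsub>PSL2R\<^esub> x)" by (simp only: eq[symmetric] h(2))
    moreover have "h \<in> \<Gamma>" using h(1) G_le by blast
    ultimately show ?thesis using mult_in[OF _ x] h(2) by simp
  qed
  have eq: "rcosets\<^bsub>?P\<^esub> (G 0) = (\<lambda>x. G 0 #>\<^bsub>PSL2R\<^esub> x) ` \<Gamma>"
    unfolding RCOSETS_def r_coset_def by auto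
  have "cover (G 0) \<Gamma> (pick ` (\<lambda>x. G 0 #>\<^bsub>PSL2R\<^esub> x) ` \<Gamma>)"
    unfolding cover_def
  proof (intro conjI)
    show "finite (pick ` (\<lambda>x. G 0 #>\<^bsub>PSL2R\<^esub> x) ` \<Gamma>)" using fin unfolding eq by (rule finite_imageI)
    show "pick ` (\<lambda>x. G 0 #>\<^bsub>PSL2R\<^esub> x) ` \<Gamma> \<subseteq> \<Gamma>" using coset by auto
    show "\<Gamma> \<subseteq> (\<Union>\<rho>\<in>pick ` (\<lambda>x. G 0 #>\<^bsub>PSL2R\<^esub> x) ` \<Gamma>. G 0 #>\<^bsub>PSL2R\<^esub> \<rho>)"
    proof
      fix x assume x: "x \<in> \<Gamma>"
      have "pick (G 0 #>\<^bsub>PSL2R\<^esub> x) \<in> pick ` (\<lambda>x. G 0 #>\<^bsub>PSL2R\<^esub> x) ` \<Gamma>" using x by (intro imageI)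
      then show "x \<in> (\<Union>\<rho>\<in>pick ` (\<lambda>x. G 0 #>\<^bsub>PSL2R\<^esub> x) ` \<Gamma>. G 0 #>\<^bsub>PSL2R\<^esub> \<rho>)"
        by (rule UN_I) (rule conjunct1[OF coset[OF x]])
    qed
  qed
  then show ?thesis by (rule that)
qed

lemma cover_G:
  obtains C :: nat where "\<And>k. \<exists>R. cover (G k) \<Gamma> R \<and> card R \<le> C * 3 ^ (3 * deg * k)"
proof -
  obtain R0 where R0: "cover (G 0) \<Gamma> R0" by (rule cover_G0)
  \<comment> \<open>The factor \<open>3 ^ deg\<close> absorbs the first step, which costs
    \<open>4 * deg\<close> in the exponent instead of \<open>3 * deg\<close>.\<close>
  have *: "\<exists>R. cover (G k) \<Gamma> R \<and> card R \<le> card R0 * (if k = 0 then 1 else 3 ^ deg) * 3 ^ (3 * deg * k)" for k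
  proof (induction k)
    case 0
    show ?case by (intro exI[of _ R0] conjI R0) simp
  next
    case (Suc k)
    then obtain R where R: "cover (G k) \<Gamma> R" "card R \<le> card R0 * (if k = 0 then 1 else 3 ^ deg) * 3 ^ (3 * deg * k)"
      by blast
    obtain S where S: "cover (G (Suc k)) (G k) S" "card S \<le> (if k = 0 then 3 ^ (4 * deg) else 3 ^ (3 * deg))"
      by (rule cover_step)
    obtain T where T: "cover (G (Suc k)) \<Gamma> T" "card T \<le> card S * card R"
      by (rule cover_trans[OF R(1) S(1) sub G_le G_Suc])
    have "card T \<le> (if k = 0 then 3 ^ (4 * deg) else 3 ^ (3 * deg)) *
        (card R0 * (if k = 0 then 1 else 3 ^ deg) * 3 ^ (3 * deg * k))"
      using T(2) mult_le_mono[OF S(2) R(2)] by (rule order_trans)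
    also have "\<dots> = card R0 * 3 ^ deg * 3 ^ (3 * deg * Suc k)"
      by (simp add: power_add power_mult flip: power_mult_distrib)
    finally show ?case using T(1) by auto
  qed
  show ?thesis
  proof (rule that[of "card R0 * 3 ^ deg"])
    fix k
    obtain R where R: "cover (G k) \<Gamma> R" "card R \<le> card R0 * (if k = 0 then 1 else 3 ^ deg) * 3 ^ (3 * deg * k)"
      using * by blast
    have "card R0 * (if k = 0 then 1 else 3 ^ deg) * 3 ^ (3 * deg * k) \<le> card R0 * 3 ^ deg * 3 ^ (3 * deg * k)"
      by (intro mult_le_mono) auto
    then show "\<exists>R. cover (G k) \<Gamma> R \<and> card R \<le> card R0 * 3 ^ deg * 3 ^ (3 * deg * k)"
      using R by (meson order_trans)
  qed
qed

section \<open>Systole, degree and area along the tower\<close>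

lemma finite_cover_G:
  obtains R where "finite R" "R \<subseteq> \<Gamma>" "\<Gamma> \<subseteq> (\<Union>\<rho>\<in>R. G k #>\<^bsub>PSL2R\<^esub> \<rho>)"
proof -
  obtain C :: nat where C: "\<And>k. \<exists>R. cover (G k) \<Gamma> R \<and> card R \<le> C * 3 ^ (3 * deg * k)" by (rule cover_G) blast
  from C[of k] obtain R where "cover (G k) \<Gamma> R" by (elim exE conjE)
  then show ?thesis by (intro that[of R]) (simp_all add: cover_def)
qed

text \<open>Stated for the displacement of an arbitrary point: it is applied along closed geodesics
  for the systole and at \<i> for the degree.\<close>

lemma length_bound:
  assumes \<gamma>: "\<gamma> \<in> G k" "\<gamma> \<noteq> \<one>\<^bsub>PSL2R\<^esub>" and z: "z \<in> \<H>"
  shows "2 * real k * real deg * ln 3 - real deg * ln 4 \<le> real r * hyp_dist z (PSL_act \<gamma> z) / 2"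
proof -
  obtain D where D: "\<gamma> \<in> \<Gamma>" "D \<in> L k" "\<gamma> = PSL_proj (\<xi> D)" using \<gamma>(1) unfolding G_iff by blast
  obtain E where E: "E \<in> \<OO>" "D = Q1 + 3 ^ k *\<^sub>R E" using D(2) unfolding L_iff by blast
  define A where "A = \<xi> D"
  define l where "l = hyp_dist z (PSL_act \<gamma> z)"
  define \<tau> where "\<tau> = red_trace D"
  define t where "t = red_norm a b E"
  have A: "A \<in> lifts \<Gamma>" unfolding lifts_iff A_def using det_L[OF D(2)] D(1,3) by simp
  have l: "l = hyp_dist z (moebius A z)" unfolding l_def D(3) PSL_act_proj A_def ..
  have trA: "trace A = \<tau>" unfolding A_def \<tau>_def by (rule trace_xi[OF L_B[OF D(2)]])
  have \<tau>K: "\<tau> \<in> K" unfolding \<tau>_def by (rule red_in_K(1)[OF L_B[OF D(2)]])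
  have tO: "t \<in> O\<^sub>K" unfolding t_def by (rule order_integral(2)[OF E(1)])
  then have tK: "t \<in> K" unfolding ring_of_integers_def by blast
  have "A \<noteq> mat 1" "A \<noteq> - mat 1"
    using \<gamma>(2) unfolding D(3) A_def[symmetric] PSL_one using PSL_proj_uminus[of "mat 1"] by auto
  \<comment> \<open>This makes \<open>t\<close> nonzero; it rests on the absence of parabolic
    elements.\<close>
  then have \<tau>2: "\<tau> \<noteq> 2" using lift_hyperbolic[OF A] trA by auto
  have "red_norm a b (Q1 + c *\<^sub>R E) = 1 + c * red_trace E + c\<^sup>2 * red_norm a b E"
    "red_trace (Q1 + c *\<^sub>R E) = 2 + c * red_trace E" for c
    by (cases E; simp add: power2_eq_square algebra_simps)+
  from this[of "3 ^ k"] have "1 = 1 + 3 ^ k * red_trace E + (3 ^ k)\<^sup>2 * t" "\<tau> = 2 + 3 ^ k * red_trace E"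
    using L_norm[OF D(2)] unfolding E(2)[symmetric] \<tau>_def t_def by simp_all
  then have t: "9 ^ k * t = 2 - \<tau>" by (simp add: power2_eq_square flip: power_mult_distrib)
  then have t0: "t \<noteq> 0" using \<tau>2 by auto
  obtain \<sigma> \<Lambda> \<Phi> F where all: "irreducible_arithmetic_lattice K r \<sigma> \<Lambda>"
      "\<forall>i<r. galois_conjugate \<Gamma> K (\<sigma> i) (\<Phi> i)" "\<forall>\<gamma>\<in>\<Gamma>. (\<lambda>i\<in>{..<r}. \<Phi> i \<gamma>) \<in> \<Lambda>"
      "\<forall>i<r. F i holomorphic_on \<H> \<and> F i ` \<H> \<subseteq> \<H> \<and>
         (\<forall>\<gamma>\<in>\<Gamma>. \<forall>z\<in>\<H>. F i (PSL_act \<gamma> z) = PSL_act (\<Phi> i \<gamma>) (F i z))"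
    using embedding unfolding admits_modular_embedding_def by (elim exE conjE)
  have emb: "irreducible_arithmetic_lattice K r \<sigma> \<Lambda>"
      "\<And>i. i < r \<Longrightarrow> galois_conjugate \<Gamma> K (\<sigma> i) (\<Phi> i)"
      "\<And>\<gamma>. \<gamma> \<in> \<Gamma> \<Longrightarrow> (\<lambda>i\<in>{..<r}. \<Phi> i \<gamma>) \<in> \<Lambda>"
    using all(1-3) by simp_all
  have hol: "F i holomorphic_on \<H>" "F i ` \<H> \<subseteq> \<H>"
      "\<forall>\<gamma>\<in>\<Gamma>. \<forall>z\<in>\<H>. F i (PSL_act \<gamma> z) = PSL_act (\<Phi> i \<gamma>) (F i z)" if i: "i < r" for i
  proof -
    note h = all(4)[rule_format, OF i]
    show "F i holomorphic_on \<H>" "F i ` \<H> \<subseteq> \<H>" by (rule conjunct1[OF h], rule conjunct1[OF conjunct2[OF h]])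
    show "\<forall>\<gamma>\<in>\<Gamma>. \<forall>z\<in>\<H>. F i (PSL_act \<gamma> z) = PSL_act (\<Phi> i \<gamma>) (F i z)" by (rule conjunct2[OF conjunct2[OF h]])
  qed
  have l0: "l \<ge> 0"
    unfolding l_def using z psl_act_closed[OF in_PSL[OF D(1)] z] by (intro hyp_dist_nonneg) (auto simp: upper_half_plane_def)
  \<comment> \<open>One exponential majorises each split factor, so that the product becomes a
    power; the factor 4 costs \<open>ln 4\<close> per embedding in the additive constant.\<close>
  have cosh: "2 + 2 * cosh (l / 2) \<le> 4 * exp (l / 2)"
  proof -
    have "cosh (l / 2) \<le> exp (l / 2)" using l0 by (simp add: cosh_def)
    moreover have "1 \<le> exp (l / 2)" using l0 by simp
    ultimately show ?thesis by linarith
  qed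
  let ?E = "real_embeddings K" and ?S = "\<sigma> ` {..<r}"
  have finE: "finite ?E" using card_real_embeddings_pos(2)[OF nf] .
  \<comment> \<open>These parameters belong to the algebra of the lattice, not to the order defining
    the congruences; they provide the \<open>r\<close> distinct embeddings listed by
    \<open>\<sigma>\<close>.\<close>
  obtain a' b' where bij: "bij_betw \<sigma> {..<r} {\<tau> \<in> ?E. splits_at a' b' \<tau>}"
    using emb(1) unfolding irreducible_arithmetic_lattice_def by blast
  have SE: "?S \<subseteq> ?E" using bij_betw_imp_surj_on[OF bij] by blast
  have cardS: "card ?S = r" using card_image[OF bij_betw_imp_inj_on[OF bij]] by simp
  have step: "9 ^ k * \<bar>h t\<bar> \<le> 4 * (if h \<in> ?S then exp (l / 2) else 1)" if h: "h \<in> ?E" for h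
  proof -
    have fe: "field_emb K h" using h unfolding real_embeddings_field_emb[OF F] by blast
    have h9: "h (of_rat q) = of_rat q" for q by (rule field_emb_of_rat[OF fe])
    have K9: "9 ^ k \<in> K" "2 \<in> K"
      using ring_of_integers_closed(6)[OF F, of "9 ^ k"] ring_of_integers_closed(6)[OF F, of 2]
      by (auto simp: ring_of_integers_def)
    have "9 ^ k * h t = h (9 ^ k * t)" using field_emb_mult[OF fe K9(1) tK] h9[of "9 ^ k"] by (simp add: of_rat_power)
    also have "\<dots> = 2 - h \<tau>" unfolding t using field_emb_diff[OF fe K9(2) \<tau>K] h9[of 2] by simp
    finally have "\<bar>9 ^ k * h t\<bar> = \<bar>2 - h \<tau>\<bar>" by (rule arg_cong)
    then have "9 ^ k * \<bar>h t\<bar> = \<bar>2 - h \<tau>\<bar>" by (simp add: abs_mult)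
    also have "\<dots> \<le> 2 + \<bar>h \<tau>\<bar>" by linarith
    also have "\<dots> \<le> 4 * (if h \<in> ?S then exp (l / 2) else 1)"
    proof (cases "h \<in> ?S")
      case True
      then obtain i where i: "i < r" "h = \<sigma> i" by blast
      have "\<bar>\<sigma> i (trace A)\<bar> \<le> 2 * cosh (l / 2)"
        unfolding l by (rule split_trace_bound[OF emb(2)[OF i(1)] A _ hol[OF i(1)] z]) (use trA \<tau>K in simp)
      then show ?thesis using cosh True unfolding i(2) trA by simp
    next
      case False
      have "\<bar>h (trace A)\<bar> \<le> 2"
        by (rule nonsplit_trace_bound[OF sub emb(1) r emb(2,3) A _ h False]) (use trA \<tau>K in simp_all)
      then show ?thesis using False trA by simp
    qed
    finally show ?thesis .
  qed
  have "9 ^ (k * deg) = (\<Prod>h\<in>?E. 9 ^ k :: real)" unfolding deg_def by (simp add: power_mult)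
  also have "\<dots> \<le> (\<Prod>h\<in>?E. 9 ^ k) * (\<Prod>h\<in>?E. \<bar>h t\<bar>)"
    using mult_left_mono[OF prod_embeddings_ge_1[OF nf tO t0], of "\<Prod>h\<in>?E. 9 ^ k"] by (simp add: prod_nonneg)
  also have "\<dots> = (\<Prod>h\<in>?E. 9 ^ k * \<bar>h t\<bar>)" by (simp add: prod.distrib)
  also have "\<dots> \<le> (\<Prod>h\<in>?E. 4 * (if h \<in> ?S then exp (l / 2) else 1))"
    by (rule prod_mono) (use step in auto)
  also have "\<dots> = 4 ^ deg * (\<Prod>h\<in>?E. if h \<in> ?S then exp (l / 2) else 1)"
    unfolding deg_def by (simp only: prod.distrib prod_constant)
  also have "(\<Prod>h\<in>?E. if h \<in> ?S then exp (l / 2) else 1) = (\<Prod>h\<in>?S. exp (l / 2))"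
    by (rule prod.mono_neutral_cong_right[OF finE SE]) auto
  also have "\<dots> = exp (l / 2) ^ r" by (simp add: cardS)
  finally have "ln (9 ^ (k * deg)) \<le> ln (4 ^ deg * exp (l / 2) ^ r)" by (subst ln_le_cancel_iff) simp_all
  also have "ln (4 ^ deg * exp (l / 2) ^ r) = deg * ln 4 + r * (l / 2)"
    by (simp add: ln_mult ln_realpow)
  also have "ln (9 ^ (k * deg)) = real (k * deg) * (2 * ln 3)"
    using ln_realpow[of 3 2] by (simp add: ln_realpow)
  finally show ?thesis unfolding l_def[symmetric] by (simp add: mult_ac)
qed

text \<open>A closed geodesic of length \<open>l\<close> lifts to a geodesic whose start is
  displaced by exactly \<open>l\<close> under some nontrivial element of \<open>G k\<close>, so
  \<open>length_bound\<close> applies to every member of the set defining the systole.\<close>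

lemma sys_bound: "2 * (2 * real k * real deg * ln 3 - real deg * ln 4) / real r \<le> sys (G k)"
proof -
  let ?M = "{l. \<exists>g. closed_geodesic (G k) g l}"
  \<comment> \<open>A nontrivial element provides a closed geodesic along its axis; an infimum over
    the empty set could not be bounded from below.\<close>
  have "infinite (G k)"
  proof
    assume fin: "finite (G k)"
    obtain R where R: "finite R" "R \<subseteq> \<Gamma>" "\<Gamma> \<subseteq> (\<Union>\<rho>\<in>R. G k #>\<^bsub>PSL2R\<^esub> \<rho>)" by (rule finite_cover_G)
    have "finite (\<Union>\<rho>\<in>R. G k #>\<^bsub>PSL2R\<^esub> \<rho>)" using R(1) fin by (auto simp: r_coset_def)
    then show False using infinite finite_subset[OF R(3)] by simp
  qed
  then have "G k \<noteq> {\<one>\<^bsub>PSL2R\<^esub>}" by auto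
  then obtain \<gamma> where \<gamma>: "\<gamma> \<in> G k" "\<gamma> \<noteq> \<one>\<^bsub>PSL2R\<^esub>" using G_one by blast
  have \<gamma>c: "\<gamma> \<in> \<Gamma>" "\<gamma> \<in> carrier PSL2R" using \<gamma>(1) G_le in_PSL by blast+
  obtain A where A: "det A = 1" "PSL_proj A = \<gamma>" by (rule lift_exists[OF \<gamma>c(2)])
  have "A \<in> lifts \<Gamma>" unfolding lifts_iff using A \<gamma>c by simp
  moreover have "A \<noteq> mat 1" "A \<noteq> - mat 1"
    using \<gamma>(2) unfolding A(2)[symmetric] PSL_one using PSL_proj_uminus[of "mat 1"] by auto
  ultimately have "\<bar>trace A\<bar> > 2" by (rule lift_hyperbolic)
  then obtain c l where c: "unit_speed_geodesic c" "l > 0" "\<And>t. moebius A (c t) = c (t + l)"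
    using hyperbolic_axis[OF A(1)] by blast
  have "orbit_pt (G k) (c (t + l)) = orbit_pt (G k) (c t)" for t
  proof -
    have "c t \<in> \<H>" using c(1) unfolding unit_speed_geodesic_def by blast
    then have "orbit_pt (G k) (PSL_act \<gamma> (c t)) = orbit_pt (G k) (c t)" by (rule orbit_pt_psl_act[OF G_sub \<gamma>(1)])
    then show ?thesis unfolding A(2)[symmetric] PSL_act_proj c(3) .
  qed
  then have "closed_geodesic (G k) (orbit_pt (G k) \<circ> c) l" unfolding closed_geodesic_def using c(1,2) by auto
  then have ne: "?M \<noteq> {}" by blast
  show ?thesis unfolding sys_def
  proof (rule cInf_greatest[OF ne])
    fix l assume "l \<in> ?M"
    then obtain g where "closed_geodesic (G k) g l" by blast
    then obtain c where c: "unit_speed_geodesic c" "g = orbit_pt (G k) \<circ> c" "l > 0" "\<And>t. g (t + l) = g t"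
      unfolding closed_geodesic_def by blast
    have cH: "c t \<in> \<H>" for t using c(1) unfolding unit_speed_geodesic_def by blast
    have "orbit_pt (G k) (c l) = orbit_pt (G k) (c 0)" using c(4)[of 0] unfolding c(2) by simp
    then have "c l \<in> orbit_pt (G k) (c 0)" using orbit_pt_self[OF G_sub[of k], of "c l"] by simp
    then obtain \<gamma> where \<gamma>: "\<gamma> \<in> G k" "c l = PSL_act \<gamma> (c 0)" unfolding orbit_pt_iff by blast
    have dist: "hyp_dist (c 0) (c l) = l" using c(1,3) unfolding unit_speed_geodesic_def by simp
    have "\<gamma> \<noteq> \<one>\<^bsub>PSL2R\<^esub>"
    proof
      assume "\<gamma> = \<one>\<^bsub>PSL2R\<^esub>"
      then have "c l = c 0" using \<gamma>(2) psl_act_one by simp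
      then show False using dist c(3) hyp_dist_eq_0[of "c 0" "c 0"] cH[of 0] by (simp add: upper_half_plane_def)
    qed
    from length_bound[OF \<gamma>(1) this cH[of 0]] have "2 * real k * real deg * ln 3 - real deg * ln 4 \<le> real r * l / 2"
      unfolding \<gamma>(2)[symmetric] dist .
    then show "2 * (2 * real k * real deg * ln 3 - real deg * ln 4) / real r \<le> l"
      using r by (subst pos_divide_le_eq) (auto simp: mult.commute)
  qed
qed

text \<open>For \<open>N\<close> elements of \<Gamma> the finitely many nontrivial quotients all
  leave \<open>G k\<close> once \<open>k\<close> is large, by \<open>length_bound\<close>; then the
  \<open>N\<close> translates of \<i> lie in distinct orbits of \<open>G k\<close>.\<close>

lemma degree_unbounded: "\<exists>k. covering_degree (G k) \<Gamma> \<ge> N"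
proof -
  interpret P: group PSL2R by (rule PSL2R_group)
  have iH: "\<i> \<in> \<H>" by (simp add: upper_half_plane_def)
  obtain X where X: "X \<subseteq> \<Gamma>" "finite X" "card X = N" using infinite_arbitrarily_large[OF infinite] by blast
  define P where "P = (\<lambda>(\<gamma>, \<delta>). \<gamma> \<otimes>\<^bsub>PSL2R\<^esub> inv\<^bsub>PSL2R\<^esub> \<delta>) ` (X \<times> X) - {\<one>\<^bsub>PSL2R\<^esub>}"
  \<comment> \<open>Dominates the right side of \<open>length_bound\<close> for all quotients in
    \<open>P\<close> at once, with the term in \<open>ln 4\<close> moved over.\<close>
  define M where "M = (\<Sum>\<pi>\<in>P. \<bar>real r * hyp_dist \<i> (PSL_act \<pi> \<i>) / 2\<bar>) + real deg * ln 4"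
  have finP: "finite P" unfolding P_def using X(2) by simp
  have "deg > 0" unfolding deg_def using card_real_embeddings_pos(1)[OF nf] .
  then have "0 < 2 * real deg * ln 3" by simp
  then obtain k where k: "M < real k * (2 * real deg * ln 3)" using reals_Archimedean3 by blast
  have none: "\<pi> \<notin> G k" if \<pi>: "\<pi> \<in> P" for \<pi>
  proof
    assume "\<pi> \<in> G k"
    moreover have "\<pi> \<noteq> \<one>\<^bsub>PSL2R\<^esub>" using \<pi> unfolding P_def by blast
    ultimately have "2 * real k * real deg * ln 3 - real deg * ln 4 \<le> real r * hyp_dist \<i> (PSL_act \<pi> \<i>) / 2"
      using iH by (rule length_bound)
    also have "\<dots> \<le> \<bar>real r * hyp_dist \<i> (PSL_act \<pi> \<i>) / 2\<bar>" by (rule abs_ge_self)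
    also have "\<dots> \<le> (\<Sum>\<pi>\<in>P. \<bar>real r * hyp_dist \<i> (PSL_act \<pi> \<i>) / 2\<bar>)"
      by (rule member_le_sum[OF \<pi> _ finP]) simp
    finally have "2 * real k * real deg * ln 3 \<le> M" unfolding M_def by linarith
    then show False using k by (simp add: mult_ac)
  qed
  let ?S = "{p \<in> surface (G k). p \<subseteq> orbit_pt \<Gamma> \<i>}" and ?o = "\<lambda>\<gamma>. orbit_pt (G k) (PSL_act \<gamma> \<i>)"
  obtain R where R: "finite R" "R \<subseteq> \<Gamma>" "\<Gamma> \<subseteq> (\<Union>\<rho>\<in>R. G k #>\<^bsub>PSL2R\<^esub> \<rho>)" by (rule finite_cover_G)
  have c: "x \<in> carrier PSL2R" "x \<in> \<Gamma>" if x: "x \<in> G k" for x using x G_le in_PSL by blast+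
  have "?S \<subseteq> ?o ` R"
  proof
    fix p assume "p \<in> ?S"
    then obtain z where z: "z \<in> \<H>" "p = orbit_pt (G k) z" "p \<subseteq> orbit_pt \<Gamma> \<i>" unfolding surface_def by blast
    have "z \<in> orbit_pt \<Gamma> \<i>" using z(2,3) orbit_pt_self[OF G_sub] by blast
    then obtain \<gamma> where \<gamma>: "\<gamma> \<in> \<Gamma>" "z = PSL_act \<gamma> \<i>" unfolding orbit_pt_iff by blast
    have "\<gamma> \<in> (\<Union>\<rho>\<in>R. G k #>\<^bsub>PSL2R\<^esub> \<rho>)" using R(3) \<gamma>(1) by (rule subsetD)
    then obtain \<rho> h where h: "h \<in> G k" "\<rho> \<in> R" "\<gamma> = h \<otimes>\<^bsub>PSL2R\<^esub> \<rho>" unfolding r_coset_def by (elim UN_E singletonE)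
    have \<rho>: "\<rho> \<in> carrier PSL2R" using h(2) R(2) in_PSL by blast
    have "z = PSL_act h (PSL_act \<rho> \<i>)" unfolding \<gamma>(2) h(3) by (rule psl_act_mult[OF \<rho> iH c(1)[OF h(1)]])
    then have "p = ?o \<rho>" unfolding z(2) using orbit_pt_psl_act[OF G_sub h(1) psl_act_closed[OF \<rho> iH]] by simp
    then show "p \<in> ?o ` R" using h(2) by blast
  qed
  \<comment> \<open>An infinite fibre would have \<open>card\<close> equal to 0 and spoil the lower
    bound.\<close>
  then have finS: "finite ?S" using R(1) finite_subset by blast
  have "?o ` X \<subseteq> ?S"
  proof
    fix p assume "p \<in> ?o ` X"
    then obtain \<gamma> where \<gamma>: "\<gamma> \<in> X" "p = ?o \<gamma>" by blast
    have \<gamma>c: "\<gamma> \<in> \<Gamma>" "\<gamma> \<in> carrier PSL2R" using \<gamma>(1) X(1) in_PSL by blast+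
    have "p \<subseteq> orbit_pt \<Gamma> (PSL_act \<gamma> \<i>)" unfolding \<gamma>(2) orbit_pt_def using G_le by blast
    also have "\<dots> = orbit_pt \<Gamma> \<i>" by (rule orbit_pt_psl_act[OF sub \<gamma>c(1) iH])
    finally show "p \<in> ?S" unfolding surface_def \<gamma>(2) using psl_act_closed[OF \<gamma>c(2) iH] by blast
  qed
  moreover have "inj_on ?o X"
  proof (rule inj_onI, rule ccontr)
    fix \<gamma> \<delta> assume \<gamma>\<delta>: "\<gamma> \<in> X" "\<delta> \<in> X" "?o \<gamma> = ?o \<delta>" "\<gamma> \<noteq> \<delta>"
    have \<gamma>c: "\<gamma> \<in> \<Gamma>" "\<gamma> \<in> carrier PSL2R" "\<delta> \<in> \<Gamma>" "\<delta> \<in> carrier PSL2R" using \<gamma>\<delta> X(1) in_PSL by blast+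
    have "PSL_act \<gamma> \<i> \<in> ?o \<delta>" using orbit_pt_self[OF G_sub] \<gamma>\<delta>(3) by blast
    then obtain h where h: "h \<in> G k" "PSL_act \<gamma> \<i> = PSL_act h (PSL_act \<delta> \<i>)" unfolding orbit_pt_iff by blast
    have "PSL_act \<gamma> \<i> = PSL_act (h \<otimes>\<^bsub>PSL2R\<^esub> \<delta>) \<i>"
      unfolding h(2) by (rule psl_act_mult[OF \<gamma>c(4) iH c(1)[OF h(1)], symmetric])
    then have "\<gamma> = h \<otimes>\<^bsub>PSL2R\<^esub> \<delta>" by (rule act_eq_imp_eq[OF \<gamma>c(1) mult_in[OF c(2)[OF h(1)] \<gamma>c(3)] iH])
    then have eq: "\<gamma> \<otimes>\<^bsub>PSL2R\<^esub> inv\<^bsub>PSL2R\<^esub> \<delta> = h"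
      using P.inv_solve_right[OF c(1)[OF h(1)] \<gamma>c(2,4)] by simp
    have "h \<noteq> \<one>\<^bsub>PSL2R\<^esub>" using \<open>\<gamma> = h \<otimes>\<^bsub>PSL2R\<^esub> \<delta>\<close> \<gamma>\<delta>(4) \<gamma>c(4) by auto
    then have "h \<in> P" unfolding P_def eq[symmetric] using \<gamma>\<delta>(1,2) by auto
    then show False using none h(1) by blast
  qed
  ultimately have "card X \<le> card ?S" using finS by (intro card_inj_on_le)
  then show ?thesis unfolding covering_degree_def using X(3) by auto
qed

text \<open>Multiplying the growth \<open>3 deg k ln 3\<close> of the logarithmic area by
  \<open>4 / (3 r)\<close> gives the leading term \<open>4 deg k ln 3 / r\<close> of
  \<open>sys_bound\<close>, so the difference is bounded independently of \<open>k\<close>.\<close>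

lemma sys_area_bound:
  obtains c where "\<And>k. sys (G k) \<ge> 4 / (3 * real r) * ln (hyp_area (G k)) - c"
proof -
  obtain D where D: "fundamental_domain \<Gamma> D" "emeasure hyp_measure D < \<infinity>"
    using cofinite unfolding cofinite_group_def by blast
  obtain C :: nat where C: "\<And>k. \<exists>R. cover (G k) \<Gamma> R \<and> card R \<le> C * 3 ^ (3 * deg * k)" by (rule cover_G) blast
  define m where "m = measure hyp_measure D"
  \<comment> \<open>At least 1, so that \<open>ln C'\<close> is nonnegative and the bound also
    covers area 0, where \<open>ln 0 = 0\<close>.\<close>
  define C' where "C' = max 1 (real C * m)"
  have C'1: "C' \<ge> 1" unfolding C'_def by simp
  have m0: "m \<ge> 0" unfolding m_def by simp
  have ln: "ln (hyp_area (G k)) \<le> ln C' + 3 * real deg * real k * ln 3" for k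
  proof -
    obtain R where R: "cover (G k) \<Gamma> R" "card R \<le> C * 3 ^ (3 * deg * k)" using C[of k] by (elim exE conjE)
    have R': "finite R" "R \<subseteq> \<Gamma>" "\<Gamma> \<subseteq> (\<Union>\<rho>\<in>R. G k #>\<^bsub>PSL2R\<^esub> \<rho>)" using R(1) by (simp_all add: cover_def)
    have "real (card R) \<le> real (C * 3 ^ (3 * deg * k))" using R(2) by (rule of_nat_mono)
    then have "real (card R) * m \<le> real (C * 3 ^ (3 * deg * k)) * m" using m0 by (rule mult_right_mono)
    also have "\<dots> = (real C * m) * 3 ^ (3 * deg * k)" by simp
    also have "\<dots> \<le> C' * 3 ^ (3 * deg * k)" unfolding C'_def by (intro mult_right_mono) auto
    finally have le: "hyp_area (G k) \<le> C' * 3 ^ (3 * deg * k)"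
      using hyp_area_le[OF D G_sub G_le R'] unfolding m_def by linarith
    have rhs: "ln C' + 3 * real deg * real k * ln 3 = ln (C' * 3 ^ (3 * deg * k))"
      using C'1 by (simp add: ln_mult ln_realpow)
    show ?thesis
    proof (cases "hyp_area (G k) > 0")
      case True
      then show ?thesis unfolding rhs using le C'1 by (subst ln_le_cancel_iff) auto
    next
      case False
      moreover have "hyp_area (G k) \<ge> 0" unfolding hyp_area_def by simp
      ultimately have "hyp_area (G k) = 0" by simp
      then show ?thesis using C'1 by simp
    qed
  qed
  show ?thesis
  proof (rule that[of "4 / (3 * real r) * ln C' + 2 * real deg * ln 4 / real r"])
    fix k
    have "4 / (3 * real r) * ln (hyp_area (G k)) \<le> 4 / (3 * real r) * (ln C' + 3 * real deg * real k * ln 3)"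
      by (rule mult_left_mono[OF ln]) simp
    also have "\<dots> = 4 / (3 * real r) * ln C' + 2 * real deg * ln 4 / real r
        + 2 * (2 * real k * real deg * ln 3 - real deg * ln 4) / real r"
      using r by (simp add: field_simps)
    finally show "sys (G k) \<ge> 4 / (3 * real r) * ln (hyp_area (G k)) -
        (4 / (3 * real r) * ln C' + 2 * real deg * ln 4 / real r)"
      using sys_bound[of k] by linarith
  qed
qed

end

theorem theorem1p5:
  fixes \<Gamma> :: "(real^2^2) set set" and r :: nat
    and a b :: real and \<OO> :: "quat set" and \<xi> :: "quat \<Rightarrow> real^2^2"
  assumes "closed_surface_group \<Gamma>"
    and "semi_arithmetic \<Gamma>"
    and "r \<ge> 1"
    and "admits_modular_embedding \<Gamma> r"
    and "congruence_data \<Gamma> a b \<OO> \<xi>"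
  shows "\<exists>(\<aa> :: nat \<Rightarrow> real set) (c :: real).
      (\<forall>i. nonzero_ideal (inv_trace_field \<Gamma>) (\<aa> i)) \<and>
      (\<forall>N::nat. \<exists>i. covering_degree (congruence_subgroup \<Gamma> a b \<OO> \<xi> (\<aa> i)) \<Gamma> \<ge> N) \<and>
      (\<forall>i. sys (congruence_subgroup \<Gamma> a b \<OO> \<xi> (\<aa> i)) \<ge>
           4 / (3 * real r) * ln (hyp_area (congruence_subgroup \<Gamma> a b \<OO> \<xi> (\<aa> i))) - c)"
proof -
  interpret S: surface_group \<Gamma> by unfold_locales (rule assms(1))
  let ?K = "inv_trace_field \<Gamma>"
  have nf: "number_field ?K" "totally_real ?K" and cof: "cofinite_group \<Gamma>"
    using assms(2) unfolding semi_arithmetic_def by blast+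
  have F: "fieldset ?K" using nf(1) unfolding number_field_def by (blast intro: subfield_imp_fieldset)
  have cd: "quat_params ?K a b" "maximal_order ?K a b \<OO>" "\<xi> \<in> alg_homs ?K a b (\<lambda>x. x)"
    "lifts \<Gamma> \<subseteq> \<xi> ` norm_one a b \<OO> \<or> lifts (squares_subgroup \<Gamma>) \<subseteq> \<xi> ` norm_one a b \<OO>"
    using assms(5) unfolding congruence_data_def Let_def by blast+
  \<comment> \<open>Through this inclusion both alternatives of \<open>congruence_data\<close> imply
    the one for squares, on which the locale is built.\<close>
  have "squares_subgroup \<Gamma> \<subseteq> \<Gamma>"
    unfolding squares_subgroup_def
    by (rule group.generate_subgroup_incl[OF PSL2R_group _ S.sub]) (use S.mult_in in blast)
  then have "lifts (squares_subgroup \<Gamma>) \<subseteq> lifts \<Gamma>" unfolding lifts_def by blast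
  then have sq: "lifts (squares_subgroup \<Gamma>) \<subseteq> \<xi> ` norm_one a b \<OO>" using cd(4) by blast
  have ord: "is_order ?K a b \<OO>" using cd(2) unfolding maximal_order_def by blast
  interpret congruence_setting \<Gamma> a b \<xi> \<OO> r
    by unfold_locales (use F cd ord nf sq assms(3,4) cof in blast)+
  obtain c where c: "\<And>k. sys (G k) \<ge> 4 / (3 * real r) * ln (hyp_area (G k)) - c" by (rule sys_area_bound) blast
  show ?thesis
    by (rule exI[of _ level], rule exI[of _ c])
      (use nonzero_ideal_level degree_unbounded c in \<open>unfold G_def, blast\<close>)
qed

end
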